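(* Let $k\ge2$ and $m\ge1$ be fixed integers. Let $0<\varpi<1/4$ and $0<\delta<1/2$ be such that $\mathrm{MPZ}[\varpi,\delta]$ holds. If $$M_k^{[\delta/(1/4+\varpi)]}>\frac m{1/4+\varpi},$$ then $\mathrm{DHL}[k,m+1]$ holds.
   Context: For a square-integrable $F:[0,\infty)^k\to\mathbb{R}$, define $$I(F)=\int_{[0,\infty)^k}F^2,\qquad J_i(F)=\int_{[0,\infty)^{k-1}}\Big(\int_0^\infty F\,dt_i\Big)^2\prod_{j\ne i}dt_j.$$ For $\alpha>0$, $M_k^{[\alpha]}$ is the supremum of $\sum_{i=1}^kJ_i(F)/I(F)$ over square-integrable $F$, not identically zero, supported in the truncated simplex $$\{(t_1,\dots,t_k)\in[0,\alpha]^k:t_1+\dots+t_k\le1\}.$$ $\mathrm{DHL}[k,j]$ means: for every admissible $k$-tuple $(h_1<\dots<h_k)$ of integers (i.e. one which avoids some residue class mod $p$ for every prime $p$), there are infinitely many $n$ with at least $j$ of the $n+h_i$ prime. $\mathrm{MPZ}[\varpi,\delta]$ is the assertion below, with $x\to\infty$. Here $X\ll Y$ means $|X|\le CY$ with $C$ independent of $x$, and $X\lessapprox Y$ means $|X|\le x^{o(1)}Y$. Let $I\subset[1,x^\delta]$ and $Q\lessapprox x^{1/2+2\varpi}$. Let $P_I$ be the product of the primes in $I$, and $\mathcal S_I$ the squarefree naturals with all prime factors in $I$. For any primitive residue class $a\ (P_I)$ (which may depend on $x$) and fixed $A\ge1$, $$\sum_{q\le Q,\ q\in\mathcal S_I}|\Delta(\Lambda\mathbf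 1_{[x,2x]};a\ (q))|\ll x\log^{-A}x,$$ with implied constant depending only on $A,\varpi,\delta$. Here $\Lambda$ is the von Mangoldt function and $$\Delta(\alpha;a\ (q))=\sum_{n\equiv a\ (q)}\alpha(n)-\frac1{\phi(q)}\sum_{(n,q)=1}\alpha(n).$$ *)

theory Defs
  imports "HOL-Analysis.Analysis" "HOL-Number_Theory.Number_Theory"
    "HOL-Computational_Algebra.Squarefree"
begin

(* Points of R^k are functions nat => real indexed by {..<k}, in the sense of the
   finite product measure. Borel measurability loses nothing: every element of L^2
   has a Borel representative. *)
abbreviation lebesgue_prod :: "nat set \<Rightarrow> (nat \<Rightarrow> real) measure" where
  "lebesgue_prod J \<equiv> Pi\<^sub>M J (\<lambda>_. lborel)"

definition orthant :: "nat set \<Rightarrow> (nat \<Rightarrow> real) set" where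
  "orthant J = (\<Pi>\<^sub>E j\<in>J. {0..})"

definition square_integrable :: "nat \<Rightarrow> ((nat \<Rightarrow> real) \<Rightarrow> real) \<Rightarrow> bool" where
  "square_integrable k F \<longleftrightarrow>
     F \<in> borel_measurable (lebesgue_prod {..<k}) \<and>
     set_integrable (lebesgue_prod {..<k}) (orthant {..<k}) (\<lambda>t. (F t)\<^sup>2)"

definition I_functional :: "nat \<Rightarrow> ((nat \<Rightarrow> real) \<Rightarrow> real) \<Rightarrow> real" where
  "I_functional k F = (LINT t:orthant {..<k}|lebesgue_prod {..<k}. (F t)\<^sup>2)"

definition J_functional :: "nat \<Rightarrow> nat \<Rightarrow> ((nat \<Rightarrow> real) \<Rightarrow> real) \<Rightarrow> real" where
  "J_functional k i F =
     (LINT t:orthant ({..<k} - {i})|lebesgue_prod ({..<k} - {i}).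
        (LINT s:{0..}|lborel. F (t(i := s)))\<^sup>2)"

definition truncated_simplex :: "nat \<Rightarrow> real \<Rightarrow> (nat \<Rightarrow> real) set" where
  "truncated_simplex k \<alpha> = {t \<in> \<Pi>\<^sub>E i\<in>{..<k}. {0..\<alpha>}. (\<Sum>i<k. t i) \<le> 1}"

(* "Not identically zero" is meant in L^2, i.e. not almost everywhere zero.
   The supremum is taken in the extended reals, so it needs no boundedness side condition. *)
definition truncated_functions :: "nat \<Rightarrow> real \<Rightarrow> ((nat \<Rightarrow> real) \<Rightarrow> real) set" where
  "truncated_functions k \<alpha> =
     {F. square_integrable k F \<and>
         (\<forall>t \<in> space (lebesgue_prod {..<k}). t \<notin> truncated_simplex k \<alpha> \<longrightarrow> F t = 0) \<and>
         \<not> (AE t in lebesgue_prod {..<k}. F t = 0)}"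

definition M_truncated :: "nat \<Rightarrow> real \<Rightarrow> ereal" where
  "M_truncated k \<alpha> =
     (SUP F \<in> truncated_functions k \<alpha>. ereal ((\<Sum>i<k. J_functional k i F) / I_functional k F))"

definition admissible_tuple :: "nat \<Rightarrow> (nat \<Rightarrow> int) \<Rightarrow> bool" where
  "admissible_tuple k h \<longleftrightarrow>
     strict_mono_on {..<k} h \<and>
     (\<forall>p::nat. prime p \<longrightarrow> (\<exists>a::int. \<forall>i<k. \<not> [h i = a] (mod int p)))"

definition DHL :: "nat \<Rightarrow> nat \<Rightarrow> bool" where
  "DHL k j \<longleftrightarrow>
     (\<forall>h. admissible_tuple k h \<longrightarrow>
        infinite {n::nat. card {i. i < k \<and> prime (int n + h i)} \<ge> j})"

(* Used only for finitely supported f. *)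
definition discrepancy :: "(nat \<Rightarrow> real) \<Rightarrow> int \<Rightarrow> nat \<Rightarrow> real" where
  "discrepancy f a q =
     (\<Sum>\<^sub>\<infinity>n\<in>{n. [int n = a] (mod int q)}. f n)
       - 1 / real (totient q) * (\<Sum>\<^sub>\<infinity>n\<in>{n. coprime n q}. f n)"

definition prime_product :: "real set \<Rightarrow> nat" where
  "prime_product I = \<Prod>{p::nat. prime p \<and> real p \<in> I}"

definition squarefree_with_factors_in :: "real set \<Rightarrow> nat set" where
  "squarefree_with_factors_in I =
     {q. squarefree q \<and> (\<forall>p. prime p \<longrightarrow> p dvd q \<longrightarrow> real p \<in> I)}"

(* |X| <= x^(o(1)) Y as x tends to infinity. *)
definition lessapprox :: "(real \<Rightarrow> real) \<Rightarrow> (real \<Rightarrow> real) \<Rightarrow> bool" where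
  "lessapprox X Y \<longleftrightarrow>
     (\<exists>\<epsilon>. (\<epsilon> \<longlongrightarrow> 0) at_top \<and> (\<forall>\<^sub>F x in at_top. \<bar>X x\<bar> \<le> x powr \<epsilon> x * Y x))"

(* I, Q and a may all vary with x; the implied constant C depends only on A, varpi and
   delta, while the threshold for "x sufficiently large" may depend on the families. *)
definition MPZ :: "real \<Rightarrow> real \<Rightarrow> bool" where
  "MPZ varpi \<delta> \<longleftrightarrow>
     (\<forall>A\<ge>1. \<exists>C>0. \<forall>(I :: real \<Rightarrow> real set) (Q :: real \<Rightarrow> real) (a :: real \<Rightarrow> int).
        (\<forall>\<^sub>F x in at_top. I x \<subseteq> {1..x powr \<delta>}) \<longrightarrow>
        lessapprox Q (\<lambda>x. x powr (1/2 + 2 * varpi)) \<longrightarrow>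
        (\<forall>\<^sub>F x in at_top. coprime (a x) (int (prime_product (I x)))) \<longrightarrow>
        (\<forall>\<^sub>F x in at_top.
           (\<Sum>q | real q \<le> Q x \<and> q \<in> squarefree_with_factors_in (I x).
              \<bar>discrepancy (\<lambda>n. mangoldt n * indicator {x..2 * x} (real n)) (a x) q\<bar>)
           \<le> C * (x * ln x powr (- A))))"

end

(*
  This is the Maynard-Tao sieve. Put theta = 1/4 + varpi and R = x^theta. For n in a residue class
  b mod W, W being the product of the primes up to a large constant w, use the weight
  nu(n) = (sum over d_i | n + h_i of lambda(d_1, ..., d_k))^2, where lambda is obtained by a diagonal
  change of variables from a nonnegative step function Phi of (log r_i / log R). Prime by prime the
  quadratic forms arising from the sum of nu(n) and from the sum of nu(n) log(n + h_m) over prime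
  n + h_m are tensor products of (k + 1) x (k + 1) matrices; in the new variables they are diagonal,
  respectively a shift of one coordinate, up to a factor exp(O(1/w)) controlled by Rankin's trick.
  They become sums of Phi^2 and of Phi(j) Phi(j with the m-th coordinate replaced), i.e. the
  functionals I and J_m of a step function. The error terms for primes involve residue classes
  modulo W d with d <= R^2 that depend on the factorisation of d; colouring all primes by the k - 1
  other shifts at random reduces them to a single class, to which MPZ applies.

  Truncating |F| and approximating it in L^1 by step functions on a grid keeps the strict inequality
  sum J_m > (m / theta) I. Hence for suitable large x the sum of
  nu(n) (sum over prime n + h_i of log(n + h_i) - m log(2x)) is positive, and m + 1 of the n + h_i
  are prime. Only the lower bound psi(2x) - psi(x) >= (1 - eps) x for unboundedly many x is needed,
  so the prime number theorem is avoided.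
*)
theory Submission
  imports Defs "HOL-Real_Asymp.Real_Asymp"
begin

text \<open>The parameter w is chosen large in terms of the step function, its bound and the shifts,
  and then stays fixed while x grows. All local errors are then a small constant multiple of the
  main term, which the strict inequality absorbs, and W is a mere constant both in the asymptotics
  and in \<open>MPZ\<close>. The truncation at \<delta> / \<theta> enters because each r_i is at
  most R powr (\<delta> / \<theta>) = x powr \<delta>: every prime of a modulus lies in the interval
  that \<open>MPZ\<close> permits, and the moduli stay below W * R^2 = W * x powr (1/2 + 2 * varpi).
  The obstacle is that \<open>MPZ\<close> bounds one residue class for all moduli at once, whereas
  the class in the sieve depends on which shift each prime divides. Only an upper bound for the sum
  of nu(n) and lower bounds for the prime sums enter. Since Phi is nonnegative, unwanted tuples may
  be added in the former and dropped in the latter. The threshold m / \<theta> is m * ln (2x)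
  measured against ln R.\<close>

section \<open>Sums over integers coprime to a fixed modulus, and Euler products\<close>

text \<open>Abel summation: the bounded partial sums of f meet the nonnegative differences of g, and
  these telescope.\<close>

lemma abs_sum_antimono_le:
  fixes f g :: "nat \<Rightarrow> real"
  assumes S: "\<And>n. \<bar>\<Sum>i=1..n. f i\<bar> \<le> K"
    and anti: "\<And>i. i \<ge> 1 \<Longrightarrow> g (Suc i) \<le> g i" and pos: "\<And>i. i \<ge> 1 \<Longrightarrow> 0 \<le> g i"
  shows "\<bar>\<Sum>i=1..n. f i * g i\<bar> \<le> K * g 1"
proof -
  define S where "S n = (\<Sum>i=1..n. f i)" for n
  have K: "K \<ge> 0" using S[of 0] by simp
  have eq: "(\<Sum>i=1..n. f i * g i) = (\<Sum>i=1..n. S i * (g i - g (Suc i))) + S n * g (Suc n)" for n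
    by (induction n) (auto simp: S_def algebra_simps)
  have tel: "(\<Sum>i=1..n. g i - g (Suc i)) = g 1 - g (Suc n)" for n
    by (induction n) auto
  have "\<bar>\<Sum>i=1..n. S i * (g i - g (Suc i))\<bar> \<le> (\<Sum>i=1..n. K * (g i - g (Suc i)))"
    by (rule order_trans[OF sum_abs], rule sum_mono)
       (use S anti K in \<open>auto simp: abs_mult S_def intro!: mult_mono\<close>)
  moreover have "\<bar>S n * g (Suc n)\<bar> \<le> K * g (Suc n)"
    using S[of n] pos[of "Suc n"] by (auto simp: abs_mult S_def intro!: mult_mono)
  ultimately have "\<bar>\<Sum>i=1..n. f i * g i\<bar> \<le> K * (\<Sum>i=1..n. g i - g (Suc i)) + K * g (Suc n)"
    unfolding eq sum_distrib_left by linarith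
  also have "\<dots> = K * g 1" unfolding tel by (simp add: algebra_simps)
  finally show ?thesis .
qed

lemma card_coprime_shift:
  "card {m \<in> {1..n + W}. coprime m W} = card {m \<in> {1..n}. coprime m W} + totient W"
proof -
  have split: "{m \<in> {1..n + W}. coprime m W} = totatives W \<union> (\<lambda>m. m + W) ` {m \<in> {1..n}. coprime m W}"
    (is "?L = ?R")
  proof (intro equalityI subsetI)
    fix x assume x: "x \<in> ?L"
    show "x \<in> ?R"
    proof (cases "x \<le> W")
      case True then show ?thesis using x by (auto simp: totatives_def)
    next
      case False
      then have "x = (x - W) + W" "x - W \<in> {1..n}" using x by auto
      moreover have "coprime (x - W) W"
        using x \<open>x = (x - W) + W\<close> by (metis (no_types, lifting) coprime_iff_gcd_eq_1 gcd_add1 mem_Collect_eq)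
      ultimately show ?thesis by blast
    qed
  next
    fix x assume "x \<in> ?R"
    moreover have "coprime (m + W) W" if "coprime m W" for m
      using that by (metis coprime_iff_gcd_eq_1 gcd_add1)
    ultimately show "x \<in> ?L" by (auto simp: totatives_def)
  qed
  have "totatives W \<inter> (\<lambda>m. m + W) ` {m \<in> {1..n}. coprime m W} = {}"
    by (auto simp: totatives_def)
  then have "card ?R = card (totatives W) + card ((\<lambda>m. m + W) ` {m \<in> {1..n}. coprime m W})"
    by (intro card_Un_disjoint) auto
  also have "card ((\<lambda>m. m + W) ` {m \<in> {1..n}. coprime m W}) = card {m \<in> {1..n}. coprime m W}"
    by (rule card_image) (auto simp: inj_on_def)
  finally show ?thesis unfolding split totient_def by simp
qed

text \<open>Full periods of length W are counted exactly, so only a final stretch shorter than W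
  contributes an error.\<close>

lemma card_coprime_approx:
  fixes n W :: nat
  assumes "W > 0"
  shows "\<bar>real (card {m \<in> {1..n}. coprime m W}) - totient W / W * n\<bar> \<le> W"
proof (induction n rule: less_induct)
  case (less n)
  show ?case
  proof (cases "n < W")
    case True
    have "card {m \<in> {1..n}. coprime m W} \<le> card {1..n}" by (rule card_mono) auto
    then have 1: "real (card {m \<in> {1..n}. coprime m W}) \<le> real W" using True by simp
    have "totient W / W * n \<le> 1 * real n"
      using totient_le[of W] assms by (intro mult_right_mono) auto
    then have 2: "totient W / W * n \<le> real W" using True by linarith
    have 3: "0 \<le> totient W / W * n" by simp
    show ?thesis using 1 2 3 unfolding abs_le_iff by linarith
  next
    case False
    then obtain j where j: "n = j + W" by (metis add.commute le_Suc_ex not_less)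
    have "totient W / W * (j + W) = totient W / W * j + totient W"
      using assms by (simp add: field_simps)
    then show ?thesis using less[of j] assms unfolding j card_coprime_shift by simp
  qed
qed

text \<open>Abel summation against the indicator of coprimality to W minus its mean value totient W
  / W; the partial sums of this difference are bounded by W.\<close>

lemma coprime_sum_approx:
  fixes g :: "nat \<Rightarrow> real" and n W :: nat
  assumes W: "W > 0" and anti: "\<And>i. i \<ge> 1 \<Longrightarrow> g (Suc i) \<le> g i"
    and pos: "\<And>i. i \<ge> 1 \<Longrightarrow> 0 \<le> g i"
  shows "\<bar>(\<Sum>i | i \<in> {1..n} \<and> coprime i W. g i) - totient W / W * (\<Sum>i=1..n. g i)\<bar> \<le> W * g 1"
proof -
  define f where "f i = (if coprime i W then 1 else 0) - totient W / W" for i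
  have eq: "(\<Sum>i | i \<in> {1..n} \<and> coprime i W. g i) - totient W / W * (\<Sum>i=1..n. g i) = (\<Sum>i=1..n. f i * g i)" for n and g :: "nat \<Rightarrow> real"
  proof -
    have "(\<Sum>i | i \<in> {1..n} \<and> coprime i W. g i) = (\<Sum>i=1..n. if coprime i W then g i else 0)"
      using sum.inter_filter[of "{1..n}" g "\<lambda>i. coprime i W"] by simp
    also have "\<dots> - totient W / W * (\<Sum>i=1..n. g i) = (\<Sum>i=1..n. f i * g i)"
      unfolding sum_distrib_left sum_subtractf[symmetric] by (intro sum.cong refl) (auto simp: f_def algebra_simps)
    finally show ?thesis .
  qed
  have "\<bar>\<Sum>i=1..n. f i\<bar> \<le> W" for n
    using card_coprime_approx[OF W, of n] eq[where g = "\<lambda>_. 1"] by simp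
  from abs_sum_antimono_le[where f = f and g = g, OF this anti pos] show ?thesis unfolding eq by simp
qed

lemma harm_le_ln: "n \<ge> 1 \<Longrightarrow> harm n \<le> ln (real n) + 1"
proof (induction n rule: nat_induct_at_least)
  case (Suc n)
  have "ln (real n / real (Suc n)) \<le> real n / real (Suc n) - 1"
    using Suc.hyps by (intro ln_le_minus_one) auto
  also have "\<dots> = - (1 / real (Suc n))" by (simp add: field_simps)
  finally have "1 / real (Suc n) \<le> ln (real (Suc n)) - ln (real n)"
    using Suc.hyps by (simp add: ln_div)
  moreover have "harm (Suc n) = harm n + 1 / real (Suc n)" by (simp add: harm_Suc divide_inverse)
  ultimately show ?case using Suc.IH by linarith
qed (auto simp: harm_def)

text \<open>The bound on n is strict so that differences of values run over half-open ranges, which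
  is the shape of the logarithmic cells.\<close>

definition coprime_harm :: "nat \<Rightarrow> real \<Rightarrow> real" where
  "coprime_harm W y = (\<Sum>n | 0 < n \<and> real n < y \<and> coprime n W. 1 / real n)"

text \<open>The error may depend on W: later W is fixed and the values are divided by a multiple of
  ln x.\<close>

lemma coprime_harm_approx:
  assumes W: "W > 0" and y: "y \<ge> 1"
  shows "\<bar>coprime_harm W y - totient W / W * ln y\<bar> \<le> W + 1"
proof -
  define n where "n = nat \<lceil>y\<rceil> - 1"
  have n: "real n < y" "y \<le> real (Suc n)"
    using y unfolding n_def by linarith+
  have set: "{m. 0 < m \<and> real m < y \<and> coprime m W} = {m. m \<in> {1..n} \<and> coprime m W}"
    using n by (auto simp: )
  have tw: "0 \<le> totient W / real W" "totient W / real W \<le> 1" using totient_le[of W] W by auto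
  have 1: "\<bar>coprime_harm W y - totient W / W * harm n\<bar> \<le> W"
    using coprime_sum_approx[OF W, of "\<lambda>i. 1 / real i" n]
    unfolding coprime_harm_def set harm_def by (simp add: divide_simps)
  have h: "ln y \<le> harm n" "harm n \<le> ln y + 1"
  proof -
    have "ln y \<le> ln (real (Suc n))" using n y by (subst ln_le_cancel_iff) auto
    then show "ln y \<le> harm n" using ln_le_harm[of n] by (simp add: add_ac)
    show "harm n \<le> ln y + 1"
    proof (cases "n = 0")
      case True then show ?thesis using y by (simp add: harm_def)
    next
      case False
      then have "harm n \<le> ln (real n) + 1" using harm_le_ln[of n] by simp
      moreover have "ln (real n) \<le> ln y" using n y False by (subst ln_le_cancel_iff) auto
      ultimately show ?thesis by simp
    qed
  qed
  have "\<bar>totient W / W * (harm n - ln y)\<bar> \<le> 1 * 1"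
    unfolding abs_mult using tw h by (intro mult_mono) auto
  moreover have "coprime_harm W y - totient W / W * ln y
      = (coprime_harm W y - totient W / W * harm n) + totient W / W * (harm n - ln y)"
    by (simp only: right_diff_distrib)
  ultimately have "\<bar>coprime_harm W y - totient W / W * ln y\<bar>
      \<le> \<bar>coprime_harm W y - totient W / W * harm n\<bar> + \<bar>totient W / W * (harm n - ln y)\<bar>"
    by (simp only: abs_triangle_ineq)
  also have "\<dots> \<le> real W + 1 * 1" by (intro add_mono) fact+
  finally show ?thesis by simp
qed

text \<open>Comparison with the integral of t powr (-(1 + \<sigma>)) over t \<ge> 1, which is 1 /
  \<sigma>; the mean value theorem takes the place of the integral.\<close>

lemma sum_powr_le:
  assumes s: "\<sigma> > 0"
  shows "(\<Sum>i=1..n. real i powr (-(1 + \<sigma>))) \<le> 1 + 1 / \<sigma>"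
proof -
  have step: "real (Suc i) powr (-(1 + \<sigma>)) \<le> (real i powr (-\<sigma>) - real (Suc i) powr (-\<sigma>)) / \<sigma>" if "i \<ge> 1" for i
  proof -
    have "\<exists>z. z > real i \<and> z < real (Suc i) \<and>
       (real (Suc i) powr (-\<sigma>) - real i powr (-\<sigma>)) = (real (Suc i) - real i) * (-\<sigma> * z powr (-\<sigma> - 1))"
    proof (rule MVT2)
      fix x assume "real i \<le> x" "x \<le> real (Suc i)"
      then have "x > 0" using that by linarith
      then show "((\<lambda>x. x powr (-\<sigma>)) has_real_derivative (-\<sigma> * x powr (-\<sigma> - 1))) (at x)"
        by (auto intro!: derivative_eq_intros)
    qed auto
    then obtain z where z: "z > real i" "z < real (Suc i)"
      "real i powr (-\<sigma>) - real (Suc i) powr (-\<sigma>) = \<sigma> * z powr (-\<sigma> - 1)" by (auto simp: algebra_simps)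
    have "real (Suc i) powr (-(1 + \<sigma>)) \<le> z powr (-(1+\<sigma>))"
      using z that s by (intro powr_mono2') auto
    moreover have "-\<sigma> - 1 = -(1 + \<sigma>)" by simp
    ultimately show ?thesis using z(3) s by (metis nonzero_mult_div_cancel_left order_less_irrefl)
  qed
  have "(\<Sum>i=1..n. real i powr (-(1 + \<sigma>))) \<le> 1 + (1 - real n powr (-\<sigma>)) / \<sigma>" if "n \<ge> 1" for n
    using that
  proof (induction n rule: nat_induct_at_least)
    case (Suc n)
    have "(\<Sum>i=1..Suc n. real i powr (-(1 + \<sigma>))) \<le> 1 + (1 - real n powr (-\<sigma>)) / \<sigma> + real (Suc n) powr (-(1 + \<sigma>))"
      using Suc.IH by (subst sum.nat_ivl_Suc') auto
    also have "\<dots> \<le> 1 + (1 - real (Suc n) powr (-\<sigma>)) / \<sigma>"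
      using step[OF Suc.hyps] unfolding diff_divide_distrib by linarith
    finally show ?case .
  qed auto
  note A = this
  show ?thesis
  proof (cases "n \<ge> 1")
    case True
    have "(1 - real n powr (-\<sigma>)) / \<sigma> \<le> 1 / \<sigma>" using s by (intro divide_right_mono) auto
    then show ?thesis using A[OF True] by linarith
  next
    case False then show ?thesis using s by simp
  qed
qed

lemma prime_dvd_prod_primes_iff:
  fixes A :: "nat set"
  assumes "finite A" "\<And>p. p \<in> A \<Longrightarrow> prime p" "prime q"
  shows "q dvd \<Prod>A \<longleftrightarrow> q \<in> A"
proof
  assume "q dvd \<Prod>A"
  then obtain p where "p \<in> A" "q dvd p" using prime_dvd_prod_iff[OF assms(1,3), of "\<lambda>x. x"] by auto
  then show "q \<in> A" using assms by (metis primes_dvd_imp_eq)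
qed (use assms in \<open>auto intro: dvd_prodI\<close>)

lemma inj_on_prod_primes:
  assumes "finite P" "\<And>p. p \<in> P \<Longrightarrow> prime (p::nat)"
  shows "inj_on (\<lambda>A. \<Prod>A) (Pow P)"
proof (rule inj_onI)
  fix A B assume AB: "A \<in> Pow P" "B \<in> Pow P" "\<Prod>A = \<Prod>B"
  have "A = {q. prime q \<and> q dvd \<Prod>A}" if "A \<in> Pow P" for A
    using prime_dvd_prod_primes_iff[of A] that assms finite_subset by blast
  then show "A = B" using AB by metis
qed

lemma prod_pos_primes: "(\<And>p. p \<in> A \<Longrightarrow> prime (p::nat)) \<Longrightarrow> \<Prod>A > 0"
  by (rule prod_pos) (auto dest: prime_gt_0_nat)

text \<open>Expanding the product gives a sum over squarefree n composed of primes in P, which is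
  enlarged to all n \<le> \<Prod>P coprime to W. With \<sigma> = 1 / ln R the bound becomes totient
  W / W * (1 + ln R) + W, so it keeps the density factor totient W / W that each variable of the
  main terms carries.\<close>

lemma euler_prod_le:
  assumes "finite P" "\<And>p. p \<in> P \<Longrightarrow> prime (p::nat)" "\<And>p. p \<in> P \<Longrightarrow> coprime p W" and W: "W > 0"
    and s: "\<sigma> > 0"
  shows "(\<Prod>p\<in>P. 1 + real p powr (-(1 + \<sigma>))) \<le> totient W / W * (1 + 1 / \<sigma>) + W"
proof -
  define M where "M = \<Prod>P"
  have "(\<Prod>p\<in>P. 1 + real p powr (-(1 + \<sigma>))) = (\<Sum>A\<in>Pow P. \<Prod>p\<in>A. real p powr (-(1 + \<sigma>)))"
    using prod_add[OF assms(1), of "\<lambda>p. real p powr (-(1 + \<sigma>))" "\<lambda>_. 1"] by (simp add: add.commute)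
  also have "\<dots> = (\<Sum>A\<in>Pow P. real (\<Prod>A) powr (-(1 + \<sigma>)))"
    by (intro sum.cong refl) (simp add: prod_powr_distrib)
  also have "\<dots> = (\<Sum>n\<in>(\<lambda>A. \<Prod>A) ` Pow P. real n powr (-(1 + \<sigma>)))"
    by (subst sum.reindex[OF inj_on_prod_primes]) (use assms in auto)
  also have "\<dots> \<le> (\<Sum>n | n \<in> {1..M} \<and> coprime n W. real n powr (-(1 + \<sigma>)))"
  proof (rule sum_mono2)
    have "\<Prod>A \<in> {1..M} \<and> coprime (\<Prod>A) W" if "A \<subseteq> P" for A
    proof -
      have "\<Prod>A dvd M" unfolding M_def using assms(1) that by (rule prod_dvd_prod_subset)
      moreover have "M > 0" "\<Prod>A > 0" unfolding M_def by (intro prod_pos_primes; use that assms in auto)+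
      moreover have "coprime (\<Prod>A) W" using that assms by (intro prod_coprime_left) auto
      ultimately show ?thesis using dvd_imp_le by auto
    qed
    then show "(\<lambda>A. \<Prod>A) ` Pow P \<subseteq> {n. n \<in> {1..M} \<and> coprime n W}" by blast
  qed auto
  also have "\<dots> \<le> totient W / W * (\<Sum>n=1..M. real n powr (-(1 + \<sigma>))) + W"
  proof -
    have "\<bar>(\<Sum>n | n \<in> {1..M} \<and> coprime n W. real n powr (-(1 + \<sigma>))) - totient W / W * (\<Sum>i=1..M. real i powr (-(1 + \<sigma>)))\<bar>
      \<le> W * (real 1 powr (-(1 + \<sigma>)))"
      by (rule coprime_sum_approx[OF W, of "\<lambda>i. real i powr (-(1 + \<sigma>))"]) (use s in \<open>auto intro!: powr_mono2'\<close>)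
    then show ?thesis by simp
  qed
  also have "\<dots> \<le> totient W / W * (1 + 1 / \<sigma>) + W"
    using sum_powr_le[OF s, of M] by (intro add_right_mono mult_left_mono) auto
  finally show ?thesis .
qed

section \<open>Chebyshev-type lower bounds for the von Mangoldt function\<close>

lemma ln_fact_ge: "n \<ge> 1 \<Longrightarrow> ln (fact n :: real) \<ge> n * ln n - n"
proof (induction n rule: nat_induct_at_least)
  case (Suc n)
  have "ln (real (Suc n) / real n) \<le> real (Suc n) / real n - 1"
    using Suc.hyps by (intro ln_le_minus_one) auto
  also have "\<dots> = 1 / real n" using Suc.hyps by (simp add: field_simps)
  finally have "n * (ln (real (Suc n)) - ln (real n)) \<le> 1"
    using Suc.hyps by (simp add: ln_div field_simps)
  moreover have "ln (fact (Suc n) :: real) = ln (real (Suc n)) + ln (fact n)"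
    unfolding fact_Suc by (subst ln_mult) (auto simp del: of_nat_Suc)
  moreover have "real (Suc n) * ln (real (Suc n)) = n * ln (real (Suc n)) + ln (real (Suc n))"
    by (simp add: algebra_simps)
  ultimately show ?case using Suc.IH by (simp add: right_diff_distrib)
qed auto

lemma card_multiples_le:
  fixes d n :: nat
  assumes "d > 0"
  shows "real (card {m \<in> {1..n}. d dvd m}) \<le> n / d"
proof -
  have "{m \<in> {1..n}. d dvd m} \<subseteq> (\<lambda>j. d * j) ` {1..n div d}"
  proof
    fix m assume "m \<in> {m \<in> {1..n}. d dvd m}"
    then obtain j where j: "m = d * j" "1 \<le> m" "m \<le> n" by auto
    then have "j \<in> {1..n div d}" using assms by (auto simp: less_eq_div_iff_mult_less_eq mult.commute intro!: Suc_leI gr0I)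
    then show "m \<in> (\<lambda>j. d * j) ` {1..n div d}" using j by blast
  qed
  then have "card {m \<in> {1..n}. d dvd m} \<le> card ((\<lambda>j. d * j) ` {1..n div d})"
    by (intro card_mono) auto
  also have "\<dots> \<le> n div d" using card_image_le[of "{1..n div d}" "\<lambda>j. d * j"] by simp
  finally have "real (card {m \<in> {1..n}. d dvd m}) \<le> real (n div d)" by simp
  also have "\<dots> \<le> n / d" by (rule of_nat_div_le_of_nat)
  finally show ?thesis .
qed

text \<open>Chebyshev's identity: ln (n!) is the sum of \<open>mangoldt d\<close> times the number
  of multiples of d up to n. That number is at most n / d, while ln (n!) \<ge> n * ln n - n.\<close>

lemma sum_mangoldt_over_ge:
  assumes "n \<ge> 1"
  shows "(\<Sum>d=1..n. mangoldt d / real d) \<ge> ln (real n) - 1"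
proof -
  have "ln (fact n :: real) = ln (\<Prod>m=1..n. real m)" by (simp add: fact_prod)
  also have "\<dots> = (\<Sum>m=1..n. ln (real m))" by (rule ln_prod) auto
  also have "\<dots> = (\<Sum>m=1..n. \<Sum>d\<in>{1..n}. if d dvd m then mangoldt d else 0)"
  proof (intro sum.cong refl)
    fix m assume m: "m \<in> {1..n}"
    then have "ln (real m) = (\<Sum>d | d dvd m. mangoldt d)" using mangoldt_sum[of m, where ?'a = real] by simp
    also have "{d. d dvd m} = {d \<in> {1..n}. d dvd m}"
    proof -
      have "d \<in> {1..n}" if "d dvd m" for d
        using dvd_imp_le[OF that] dvd_pos_nat[OF _ that] m by auto
      then show ?thesis by blast
    qed
    also have "(\<Sum>d\<in>\<dots>. mangoldt d) = (\<Sum>d\<in>{1..n}. if d dvd m then mangoldt d else 0)"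
      by (rule sum.inter_filter) auto
    finally show "ln (real m) = \<dots>" .
  qed
  also have "\<dots> = (\<Sum>d\<in>{1..n}. \<Sum>m=1..n. if d dvd m then mangoldt d else 0)" by (rule sum.swap)
  also have "\<dots> = (\<Sum>d\<in>{1..n}. mangoldt d * real (card {m \<in> {1..n}. d dvd m}))"
    by (intro sum.cong refl) (subst sum.inter_filter[symmetric], auto)
  also have "\<dots> \<le> (\<Sum>d\<in>{1..n}. mangoldt d * (n / d))"
    by (intro sum_mono mult_left_mono card_multiples_le) (auto simp: mangoldt_nonneg)
  also have "\<dots> = n * (\<Sum>d=1..n. mangoldt d / real d)" by (simp add: sum_distrib_left field_simps)
  finally have "n * (\<Sum>d=1..n. mangoldt d / real d) \<ge> n * (ln (real n) - 1)"
    using ln_fact_ge[OF assms] by (simp add: algebra_simps)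
  then show ?thesis using assms by simp
qed

text \<open>From \<open>mangoldt d\<close> \<le> ln d \<le> 2 * sqrt d the sum is at most 2 * (1 + 1
  / (1/2)) = 6.\<close>

lemma sum_mangoldt_square_le: "(\<Sum>d=1..n. mangoldt d / (real d * real d)) \<le> 6"
proof -
  have "mangoldt d / (real d * real d) \<le> 2 * real d powr (-(1 + 1/2))" if "d \<in> {1..n}" for d
  proof -
    have "mangoldt d \<le> ln (real d)" using mangoldt_le that by auto
    also have "ln (real d) = 2 * ln (real d powr (1/2))" using that by (simp add: ln_powr)
    also have "\<dots> \<le> 2 * real d powr (1/2)"
      using ln_le_minus_one[of "real d powr (1/2)"] that by (intro mult_left_mono) auto
    finally have "mangoldt d / (real d * real d) \<le> 2 * real d powr (1/2) / (real d * real d)"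
      by (intro divide_right_mono) auto
    also have "2 * real d powr (1/2) / (real d * real d) = 2 * (real d powr (1/2) / real d powr 2)"
      using that by (simp add: powr_numeral power2_eq_square)
    also have "\<dots> = 2 * real d powr (1/2 - 2)" using that by (simp only: powr_diff)
    also have "1/2 - 2 = (-(1 + 1/2) :: real)" by simp
    finally show ?thesis .
  qed
  then have "(\<Sum>d=1..n. mangoldt d / (real d * real d)) \<le> (\<Sum>d=1..n. 2 * real d powr (-(1 + 1/2)))"
    by (rule sum_mono)
  also have "\<dots> \<le> 2 * (1 + 1 / (1/2))"
    unfolding sum_distrib_left[symmetric] using sum_powr_le[of "1/2" n] by (intro mult_left_mono) auto
  finally show ?thesis by simp
qed

lemma sum_reciprocal_telescope:
  assumes "1 \<le> a" "a \<le> Suc n"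
  shows "(\<Sum>x=a..n. 1 / (real x * real (Suc x))) = 1 / a - 1 / Suc n"
proof -
  have "(\<Sum>x=a..n. 1 / (real x * real (Suc x))) = (\<Sum>x=a..n. 1 / real x - 1 / real (Suc x))"
    using assms(1) by (intro sum.cong refl) (auto simp: field_simps)
  also have "\<dots> = - (\<Sum>x=a..n. 1 / real (Suc x) - 1 / real x)" by (simp add: sum_negf[symmetric])
  also have "\<dots> = - (1 / real (Suc n) - 1 / real a)"
    using assms(2) by (subst sum_Suc_diff) auto
  finally show ?thesis by simp
qed

text \<open>Averaging \<open>\<Psi>(2x) - \<Psi>(x)\<close> against \<open>1 / (x (x + 1))\<close> recovers
  \<open>\<Sum>\<Lambda>(n) / n\<close>, so the elementary bound for the latter already produces
  arbitrarily large dyadic intervals with the expected amount of primes; the prime number theorem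
  is not needed.\<close>
lemma dyadic_mangoldt_ge:
  assumes "\<epsilon> > 0"
  shows "\<exists>x\<ge>x0. (\<Sum>n=x..2*x. mangoldt n) \<ge> (1 - \<epsilon>) * real x"
proof (rule ccontr)
  assume "\<not> ?thesis"
  then have neg: "(\<Sum>n=x..2*x. mangoldt n) < (1 - \<epsilon>) * real x" if "x \<ge> x0" for x
    using that by force
  define \<Psi> where "\<Psi> x = (\<Sum>n=x..2*x. mangoldt n :: real)" for x :: nat
  have \<Psi>0: "\<Psi> x \<ge> 0" for x unfolding \<Psi>_def by (intro sum_nonneg mangoldt_nonneg)
  have e1: "\<epsilon> < 1"
  proof -
    have "0 < (1 - \<epsilon>) * real (Suc x0)" using neg[of "Suc x0"] \<Psi>0[of "Suc x0"] unfolding \<Psi>_def by linarith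
    then show ?thesis by (simp add: zero_less_mult_iff)
  qed
  define K where "K = (\<Sum>x=1..x0. \<Psi> x)"
  have K0: "K \<ge> 0" unfolding K_def by (intro sum_nonneg \<Psi>0)
  define T where "T y = (\<Sum>x=1..y. \<Psi> x * (1 / (real x * real (Suc x))))" for y :: nat
  have lower: "T y \<ge> ln (real y) - 7" if y: "y \<ge> 1" for y
  proof -
    have "T y = (\<Sum>x=1..y. \<Sum>n=1..2*y. if n \<in> {x..2*x} then mangoldt n * (1 / (real x * real (Suc x))) else 0)"
      unfolding T_def
    proof (intro sum.cong refl)
      fix x assume x: "x \<in> {1..y}"
      have "\<Psi> x * (1 / (real x * real (Suc x))) = (\<Sum>n=x..2*x. mangoldt n * (1 / (real x * real (Suc x))))"
        unfolding \<Psi>_def by (rule sum_distrib_right)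
      also have "{x..2*x} = {n \<in> {1..2*y}. n \<in> {x..2*x}}" using x by auto
      also have "(\<Sum>n\<in>\<dots>. mangoldt n * (1 / (real x * real (Suc x)))) =
         (\<Sum>n=1..2*y. if n \<in> {x..2*x} then mangoldt n * (1 / (real x * real (Suc x))) else 0)"
        by (rule sum.inter_filter) auto
      finally show "\<Psi> x * (1 / (real x * real (Suc x))) = \<dots>" .
    qed
    also have "\<dots> = (\<Sum>n=1..2*y. \<Sum>x=1..y. if n \<in> {x..2*x} then mangoldt n * (1 / (real x * real (Suc x))) else 0)"
      by (rule sum.swap)
    \<comment> \<open>For n > y the range of x would be cut off at y, so these terms are
      dropped.\<close>
    also have "\<dots> \<ge> (\<Sum>n=1..y. \<Sum>x=1..y. if n \<in> {x..2*x} then mangoldt n * (1 / (real x * real (Suc x))) else 0)"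
      by (intro sum_mono2 sum_nonneg) (auto simp: mangoldt_nonneg)
    also have "(\<Sum>n=1..y. \<Sum>x=1..y. if n \<in> {x..2*x} then mangoldt n * (1 / (real x * real (Suc x))) else 0)
       \<ge> (\<Sum>n=1..y. mangoldt n / real n - mangoldt n / (real n * real n))"
    proof (rule sum_mono)
      fix n assume n: "n \<in> {1..y}"
      have "(\<Sum>x=1..y. if n \<in> {x..2*x} then mangoldt n * (1 / (real x * real (Suc x))) else 0)
         = (\<Sum>x\<in>{x \<in> {1..y}. n \<in> {x..2*x}}. mangoldt n * (1 / (real x * real (Suc x))))"
        by (rule sum.inter_filter[symmetric]) auto
      \<comment> \<open>\<open>Suc n div 2\<close> is n / 2 rounded up, the least x with n \<le>
        2x.\<close>
      also have "{x \<in> {1..y}. n \<in> {x..2*x}} = {Suc n div 2..n}" using n by auto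
      also have "(\<Sum>x=Suc n div 2..n. mangoldt n * (1 / (real x * real (Suc x))))
        = mangoldt n * (1 / real (Suc n div 2) - 1 / real (Suc n))"
        unfolding sum_distrib_left[symmetric] by (subst sum_reciprocal_telescope) (use n in auto)
      \<comment> \<open>The bracket is at least 2 / (n + 1) - 1 / (n + 1) = 1 / (n + 1), which loses
        only 1 / n^2 against 1 / n.\<close>
      also have "\<dots> \<ge> mangoldt n * (1 / real n - 1 / (real n * real n))"
      proof (rule mult_left_mono[OF _ mangoldt_nonneg])
        have "real (Suc n div 2) \<le> real (Suc n) / 2" using of_nat_div_le_of_nat[of "Suc n" 2] by simp
        moreover have "real (Suc n div 2) > 0" using n by (simp add: div_greater_zero_iff)
        ultimately have "1 / (real (Suc n) / 2) \<le> 1 / real (Suc n div 2)" by (intro divide_left_mono) auto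
        moreover have "1 / real n - 1 / (real n * real n) \<le> 1 / real (Suc n)"
          using n by (simp add: field_simps)
        ultimately show "1 / real n - 1 / (real n * real n) \<le> 1 / real (Suc n div 2) - 1 / real (Suc n)"
          by simp
      qed
      finally show "mangoldt n / real n - mangoldt n / (real n * real n) \<le>
         (\<Sum>x=1..y. if n \<in> {x..2*x} then mangoldt n * (1 / (real x * real (Suc x))) else 0)"
        by (simp add: right_diff_distrib)
    qed
    also have "(\<Sum>n=1..y. mangoldt n / real n - mangoldt n / (real n * real n)) \<ge> ln (real y) - 7"
      using sum_mangoldt_over_ge[OF y] sum_mangoldt_square_le[of y] unfolding sum_subtractf by linarith
    finally show ?thesis by linarith
  qed
  have upper: "T y \<le> K + (1 - \<epsilon>) * (ln (real y) + 1)" if y: "y \<ge> 1" for y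
  proof -
    have "T y \<le> (\<Sum>x=1..y. (if x \<le> x0 then \<Psi> x else 0) + (1 - \<epsilon>) * (1 / real x))"
      unfolding T_def
    proof (rule sum_mono)
      fix x assume x: "x \<in> {1..y}"
      show "\<Psi> x * (1 / (real x * real (Suc x))) \<le> (if x \<le> x0 then \<Psi> x else 0) + (1 - \<epsilon>) * (1 / real x)"
      proof (cases "x \<le> x0")
        case True
        have "real x * real (Suc x) \<ge> 1 * 1" using x by (intro mult_mono) auto
        then have "\<Psi> x * (1 / (real x * real (Suc x))) \<le> \<Psi> x * 1"
          using \<Psi>0 by (intro mult_left_mono) auto
        moreover have "(1 - \<epsilon>) * (1 / real x) \<ge> 0" using e1 by auto
        ultimately show ?thesis using True by simp
      next
        case False
        have "\<Psi> x * (1 / (real x * real (Suc x))) \<le> ((1 - \<epsilon>) * real x) * (1 / (real x * real (Suc x)))"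
          using neg[of x] False unfolding \<Psi>_def by (intro mult_right_mono) auto
        also have "\<dots> = (1 - \<epsilon>) * (1 / real (Suc x))" using x by simp
        also have "\<dots> \<le> (1 - \<epsilon>) * (1 / real x)"
          using e1 x by (intro mult_left_mono divide_left_mono) auto
        finally show ?thesis using False by simp
      qed
    qed
    also have "\<dots> = (\<Sum>x\<in>{x\<in>{1..y}. x \<le> x0}. \<Psi> x) + (1 - \<epsilon>) * harm y"
      by (subst sum.inter_filter) (simp_all add: sum.distrib sum_distrib_left harm_def divide_inverse)
    also have "\<dots> \<le> K + (1 - \<epsilon>) * (ln (real y) + 1)"
      unfolding K_def using e1 harm_le_ln[OF y]
      by (intro add_mono mult_left_mono sum_mono2 \<Psi>0) auto
    finally show ?thesis .
  qed
  \<comment> \<open>The two bounds for \<open>T y\<close> give \<epsilon> * ln y \<le> K + 8 -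
    \<epsilon>, so \<epsilon> * ln y \<ge> K + 9 is a contradiction.\<close>
  define y where "y = nat \<lceil>exp ((K + 9) / \<epsilon>)\<rceil> + 1"
  have y: "real y \<ge> exp ((K + 9) / \<epsilon>)" "y \<ge> 1" unfolding y_def by linarith+
  then have "ln (real y) \<ge> (K + 9) / \<epsilon>" using ln_ge_iff[of "real y"] by simp
  then have "\<epsilon> * ln (real y) \<ge> K + 9" using assms by (simp add: field_simps)
  moreover have "ln (real y) - 7 \<le> K + (1 - \<epsilon>) * (ln (real y) + 1)"
    using lower[OF y(2)] upper[OF y(2)] by linarith
  ultimately show False using assms by (simp add: algebra_simps)
qed

subsection \<open>Tensor quadratic forms\<close>

abbreviation colourings :: "nat set \<Rightarrow> nat \<Rightarrow> (nat \<Rightarrow> nat) set" where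
  "colourings P k \<equiv> PiE P (\<lambda>_. {..k})"

lemma finite_colourings: "finite P \<Longrightarrow> finite (colourings P k)"
  by (intro finite_PiE) auto

lemma sum_PiE_pairs:
  fixes f :: "'a \<Rightarrow> 'b \<Rightarrow> 'c \<Rightarrow> 'd :: comm_semiring_1"
  assumes "finite P" "finite S" "finite T"
  shows "(\<Sum>r\<in>PiE P (\<lambda>_. S). \<Sum>s\<in>PiE P (\<lambda>_. T). \<Prod>p\<in>P. f p (r p) (s p))
       = (\<Prod>p\<in>P. \<Sum>a\<in>S. \<Sum>b\<in>T. f p a b)"
proof -
  have "(\<Prod>p\<in>P. \<Sum>a\<in>S. \<Sum>b\<in>T. f p a b) = (\<Sum>r\<in>PiE P (\<lambda>_. S). \<Prod>p\<in>P. \<Sum>b\<in>T. f p (r p) b)"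
    using assms by (intro prod_sum_PiE) auto
  also have "\<dots> = (\<Sum>r\<in>PiE P (\<lambda>_. S). \<Sum>s\<in>PiE P (\<lambda>_. T). \<Prod>p\<in>P. f p (r p) (s p))"
    using assms by (intro sum.cong refl prod_sum_PiE) auto
  finally show ?thesis by simp
qed

text \<open>With lam = L y for the tensor product L of the local matrices \<open>L p\<close>, the
  form with matrix M becomes the form in y with matrix L^T M L. Its entries factor over P because
  those of L and M do.\<close>

lemma tensor_change_of_variables:
  fixes L :: "'a \<Rightarrow> 'b \<Rightarrow> 'b \<Rightarrow> real" and y :: "('a \<Rightarrow> 'b) \<Rightarrow> real" and M :: "'a \<Rightarrow> 'b \<Rightarrow> 'b \<Rightarrow> real"
  assumes P: "finite P" and S: "finite S"
  defines "C \<equiv> PiE P (\<lambda>_. S)"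
  defines "lam \<equiv> (\<lambda>d. \<Sum>r\<in>C. (\<Prod>p\<in>P. L p (d p) (r p)) * y r)"
  shows "(\<Sum>d\<in>C. \<Sum>e\<in>C. lam d * lam e * (\<Prod>p\<in>P. M p (d p) (e p)))
    = (\<Sum>r\<in>C. \<Sum>s\<in>C. y r * y s * (\<Prod>p\<in>P. \<Sum>u\<in>S. \<Sum>v\<in>S. L p u (r p) * L p v (s p) * M p u v))"
proof -
  have "(\<Sum>d\<in>C. \<Sum>e\<in>C. lam d * lam e * (\<Prod>p\<in>P. M p (d p) (e p)))
     = (\<Sum>d\<in>C. \<Sum>e\<in>C. \<Sum>r\<in>C. \<Sum>s\<in>C. y r * y s * (\<Prod>p\<in>P. L p (d p) (r p) * L p (e p) (s p) * M p (d p) (e p)))"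
    unfolding lam_def sum_product unfolding sum_distrib_right
    by (intro sum.cong refl) (simp add: prod.distrib ac_simps)
  also have "\<dots> = (\<Sum>d\<in>C. \<Sum>r\<in>C. \<Sum>e\<in>C. \<Sum>s\<in>C. y r * y s * (\<Prod>p\<in>P. L p (d p) (r p) * L p (e p) (s p) * M p (d p) (e p)))"
    by (rule sum.cong[OF refl], rule sum.swap)
  also have "\<dots> = (\<Sum>r\<in>C. \<Sum>d\<in>C. \<Sum>e\<in>C. \<Sum>s\<in>C. y r * y s * (\<Prod>p\<in>P. L p (d p) (r p) * L p (e p) (s p) * M p (d p) (e p)))"
    by (rule sum.swap)
  also have "\<dots> = (\<Sum>r\<in>C. \<Sum>d\<in>C. \<Sum>s\<in>C. \<Sum>e\<in>C. y r * y s * (\<Prod>p\<in>P. L p (d p) (r p) * L p (e p) (s p) * M p (d p) (e p)))"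
    by (rule sum.cong[OF refl], rule sum.cong[OF refl], rule sum.swap)
  also have "\<dots> = (\<Sum>r\<in>C. \<Sum>s\<in>C. \<Sum>d\<in>C. \<Sum>e\<in>C. y r * y s * (\<Prod>p\<in>P. L p (d p) (r p) * L p (e p) (s p) * M p (d p) (e p)))"
    by (rule sum.cong[OF refl], rule sum.swap)
  also have "\<dots> = (\<Sum>r\<in>C. \<Sum>s\<in>C. y r * y s * (\<Prod>p\<in>P. \<Sum>u\<in>S. \<Sum>v\<in>S. L p u (r p) * L p v (s p) * M p u v))"
  proof (intro sum.cong refl)
    fix r s
    show "(\<Sum>d\<in>C. \<Sum>e\<in>C. y r * y s * (\<Prod>p\<in>P. L p (d p) (r p) * L p (e p) (s p) * M p (d p) (e p)))
      = y r * y s * (\<Prod>p\<in>P. \<Sum>u\<in>S. \<Sum>v\<in>S. L p u (r p) * L p v (s p) * M p u v)"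
      unfolding sum_distrib_left[symmetric] C_def
      by (subst sum_PiE_pairs[OF P S S, symmetric]) (rule refl)
  qed
  finally show ?thesis .
qed

text \<open>Write n = a + (n - a): in the expanded product every term except that of the a's alone
  contains a factor n - a, and replacing each such factor by z yields the same expansion with
  nonnegative terms.\<close>

lemma abs_prod_diff_le:
  fixes a n z :: "'a \<Rightarrow> real"
  assumes "finite P" "\<And>p. p \<in> P \<Longrightarrow> 0 \<le> a p" "\<And>p. p \<in> P \<Longrightarrow> \<bar>n p - a p\<bar> \<le> z p"
  shows "\<bar>(\<Prod>p\<in>P. n p) - (\<Prod>p\<in>P. a p)\<bar> \<le> (\<Prod>p\<in>P. a p + z p) - (\<Prod>p\<in>P. a p)"
  using assms
proof (induction P rule: finite_induct)
  case (insert q P)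
  have IH: "\<bar>(\<Prod>p\<in>P. n p) - (\<Prod>p\<in>P. a p)\<bar> \<le> (\<Prod>p\<in>P. a p + z p) - (\<Prod>p\<in>P. a p)"
    using insert by auto
  have n: "\<bar>n p\<bar> \<le> a p + z p" if "p \<in> insert q P" for p
    using insert.prems[of p] that by (auto simp: abs_le_iff)
  have N: "\<bar>\<Prod>p\<in>P. n p\<bar> \<le> (\<Prod>p\<in>P. a p + z p)"
    unfolding abs_prod using n by (intro prod_mono) auto
  have q: "0 \<le> a q" "\<bar>n q - a q\<bar> \<le> z q" using insert.prems by auto
  have "n q * (\<Prod>p\<in>P. n p) - a q * (\<Prod>p\<in>P. a p) = (n q - a q) * (\<Prod>p\<in>P. n p) + a q * ((\<Prod>p\<in>P. n p) - (\<Prod>p\<in>P. a p))"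
    by (simp add: algebra_simps)
  also have "\<bar>\<dots>\<bar> \<le> \<bar>(n q - a q) * (\<Prod>p\<in>P. n p)\<bar> + \<bar>a q * ((\<Prod>p\<in>P. n p) - (\<Prod>p\<in>P. a p))\<bar>"
    by (rule abs_triangle_ineq)
  also have "\<dots> \<le> z q * (\<Prod>p\<in>P. a p + z p) + a q * ((\<Prod>p\<in>P. a p + z p) - (\<Prod>p\<in>P. a p))"
    unfolding abs_mult using q N IH by (intro add_mono mult_mono) auto
  also have "\<dots> = (a q + z q) * (\<Prod>p\<in>P. a p + z p) - a q * (\<Prod>p\<in>P. a p)"
    by (simp add: algebra_simps)
  finally show ?case using insert by simp
qed auto

text \<open>Here s + z \<le> s * (1 + z) \<le> s * exp z, which is where s \<ge> 1 enters: absolute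
  errors become relative ones.\<close>

lemma prod_add_diff_le:
  fixes s z :: "'a \<Rightarrow> real"
  assumes "finite P" "\<And>p. p \<in> P \<Longrightarrow> 1 \<le> s p" "\<And>p. p \<in> P \<Longrightarrow> 0 \<le> z p"
  shows "(\<Prod>p\<in>P. s p + z p) - (\<Prod>p\<in>P. s p) \<le> (\<Prod>p\<in>P. s p) * (exp (\<Sum>p\<in>P. z p) - 1)"
proof -
  have "(\<Prod>p\<in>P. s p + z p) \<le> (\<Prod>p\<in>P. s p * exp (z p))"
  proof (intro prod_mono conjI)
    fix p assume p: "p \<in> P"
    have "s p + z p \<le> s p * (1 + z p)" using assms(2,3)[OF p] using mult_right_mono[of 1 "s p" "z p"] by (simp add: algebra_simps)
    also have "\<dots> \<le> s p * exp (z p)" using assms(2)[OF p] by (intro mult_left_mono exp_ge_add_one_self) auto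
    finally show "s p + z p \<le> s p * exp (z p)" .
    show "0 \<le> s p + z p" using assms(2,3)[OF p] by linarith
  qed
  also have "\<dots> = (\<Prod>p\<in>P. s p) * exp (\<Sum>p\<in>P. z p)" using assms(1) by (simp add: prod.distrib exp_sum)
  finally show ?thesis by (simp add: algebra_simps)
qed

text \<open>Rankin's trick turns the support condition on \<open>y\<close> into multiplicative weights \<open>\<rho>\<close>, after which
  the sum over pairs of colourings factors over the primes.\<close>
lemma tensor_perturbation_le:
  fixes A N Z :: "'a \<Rightarrow> 'b \<Rightarrow> 'b \<Rightarrow> real" and \<rho> :: "'a \<Rightarrow> 'b \<Rightarrow> real" and y :: "('a \<Rightarrow> 'b) \<Rightarrow> real"
  assumes P: "finite P" and S: "finite S"
  defines "C \<equiv> PiE P (\<lambda>_. S)"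
  assumes A: "\<And>p a b. p \<in> P \<Longrightarrow> a \<in> S \<Longrightarrow> b \<in> S \<Longrightarrow> 0 \<le> A p a b"
    and Z: "\<And>p a b. p \<in> P \<Longrightarrow> a \<in> S \<Longrightarrow> b \<in> S \<Longrightarrow> \<bar>N p a b - A p a b\<bar> \<le> Z p a b"
    and \<rho>: "\<And>p a. p \<in> P \<Longrightarrow> a \<in> S \<Longrightarrow> 0 \<le> \<rho> p a \<and> \<rho> p a \<le> 1"
    and y: "\<And>r. r \<in> C \<Longrightarrow> \<bar>y r\<bar> \<le> Y * (\<Prod>p\<in>P. \<rho> p (r p))"
    and sl: "\<And>p. p \<in> P \<Longrightarrow> 1 \<le> (\<Sum>a\<in>S. \<Sum>b\<in>S. A p a b * \<rho> p a * \<rho> p b)"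
    and su: "\<And>p. p \<in> P \<Longrightarrow> (\<Sum>a\<in>S. \<Sum>b\<in>S. A p a b * \<rho> p a * \<rho> p b) \<le> \<alpha> p"
    and z: "\<And>p. p \<in> P \<Longrightarrow> (\<Sum>a\<in>S. \<Sum>b\<in>S. Z p a b) \<le> \<zeta> p"
  shows "\<bar>(\<Sum>r\<in>C. \<Sum>s\<in>C. y r * y s * (\<Prod>p\<in>P. N p (r p) (s p))) - (\<Sum>r\<in>C. \<Sum>s\<in>C. y r * y s * (\<Prod>p\<in>P. A p (r p) (s p)))\<bar>
    \<le> Y\<^sup>2 * ((\<Prod>p\<in>P. \<alpha> p) * (exp (\<Sum>p\<in>P. \<zeta> p) - 1))"
proof -
  define pr where "pr r = (\<Prod>p\<in>P. \<rho> p (r p))" for r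
  define sA where "sA p = (\<Sum>a\<in>S. \<Sum>b\<in>S. A p a b * \<rho> p a * \<rho> p b)" for p
  define sZ where "sZ p = (\<Sum>a\<in>S. \<Sum>b\<in>S. Z p a b * \<rho> p a * \<rho> p b)" for p
  have Z0: "0 \<le> Z p a b" if "p \<in> P" "a \<in> S" "b \<in> S" for p a b using Z[OF that] by linarith
  have memC: "r p \<in> S" if "r \<in> C" "p \<in> P" for r p using that unfolding C_def by auto
  have "\<bar>(\<Sum>r\<in>C. \<Sum>s\<in>C. y r * y s * (\<Prod>p\<in>P. N p (r p) (s p))) - (\<Sum>r\<in>C. \<Sum>s\<in>C. y r * y s * (\<Prod>p\<in>P. A p (r p) (s p)))\<bar>
     = \<bar>\<Sum>r\<in>C. \<Sum>s\<in>C. y r * y s * ((\<Prod>p\<in>P. N p (r p) (s p)) - (\<Prod>p\<in>P. A p (r p) (s p)))\<bar>"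
    by (simp add: sum_subtractf right_diff_distrib)
  also have "\<dots> \<le> (\<Sum>r\<in>C. \<Sum>s\<in>C. \<bar>y r * y s * ((\<Prod>p\<in>P. N p (r p) (s p)) - (\<Prod>p\<in>P. A p (r p) (s p)))\<bar>)"
    by (rule order_trans[OF sum_abs], rule sum_mono, rule sum_abs)
  also have "\<dots> \<le> (\<Sum>r\<in>C. \<Sum>s\<in>C. Y\<^sup>2 * ((\<Prod>p\<in>P. (A p (r p) (s p) + Z p (r p) (s p)) * \<rho> p (r p) * \<rho> p (s p))
        - (\<Prod>p\<in>P. A p (r p) (s p) * \<rho> p (r p) * \<rho> p (s p))))"
  proof (intro sum_mono)
    fix r s assume rs: "r \<in> C" "s \<in> C"
    have "\<bar>(\<Prod>p\<in>P. N p (r p) (s p)) - (\<Prod>p\<in>P. A p (r p) (s p))\<bar>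
       \<le> (\<Prod>p\<in>P. A p (r p) (s p) + Z p (r p) (s p)) - (\<Prod>p\<in>P. A p (r p) (s p))"
      using rs memC by (intro abs_prod_diff_le P A Z) auto
    moreover have yy: "\<bar>y r * y s\<bar> \<le> (Y * pr r) * (Y * pr s)"
      unfolding abs_mult
    proof (rule mult_mono)
      show r: "\<bar>y r\<bar> \<le> Y * pr r" and "\<bar>y s\<bar> \<le> Y * pr s" using y rs unfolding pr_def by auto
      show "0 \<le> Y * pr r" using r by linarith
    qed simp
    moreover have "0 \<le> (Y * pr r) * (Y * pr s)" using yy by linarith
    ultimately have "\<bar>y r * y s * ((\<Prod>p\<in>P. N p (r p) (s p)) - (\<Prod>p\<in>P. A p (r p) (s p)))\<bar>
      \<le> ((Y * pr r) * (Y * pr s)) * ((\<Prod>p\<in>P. A p (r p) (s p) + Z p (r p) (s p)) - (\<Prod>p\<in>P. A p (r p) (s p)))"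
      unfolding abs_mult[of "y r * y s"] by (intro mult_mono) simp_all
    also have "\<dots> = Y\<^sup>2 * ((\<Prod>p\<in>P. A p (r p) (s p) + Z p (r p) (s p)) * pr r * pr s - (\<Prod>p\<in>P. A p (r p) (s p)) * pr r * pr s)"
      by (simp add: algebra_simps power2_eq_square)
    finally show "\<bar>y r * y s * ((\<Prod>p\<in>P. N p (r p) (s p)) - (\<Prod>p\<in>P. A p (r p) (s p)))\<bar>
      \<le> Y\<^sup>2 * ((\<Prod>p\<in>P. (A p (r p) (s p) + Z p (r p) (s p)) * \<rho> p (r p) * \<rho> p (s p))
        - (\<Prod>p\<in>P. A p (r p) (s p) * \<rho> p (r p) * \<rho> p (s p)))"
      by (simp add: prod.distrib pr_def)
  qed
  also have "\<dots> = Y\<^sup>2 * ((\<Prod>p\<in>P. \<Sum>a\<in>S. \<Sum>b\<in>S. (A p a b + Z p a b) * \<rho> p a * \<rho> p b) - (\<Prod>p\<in>P. sA p))"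
    unfolding sA_def C_def sum_PiE_pairs[OF P S S, symmetric] by (simp only: sum_distrib_left[symmetric] sum_subtractf)
  also have "(\<Prod>p\<in>P. \<Sum>a\<in>S. \<Sum>b\<in>S. (A p a b + Z p a b) * \<rho> p a * \<rho> p b) = (\<Prod>p\<in>P. sA p + sZ p)"
    unfolding sA_def sZ_def by (simp add: sum.distrib distrib_right)
  also have "Y\<^sup>2 * ((\<Prod>p\<in>P. sA p + sZ p) - (\<Prod>p\<in>P. sA p)) \<le> Y\<^sup>2 * ((\<Prod>p\<in>P. \<alpha> p) * (exp (\<Sum>p\<in>P. \<zeta> p) - 1))"
  proof (rule mult_left_mono)
    have sZ0: "0 \<le> sZ p" if "p \<in> P" for p unfolding sZ_def using that Z0 \<rho> by (intro sum_nonneg mult_nonneg_nonneg) auto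
    \<comment> \<open>The weights \<rho> are simply dropped here; in the application the errors are
      summable over the primes by themselves.\<close>
    have sZ: "sZ p \<le> \<zeta> p" if p: "p \<in> P" for p
    proof -
      have "sZ p \<le> (\<Sum>a\<in>S. \<Sum>b\<in>S. Z p a b)"
        unfolding sZ_def
      proof (intro sum_mono)
        fix a b assume ab: "a \<in> S" "b \<in> S"
        have "Z p a b * \<rho> p a * \<rho> p b \<le> Z p a b * 1 * 1"
          using Z0[OF p ab] \<rho>[OF p ab(1)] \<rho>[OF p ab(2)] by (intro mult_mono) auto
        then show "Z p a b * \<rho> p a * \<rho> p b \<le> Z p a b" by simp
      qed
      then show ?thesis using z[OF p] by linarith
    qed
    have "(\<Prod>p\<in>P. sA p + sZ p) - (\<Prod>p\<in>P. sA p) \<le> (\<Prod>p\<in>P. sA p) * (exp (\<Sum>p\<in>P. sZ p) - 1)"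
      using sl sZ0 unfolding sA_def by (intro prod_add_diff_le P) auto
    also have "\<dots> \<le> (\<Prod>p\<in>P. \<alpha> p) * (exp (\<Sum>p\<in>P. \<zeta> p) - 1)"
    proof (rule mult_mono)
      show "(\<Prod>p\<in>P. sA p) \<le> (\<Prod>p\<in>P. \<alpha> p)"
        using sl su unfolding sA_def by (intro prod_mono conjI) (meson order_trans zero_le_one)+
      show "exp (\<Sum>p\<in>P. sZ p) - 1 \<le> exp (\<Sum>p\<in>P. \<zeta> p) - 1" using sZ by (simp add: sum_mono)
      show "0 \<le> (\<Prod>p\<in>P. \<alpha> p)"
        using sl su by (intro prod_nonneg) (meson order_trans zero_le_one)
      show "0 \<le> exp (\<Sum>p\<in>P. sZ p) - 1" using sZ0 by (simp add: sum_nonneg)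
    qed
    finally show "(\<Prod>p\<in>P. sA p + sZ p) - (\<Prod>p\<in>P. sA p) \<le> (\<Prod>p\<in>P. \<alpha> p) * (exp (\<Sum>p\<in>P. \<zeta> p) - 1)" .
  qed simp
  finally show ?thesis .
qed

subsection \<open>Local matrices\<close>

text \<open>A colouring \<open>r\<close> encodes a tuple of coprime squarefree numbers: the \<open>i\<close>-th one is the product of
  the primes \<open>p\<close> with \<open>r p = i < k\<close>, and \<open>r p = k\<close> means that \<open>p\<close> divides none of them. For a random \<open>n\<close>, the probability that \<open>p\<close> divides
  the shifts \<open>n + h u\<close> and \<open>n + h v\<close> is \<open>density_matrix\<close>, and \<open>prime_density_matrix\<close> when \<open>n + h m\<close> is
  prime. Conjugation by \<open>weight_matrix\<close> turns them into the sparse \<open>main_matrix\<close> and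
  \<open>prime_main_matrix\<close>, up to an error \<open>O(1 / p\<^sup>2)\<close> that is negligible because all primes exceed \<open>w\<close>.\<close>

definition weight_matrix :: "nat \<Rightarrow> nat \<Rightarrow> nat \<Rightarrow> nat \<Rightarrow> real" where
  "weight_matrix k p u a = (if a = k then (if u = k then 1 else 0)
     else if u = k then 1 / (real p - 1) else if u = a then - real p / (real p - 1) else 0)"

definition density_matrix :: "nat \<Rightarrow> real \<Rightarrow> nat \<Rightarrow> nat \<Rightarrow> real" where
  "density_matrix k q u v = (if u = k \<and> v = k then 1 else if u = k \<or> v = k \<or> u = v then 1 / q else 0)"

text \<open>Row and column m vanish because a prime n + h m larger than all sieving primes is
  divisible by none of them. Otherwise n + h m runs over the invertible classes mod p, whence the
  density 1 / (p - 1).\<close>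

definition prime_density_matrix :: "nat \<Rightarrow> nat \<Rightarrow> real \<Rightarrow> nat \<Rightarrow> nat \<Rightarrow> real" where
  "prime_density_matrix k m q u v = (if u = m \<or> v = m then 0 else density_matrix k (q - 1) u v)"

definition transformed_matrix :: "nat \<Rightarrow> nat \<Rightarrow> (nat \<Rightarrow> nat \<Rightarrow> real) \<Rightarrow> nat \<Rightarrow> nat \<Rightarrow> real" where
  "transformed_matrix k p M a b = (\<Sum>u\<le>k. \<Sum>v\<le>k. weight_matrix k p u a * weight_matrix k p v b * M u v)"

definition main_matrix :: "nat \<Rightarrow> real \<Rightarrow> nat \<Rightarrow> nat \<Rightarrow> real" where
  "main_matrix k q a b = (if a = b then (if a = k then 1 else 1 / q) else 0)"

text \<open>The entries 1 / q at (k, m) and (m, k) let a prime belong to the m-th number of one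
  tuple without dividing the other tuple, while the entry at (m, m) is 0. So the m-th coordinates of
  the two tuples vary essentially independently and all other coordinates agree, which is the
  structure of J_m.\<close>

definition prime_main_matrix :: "nat \<Rightarrow> nat \<Rightarrow> real \<Rightarrow> nat \<Rightarrow> nat \<Rightarrow> real" where
  "prime_main_matrix k m q a b = (if a = k \<and> b = k then 1
     else if a = k \<and> b = m \<or> a = m \<and> b = k \<or> a = b \<and> a \<noteq> m then 1 / q else 0)"

lemma sum_weight_matrix:
  assumes "a \<le> k"
  shows "(\<Sum>u\<le>k. weight_matrix k p u a * f u) = (if a = k then f k else (f k - p * f a) / (real p - 1))"
proof (cases "a = k")
  case True
  have "(\<Sum>u\<le>k. weight_matrix k p u a * f u) = (\<Sum>u\<le>k. if u = k then f u else 0)"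
    using True by (intro sum.cong refl) (auto simp: weight_matrix_def)
  then show ?thesis using True by simp
next
  case False
  have "(\<Sum>u\<le>k. weight_matrix k p u a * f u)
     = (\<Sum>u\<le>k. (if u = k then f k / (real p - 1) else 0) + (if u = a then - (p * f a / (real p - 1)) else 0))"
    using False by (intro sum.cong refl) (auto simp: weight_matrix_def)
  also have "\<dots> = f k / (real p - 1) - p * f a / (real p - 1)"
    using assms by (simp add: sum.distrib)
  finally show ?thesis using False by (simp add: diff_divide_distrib)
qed

lemma transformed_matrix_eq:
  assumes "a \<le> k" "b \<le> k"
  shows "transformed_matrix k p M a b =
    (let g = (\<lambda>u. if b = k then M u k else (M u k - p * M u b) / (real p - 1))
     in if a = k then g k else (g k - p * g a) / (real p - 1))"
proof -
  have "transformed_matrix k p M a b = (\<Sum>u\<le>k. weight_matrix k p u a * (\<Sum>v\<le>k. weight_matrix k p v b * M u v))"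
    unfolding transformed_matrix_def by (simp add: sum_distrib_left mult_ac)
  also have "\<dots> = (\<Sum>u\<le>k. weight_matrix k p u a * (if b = k then M u k else (M u k - p * M u b) / (real p - 1)))"
    using sum_weight_matrix[OF assms(2)] by simp
  also have "\<dots> = (let g = (\<lambda>u. if b = k then M u k else (M u k - p * M u b) / (real p - 1))
     in if a = k then g k else (g k - p * g a) / (real p - 1))"
    unfolding Let_def by (rule sum_weight_matrix[OF assms(1)])
  finally show ?thesis .
qed

lemma prime_reciprocal_bounds:
  fixes q :: real
  assumes "q \<ge> 3"
  shows "1 / (q - 1) ^ 2 \<le> 3 / q ^ 2" "1 / (q * (q - 1)) \<le> 2 / q ^ 2"
    "1 / (q - 1) ^ 3 \<le> 3 / q ^ 2" "(q + 1) / (q - 1) ^ 3 \<le> 6 / q ^ 2" "(q - 2) / (q - 1) ^ 3 \<le> 3 / q ^ 2"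
proof -
  have q: "q / 3 * 2 \<le> q - 1" using assms by simp
  have a: "4/9 * q ^ 2 \<le> (q - 1) ^ 2" using power_mono[OF q, of 2] assms by (simp add: power_mult_distrib power_divide)
  then have "q ^ 2 \<le> 3 * (q - 1) ^ 2" using zero_le_power2[of q] by linarith
  then show A: "1 / (q - 1) ^ 2 \<le> 3 / q ^ 2" using assms by (simp add: divide_simps)
  have "q ^ 2 \<le> 2 * (q * (q - 1))" using assms by (simp add: power2_eq_square algebra_simps)
  then show "1 / (q * (q - 1)) \<le> 2 / q ^ 2" using assms by (simp add: divide_simps)
  have "1 / (q - 1) ^ 3 = 1 / (q - 1) ^ 2 * (1 / (q - 1))" by (simp add: power2_eq_square power3_eq_cube)
  also have "\<dots> \<le> 1 / (q - 1) ^ 2 * 1" using assms by (intro mult_left_mono) auto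
  finally show "1 / (q - 1) ^ 3 \<le> 3 / q ^ 2" using A by linarith
  have "(q + 1) / (q - 1) ^ 3 = 1 / (q - 1) ^ 2 * ((q + 1) / (q - 1))" by (simp add: power2_eq_square power3_eq_cube)
  also have "\<dots> \<le> 1 / (q - 1) ^ 2 * 2" using assms by (intro mult_left_mono) (auto simp: divide_simps)
  finally show "(q + 1) / (q - 1) ^ 3 \<le> 6 / q ^ 2" using A by linarith
  have "(q - 2) / (q - 1) ^ 3 = 1 / (q - 1) ^ 2 * ((q - 2) / (q - 1))" by (simp add: power2_eq_square power3_eq_cube)
  also have "\<dots> \<le> 1 / (q - 1) ^ 2 * 1" using assms by (intro mult_left_mono) (auto simp: divide_simps)
  finally show "(q - 2) / (q - 1) ^ 3 \<le> 3 / q ^ 2" using A by linarith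
qed

text \<open>The entries of \<open>weight_matrix\<close> make every column a < k orthogonal to column
  k under \<open>density_matrix\<close>: 1 - p * (1 / p) = 0. The diagonal entry becomes 1 / (p - 1)
  and the remaining ones -1 / (p - 1)^2, all within O(1 / p^2) of
  \<open>main_matrix\<close>.\<close>

lemma main_matrix_approx:
  assumes "a \<le> k" "b \<le> k" "p \<ge> 3"
  shows "\<bar>transformed_matrix k p (density_matrix k p) a b - main_matrix k p a b\<bar> \<le> 6 / p ^ 2"
proof -
  define q where "q = real p"
  have q: "q \<ge> 3" "q \<noteq> 0" "q - 1 \<noteq> 0" "q - 1 > 0" "q > 0" using assms unfolding q_def by auto
  note B = prime_reciprocal_bounds[OF q(1)]
  have pos: "0 \<le> 6 / q ^ 2" by simp
  have le6: "2 / q ^ 2 \<le> 6 / q ^ 2" "3 / q ^ 2 \<le> 6 / q ^ 2" using q by (auto simp: divide_right_mono)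
  have nn: "0 \<le> 1 / (q * (q - 1))" "0 \<le> 1 / (q - 1) ^ 2" "0 \<le> 1 / (q - 1) ^ 3" using q by auto
  consider "a = k" "b = k" | "a = k" "b \<noteq> k" | "a \<noteq> k" "b = k" | "a \<noteq> k" "b = a" | "a \<noteq> k" "b \<noteq> k" "a \<noteq> b" by blast
  then show ?thesis
  proof cases
    case 4
    have "transformed_matrix k p (density_matrix k p) a b = (- q * ((1 / q - q * (1 / q)) / (q - 1))) / (q - 1)"
      unfolding transformed_matrix_eq[OF assms(1,2)] q_def[symmetric] using 4 q
      by (simp add: density_matrix_def)
    also have "(1 / q - q * (1 / q)) / (q - 1) = - 1 / q" using q by (simp add: field_simps)
    also have "- q * (- 1 / q) / (q - 1) = 1 / q + 1 / (q * (q - 1))" using q by (simp add: field_simps)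
    finally have "transformed_matrix k p (density_matrix k p) a b - main_matrix k p a b = 1 / (q * (q - 1))"
      using 4 by (simp add: main_matrix_def q_def)
    then show ?thesis using B(2) le6 nn unfolding q_def[symmetric] by linarith
  next
    case 5
    have "transformed_matrix k p (density_matrix k p) a b = - (1 / (q - 1) ^ 2)"
      unfolding transformed_matrix_eq[OF assms(1,2)] q_def[symmetric] using 5 q
      by (simp add: density_matrix_def power2_eq_square)
    then have "transformed_matrix k p (density_matrix k p) a b - main_matrix k p a b = - (1 / (q - 1) ^ 2)"
      using 5 by (simp add: main_matrix_def)
    then have "\<bar>transformed_matrix k p (density_matrix k p) a b - main_matrix k p a b\<bar> = 1 / (q - 1) ^ 2" by simp
    also have "\<dots> \<le> 6 / q ^ 2" using B(1) le6 by linarith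
    finally show ?thesis unfolding q_def .
  qed (unfold transformed_matrix_eq[OF assms(1,2)] q_def[symmetric], insert q pos, simp_all add: density_matrix_def main_matrix_def)
qed

text \<open>Row and column m of the density vanish, so column m of the weights acts only through its
  entry 1 / (p - 1) at k; this creates the entries (k, m) and (m, k). The constant 6 is set by the
  off-diagonal value (p + 1) / (p - 1)^3.\<close>

lemma prime_main_matrix_approx:
  assumes "a \<le> k" "b \<le> k" "p \<ge> 3" "m < k"
  shows "\<bar>transformed_matrix k p (prime_density_matrix k m p) a b - prime_main_matrix k m p a b\<bar> \<le> 6 / p ^ 2"
proof -
  define q where "q = real p"
  have q: "q \<ge> 3" "q \<noteq> 0" "q - 1 \<noteq> 0" "q - 1 > 0" "q > 0" using assms unfolding q_def by auto
  note B = prime_reciprocal_bounds[OF q(1)]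
  have pos: "0 \<le> 6 / q ^ 2" by simp
  have le6: "2 / q ^ 2 \<le> 6 / q ^ 2" "3 / q ^ 2 \<le> 6 / q ^ 2" using q by (auto simp: divide_right_mono)
  have nn: "0 \<le> 1 / (q * (q - 1))" "0 \<le> 1 / (q - 1) ^ 2" "0 \<le> 1 / (q - 1) ^ 3" using q by auto
  have mk: "m \<noteq> k" using assms by simp
  define T where "T = transformed_matrix k p (prime_density_matrix k m p) a b"
  define A where "A = prime_main_matrix k m p a b"
  define D where "D = prime_density_matrix k m q"
  have D: "D k k = 1" "D m u = 0" "D u m = 0" for u using mk by (auto simp: D_def prime_density_matrix_def density_matrix_def)
  have D2: "D k u = 1 / (q - 1)" "D u k = 1 / (q - 1)" "D u u = 1 / (q - 1)" if "u \<noteq> m" "u \<noteq> k" for u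
    using that mk by (auto simp: D_def prime_density_matrix_def density_matrix_def)
  have D3: "D u v = 0" if "u \<noteq> k" "v \<noteq> k" "u \<noteq> v" for u v
    using that mk by (auto simp: D_def prime_density_matrix_def density_matrix_def)
  have T: "T = (let g = (\<lambda>u. if b = k then D u k else (D u k - q * D u b) / (q - 1))
     in if a = k then g k else (g k - q * g a) / (q - 1))"
    unfolding T_def transformed_matrix_eq[OF assms(1,2)] D_def q_def ..
  have swap: "1 - q / (q - 1) = - 1 / (q - 1)" using q by (simp add: field_simps)
  have swap2: "1 / (q - 1) - q / ((q - 1) * (q - 1)) = - 1 / ((q - 1) * (q - 1))"
    using arg_cong[OF swap, of "\<lambda>t. t / (q - 1)"] by (simp add: diff_divide_distrib)
  consider "a = k" "b = k" | "a = k" "b = m" | "a = m" "b = k" | "a = m" "b = m"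
    | "a = k" "b \<noteq> k" "b \<noteq> m" | "b = k" "a \<noteq> k" "a \<noteq> m" | "a = m" "b \<noteq> k" "b \<noteq> m" | "b = m" "a \<noteq> k" "a \<noteq> m"
    | "a = b" "a \<noteq> k" "a \<noteq> m" | "a \<noteq> b" "a \<noteq> k" "a \<noteq> m" "b \<noteq> k" "b \<noteq> m" by blast
  then have "\<bar>T - A\<bar> \<le> 6 / q ^ 2"
  proof cases
    case 1 then show ?thesis using pos by (simp add: T D A_def prime_main_matrix_def)
  next
    case 2
    then have "T - A = 1 / (q * (q - 1))" using q mk by (simp add: T D A_def prime_main_matrix_def q_def[symmetric] field_simps)
    then show ?thesis using B(2) le6 nn by linarith
  next
    case 3
    then have "T - A = 1 / (q * (q - 1))" using q mk by (simp add: T D A_def prime_main_matrix_def q_def[symmetric] field_simps)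
    then show ?thesis using B(2) le6 nn by linarith
  next
    case 4
    then have "T - A = 1 / (q - 1) ^ 2" using q mk by (simp add: T D A_def prime_main_matrix_def power2_eq_square)
    then show ?thesis using B(1) le6 nn by linarith
  next
    case 5
    then have "T - A = - (1 / (q - 1) ^ 2)" using q mk by (simp add: T D D2 A_def prime_main_matrix_def swap power2_eq_square)
    then show ?thesis using B(1) le6 nn by linarith
  next
    case 6
    then have "T - A = - (1 / (q - 1) ^ 2)" using q mk by (simp add: T D D2 A_def prime_main_matrix_def swap power2_eq_square)
    then show ?thesis using B(1) le6 nn by linarith
  next
    case 7
    then have "T - A = - (1 / (q - 1) ^ 3)" using q mk by (simp add: T D D2 A_def prime_main_matrix_def swap power3_eq_cube)
    then show ?thesis using B(3) le6 nn by linarith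
  next
    case 8
    then have "T - A = - (1 / (q - 1) ^ 3)" using q mk by (simp add: T D D2 A_def prime_main_matrix_def swap swap2 power3_eq_cube)
    then show ?thesis using B(3) le6 nn by linarith
  next
    case 9
    have "T = ((1 - q / (q - 1)) / (q - 1) - q * ((1 / (q - 1) - q / (q - 1)) / (q - 1))) / (q - 1)"
      using 9 q mk by (simp add: T D D2)
    also have "1 / (q - 1) - q / (q - 1) = -1" using q by (simp add: field_simps)
    finally have T9: "T = (- 1 / (q - 1) / (q - 1) - q * (- 1 / (q - 1))) / (q - 1)"
      unfolding swap by simp
    have "(- 1 / e / e - q * (- 1 / e)) / e = (q * e - 1) / e ^ 3" if "e \<noteq> 0" for e :: real
      using that by (simp add: field_simps power3_eq_cube)
    then have "T = (q * (q - 1) - 1) / (q - 1) ^ 3" using T9 q(3) by metis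
    moreover have "q * (q - 1) - 1 = q\<^sup>2 - q - 1" by (simp add: power2_eq_square right_diff_distrib)
    ultimately have "T = (q\<^sup>2 - q - 1) / (q - 1) ^ 3" by simp
    moreover have "(q\<^sup>2 - q - 1) / (q - 1) ^ 3 = 1 / q + 1 / (q * (q - 1)) + (q - 2) / (q - 1) ^ 3"
    proof -
      have "1 / q + 1 / (q * (q - 1)) = (q - 1)\<^sup>2 / (q - 1) ^ 3"
        using q by (simp add: power2_eq_square power3_eq_cube) (simp add: field_simps)
      moreover have "q\<^sup>2 - q - 1 = (q - 1)\<^sup>2 + (q - 2)" by (simp add: power2_eq_square algebra_simps)
      ultimately show ?thesis by (simp only: add_divide_distrib)
    qed
    moreover have "A = 1 / q" using 9 by (simp add: A_def prime_main_matrix_def q_def)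
    ultimately have "T - A = 1 / (q * (q - 1)) + (q - 2) / (q - 1) ^ 3" by simp
    moreover have "0 \<le> 1 / (q * (q - 1))" "0 \<le> (q - 2) / (q - 1) ^ 3" using q by auto
    moreover have "2 / q ^ 2 + 3 / q ^ 2 \<le> 6 / q ^ 2" using q by (simp add: divide_simps)
    ultimately show ?thesis using B(2,5) by linarith
  next
    case 10
    have "T = ((1 - q / (q - 1)) / (q - 1) - q * (1 / (q - 1) / (q - 1))) / (q - 1)"
      using 10 q mk by (simp add: T D D2 D3)
    also have "\<dots> = (- 1 / (q - 1) / (q - 1) - q * (1 / (q - 1) / (q - 1))) / (q - 1)" unfolding swap ..
    also have "\<dots> = - ((q + 1) / (q - 1) ^ 3)"
    proof -
      have "(- 1 / e / e - q * (1 / e / e)) / e = - ((q + 1) / e ^ 3)" if "e \<noteq> 0" for e :: real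
        using that by (simp add: field_simps power3_eq_cube)
      then show ?thesis using q(3) by metis
    qed
    finally have "T - A = - ((q + 1) / (q - 1) ^ 3)" using 10 by (simp add: A_def prime_main_matrix_def)
    moreover have "0 \<le> (q + 1) / (q - 1) ^ 3" using q by auto
    ultimately show ?thesis using B(4) by linarith
  qed
  then show ?thesis unfolding T_def A_def q_def .
qed

subsection \<open>Sieve weights\<close>

lemma sum_inverse_squares_le:
  fixes w :: nat
  assumes "finite P" "\<And>p. p \<in> P \<Longrightarrow> w < p" "w \<ge> 1"
  shows "(\<Sum>p\<in>P. 1 / real p ^ 2) \<le> 1 / w"
proof -
  obtain N where N: "P \<subseteq> {Suc w..N}" "w \<le> N"
  proof -
    obtain N where "\<And>p. p \<in> P \<Longrightarrow> p \<le> N" using assms(1) finite_nat_set_iff_bounded_le by auto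
    then have "P \<subseteq> {Suc w..max w N}" using assms(2) by (auto simp: Suc_le_eq le_max_iff_disj)
    then show ?thesis using that[of "max w N"] by auto
  qed
  have "(\<Sum>p\<in>P. 1 / real p ^ 2) \<le> (\<Sum>p=Suc w..N. 1 / real p ^ 2)"
    using N by (intro sum_mono2) auto
  also have "\<dots> \<le> 1 / w - 1 / N"
    using N(2)
  proof (induction N rule: dec_induct)
    case (step n)
    have n: "n \<ge> 1" using step assms by simp
    have "1 / real (Suc n) ^ 2 \<le> 1 / (real n * real (Suc n))"
      unfolding power2_eq_square using n by (intro divide_left_mono mult_right_mono) auto
    also have "\<dots> = 1 / real n - 1 / real (Suc n)" using n by (simp add: field_simps)
    finally show ?case using step by simp
  qed simp
  also have "\<dots> \<le> 1 / w" by simp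
  finally show ?thesis .
qed

locale sieve_weights =
  fixes k w :: nat and P :: "nat set" and R Y :: real and y :: "(nat \<Rightarrow> nat) \<Rightarrow> real"
  assumes finite_P: "finite P" and prime_P: "\<And>p. p \<in> P \<Longrightarrow> prime p"
    and P_gt: "\<And>p. p \<in> P \<Longrightarrow> w < p" and w_ge: "w \<ge> 2" and R_gt: "R > 1"
    and y_nonneg: "\<And>r. 0 \<le> y r" and y_le: "\<And>r. y r \<le> Y"
    and y_support: "\<And>r. r \<in> colourings P k \<Longrightarrow> y r \<noteq> 0 \<Longrightarrow> (\<Prod>p\<in>{p \<in> P. r p < k}. real p) \<le> R"
begin

text \<open>The Rankin exponent: R powr \<sigma> = e, so replacing the condition modulus \<le> R by
  multiplicative weights costs only a factor e.\<close>

definition \<sigma> :: real where "\<sigma> = 1 / ln R"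

text \<open>The Euler product to which all Rankin sums reduce; each factor \<Omega> is at most of
  order ln R.\<close>

definition \<Omega> :: real where "\<Omega> = (\<Prod>p\<in>P. 1 + real p powr (-(1 + \<sigma>)))"

definition lam :: "(nat \<Rightarrow> nat) \<Rightarrow> real" where
  "lam d = (\<Sum>r\<in>colourings P k. (\<Prod>p\<in>P. weight_matrix k p (d p) (r p)) * y r)"

definition \<rho> :: "nat \<Rightarrow> nat \<Rightarrow> real" where "\<rho> p a = (if a < k then real p powr (-\<sigma>) else 1)"

definition modulus :: "(nat \<Rightarrow> nat) \<Rightarrow> real" where "modulus r = (\<Prod>p\<in>{p \<in> P. r p < k}. real p)"

lemma P_ge3: "p \<in> P \<Longrightarrow> 3 \<le> p" using P_gt[of p] w_ge by simp

lemma \<sigma>_pos: "0 < \<sigma>" using R_gt by (simp add: \<sigma>_def)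

lemma Y_nonneg: "0 \<le> Y" using y_nonneg[of undefined] y_le[of undefined] by linarith

lemma R_powr: "R powr \<sigma> = exp 1" using R_gt by (simp add: \<sigma>_def powr_def)

lemma p_powr_split: "p \<in> P \<Longrightarrow> real p powr (-(1 + \<sigma>)) = real p powr (-\<sigma>) / p"
  using P_ge3[of p] powr_add[of "real p" "-\<sigma>" "-1"] by (simp add: powr_minus_divide[of _ 1] algebra_simps)

lemma p_powr_le1: "p \<in> P \<Longrightarrow> real p powr (-\<sigma>) \<le> 1"
  using P_ge3[of p] \<sigma>_pos ge_one_powr_ge_zero[of "real p" \<sigma>] by (simp add: powr_minus_divide)

lemma \<rho>_bounds: "p \<in> P \<Longrightarrow> 0 \<le> \<rho> p a \<and> \<rho> p a \<le> 1"
  unfolding \<rho>_def using p_powr_le1 by simp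

lemma modulus_pos: "modulus r > 0"
  unfolding modulus_def by (intro prod_pos) (auto dest: P_ge3)

lemma prod_\<rho>: "(\<Prod>p\<in>P. \<rho> p (r p)) = modulus r powr (-\<sigma>)"
proof -
  have "(\<Prod>p\<in>P. \<rho> p (r p)) = (\<Prod>p\<in>{p \<in> P. r p < k}. real p powr (-\<sigma>))"
    unfolding \<rho>_def by (rule prod.inter_filter[OF finite_P, symmetric])
  then show ?thesis unfolding modulus_def by (simp add: prod_powr_distrib)
qed

lemma rankin:
  assumes "modulus r \<le> R"
  shows "1 \<le> exp 1 * (\<Prod>p\<in>P. \<rho> p (r p))"
proof -
  have "modulus r powr \<sigma> \<le> R powr \<sigma>" using assms modulus_pos[of r] \<sigma>_pos by (intro powr_mono2) auto
  then have "modulus r powr \<sigma> \<le> exp 1" using R_powr by simp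
  then show ?thesis unfolding prod_\<rho> powr_minus using modulus_pos[of r] by (simp add: field_simps)
qed

lemma y_le_rankin:
  assumes "r \<in> colourings P k"
  shows "\<bar>y r\<bar> \<le> exp 1 * Y * (\<Prod>p\<in>P. \<rho> p (r p))"
proof (cases "y r = 0")
  case True
  moreover have "0 \<le> (\<Prod>p\<in>P. \<rho> p (r p))" using \<rho>_bounds by (intro prod_nonneg) auto
  ultimately show ?thesis using Y_nonneg by simp
next
  case False
  then have "modulus r \<le> R" unfolding modulus_def using y_support assms by auto
  then have "Y * 1 \<le> Y * (exp 1 * (\<Prod>p\<in>P. \<rho> p (r p)))" by (intro mult_left_mono rankin Y_nonneg)
  then show ?thesis using y_nonneg[of r] y_le[of r] by (simp add: ac_simps)
qed

lemma \<Omega>_ge1: "1 \<le> \<Omega>" unfolding \<Omega>_def by (intro prod_ge_1) simp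

text \<open>Bernoulli's inequality 1 + c * t \<le> (1 + t) ^ c in each factor.\<close>

lemma prod_le_\<Omega>_power:
  assumes "\<And>p. p \<in> P \<Longrightarrow> 0 \<le> g p" "\<And>p. p \<in> P \<Longrightarrow> g p \<le> 1 + c * real p powr (-(1 + \<sigma>))" "c \<ge> (0::nat)"
  shows "(\<Prod>p\<in>P. g p) \<le> \<Omega> ^ c"
proof -
  have "(\<Prod>p\<in>P. g p) \<le> (\<Prod>p\<in>P. (1 + real p powr (-(1 + \<sigma>))) ^ c)"
  proof (intro prod_mono conjI)
    fix p assume p: "p \<in> P"
    have "1 + c * real p powr (-(1 + \<sigma>)) \<le> (1 + real p powr (-(1 + \<sigma>))) ^ c"
      by (rule Bernoulli_inequality) (rule order_trans[of _ 0], auto)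
    then show "g p \<le> (1 + real p powr (-(1 + \<sigma>))) ^ c" using assms(2)[OF p] by linarith
  qed (use assms in auto)
  also have "\<dots> = \<Omega> ^ c" unfolding \<Omega>_def by (rule prod_power_distrib[symmetric])
  finally show ?thesis .
qed

lemma sum_colourings_modulus:
  assumes "c \<ge> (0::real)"
  shows "(\<Sum>d\<in>colourings P n. \<Prod>p\<in>P. if d p < n then c * real p powr (-(1 + \<sigma>)) else 1)
     = (\<Prod>p\<in>P. 1 + n * c * real p powr (-(1 + \<sigma>)))"
proof -
  have "(\<Sum>d\<in>colourings P n. \<Prod>p\<in>P. if d p < n then c * real p powr (-(1 + \<sigma>)) else 1)
     = (\<Prod>p\<in>P. \<Sum>a\<le>n. if a < n then c * real p powr (-(1 + \<sigma>)) else 1)"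
    by (rule prod_sum_PiE[symmetric]) (auto simp: finite_P)
  also have "\<dots> = (\<Prod>p\<in>P. 1 + n * c * real p powr (-(1 + \<sigma>)))"
    by (intro prod.cong refl) (simp add: lessThan_Suc_atMost[symmetric])
  finally show ?thesis .
qed

text \<open>Row k has the entry 1 / (p - 1) in each column a < k besides its diagonal 1; a row u < k
  has the single nonzero entry -p / (p - 1), of absolute value at most 2. This 2 becomes the factor
  2 per prime of d in the bound for \<open>lam\<close>.\<close>

lemma weight_row_le:
  assumes p: "p \<in> P" and u: "u \<le> k"
  shows "(\<Sum>a\<le>k. \<bar>weight_matrix k p u a\<bar> * \<rho> p a)
    \<le> (if u < k then 2 else 1) * (1 + (2 * k) * real p powr (-(1 + \<sigma>)))"
proof -
  have p3: "real p \<ge> 3" using P_ge3[OF p] by simp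
  define t where "t = real p powr (-\<sigma>)"
  have t: "0 \<le> t" "t \<le> 1" "real p powr (-(1 + \<sigma>)) = t / p" unfolding t_def using p_powr_le1 p_powr_split p by auto
  have split: "(\<Sum>a\<le>k. f a) = (\<Sum>a<k. f a) + f k" for f :: "nat \<Rightarrow> real" by (simp add: lessThan_Suc_atMost[symmetric])
  show ?thesis
  proof (cases "u = k")
    case True
    have "(\<Sum>a\<le>k. \<bar>weight_matrix k p u a\<bar> * \<rho> p a) = (\<Sum>a<k. t / (real p - 1)) + 1"
      unfolding split using True p3 by (simp add: weight_matrix_def \<rho>_def t_def)
    also have "\<dots> = k * (t * (1 / (real p - 1))) + 1" by simp
    also have "\<dots> \<le> k * (t * (2 / p)) + 1"
      using p3 t by (intro add_right_mono mult_left_mono) (auto simp: divide_simps)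
    finally show ?thesis using True t by (simp add: field_simps)
  next
    case False
    then have u: "u < k" using assms by simp
    have "(\<Sum>a\<le>k. \<bar>weight_matrix k p u a\<bar> * \<rho> p a) = (\<Sum>a<k. if a = u then p / (real p - 1) * t else 0)"
    proof -
      have "\<bar>weight_matrix k p u a\<bar> * \<rho> p a = (if a = u then p / (real p - 1) * t else 0)" if "a < k" for a
        using that u p3 by (auto simp: weight_matrix_def \<rho>_def t_def)
      moreover have "weight_matrix k p u k = 0" using u by (simp add: weight_matrix_def)
      ultimately show ?thesis unfolding split by simp
    qed
    also have "\<dots> = p / (real p - 1) * t" using u by simp
    also have "\<dots> \<le> 2 * 1" using p3 t by (intro mult_mono) (auto simp: divide_simps)
    also have "\<dots> \<le> 2 * (1 + (2 * k) * (t / p))" using t p3 by (intro mult_left_mono) auto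
    finally show ?thesis using u t by simp
  qed
qed

lemma abs_lam_le:
  assumes d: "d \<in> colourings P k"
  shows "\<bar>lam d\<bar> \<le> exp 1 * Y * \<Omega> ^ (2 * k) * 2 ^ card {p \<in> P. d p < k}"
proof -
  have "\<bar>lam d\<bar> \<le> (\<Sum>r\<in>colourings P k. (\<Prod>p\<in>P. \<bar>weight_matrix k p (d p) (r p)\<bar>) * \<bar>y r\<bar>)"
    unfolding lam_def by (rule order_trans[OF sum_abs]) (simp add: abs_mult abs_prod)
  also have "\<dots> \<le> (\<Sum>r\<in>colourings P k. (\<Prod>p\<in>P. \<bar>weight_matrix k p (d p) (r p)\<bar>) * (exp 1 * Y * (\<Prod>p\<in>P. \<rho> p (r p))))"
    by (intro sum_mono mult_left_mono y_le_rankin prod_nonneg) auto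
  also have "\<dots> = exp 1 * Y * (\<Sum>r\<in>colourings P k. \<Prod>p\<in>P. \<bar>weight_matrix k p (d p) (r p)\<bar> * \<rho> p (r p))"
    by (simp add: sum_distrib_left prod.distrib mult_ac)
  also have "(\<Sum>r\<in>colourings P k. \<Prod>p\<in>P. \<bar>weight_matrix k p (d p) (r p)\<bar> * \<rho> p (r p))
     = (\<Prod>p\<in>P. \<Sum>a\<le>k. \<bar>weight_matrix k p (d p) a\<bar> * \<rho> p a)"
    by (rule prod_sum_PiE[symmetric]) (auto simp: finite_P)
  also have "\<dots> \<le> (\<Prod>p\<in>P. (if d p < k then 2 else 1) * (1 + (2 * k) * real p powr (-(1 + \<sigma>))))"
  proof (intro prod_mono conjI)
    fix p assume p: "p \<in> P"
    show "(\<Sum>a\<le>k. \<bar>weight_matrix k p (d p) a\<bar> * \<rho> p a) \<le> (if d p < k then 2 else 1) * (1 + (2 * k) * real p powr (-(1 + \<sigma>)))"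
      using d p by (intro weight_row_le) auto
    show "0 \<le> (\<Sum>a\<le>k. \<bar>weight_matrix k p (d p) a\<bar> * \<rho> p a)"
      using \<rho>_bounds[OF p] by (intro sum_nonneg mult_nonneg_nonneg) auto
  qed
  also have "\<dots> = (\<Prod>p\<in>P. if d p < k then 2 else 1) * (\<Prod>p\<in>P. 1 + (2 * k) * real p powr (-(1 + \<sigma>)))"
    by (rule prod.distrib)
  also have "(\<Prod>p\<in>P. if d p < k then 2 else 1 :: real) = 2 ^ card {p \<in> P. d p < k}"
    by (subst prod.inter_filter[OF finite_P, symmetric]) simp
  also have "(\<Prod>p\<in>P. 1 + (2 * k) * real p powr (-(1 + \<sigma>))) \<le> \<Omega> ^ (2 * k)"
    by (rule prod_le_\<Omega>_power) auto
  finally have "\<bar>lam d\<bar> \<le> exp 1 * Y * (2 ^ card {p \<in> P. d p < k} * \<Omega> ^ (2 * k))"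
    using Y_nonneg by (simp add: mult_left_mono)
  then show ?thesis by (simp add: mult_ac)
qed

lemma lam_support:
  assumes d: "d \<in> colourings P k" and nz: "lam d \<noteq> 0"
  shows "modulus d \<le> R"
proof -
  obtain r where r: "r \<in> colourings P k" "(\<Prod>p\<in>P. weight_matrix k p (d p) (r p)) * y r \<noteq> 0"
    using nz unfolding lam_def by (meson sum.neutral)
  then have "\<forall>p\<in>P. weight_matrix k p (d p) (r p) \<noteq> 0" "y r \<noteq> 0" using finite_P by auto
  then have sub: "{p \<in> P. d p < k} \<subseteq> {p \<in> P. r p < k}"
    using r(1) by (fastforce simp: weight_matrix_def split: if_splits)
  have "modulus d \<le> modulus r" unfolding modulus_def
    using sub finite_P by (intro prod_mono2) (auto dest!: P_ge3)
  also have "\<dots> \<le> R" unfolding modulus_def using y_support r \<open>y r \<noteq> 0\<close> by auto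
  finally show ?thesis .
qed

text \<open>Where \<open>lam d\<close> is nonzero the modulus is at most R, so 1 \<le> e * R *
  modulus d powr (-(1 + \<sigma>)). Paying the factor e * R turns the sum over d into an Euler
  product.\<close>

lemma abs_lam_le_modulus:
  assumes d: "d \<in> colourings P k"
  shows "\<bar>lam d\<bar> \<le> exp 1 * Y * \<Omega> ^ (2 * k) * (exp 1 * R) * (\<Prod>p\<in>P. if d p < k then 2 * real p powr (-(1 + \<sigma>)) else 1)"
proof (cases "lam d = 0")
  case True
  have "0 \<le> (\<Prod>p\<in>P. if d p < k then 2 * real p powr (-(1 + \<sigma>)) else 1)" by (intro prod_nonneg) auto
  then show ?thesis using True Y_nonneg R_gt \<Omega>_ge1 by simp
next
  case False
  have "(\<Prod>p\<in>P. if d p < k then 2 * real p powr (-(1 + \<sigma>)) else 1)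
     = 2 ^ card {p \<in> P. d p < k} * modulus d powr (-(1 + \<sigma>))"
    by (subst prod.inter_filter[OF finite_P, symmetric]) (simp add: prod.distrib prod_powr_distrib modulus_def)
  moreover have "1 \<le> (exp 1 * R) * modulus d powr (-(1 + \<sigma>))"
  proof -
    have "modulus d powr (1 + \<sigma>) \<le> R powr (1 + \<sigma>)"
      using lam_support[OF d False] modulus_pos[of d] \<sigma>_pos by (intro powr_mono2) auto
    also have "\<dots> = exp 1 * R" using R_gt R_powr by (simp add: powr_add)
    finally show ?thesis unfolding powr_minus using modulus_pos[of d] by (simp add: field_simps)
  qed
  ultimately have "2 ^ card {p \<in> P. d p < k} * 1 \<le> (exp 1 * R) * (\<Prod>p\<in>P. if d p < k then 2 * real p powr (-(1 + \<sigma>)) else 1)"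
    by (simp add: mult_ac)
  then have "exp 1 * Y * \<Omega> ^ (2 * k) * 2 ^ card {p \<in> P. d p < k}
    \<le> exp 1 * Y * \<Omega> ^ (2 * k) * ((exp 1 * R) * (\<Prod>p\<in>P. if d p < k then 2 * real p powr (-(1 + \<sigma>)) else 1))"
    using Y_nonneg \<Omega>_ge1 by (intro mult_left_mono) auto
  then show ?thesis using abs_lam_le[OF d] by (simp add: mult_ac)
qed

text \<open>Up to powers of ln R this is R. Its square bounds the rounding errors in counting
  integers, so R^2 has to be a power of x with exponent below 1, i.e. \<theta> < 1/2.\<close>

lemma sum_abs_lam_le: "(\<Sum>d\<in>colourings P k. \<bar>lam d\<bar>) \<le> exp 2 * Y * R * \<Omega> ^ (4 * k)"
proof -
  have "(\<Sum>d\<in>colourings P k. \<bar>lam d\<bar>)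
    \<le> (\<Sum>d\<in>colourings P k. exp 1 * Y * \<Omega> ^ (2 * k) * (exp 1 * R) * (\<Prod>p\<in>P. if d p < k then 2 * real p powr (-(1 + \<sigma>)) else 1))"
    by (intro sum_mono abs_lam_le_modulus)
  also have "\<dots> = exp 1 * Y * \<Omega> ^ (2 * k) * (exp 1 * R) * (\<Prod>p\<in>P. 1 + k * 2 * real p powr (-(1 + \<sigma>)))"
    unfolding sum_distrib_left[symmetric] by (subst sum_colourings_modulus) auto
  also have "\<dots> \<le> exp 1 * Y * \<Omega> ^ (2 * k) * (exp 1 * R) * \<Omega> ^ (2 * k)"
    using Y_nonneg \<Omega>_ge1 R_gt by (intro mult_left_mono prod_le_\<Omega>_power) (auto simp: mult.commute)
  also have "\<dots> = exp 2 * Y * R * \<Omega> ^ (4 * k)"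
    by (simp add: mult_ac power_add[symmetric] exp_add[symmetric] flip: mult.assoc)
  finally show ?thesis .
qed

end

section \<open>Approximation of the two quadratic forms by their main matrices\<close>

context sieve_weights
begin

lemma sum_matrix_ge_1:
  fixes A :: "nat \<Rightarrow> nat \<Rightarrow> real"
  assumes p: "p \<in> P" and nn: "\<And>a b. 0 \<le> A a b" and one: "A k k = 1"
  shows "1 \<le> (\<Sum>a\<le>k. \<Sum>b\<le>k. A a b * \<rho> p a * \<rho> p b)"
proof -
  have nn': "0 \<le> A a b * \<rho> p a * \<rho> p b" for a b using nn \<rho>_bounds[OF p] by (intro mult_nonneg_nonneg) auto
  have "1 = A k k * \<rho> p k * \<rho> p k" using one by (simp add: \<rho>_def)
  also have "\<dots> \<le> (\<Sum>b\<le>k. A k b * \<rho> p k * \<rho> p b)" by (rule member_le_sum) (use nn' in auto)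
  also have "\<dots> \<le> (\<Sum>a\<le>k. \<Sum>b\<le>k. A a b * \<rho> p a * \<rho> p b)"
    by (rule member_le_sum[of k "{..k}" "\<lambda>a. \<Sum>b\<le>k. A a b * \<rho> p a * \<rho> p b"]) (use nn' in \<open>auto intro!: sum_nonneg\<close>)
  finally show ?thesis .
qed

lemma sum_error_weights_le: "(\<Sum>p\<in>P. (k + 1)\<^sup>2 * (6 / real p ^ 2)) \<le> 6 * (k + 1)\<^sup>2 / w"
proof -
  have "(\<Sum>p\<in>P. (k + 1)\<^sup>2 * (6 / real p ^ 2)) = 6 * (k + 1)\<^sup>2 * (\<Sum>p\<in>P. 1 / real p ^ 2)"
    by (simp add: sum_distrib_left mult_ac)
  also have "\<dots> \<le> 6 * (k + 1)\<^sup>2 * (1 / w)"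
    using w_ge by (intro mult_left_mono sum_inverse_squares_le finite_P P_gt) auto
  finally show ?thesis by simp
qed

text \<open>In the applications c counts the entries 1 / p of A, each of which contributes one
  factor \<Omega>: c = k for the integers and c = k + 1 for the primes. These are the powers of ln R
  in the main terms, so the relative error is of size exp (O(1 / w)) - 1.\<close>

lemma quadratic_form_approx:
  fixes M A :: "nat \<Rightarrow> nat \<Rightarrow> nat \<Rightarrow> real"
  assumes A: "\<And>p a b. p \<in> P \<Longrightarrow> 0 \<le> A p a b" and one: "\<And>p. A p k k = 1"
    and approx: "\<And>p a b. p \<in> P \<Longrightarrow> a \<le> k \<Longrightarrow> b \<le> k \<Longrightarrow> \<bar>transformed_matrix k p (M p) a b - A p a b\<bar> \<le> 6 / p ^ 2"
    and su: "\<And>p. p \<in> P \<Longrightarrow> (\<Sum>a\<le>k. \<Sum>b\<le>k. A p a b * \<rho> p a * \<rho> p b) \<le> 1 + c * real p powr (-(1 + \<sigma>))"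
  shows "\<bar>(\<Sum>d\<in>colourings P k. \<Sum>e\<in>colourings P k. lam d * lam e * (\<Prod>p\<in>P. M p (d p) (e p)))
      - (\<Sum>r\<in>colourings P k. \<Sum>s\<in>colourings P k. y r * y s * (\<Prod>p\<in>P. A p (r p) (s p)))\<bar>
    \<le> (exp 1 * Y)\<^sup>2 * (\<Omega> ^ c * (exp (6 * (k + 1)\<^sup>2 / w) - 1))"
proof -
  have "(\<Sum>d\<in>colourings P k. \<Sum>e\<in>colourings P k. lam d * lam e * (\<Prod>p\<in>P. M p (d p) (e p)))
    = (\<Sum>r\<in>colourings P k. \<Sum>s\<in>colourings P k. y r * y s * (\<Prod>p\<in>P. transformed_matrix k p (M p) (r p) (s p)))"
    unfolding lam_def transformed_matrix_def
    by (rule tensor_change_of_variables[OF finite_P finite_atMost])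
  moreover have "\<bar>(\<Sum>r\<in>colourings P k. \<Sum>s\<in>colourings P k. y r * y s * (\<Prod>p\<in>P. transformed_matrix k p (M p) (r p) (s p)))
      - (\<Sum>r\<in>colourings P k. \<Sum>s\<in>colourings P k. y r * y s * (\<Prod>p\<in>P. A p (r p) (s p)))\<bar>
    \<le> (exp 1 * Y)\<^sup>2 * ((\<Prod>p\<in>P. 1 + c * real p powr (-(1 + \<sigma>))) * (exp (\<Sum>p\<in>P. (k + 1)\<^sup>2 * (6 / real p ^ 2)) - 1))"
  proof (rule tensor_perturbation_le[OF finite_P finite_atMost, where \<rho> = \<rho> and Z = "\<lambda>p a b. 6 / real p ^ 2"])
    fix p assume p: "p \<in> P"
    show "1 \<le> (\<Sum>a\<le>k. \<Sum>b\<le>k. A p a b * \<rho> p a * \<rho> p b)"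
      using A[OF p] one by (intro sum_matrix_ge_1 p) auto
    show "(\<Sum>a\<le>k. \<Sum>b\<le>k. A p a b * \<rho> p a * \<rho> p b) \<le> 1 + c * real p powr (-(1 + \<sigma>))" by (rule su[OF p])
    show "(\<Sum>a\<le>k. \<Sum>b\<le>k. 6 / real p ^ 2) \<le> (k + 1)\<^sup>2 * (6 / real p ^ 2)"
      by (simp only: sum_constant card_atMost power2_eq_square[of "k + 1"] Suc_eq_plus1 of_nat_mult mult.assoc order_refl)
  qed (use A approx \<rho>_bounds y_le_rankin in auto)
  moreover have "(\<Prod>p\<in>P. 1 + c * real p powr (-(1 + \<sigma>))) * (exp (\<Sum>p\<in>P. (k + 1)\<^sup>2 * (6 / real p ^ 2)) - 1)
    \<le> \<Omega> ^ c * (exp (6 * (k + 1)\<^sup>2 / w) - 1)"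
  proof (rule mult_mono)
    show "(\<Prod>p\<in>P. 1 + c * real p powr (-(1 + \<sigma>))) \<le> \<Omega> ^ c" by (rule prod_le_\<Omega>_power) auto
    show "exp (\<Sum>p\<in>P. (k + 1)\<^sup>2 * (6 / real p ^ 2)) - 1 \<le> exp (6 * (k + 1)\<^sup>2 / w) - 1"
      using sum_error_weights_le by simp
    show "0 \<le> exp (\<Sum>p\<in>P. (k + 1)\<^sup>2 * (6 / real p ^ 2)) - 1" by (simp add: sum_nonneg)
  qed (use \<Omega>_ge1 in auto)
  ultimately show ?thesis
    by (simp only:) (erule order_trans, rule mult_left_mono, assumption, simp)
qed

lemma row_sums_le:
  fixes A :: "nat \<Rightarrow> nat \<Rightarrow> real"
  assumes p: "p \<in> P" and nn: "\<And>a b. 0 \<le> A a b"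
    and row: "\<And>a. a < k \<Longrightarrow> (\<Sum>b\<le>k. A a b) \<le> 1 / p"
    and last: "(\<Sum>b\<le>k. A k b * \<rho> p b) \<le> 1 + c * real p powr (-(1 + \<sigma>))"
  shows "(\<Sum>a\<le>k. \<Sum>b\<le>k. A a b * \<rho> p a * \<rho> p b) \<le> 1 + (k + c) * real p powr (-(1 + \<sigma>))"
proof -
  have "(\<Sum>b\<le>k. A a b * \<rho> p a * \<rho> p b) \<le> real p powr (-(1 + \<sigma>))" if a: "a < k" for a
  proof -
    have "(\<Sum>b\<le>k. A a b * \<rho> p a * \<rho> p b) \<le> (\<Sum>b\<le>k. \<rho> p a * A a b)"
    proof (rule sum_mono)
      fix b
      have "A a b * \<rho> p a * \<rho> p b \<le> A a b * \<rho> p a * 1"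
        using nn[of a b] \<rho>_bounds[OF p] by (intro mult_left_mono mult_nonneg_nonneg) auto
      then show "A a b * \<rho> p a * \<rho> p b \<le> \<rho> p a * A a b" by (simp add: mult.commute)
    qed
    also have "\<dots> \<le> \<rho> p a * (1 / p)" unfolding sum_distrib_left[symmetric]
      using row[OF a] \<rho>_bounds[OF p] by (intro mult_left_mono) auto
    also have "\<dots> = real p powr (-(1 + \<sigma>))" using a p_powr_split[OF p] by (simp add: \<rho>_def)
    finally show ?thesis .
  qed
  then have "(\<Sum>a<k. \<Sum>b\<le>k. A a b * \<rho> p a * \<rho> p b) \<le> (\<Sum>a<k. real p powr (-(1 + \<sigma>)))" by (intro sum_mono) auto
  then have "(\<Sum>a<k. \<Sum>b\<le>k. A a b * \<rho> p a * \<rho> p b) \<le> k * real p powr (-(1 + \<sigma>))" by simp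
  moreover have "(\<Sum>b\<le>k. A k b * \<rho> p k * \<rho> p b) \<le> 1 + c * real p powr (-(1 + \<sigma>))"
    using last by (simp add: \<rho>_def)
  moreover have "(\<Sum>a\<le>k. \<Sum>b\<le>k. A a b * \<rho> p a * \<rho> p b)
     = (\<Sum>a<k. \<Sum>b\<le>k. A a b * \<rho> p a * \<rho> p b) + (\<Sum>b\<le>k. A k b * \<rho> p k * \<rho> p b)"
    by (subst lessThan_Suc_atMost[symmetric]) (rule sum.lessThan_Suc)
  ultimately show ?thesis by (simp add: distrib_right)
qed

lemma density_form_approx:
  "\<bar>(\<Sum>d\<in>colourings P k. \<Sum>e\<in>colourings P k. lam d * lam e * (\<Prod>p\<in>P. density_matrix k (real p) (d p) (e p)))
      - (\<Sum>r\<in>colourings P k. \<Sum>s\<in>colourings P k. y r * y s * (\<Prod>p\<in>P. main_matrix k (real p) (r p) (s p)))\<bar>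
    \<le> (exp 1 * Y)\<^sup>2 * (\<Omega> ^ k * (exp (6 * (k + 1)\<^sup>2 / w) - 1))"
proof (rule quadratic_form_approx[where A = "\<lambda>p. main_matrix k (real p)" and M = "\<lambda>p. density_matrix k (real p)"])
  fix p assume p: "p \<in> P"
  have "(\<Sum>b\<le>k. main_matrix k p a b) = 1 / p" if "a < k" for a using that by (simp add: main_matrix_def)
  moreover have "(\<Sum>b\<le>k. main_matrix k p k b * \<rho> p b) = 1"
  proof -
    have "(\<Sum>b\<le>k. main_matrix k p k b * \<rho> p b) = (\<Sum>b\<le>k. if k = b then 1 else 0)"
      by (intro sum.cong refl) (simp add: main_matrix_def \<rho>_def)
    then show ?thesis by simp
  qed
  ultimately show "(\<Sum>a\<le>k. \<Sum>b\<le>k. main_matrix k p a b * \<rho> p a * \<rho> p b) \<le> 1 + k * real p powr (-(1 + \<sigma>))"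
    using row_sums_le[OF p, of "main_matrix k p" 0] by (simp add: main_matrix_def)
next
  show "\<bar>transformed_matrix k p (density_matrix k p) a b - main_matrix k p a b\<bar> \<le> 6 / p ^ 2"
    if "p \<in> P" "a \<le> k" "b \<le> k" for p a b
    using main_matrix_approx[OF that(2,3) P_ge3[OF that(1)]] .
qed (simp_all add: main_matrix_def)

lemma prime_density_form_approx:
  assumes m: "m < k"
  shows "\<bar>(\<Sum>d\<in>colourings P k. \<Sum>e\<in>colourings P k. lam d * lam e * (\<Prod>p\<in>P. prime_density_matrix k m (real p) (d p) (e p)))
      - (\<Sum>r\<in>colourings P k. \<Sum>s\<in>colourings P k. y r * y s * (\<Prod>p\<in>P. prime_main_matrix k m (real p) (r p) (s p)))\<bar>
    \<le> (exp 1 * Y)\<^sup>2 * (\<Omega> ^ (k + 1) * (exp (real (6 * (k + 1)\<^sup>2) / real w) - 1))"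
proof (rule quadratic_form_approx[where A = "\<lambda>p. prime_main_matrix k m (real p)" and M = "\<lambda>p. prime_density_matrix k m (real p)"])
  fix p assume p: "p \<in> P"
  have row: "(\<Sum>b\<le>k. prime_main_matrix k m p a b) = 1 / p" if "a < k" for a
  proof -
    have "(\<Sum>b\<le>k. prime_main_matrix k m p a b) = (\<Sum>b\<le>k. if b = (if a = m then k else a) then 1 / p else 0)"
    proof (rule sum.cong[OF refl])
      fix b
      show "prime_main_matrix k m p a b = (if b = (if a = m then k else a) then 1 / p else 0)"
        by (cases "a = m"; cases "b = k"; cases "b = a") (use that m in \<open>simp_all add: prime_main_matrix_def\<close>)
    qed
    then show ?thesis using that m by simp
  qed
  have last: "(\<Sum>b\<le>k. prime_main_matrix k m p k b * \<rho> p b) = 1 + real p powr (-(1 + \<sigma>))"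
  proof -
    have "(\<Sum>b\<le>k. prime_main_matrix k m p k b * \<rho> p b)
       = (\<Sum>b\<le>k. (if b = k then 1 else 0) + (if b = m then real p powr (-(1 + \<sigma>)) else 0))"
    proof (rule sum.cong[OF refl])
      fix b
      show "prime_main_matrix k m p k b * \<rho> p b = (if b = k then 1 else 0) + (if b = m then real p powr (-(1 + \<sigma>)) else 0)"
        by (cases "b = m"; cases "b = k") (use m p_powr_split[OF p] in \<open>simp_all add: prime_main_matrix_def \<rho>_def\<close>)
    qed
    then show ?thesis using m by (simp add: sum.distrib)
  qed
  show "(\<Sum>a\<le>k. \<Sum>b\<le>k. prime_main_matrix k m p a b * \<rho> p a * \<rho> p b) \<le> 1 + (k + 1) * real p powr (-(1 + \<sigma>))"
    using row_sums_le[OF p, of "prime_main_matrix k m p" 1] row last by (simp add: prime_main_matrix_def)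
next
  show "\<bar>transformed_matrix k p (prime_density_matrix k m p) a b - prime_main_matrix k m p a b\<bar> \<le> 6 / p ^ 2"
    if "p \<in> P" "a \<le> k" "b \<le> k" for p a b
    using prime_main_matrix_approx[OF that(2,3) P_ge3[OF that(1)] m] .
qed (simp_all add: prime_main_matrix_def)

end

subsection \<open>Colourings and tuples of integers\<close>

text \<open>The length K is kept general because the prime sums lead to tuples with k + 1 entries.
  Primes of colour K divide no entry, and the restriction puts the tuples into the
  \<open>PiE\<close> sets over which sums factor.\<close>

definition tuple_of :: "nat set \<Rightarrow> nat \<Rightarrow> (nat \<Rightarrow> nat) \<Rightarrow> nat \<Rightarrow> nat" where
  "tuple_of P K s = (\<lambda>i\<in>{..<K}. \<Prod>{p \<in> P. s p = i})"

lemma prod_fibres: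
  fixes g :: "'b \<Rightarrow> 'a :: comm_monoid_mult" and s :: "'b \<Rightarrow> nat"
  assumes "finite P"
  shows "(\<Prod>i<K. \<Prod>p\<in>{p \<in> P. s p = i}. g p) = (\<Prod>p\<in>{p \<in> P. s p < K}. g p)"
proof -
  have "(\<Prod>p\<in>(\<Union>i\<in>{..<K}. {p \<in> P. s p = i}). g p) = (\<Prod>i<K. \<Prod>p\<in>{p \<in> P. s p = i}. g p)"
    by (rule prod.UNION_disjoint) (use assms in auto)
  moreover have "(\<Union>i\<in>{..<K}. {p \<in> P. s p = i}) = {p \<in> P. s p < K}" by auto
  ultimately show ?thesis by simp
qed

lemma tuple_of_weight:
  assumes "finite P"
  shows "(\<Prod>i<K. 1 / real (tuple_of P K s i)) = (\<Prod>p\<in>P. if s p < K then 1 / real p else 1)"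
proof -
  have "(\<Prod>i<K. 1 / real (tuple_of P K s i)) = (\<Prod>i<K. \<Prod>p\<in>{p \<in> P. s p = i}. 1 / real p)"
    by (intro prod.cong refl) (simp add: tuple_of_def prod_dividef)
  also have "\<dots> = (\<Prod>p\<in>P. if s p < K then 1 / real p else 1)"
    unfolding prod_fibres[OF assms] by (rule prod.inter_filter[OF assms])
  finally show ?thesis .
qed

lemma dvd_tuple_of_iff:
  assumes "finite P" "\<And>p. p \<in> P \<Longrightarrow> prime p" "prime q" "i < K"
  shows "q dvd tuple_of P K s i \<longleftrightarrow> q \<in> P \<and> s q = i"
  using prime_dvd_prod_primes_iff[of "{p \<in> P. s p = i}" q] assms by (auto simp: tuple_of_def)

lemma inj_on_tuple_of:
  assumes "finite P" "\<And>p. p \<in> P \<Longrightarrow> prime p"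
  shows "inj_on (tuple_of P K) (colourings P K)"
proof (rule inj_onI)
  fix s t assume st: "s \<in> colourings P K" "t \<in> colourings P K" "tuple_of P K s = tuple_of P K t"
  have "s p = t p" if p: "p \<in> P" for p
  proof -
    have iff: "s p = i \<longleftrightarrow> t p = i" if "i < K" for i
      using dvd_tuple_of_iff[OF assms assms(2)[OF p] that, of s] dvd_tuple_of_iff[OF assms assms(2)[OF p] that, of t]
        st(3) p by auto
    have "s p \<le> K" "t p \<le> K" using st p by auto
    then show ?thesis using iff[of "s p"] iff[of "t p"] by (metis le_neq_implies_less)
  qed
  then show "s = t" using st by (intro PiE_ext) auto
qed

definition good_tuple :: "nat set \<Rightarrow> nat \<Rightarrow> (nat \<Rightarrow> nat) \<Rightarrow> bool" where
  "good_tuple P K n \<longleftrightarrow> (\<forall>i<K. n i > 0 \<and> squarefree (n i) \<and> (\<forall>p. prime p \<longrightarrow> p dvd n i \<longrightarrow> p \<in> P))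
     \<and> (\<forall>i<K. \<forall>j<K. i \<noteq> j \<longrightarrow> coprime (n i) (n j))"

lemma squarefree_eq_prod:
  assumes "squarefree (n::nat)" "finite A" "\<And>p. p \<in> A \<longleftrightarrow> prime p \<and> p dvd n"
  shows "n = \<Prod>A"
proof -
  have "n \<noteq> 0" using assms(1) by (metis not_squarefree_0)
  have A: "A = prime_factors n" using assms(3) \<open>n \<noteq> 0\<close> by (auto simp: in_prime_factors_iff)
  have "n = (\<Prod>p\<in>prime_factors n. p ^ multiplicity p n)" using prime_factorization_nat[of n] \<open>n \<noteq> 0\<close> by simp
  also have "\<dots> = (\<Prod>p\<in>prime_factors n. p)"
  proof (intro prod.cong refl)
    fix p assume p: "p \<in> prime_factors n"
    then have "multiplicity p n = 1" using assms(1) squarefree_factorial_semiring'[of n] \<open>n \<noteq> 0\<close> by (auto)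
    then show "p ^ multiplicity p n = p" by simp
  qed
  finally show ?thesis using A by simp
qed

lemma good_tuple_in_image:
  assumes P: "finite P" and n: "n \<in> extensional {..<K}" "good_tuple P K n"
  shows "n \<in> tuple_of P K ` colourings P K"
proof
  \<comment> \<open>The index is unique because the entries are pairwise coprime; primes that divide
    no entry receive the spare colour K.\<close>
  define s where "s = (\<lambda>p\<in>P. if \<exists>i<K. p dvd n i \<and> prime p then (THE i. i < K \<and> p dvd n i) else K)"
  have uniq: "i = j" if "i < K" "j < K" "p dvd n i" "p dvd n j" "prime p" for i j p
  proof (rule ccontr)
    assume "i \<noteq> j"
    then have "coprime (n i) (n j)" using n(2) that by (auto simp: good_tuple_def)
    then have "is_unit p" using that by (meson coprime_common_divisor)
    then show False using that(5) not_prime_unit by blast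
  qed
  have the: "(THE i. i < K \<and> p dvd n i) = i" if "i < K" "p dvd n i" "prime p" for i p
    by (rule the_equality) (use that uniq in \<open>blast+\<close>)
  have sP: "s p = i \<longleftrightarrow> p dvd n i \<and> prime p" if "p \<in> P" "i < K" for p i
    using that the unfolding s_def by (auto; metis nat_less_le)
  show "s \<in> colourings P K"
  proof -
    have "s p \<le> K" if p: "p \<in> P" for p
      unfolding s_def using p the by auto
    then show ?thesis unfolding s_def by auto
  qed
  show "n = tuple_of P K s"
  proof (rule extensionalityI[OF n(1)])
    show "tuple_of P K s \<in> extensional {..<K}" by (simp add: tuple_of_def)
    fix i assume i: "i \<in> {..<K}"
    have "n i = \<Prod>{p \<in> P. s p = i}"
    proof (rule squarefree_eq_prod)
      show "squarefree (n i)" using n(2) i by (auto simp: good_tuple_def)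
      show "p \<in> {p \<in> P. s p = i} \<longleftrightarrow> prime p \<and> p dvd n i" for p
        using sP[of p i] i n(2) by (auto simp: good_tuple_def)
    qed (use P in auto)
    then show "n i = tuple_of P K s i" using i by (simp add: tuple_of_def)
  qed
qed

lemma colouring_sum_eq:
  fixes g :: "(nat \<Rightarrow> nat) \<Rightarrow> real"
  assumes "finite P" "\<And>p. p \<in> P \<Longrightarrow> prime p"
  shows "(\<Sum>s\<in>colourings P K. g (tuple_of P K s) * (\<Prod>p\<in>P. if s p < K then 1 / real p else 1))
    = (\<Sum>n\<in>tuple_of P K ` colourings P K. g n * (\<Prod>i<K. 1 / real (n i)))"
  by (subst sum.reindex[OF inj_on_tuple_of[OF assms]]) (simp_all add: tuple_of_weight[OF assms(1)])

text \<open>Colourings inject into tuples, and dropping the conditions that the entries are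
  squarefree, pairwise coprime and built from P only adds nonnegative terms. The larger sum runs
  over a full product set, so it can be split by coordinates.\<close>

lemma colouring_sum_le:
  fixes g :: "(nat \<Rightarrow> nat) \<Rightarrow> real"
  assumes P: "finite P" "\<And>p. p \<in> P \<Longrightarrow> prime p" "\<And>p. p \<in> P \<Longrightarrow> coprime p W"
    and g: "\<And>n. 0 \<le> g n" and D: "finite D"
    and supp: "\<And>n i. n \<in> extensional {..<K} \<Longrightarrow> g n \<noteq> 0 \<Longrightarrow> i < K \<Longrightarrow> n i > 0 \<Longrightarrow> coprime (n i) W \<Longrightarrow> n i \<in> D"
  shows "(\<Sum>s\<in>colourings P K. g (tuple_of P K s) * (\<Prod>p\<in>P. if s p < K then 1 / real p else 1))
    \<le> (\<Sum>n\<in>PiE {..<K} (\<lambda>_. D). g n * (\<Prod>i<K. 1 / real (n i)))"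
proof -
  have "(\<Sum>n\<in>tuple_of P K ` colourings P K. g n * (\<Prod>i<K. 1 / real (n i)))
      = (\<Sum>n\<in>{n \<in> tuple_of P K ` colourings P K. g n \<noteq> 0}. g n * (\<Prod>i<K. 1 / real (n i)))"
    by (rule sum.mono_neutral_right) (auto simp: finite_colourings P)
  also have "\<dots> \<le> (\<Sum>n\<in>PiE {..<K} (\<lambda>_. D). g n * (\<Prod>i<K. 1 / real (n i)))"
  proof (rule sum_mono2)
    show "{n \<in> tuple_of P K ` colourings P K. g n \<noteq> 0} \<subseteq> PiE {..<K} (\<lambda>_. D)"
    proof
      fix n assume n: "n \<in> {n \<in> tuple_of P K ` colourings P K. g n \<noteq> 0}"
      then obtain s where s: "n = tuple_of P K s" by auto
      have ext: "n \<in> extensional {..<K}" unfolding s by (simp add: tuple_of_def)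
      moreover have "n i \<in> D" if i: "i < K" for i
      proof (rule supp[OF ext _ i])
        show "g n \<noteq> 0" using n by simp
        show "n i > 0" using i P unfolding s by (auto simp: tuple_of_def intro!: prod_pos dest!: prime_gt_0_nat)
        show "coprime (n i) W" using i P unfolding s by (auto simp: tuple_of_def intro!: prod_coprime_left)
      qed
      ultimately show "n \<in> PiE {..<K} (\<lambda>_. D)" by (auto simp: PiE_iff)
    qed
  qed (use D g in \<open>auto intro!: finite_PiE mult_nonneg_nonneg prod_nonneg\<close>)
  finally show ?thesis by (subst colouring_sum_eq[OF P(1,2)])
qed

section \<open>Tuples of integers that do not come from colourings\<close>

text \<open>The case i = j records that entry i is not squarefree, the case i \<noteq> j that two
  entries are not coprime; in both the prime costs a factor 1 / p^2.\<close>

definition bad_prime :: "nat \<Rightarrow> nat \<Rightarrow> nat \<Rightarrow> (nat \<Rightarrow> nat) \<Rightarrow> bool" where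
  "bad_prime p i j n \<longleftrightarrow> (if i = j then p\<^sup>2 dvd n i else p dvd n i \<and> p dvd n j)"

text \<open>D is closed under divisors: if e * l lies in D, so does l.\<close>

lemma sum_multiples_le:
  assumes D: "D = {n. 0 < n \<and> real n < y \<and> coprime n W}" and e: "e > 0"
  shows "(\<Sum>n\<in>{n \<in> D. e dvd n}. 1 / real n) \<le> 1 / real e * (\<Sum>n\<in>D. 1 / real n)"
proof -
  have fin: "finite D" unfolding D by (rule finite_subset[of _ "{..nat \<lceil>y\<rceil>}"]) (auto, linarith)
  have "(\<Sum>n\<in>{n \<in> D. e dvd n}. 1 / real n) \<le> (\<Sum>n\<in>(\<lambda>n. e * n) ` D. 1 / real n)"
  proof (rule sum_mono2)
    show "{n \<in> D. e dvd n} \<subseteq> (\<lambda>n. e * n) ` D"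
    proof
      fix n assume n: "n \<in> {n \<in> D. e dvd n}"
      then obtain l where l: "n = e * l" by auto
      have "l \<le> e * l" using e by simp
      then have "real l \<le> real e * real l" by (metis of_nat_le_iff of_nat_mult)
      moreover have n': "0 < n" "real n < y" "coprime n W" using n unfolding D by auto
      ultimately have "real l < y" unfolding l of_nat_mult by linarith
      moreover have "0 < l" "coprime l W" using n' unfolding l by auto
      ultimately have "l \<in> D" unfolding D by simp
      then show "n \<in> (\<lambda>n. e * n) ` D" using l by auto
    qed
  qed (use fin in auto)
  also have "\<dots> = (\<Sum>n\<in>D. 1 / real (e * n))" by (subst sum.reindex) (use e in \<open>auto simp: inj_on_def\<close>)
  also have "\<dots> = 1 / real e * (\<Sum>n\<in>D. 1 / real n)" by (simp add: sum_distrib_left)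
  finally show ?thesis .
qed

lemma sum_bad_prime_le:
  assumes D: "D = {n. 0 < n \<and> real n < y \<and> coprime n W}" and p: "p > 0" and ij: "i < K" "j < K"
  shows "(\<Sum>n\<in>{n \<in> PiE {..<K} (\<lambda>_. D). bad_prime p i j n}. \<Prod>l<K. 1 / real (n l))
    \<le> 1 / real p ^ 2 * (\<Sum>n\<in>D. 1 / real n) ^ K"
proof -
  \<comment> \<open>A bad prime imposes one divisibility on each coordinate, with product p^2 in
    both cases, so the sum factors.\<close>
  define e where "e l = (if l = i \<and> i = j then p\<^sup>2 else if l = i \<or> l = j then p else 1)" for l
  have fin: "finite D" unfolding D by (rule finite_subset[of _ "{..nat \<lceil>y\<rceil>}"]) (auto, linarith)
  have "{n \<in> PiE {..<K} (\<lambda>_. D). bad_prime p i j n} = PiE {..<K} (\<lambda>l. {n \<in> D. e l dvd n})"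
  proof (rule Set.set_eqI)
    fix n
    have "bad_prime p i j n \<longleftrightarrow> (\<forall>l<K. e l dvd n l)"
    proof (cases "i = j")
      case True then show ?thesis using ij unfolding bad_prime_def e_def by (simp; metis one_dvd)
    next
      case False
      then have e: "e i = p" "e j = p" "\<And>l. l \<noteq> i \<Longrightarrow> l \<noteq> j \<Longrightarrow> e l = 1" unfolding e_def by auto
      show ?thesis using ij False unfolding bad_prime_def by (simp; metis e one_dvd)
    qed
    then show "n \<in> {n \<in> PiE {..<K} (\<lambda>_. D). bad_prime p i j n} \<longleftrightarrow> n \<in> PiE {..<K} (\<lambda>l. {n \<in> D. e l dvd n})"
      by (simp add: PiE_iff) blast
  qed
  then have "(\<Sum>n\<in>{n \<in> PiE {..<K} (\<lambda>_. D). bad_prime p i j n}. \<Prod>l<K. 1 / real (n l))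
     = (\<Prod>l<K. \<Sum>n\<in>{n \<in> D. e l dvd n}. 1 / real n)"
    using fin by (simp add: prod_sum_PiE)
  also have "\<dots> \<le> (\<Prod>l<K. 1 / real (e l) * (\<Sum>n\<in>D. 1 / real n))"
    using p by (intro prod_mono conjI sum_nonneg sum_multiples_le[OF D]) (auto simp: e_def)
  also have "\<dots> = (\<Prod>l<K. 1 / real (e l)) * (\<Sum>n\<in>D. 1 / real n) ^ K"
    by (simp only: prod.distrib prod_constant card_lessThan)
  also have "(\<Prod>l<K. 1 / real (e l)) = 1 / real p ^ 2"
  proof (cases "i = j")
    case True
    have "(\<Prod>l<K. 1 / real (e l)) = (\<Prod>l<K. if l = i then 1 / real p ^ 2 else 1)"
      using True by (intro prod.cong refl) (auto simp: e_def)
    then show ?thesis using ij by simp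
  next
    case False
    have "(\<Prod>l<K. 1 / real (e l)) = (\<Prod>l<K. (if l = i then 1 / real p else 1) * (if l = j then 1 / real p else 1))"
      using False by (intro prod.cong refl) (auto simp: e_def)
    then show ?thesis using ij by (simp add: prod.distrib power2_eq_square)
  qed
  finally show ?thesis .
qed

lemma sum_UN_le:
  fixes f :: "'a \<Rightarrow> real"
  assumes "finite I" "\<And>i. i \<in> I \<Longrightarrow> finite (A i)" "\<And>x. 0 \<le> f x"
  shows "(\<Sum>x\<in>(\<Union>i\<in>I. A i). f x) \<le> (\<Sum>i\<in>I. \<Sum>x\<in>A i. f x)"
  using assms(1,2)
proof (induction I rule: finite_induct)
  case (insert i I)
  have "(\<Sum>x\<in>A i \<union> (\<Union>i\<in>I. A i). f x) \<le> (\<Sum>x\<in>A i. f x) + (\<Sum>x\<in>(\<Union>i\<in>I. A i). f x)"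
    using insert assms(3) by (subst sum.union_inter[symmetric]) (auto intro: sum_nonneg)
  then show ?case using insert by force
qed simp

text \<open>A tuple with nonzero g that comes from no colouring has a bad prime, and this prime
  exceeds w because the entries are coprime to W. The union bound over p, i, j costs K^2 times the
  sum of 1 / p^2 over p > w, hence the factor K^2 / w.\<close>

lemma colouring_sum_ge:
  fixes g :: "(nat \<Rightarrow> nat) \<Rightarrow> real"
  assumes P: "P = {p. prime p \<and> w < p \<and> real p \<le> z}" and w: "w \<ge> 1"
    and W: "\<And>p. prime p \<Longrightarrow> p \<le> w \<Longrightarrow> p dvd W"
    and D: "D = {n. 0 < n \<and> real n < y \<and> coprime n W}"
    and g: "\<And>n. 0 \<le> g n" "\<And>n. g n \<le> G"
    and supp: "\<And>n i. n \<in> PiE {..<K} (\<lambda>_. D) \<Longrightarrow> g n \<noteq> 0 \<Longrightarrow> i < K \<Longrightarrow> real (n i) \<le> z"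
  shows "(\<Sum>n\<in>PiE {..<K} (\<lambda>_. D). g n * (\<Prod>i<K. 1 / real (n i))) - G * (real K ^ 2 / w * (\<Sum>n\<in>D. 1 / real n) ^ K)
    \<le> (\<Sum>s\<in>colourings P K. g (tuple_of P K s) * (\<Prod>p\<in>P. if s p < K then 1 / real p else 1))"
proof -
  define T where "T = PiE {..<K} (\<lambda>_. D)"
  define wt where "wt n = (\<Prod>i<K. 1 / real (n i))" for n :: "nat \<Rightarrow> nat"
  define Q where "Q = {p. prime p \<and> w < p \<and> real p < y}"
  define U where "U = (\<Sum>n\<in>D. 1 / real n)"
  have finD: "finite D" unfolding D by (rule finite_subset[of _ "{..nat \<lceil>y\<rceil>}"]) (auto, linarith)
  have finP: "finite P" unfolding P by (rule finite_subset[of _ "{..nat \<lceil>z\<rceil>}"]) (auto, linarith)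
  have finQ: "finite Q" unfolding Q_def by (rule finite_subset[of _ "{..nat \<lceil>y\<rceil>}"]) (auto, linarith)
  have finT: "finite T" unfolding T_def using finD by (intro finite_PiE) auto
  have primeP: "prime p" if "p \<in> P" for p using that P by auto
  have wt0: "0 \<le> wt n" for n unfolding wt_def by (intro prod_nonneg) auto
  have G0: "0 \<le> G" using g[of undefined] by linarith
  define B where "B = (\<lambda>(p,i,j). {n \<in> T. bad_prime p i j n})"
  have cover: "{n \<in> T. g n \<noteq> 0 \<and> \<not> good_tuple P K n} \<subseteq> (\<Union>x\<in>Q \<times> {..<K} \<times> {..<K}. B x)"
  proof
    fix n assume n: "n \<in> {n \<in> T. g n \<noteq> 0 \<and> \<not> good_tuple P K n}"
    have nD: "n i \<in> D" if "i < K" for i using n that unfolding T_def by auto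
    have pQ: "p \<in> Q" if "i < K" "prime p" "p dvd n i" for p i
    proof -
      have "0 < n i" "real (n i) < y" "coprime (n i) W" using nD[OF that(1)] unfolding D by auto
      have "real p \<le> real (n i)" using dvd_imp_le[OF that(3)] \<open>0 < n i\<close> by simp
      moreover have "\<not> p \<le> w"
      proof
        assume "p \<le> w"
        then have "p dvd W" using W that(2) by simp
        then have "is_unit p" using \<open>coprime (n i) W\<close> that(3) by (meson coprime_common_divisor)
        then show False using that(2) not_prime_unit by blast
      qed
      ultimately show ?thesis using that(2) \<open>real (n i) < y\<close> unfolding Q_def by auto
    qed
    have pP: "p \<in> P" if "i < K" "prime p" "p dvd n i" for p i
    proof -
      have "real (n i) \<le> z" using supp[of n i] n that unfolding T_def by auto
      moreover have "real p \<le> real (n i)" using dvd_imp_le[OF that(3)] nD[OF that(1)] unfolding D by simp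
      ultimately show ?thesis using pQ[OF that] unfolding P Q_def by auto
    qed
    have "\<not> good_tuple P K n" using n by simp
    then consider i where "i < K" "\<not> squarefree (n i)" | i j where "i < K" "j < K" "i \<noteq> j" "\<not> coprime (n i) (n j)"
      unfolding good_tuple_def using pP nD unfolding D by blast
    then show "n \<in> (\<Union>x\<in>Q \<times> {..<K} \<times> {..<K}. B x)"
    proof cases
      case 1
      then have "n i \<noteq> 0" using nD unfolding D by auto
      then obtain p where p: "prime p" "p\<^sup>2 dvd n i"
        using 1(2) squarefree_factorial_semiring[of "n i"] by auto
      then have "p dvd n i" by (meson dvd_power dvd_trans pos2)
      then have "p \<in> Q" using pQ 1(1) p by blast
      moreover have "n \<in> B (p,i,i)" using n p unfolding B_def bad_prime_def by simp
      ultimately show ?thesis using 1(1) by (intro UN_I[of "(p,i,i)"]) auto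
    next
      case 2
      then obtain p where p: "prime p" "p dvd n i" "p dvd n j"
      proof -
        have "gcd (n i) (n j) \<noteq> 1" using 2(4) by (metis coprime_iff_gcd_eq_1)
        then obtain p where "prime p" "p dvd gcd (n i) (n j)" using prime_factor_nat by blast
        then show ?thesis using that by auto
      qed
      then have "p \<in> Q" using pQ 2(1) by blast
      moreover have "n \<in> B (p,i,j)" using n p 2 unfolding B_def bad_prime_def by simp
      ultimately show ?thesis using 2(1,2) by (intro UN_I[of "(p,i,j)"]) simp_all
    qed
  qed
  have finB: "finite (\<Union>x\<in>Q \<times> {..<K} \<times> {..<K}. B x)"
    using finQ finT unfolding B_def by auto
  have bad: "(\<Sum>n\<in>{n \<in> T. g n \<noteq> 0 \<and> \<not> good_tuple P K n}. wt n) \<le> real K ^ 2 / w * U ^ K"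
  proof -
    have "(\<Sum>n\<in>{n \<in> T. g n \<noteq> 0 \<and> \<not> good_tuple P K n}. wt n) \<le> (\<Sum>n\<in>(\<Union>x\<in>Q \<times> {..<K} \<times> {..<K}. B x). wt n)"
      by (rule sum_mono2[OF finB cover]) (rule wt0)
    also have "\<dots> \<le> (\<Sum>x\<in>Q \<times> {..<K} \<times> {..<K}. \<Sum>n\<in>B x. wt n)"
      using finQ finT wt0 by (intro sum_UN_le) (auto simp: B_def)
    also have "\<dots> \<le> (\<Sum>x\<in>Q \<times> {..<K} \<times> {..<K}. 1 / real (fst x) ^ 2 * U ^ K)"
    proof (rule sum_mono)
      fix x assume "x \<in> Q \<times> {..<K} \<times> {..<K}"
      then obtain p i j where x: "x = (p,i,j)" "p \<in> Q" "i < K" "j < K" by auto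
      have "p > 0" using x(2) unfolding Q_def by auto
      from sum_bad_prime_le[OF D this x(3,4)] show "(\<Sum>n\<in>B x. wt n) \<le> 1 / real (fst x) ^ 2 * U ^ K"
        unfolding x(1) B_def wt_def U_def T_def by simp
    qed
    also have "\<dots> = (\<Sum>p\<in>Q. 1 / real p ^ 2) * (real K ^ 2 * U ^ K)"
    proof -
      have "(\<Sum>x\<in>Q \<times> {..<K} \<times> {..<K}. 1 / real (fst x) ^ 2 * U ^ K) = (\<Sum>p\<in>Q. \<Sum>_\<in>{..<K} \<times> {..<K}. 1 / real p ^ 2 * U ^ K)"
        unfolding sum.cartesian_product by (simp add: split_def)
      also have "\<dots> = (\<Sum>p\<in>Q. (1 / real p ^ 2) * (real K ^ 2 * U ^ K))"
        by (intro sum.cong refl) (simp add: card_cartesian_product power2_eq_square)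
      finally show ?thesis by (simp only: sum_distrib_right)
    qed
    also have "\<dots> \<le> 1 / w * (real K ^ 2 * U ^ K)"
      using w finQ unfolding U_def by (intro mult_right_mono sum_inverse_squares_le mult_nonneg_nonneg zero_le_power sum_nonneg) (auto simp: Q_def)
    finally show ?thesis by simp
  qed
  have "(\<Sum>n\<in>T. g n * wt n) = (\<Sum>n\<in>{n \<in> T. good_tuple P K n}. g n * wt n) + (\<Sum>n\<in>{n \<in> T. g n \<noteq> 0 \<and> \<not> good_tuple P K n}. g n * wt n)"
  proof -
    have "(\<Sum>n\<in>T. g n * wt n) = (\<Sum>n\<in>{n \<in> T. good_tuple P K n} \<union> {n \<in> T. g n \<noteq> 0 \<and> \<not> good_tuple P K n}. g n * wt n)"
      using finT by (intro sum.mono_neutral_right) auto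
    also have "\<dots> = (\<Sum>n\<in>{n \<in> T. good_tuple P K n}. g n * wt n) + (\<Sum>n\<in>{n \<in> T. g n \<noteq> 0 \<and> \<not> good_tuple P K n}. g n * wt n)"
      using finT by (intro sum.union_disjoint) auto
    finally show ?thesis .
  qed
  moreover have "(\<Sum>n\<in>{n \<in> T. g n \<noteq> 0 \<and> \<not> good_tuple P K n}. g n * wt n) \<le> G * (real K ^ 2 / w * U ^ K)"
  proof -
    have "(\<Sum>n\<in>{n \<in> T. g n \<noteq> 0 \<and> \<not> good_tuple P K n}. g n * wt n) \<le> (\<Sum>n\<in>{n \<in> T. g n \<noteq> 0 \<and> \<not> good_tuple P K n}. G * wt n)"
      using g wt0 by (intro sum_mono mult_right_mono) auto
    also have "\<dots> \<le> G * (real K ^ 2 / w * U ^ K)"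
      unfolding sum_distrib_left[symmetric] using bad G0 by (intro mult_left_mono) auto
    finally show ?thesis .
  qed
  moreover have "(\<Sum>n\<in>{n \<in> T. good_tuple P K n}. g n * wt n) \<le> (\<Sum>n\<in>tuple_of P K ` colourings P K. g n * wt n)"
    using good_tuple_in_image[OF finP] wt0 g(1) finP unfolding T_def
    by (intro sum_mono2 finite_imageI finite_colourings) (auto simp: PiE_iff)
  moreover have "(\<Sum>s\<in>colourings P K. g (tuple_of P K s) * (\<Prod>p\<in>P. if s p < K then 1 / real p else 1))
    = (\<Sum>n\<in>tuple_of P K ` colourings P K. g n * wt n)"
    unfolding wt_def by (rule colouring_sum_eq[OF finP primeP])
  ultimately show ?thesis
    unfolding T_def[symmetric] wt_def[symmetric] U_def[symmetric] by linarith
qed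

text \<open>Once the cells of all coordinates are fixed, the sum over tuples is a product of
  one-dimensional sums.\<close>

lemma sum_over_cells:
  fixes G :: "(nat \<Rightarrow> nat) \<Rightarrow> real" and f :: "nat \<Rightarrow> real" and c :: "nat \<Rightarrow> nat"
  assumes D: "finite D" and J: "finite J" "c ` D \<subseteq> J"
  shows "(\<Sum>n\<in>PiE {..<K} (\<lambda>_. D). G (\<lambda>i\<in>{..<K}. c (n i)) * (\<Prod>i<K. f (n i)))
    = (\<Sum>j\<in>PiE {..<K} (\<lambda>_. J). G j * (\<Prod>i<K. \<Sum>n\<in>{n \<in> D. c n = j i}. f n))"
proof -
  define q where "q n = (\<lambda>i\<in>{..<K}. c (n i))" for n
  have "(\<Sum>n\<in>PiE {..<K} (\<lambda>_. D). G (q n) * (\<Prod>i<K. f (n i)))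
     = (\<Sum>j\<in>PiE {..<K} (\<lambda>_. J). \<Sum>n\<in>{n \<in> PiE {..<K} (\<lambda>_. D). q n = j}. G (q n) * (\<Prod>i<K. f (n i)))"
    using D J by (intro sum.group[symmetric] finite_PiE) (auto simp: q_def image_subset_iff PiE_iff)
  also have "\<dots> = (\<Sum>j\<in>PiE {..<K} (\<lambda>_. J). G j * (\<Prod>i<K. \<Sum>n\<in>{n \<in> D. c n = j i}. f n))"
  proof (rule sum.cong[OF refl])
    fix j assume j: "j \<in> PiE {..<K} (\<lambda>_. J)"
    have "q n = j \<longleftrightarrow> (\<forall>i<K. c (n i) = j i)" for n
      using j unfolding q_def by (auto simp: PiE_iff extensional_def fun_eq_iff restrict_def)
    then have "{n \<in> PiE {..<K} (\<lambda>_. D). q n = j} = PiE {..<K} (\<lambda>i. {n \<in> D. c n = j i})"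
      by (simp add: PiE_iff set_eq_iff) blast
    then have "(\<Sum>n\<in>{n \<in> PiE {..<K} (\<lambda>_. D). q n = j}. G (q n) * (\<Prod>i<K. f (n i)))
       = (\<Sum>n\<in>PiE {..<K} (\<lambda>i. {n \<in> D. c n = j i}). G j * (\<Prod>i<K. f (n i)))"
      by (intro sum.cong) auto
    also have "\<dots> = G j * (\<Prod>i<K. \<Sum>n\<in>{n \<in> D. c n = j i}. f n)"
      unfolding sum_distrib_left[symmetric] using D by (subst prod_sum_PiE) auto
    finally show "(\<Sum>n\<in>{n \<in> PiE {..<K} (\<lambda>_. D). q n = j}. G (q n) * (\<Prod>i<K. f (n i)))
       = G j * (\<Prod>i<K. \<Sum>n\<in>{n \<in> D. c n = j i}. f n)" .
  qed
  finally show ?thesis unfolding q_def .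
qed

subsection \<open>Step functions on the logarithmic grid\<close>

definition primorial :: "nat \<Rightarrow> nat" where "primorial w = \<Prod>{p. prime p \<and> p \<le> w}"

lemma finite_primes_le: "finite {p::nat. prime p \<and> p \<le> w}"
  by (rule finite_subset[of _ "{..w}"]) auto

lemma primorial_pos: "primorial w > 0"
  unfolding primorial_def by (rule prod_pos_primes) auto

lemma prime_dvd_primorial_iff: "prime p \<Longrightarrow> p dvd primorial w \<longleftrightarrow> p \<le> w"
  unfolding primorial_def by (subst prime_dvd_prod_primes_iff[OF finite_primes_le]) auto

lemma coprime_primorial: "prime p \<Longrightarrow> w < p \<Longrightarrow> coprime p (primorial w)"
  using prime_dvd_primorial_iff[of p w] by (metis not_less prime_imp_coprime)

definition log_cell :: "nat \<Rightarrow> real \<Rightarrow> nat \<Rightarrow> nat" where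
  "log_cell N R n = nat \<lfloor>N * ln n / ln R\<rfloor>"

lemma log_cell_iff:
  assumes "R > 1" "N \<ge> 1" "n \<ge> 1"
  shows "log_cell N R n = j \<longleftrightarrow> R powr (j / N) \<le> n \<and> n < R powr (Suc j / N)"
proof -
  have lnR: "ln R > 0" and N: "real N > 0" and n: "real n > 0" using assms by auto
  have "0 \<le> N * ln n / ln R" using assms lnR by auto
  then have "log_cell N R n = j \<longleftrightarrow> \<lfloor>N * ln n / ln R\<rfloor> = int j"
    unfolding log_cell_def by (metis int_nat_eq nat_int zero_le_floor)
  also have "\<dots> \<longleftrightarrow> real j \<le> N * ln n / ln R \<and> N * ln n / ln R < real j + 1"
    by (subst floor_eq_iff) auto
  also have "\<dots> \<longleftrightarrow> j / N * ln R \<le> ln n \<and> ln n < Suc j / N * ln R"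
    using lnR N by (simp add: field_simps)
  also have "\<dots> \<longleftrightarrow> R powr (j / N) \<le> n \<and> n < R powr (Suc j / N)"
  proof -
    have "a * ln R \<le> ln n \<longleftrightarrow> R powr a \<le> n" for a
      using ln_ge_iff[OF n, of "a * ln R"] assms by (simp add: powr_def)
    then show ?thesis by (simp only: not_le[symmetric])
  qed
  finally show ?thesis .
qed

text \<open>The conditions on \<Phi> concern the upper corners \<open>Suc (j i)\<close> of the
  cells. Every r_i in a cell of the support is then below z, which will be x powr \<delta>, and the
  product of the r_i is at most R.\<close>

locale grid_sieve =
  fixes k w N :: nat and z R Y :: real and \<Phi> :: "(nat \<Rightarrow> nat) \<Rightarrow> real"
  assumes w_ge2: "w \<ge> 2" and R_gt1: "R > 1" and N_ge1: "N \<ge> 1"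
    and \<Phi>_nonneg: "\<And>j. 0 \<le> \<Phi> j" and \<Phi>_le: "\<And>j. \<Phi> j \<le> Y"
    and \<Phi>_support: "\<And>j. \<Phi> j \<noteq> 0 \<Longrightarrow> j \<in> PiE {..<k} (\<lambda>_. {..<N})"
    and \<Phi>_sum: "\<And>j. \<Phi> j \<noteq> 0 \<Longrightarrow> (\<Sum>i<k. Suc (j i)) \<le> N"
    and \<Phi>_max: "\<And>j i. \<Phi> j \<noteq> 0 \<Longrightarrow> i < k \<Longrightarrow> R powr (Suc (j i) / N) \<le> z"
begin

definition P :: "nat set" where "P = {p. prime p \<and> w < p \<and> real p \<le> z}"

definition D :: "nat set" where "D = {n. 0 < n \<and> real n < R \<and> coprime n (primorial w)}"

definition cells :: "nat \<Rightarrow> (nat \<Rightarrow> nat) \<Rightarrow> nat \<Rightarrow> nat" where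
  "cells K n = (\<lambda>i\<in>{..<K}. log_cell N R (n i))"

definition y :: "(nat \<Rightarrow> nat) \<Rightarrow> real" where "y r = \<Phi> (cells k (tuple_of P k r))"

definition H :: "nat \<Rightarrow> real" where "H j = (\<Sum>n\<in>{n \<in> D. log_cell N R n = j}. 1 / real n)"

lemma finite_P': "finite P"
  unfolding P_def by (rule finite_subset[of _ "{..nat \<lceil>z\<rceil>}"]) (auto, linarith)

lemma finite_D: "finite D"
  unfolding D_def by (rule finite_subset[of _ "{..nat \<lceil>R\<rceil>}"]) (auto, linarith)

lemma tuple_of_pos: "i < k' \<Longrightarrow> tuple_of P k' r i \<ge> 1"
  by (auto simp: tuple_of_def P_def Suc_le_eq intro!: prod_pos dest: prime_gt_0_nat)

lemma log_cell_less: "n \<ge> 1 \<Longrightarrow> real n < R powr (Suc (log_cell N R n) / N)"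
  using log_cell_iff[OF R_gt1 N_ge1] by blast

sublocale sieve_weights k w P R Y y
proof
  fix r assume r: "r \<in> colourings P k" "y r \<noteq> 0"
  define n where "n = tuple_of P k r"
  have \<Phi>: "\<Phi> (cells k n) \<noteq> 0" using r(2) unfolding y_def n_def .
  have "(\<Prod>p\<in>{p \<in> P. r p < k}. real p) = (\<Prod>i<k. \<Prod>p\<in>{p \<in> P. r p = i}. real p)"
    by (rule prod_fibres[OF finite_P', symmetric])
  also have "\<dots> = (\<Prod>i<k. real (n i))" unfolding n_def by (intro prod.cong refl) (simp add: tuple_of_def)
  also have "\<dots> \<le> (\<Prod>i<k. R powr (Suc (cells k n i) / N))"
  proof (intro prod_mono conjI)
    fix i assume "i \<in> {..<k}"
    then show "real (n i) \<le> R powr (Suc (cells k n i) / N)"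
      using log_cell_less[of "n i"] tuple_of_pos[of i k r] unfolding n_def cells_def by simp
  qed auto
  also have "\<dots> = R powr (\<Sum>i<k. Suc (cells k n i) / N)" using R_gt1 by (simp add: powr_sum)
  also have "(\<Sum>i<k. Suc (cells k n i) / N) = real (\<Sum>i<k. Suc (cells k n i)) / N"
    by (simp add: sum_divide_distrib)
  also have "R powr \<dots> \<le> R powr 1"
  proof (rule powr_mono)
    have "real (\<Sum>i<k. Suc (cells k n i)) \<le> real N" using \<Phi>_sum[OF \<Phi>] by (simp only: of_nat_le_iff)
    then show "real (\<Sum>i<k. Suc (cells k n i)) / N \<le> 1" using N_ge1 by (simp add: divide_le_eq_1)
  qed (use R_gt1 in auto)
  finally show "(\<Prod>p\<in>{p \<in> P. r p < k}. real p) \<le> R" using R_gt1 by simp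
qed (use finite_P' w_ge2 R_gt1 \<Phi>_nonneg \<Phi>_le in \<open>auto simp: P_def y_def\<close>)

lemma log_cell_D: "n \<in> D \<Longrightarrow> log_cell N R n < N"
proof -
  assume n: "n \<in> D"
  then have "R powr (log_cell N R n / N) \<le> n" using log_cell_iff[OF R_gt1 N_ge1, of n] unfolding D_def by auto
  also have "\<dots> < R powr 1" using n R_gt1 unfolding D_def by simp
  finally have "log_cell N R n / N < 1" using R_gt1 by (subst (asm) powr_less_cancel_iff) auto
  then show ?thesis using N_ge1 by simp
qed

lemma mem_D:
  assumes "\<Phi> j \<noteq> 0" "i < k" "log_cell N R n = j i" "n > 0" "coprime n (primorial w)"
  shows "n \<in> D" and "real n \<le> z"
proof -
  have n: "real n < R powr (Suc (j i) / N)" using log_cell_less[of n] assms by simp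
  have "Suc (j i) \<le> (\<Sum>i<k. Suc (j i))" by (rule member_le_sum) (use assms in auto)
  then have "Suc (j i) \<le> N" using \<Phi>_sum[OF assms(1)] by linarith
  then have "R powr (Suc (j i) / N) \<le> R powr 1" using R_gt1 N_ge1 by (intro powr_mono) auto
  then show "n \<in> D" using n assms R_gt1 unfolding D_def by simp
  show "real n \<le> z" using n \<Phi>_max[OF assms(1,2)] by linarith
qed

lemma P_coprime: "p \<in> P \<Longrightarrow> coprime p (primorial w)"
  unfolding P_def using coprime_primorial by auto

text \<open>\<open>main_matrix\<close> is diagonal, so only r = s survives and leaves the square of
  \<open>y r\<close> divided by the product of the coloured primes; this is summed over tuples and
  then collected by cells.\<close>

lemma main_form_le:
  "(\<Sum>r\<in>colourings P k. \<Sum>s\<in>colourings P k. y r * y s * (\<Prod>p\<in>P. main_matrix k (real p) (r p) (s p)))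
    \<le> (\<Sum>j\<in>PiE {..<k} (\<lambda>_. {..<N}). (\<Phi> j)\<^sup>2 * (\<Prod>i<k. H (j i)))"
proof -
  have diag: "(\<Sum>s\<in>colourings P k. y r * y s * (\<Prod>p\<in>P. main_matrix k (real p) (r p) (s p)))
     = (y r)\<^sup>2 * (\<Prod>p\<in>P. if r p < k then 1 / real p else 1)" if r: "r \<in> colourings P k" for r
  proof -
    have "(\<Sum>s\<in>colourings P k. y r * y s * (\<Prod>p\<in>P. main_matrix k (real p) (r p) (s p)))
       = (\<Sum>s\<in>colourings P k. if s = r then (y r)\<^sup>2 * (\<Prod>p\<in>P. if r p < k then 1 / real p else 1) else 0)"
    proof (rule sum.cong[OF refl])
      fix s assume s: "s \<in> colourings P k"
      show "y r * y s * (\<Prod>p\<in>P. main_matrix k (real p) (r p) (s p))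
         = (if s = r then (y r)\<^sup>2 * (\<Prod>p\<in>P. if r p < k then 1 / real p else 1) else 0)"
      proof (cases "s = r")
        case True
        have "main_matrix k (real p) (r p) (r p) = (if r p < k then 1 / real p else 1)" if "p \<in> P" for p
          using r that by (auto simp: main_matrix_def PiE_iff)
        then show ?thesis using True by (simp add: power2_eq_square)
      next
        case False
        then obtain p where "p \<in> P" "s p \<noteq> r p" using r s PiE_ext by blast
        then have "(\<Prod>p\<in>P. main_matrix k (real p) (r p) (s p)) = 0"
          using finite_P by (intro prod_zero bexI[of _ p]) (auto simp: main_matrix_def)
        then show ?thesis using False by simp
      qed
    qed
    then show ?thesis using r finite_colourings[OF finite_P] by simp
  qed
  have "(\<Sum>r\<in>colourings P k. \<Sum>s\<in>colourings P k. y r * y s * (\<Prod>p\<in>P. main_matrix k (real p) (r p) (s p)))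
     = (\<Sum>r\<in>colourings P k. (\<Phi> (cells k (tuple_of P k r)))\<^sup>2 * (\<Prod>p\<in>P. if r p < k then 1 / real p else 1))"
    using diag unfolding y_def by (intro sum.cong refl) auto
  also have "\<dots> \<le> (\<Sum>n\<in>PiE {..<k} (\<lambda>_. D). (\<Phi> (cells k n))\<^sup>2 * (\<Prod>i<k. 1 / real (n i)))"
  proof (rule colouring_sum_le[where g = "\<lambda>n. (\<Phi> (cells k n))\<^sup>2", OF finite_P prime_P P_coprime _ finite_D])
    fix n i assume n: "(\<Phi> (cells k n))\<^sup>2 \<noteq> 0" "i < k" "n i > 0" "coprime (n i) (primorial w)"
    show "n i \<in> D" by (rule mem_D(1)[of "cells k n" i]) (use n in \<open>auto simp: cells_def\<close>)
  qed auto
  also have "\<dots> = (\<Sum>j\<in>PiE {..<k} (\<lambda>_. {..<N}). (\<Phi> j)\<^sup>2 * (\<Prod>i<k. H (j i)))"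
    unfolding cells_def H_def
    by (rule sum_over_cells[OF finite_D, where G = "\<lambda>j. (\<Phi> j)\<^sup>2" and f = "\<lambda>n. 1 / real n"]) (use log_cell_D in auto)
  finally show ?thesis .
qed

text \<open>A pair of colourings with nonzero matrix product amounts to one colouring with k + 1
  colours: the colours i < k other than m are shared, colour m belongs to the first one only, and
  colour k stands for the m-th entry of the second. Merging turns the form into a sum over tuples of
  length k + 1, to which the lower bound for colouring sums applies.\<close>

lemma prime_main_form_ge:
  assumes m: "m < k"
  shows "(\<Sum>j\<in>PiE {..<Suc k} (\<lambda>_. {..<N}). \<Phi> (restrict j {..<k}) * \<Phi> (restrict (j(m := j k)) {..<k}) * (\<Prod>i<Suc k. H (j i)))
      - Y\<^sup>2 * (real (Suc k) ^ 2 / w * (\<Sum>n\<in>D. 1 / real n) ^ Suc k)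
    \<le> (\<Sum>r\<in>colourings P k. \<Sum>s\<in>colourings P k. y r * y s * (\<Prod>p\<in>P. prime_main_matrix k m (real p) (r p) (s p)))"
proof -
  define G where "G j = \<Phi> (restrict j {..<k}) * \<Phi> (restrict (j(m := j k)) {..<k})" for j
  define g where "g n = G (cells (Suc k) n)" for n
  \<comment> \<open>\<open>r1\<close> and \<open>r2\<close> recover the two colourings, in which k
    means blank: colour m is blank in the second, colour k is blank in the first and becomes m in
    the second, and \<open>Suc k\<close> is blank in both.\<close>
  define r1 where "r1 s = (\<lambda>p\<in>P. if s p \<ge> k then k else s p)" for s :: "nat \<Rightarrow> nat"
  define r2 where "r2 s = (\<lambda>p\<in>P. if s p = Suc k \<or> s p = m then k else if s p = k then m else s p)" for s :: "nat \<Rightarrow> nat"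
  define S where "S = colourings P (Suc k)"
  have G0: "0 \<le> G j" for j unfolding G_def using \<Phi>_nonneg by simp
  have G_le: "G j \<le> Y\<^sup>2" for j unfolding G_def power2_eq_square using \<Phi>_nonneg \<Phi>_le by (intro mult_mono) (auto intro: Y_nonneg)
  have c1: "restrict (cells (Suc k) n) {..<k} = cells k n" for n
    by (auto simp: cells_def restrict_def fun_eq_iff)
  have c2: "restrict ((cells (Suc k) n)(m := cells (Suc k) n k)) {..<k} = cells k (n(m := n k))" for n
    using m by (auto simp: cells_def restrict_def fun_eq_iff)
  have "(\<Sum>j\<in>PiE {..<Suc k} (\<lambda>_. {..<N}). G j * (\<Prod>i<Suc k. H (j i)))
     = (\<Sum>n\<in>PiE {..<Suc k} (\<lambda>_. D). g n * (\<Prod>i<Suc k. 1 / real (n i)))"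
    unfolding g_def cells_def H_def
    by (rule sum_over_cells[OF finite_D, symmetric]) (use log_cell_D in auto)
  also have "\<dots> - Y\<^sup>2 * (real (Suc k) ^ 2 / w * (\<Sum>n\<in>D. 1 / real n) ^ Suc k)
     \<le> (\<Sum>s\<in>S. g (tuple_of P (Suc k) s) * (\<Prod>p\<in>P. if s p < Suc k then 1 / real p else 1))"
    unfolding S_def
  proof (rule colouring_sum_ge[OF P_def _ _ D_def])
    show "1 \<le> w" using w_ge by simp
    show "p dvd primorial w" if "prime p" "p \<le> w" for p using that prime_dvd_primorial_iff by simp
    show "0 \<le> g n" "g n \<le> Y\<^sup>2" for n unfolding g_def using G0 G_le by auto
    fix n i assume n: "n \<in> PiE {..<Suc k} (\<lambda>_. D)" "g n \<noteq> 0" "i < Suc k"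
    have nz: "\<Phi> (cells k n) \<noteq> 0" "\<Phi> (cells k (n(m := n k))) \<noteq> 0" using n(2) unfolding g_def G_def c1 c2 by auto
    have D: "n i > 0" "coprime (n i) (primorial w)" using n(1,3) unfolding D_def by auto
    show "real (n i) \<le> z"
    proof (cases "i = k")
      case True
      show ?thesis by (rule mem_D(2)[OF nz(2) m]) (use D True m in \<open>auto simp: cells_def\<close>)
    next
      case False
      then have "i < k" using n(3) by simp
      show ?thesis by (rule mem_D(2)[OF nz(1) \<open>i < k\<close>]) (use D \<open>i < k\<close> in \<open>auto simp: cells_def\<close>)
    qed
  qed
  also have "\<dots> = (\<Sum>s\<in>S. y (r1 s) * y (r2 s) * (\<Prod>p\<in>P. prime_main_matrix k m (real p) (r1 s p) (r2 s p)))"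
  proof (rule sum.cong[OF refl])
    fix s assume s: "s \<in> S"
    have "cells k (tuple_of P (Suc k) s) = cells k (tuple_of P k (r1 s))"
      unfolding cells_def
    proof (rule restrict_ext)
      fix i assume "i \<in> {..<k}"
      then have "{p \<in> P. r1 s p = i} = {p \<in> P. s p = i}" by (auto simp: r1_def)
      then show "log_cell N R (tuple_of P (Suc k) s i) = log_cell N R (tuple_of P k (r1 s) i)"
        using \<open>i \<in> {..<k}\<close> by (simp add: tuple_of_def)
    qed
    moreover have "cells k ((tuple_of P (Suc k) s)(m := tuple_of P (Suc k) s k)) = cells k (tuple_of P k (r2 s))"
      unfolding cells_def
    proof (rule restrict_ext)
      fix i assume i: "i \<in> {..<k}"
      have "{p \<in> P. r2 s p = i} = {p \<in> P. s p = (if i = m then k else i)}"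
        using i m by (auto simp: r2_def)
      then show "log_cell N R (((tuple_of P (Suc k) s)(m := tuple_of P (Suc k) s k)) i) = log_cell N R (tuple_of P k (r2 s) i)"
        using i by (simp add: tuple_of_def)
    qed
    ultimately have "g (tuple_of P (Suc k) s) = y (r1 s) * y (r2 s)"
      unfolding g_def G_def c1 c2 y_def by simp
    moreover have "(if s p < Suc k then 1 / real p else 1) = prime_main_matrix k m (real p) (r1 s p) (r2 s p)" if p: "p \<in> P" for p
    proof -
      have "s p \<le> Suc k" using s p unfolding S_def by auto
      then consider "s p = Suc k" | "s p = k" | "s p = m" | "s p < k" "s p \<noteq> m" by linarith
      then show ?thesis by cases (use p m in \<open>simp_all add: r1_def r2_def prime_main_matrix_def\<close>)
    qed
    ultimately show "g (tuple_of P (Suc k) s) * (\<Prod>p\<in>P. if s p < Suc k then 1 / real p else 1)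
       = y (r1 s) * y (r2 s) * (\<Prod>p\<in>P. prime_main_matrix k m (real p) (r1 s p) (r2 s p))" by simp
  qed
  also have "\<dots> = (\<Sum>x\<in>(\<lambda>s. (r1 s, r2 s)) ` S. y (fst x) * y (snd x) * (\<Prod>p\<in>P. prime_main_matrix k m (real p) (fst x p) (snd x p)))"
  proof (subst sum.reindex)
    show "inj_on (\<lambda>s. (r1 s, r2 s)) S"
    proof (rule inj_onI)
      fix s t assume st: "s \<in> S" "t \<in> S" "(r1 s, r2 s) = (r1 t, r2 t)"
      have "s p = t p" if p: "p \<in> P" for p
      proof -
        have "s p \<le> Suc k" "t p \<le> Suc k" using st p unfolding S_def by auto
        moreover have "r1 s p = r1 t p" "r2 s p = r2 t p" using st by auto
        ultimately show ?thesis using p m unfolding r1_def r2_def by (simp split: if_splits)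
      qed
      then show "s = t" using st unfolding S_def by (intro PiE_ext) auto
    qed
  qed simp
  also have "\<dots> \<le> (\<Sum>x\<in>colourings P k \<times> colourings P k. y (fst x) * y (snd x) * (\<Prod>p\<in>P. prime_main_matrix k m (real p) (fst x p) (snd x p)))"
  proof (rule sum_mono2)
    show "finite (colourings P k \<times> colourings P k)" using finite_colourings[OF finite_P] by auto
    have "r1 s \<in> colourings P k" "r2 s \<in> colourings P k" if "s \<in> S" for s
      using that m unfolding S_def r1_def r2_def by (auto simp: PiE_iff le_Suc_eq)
    then show "(\<lambda>s. (r1 s, r2 s)) ` S \<subseteq> colourings P k \<times> colourings P k"
      by (intro image_subsetI SigmaI)
  qed (auto intro!: mult_nonneg_nonneg prod_nonneg simp: prime_main_matrix_def y_def \<Phi>_nonneg)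
  also have "\<dots> = (\<Sum>r\<in>colourings P k. \<Sum>s\<in>colourings P k. y r * y s * (\<Prod>p\<in>P. prime_main_matrix k m (real p) (r p) (s p)))"
    by (simp add: sum.cartesian_product')
  finally show ?thesis unfolding G_def .
qed

lemma H_eq:
  assumes "j < N"
  shows "H j = coprime_harm (primorial w) (R powr (Suc j / N)) - coprime_harm (primorial w) (R powr (j / N))"
proof -
  define E where "E t = {n. 0 < n \<and> real n < t \<and> coprime n (primorial w)}" for t
  have fin: "finite (E t)" for t
    unfolding E_def by (rule finite_subset[of _ "{..nat \<lceil>t\<rceil>}"]) (auto, linarith)
  have le: "R powr (j / N) \<le> R powr (Suc j / N)" "R powr (Suc j / N) \<le> R powr 1"
    using R_gt1 N_ge1 assms by (intro powr_mono; auto simp: divide_right_mono)+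
  have "{n \<in> D. log_cell N R n = j} = E (R powr (Suc j / N)) - E (R powr (j / N))"
  proof (intro equalityI subsetI)
    fix n assume "n \<in> {n \<in> D. log_cell N R n = j}"
    then show "n \<in> E (R powr (Suc j / N)) - E (R powr (j / N))"
      using log_cell_iff[OF R_gt1 N_ge1, of n j] unfolding D_def E_def by auto
  next
    fix n assume "n \<in> E (R powr (Suc j / N)) - E (R powr (j / N))"
    then show "n \<in> {n \<in> D. log_cell N R n = j}"
      using log_cell_iff[OF R_gt1 N_ge1, of n j] le R_gt1 unfolding D_def E_def by auto
  qed
  moreover have "E (R powr (j / N)) \<subseteq> E (R powr (Suc j / N))" using le unfolding E_def by auto
  ultimately show ?thesis unfolding H_def coprime_harm_def E_def[symmetric]
    using fin by (simp add: sum_diff)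
qed

lemma sum_D_eq: "(\<Sum>n\<in>D. 1 / real n) = coprime_harm (primorial w) R"
  unfolding D_def coprime_harm_def ..

end

subsection \<open>Counting in residue classes\<close>

lemma chinese_remainder_primes:
  fixes A :: "nat set" and f :: "nat \<Rightarrow> int"
  assumes "finite A" "\<And>p. p \<in> A \<Longrightarrow> prime p"
  shows "\<exists>a. \<forall>n. (\<forall>p\<in>A. [n = f p] (mod int p)) \<longleftrightarrow> [n = a] (mod int (\<Prod>A))"
  using assms
proof (induction A rule: finite_induct)
  case (insert q A)
  then obtain a where a: "\<And>n. (\<forall>p\<in>A. [n = f p] (mod int p)) \<longleftrightarrow> [n = a] (mod int (\<Prod>A))" by auto
  have "coprime q (\<Prod>A)"
    using insert by (intro prod_coprime_right) (metis insertCI primes_coprime)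
  then have cop: "coprime (int q) (int (\<Prod>A))" by (simp only: coprime_int_iff)
  obtain c where c: "[c = f q] (mod int q)" "[c = a] (mod int (\<Prod>A))"
    using binary_chinese_remainder_int[OF cop] by blast
  have "(\<forall>p\<in>insert q A. [n = f p] (mod int p)) \<longleftrightarrow> [n = c] (mod int (\<Prod>(insert q A)))" for n
  proof -
    have "(\<forall>p\<in>insert q A. [n = f p] (mod int p)) \<longleftrightarrow> [n = f q] (mod int q) \<and> [n = a] (mod int (\<Prod>A))"
      using a by auto
    also have "\<dots> \<longleftrightarrow> [n = c] (mod int q) \<and> [n = c] (mod int (\<Prod>A))"
      using c by (meson cong_sym cong_trans)
    also have "\<dots> \<longleftrightarrow> [n = c] (mod int q * int (\<Prod>A))"
      using cop by (meson cong_modulus_mult coprime_cong_mult cong_modulus_mult_nat mult.commute cong_dvd_modulus dvd_triv_left dvd_triv_right)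
    finally show ?thesis using insert by simp
  qed
  then show ?case by blast
qed auto

lemma card_cong_approx:
  fixes u v a :: int and q :: nat
  assumes "q > 0" "u \<le> v"
  shows "\<bar>real (card {n \<in> {u..v}. [n = a] (mod int q)}) - real_of_int (v - u) / q\<bar> \<le> 1"
proof -
  define \<alpha> \<beta> where "\<alpha> = real_of_int (u - a) / q" and "\<beta> = real_of_int (v - a) / q"
  have q: "real q > 0" using assms by simp
  have "{n \<in> {u..v}. [n = a] (mod int q)} = (\<lambda>t. a + int q * t) ` {\<lceil>\<alpha>\<rceil>..\<lfloor>\<beta>\<rfloor>}"
  proof (intro equalityI subsetI)
    fix n assume n: "n \<in> {n \<in> {u..v}. [n = a] (mod int q)}"
    then obtain t where t: "n = a + int q * t"
      by (metis (no_types, lifting) cong_iff_lin cong_sym mem_Collect_eq)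
    have "u - a \<le> int q * t" "int q * t \<le> v - a" using n unfolding t by auto
    then have "real_of_int (u - a) \<le> real_of_int (int q * t)" "real_of_int (int q * t) \<le> real_of_int (v - a)"
      by (simp_all only: of_int_le_iff)
    then have "real_of_int (u - a) \<le> q * t" "q * t \<le> real_of_int (v - a)" by simp_all
    then have "\<alpha> \<le> t" "t \<le> \<beta>" unfolding \<alpha>_def \<beta>_def using q by (simp_all add: field_simps)
    then show "n \<in> (\<lambda>t. a + int q * t) ` {\<lceil>\<alpha>\<rceil>..\<lfloor>\<beta>\<rfloor>}"
      unfolding t by (auto simp: ceiling_le_iff le_floor_iff)
  next
    fix n assume "n \<in> (\<lambda>t. a + int q * t) ` {\<lceil>\<alpha>\<rceil>..\<lfloor>\<beta>\<rfloor>}"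
    then obtain t where t: "n = a + int q * t" "\<alpha> \<le> t" "t \<le> \<beta>"
      by (metis (no_types, lifting) atLeastAtMost_iff ceiling_le_iff imageE le_floor_iff)
    then have "real_of_int (u - a) \<le> q * t" "q * t \<le> real_of_int (v - a)"
      unfolding \<alpha>_def \<beta>_def using q by (simp_all add: field_simps)
    then have "real_of_int (u - a) \<le> real_of_int (int q * t)" "real_of_int (int q * t) \<le> real_of_int (v - a)" by simp_all
    then have "u - a \<le> int q * t" "int q * t \<le> v - a" by (simp_all only: of_int_le_iff)
    then show "n \<in> {n \<in> {u..v}. [n = a] (mod int q)}" unfolding t by (auto simp: cong_def)
  qed
  moreover have "inj_on (\<lambda>t. a + int q * t) {\<lceil>\<alpha>\<rceil>..\<lfloor>\<beta>\<rfloor>}" using assms by (auto simp: inj_on_def)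
  ultimately have card: "card {n \<in> {u..v}. [n = a] (mod int q)} = nat (\<lfloor>\<beta>\<rfloor> - \<lceil>\<alpha>\<rceil> + 1)"
    by (simp add: card_image)
  have diff: "\<beta> - \<alpha> = real_of_int (v - u) / q" unfolding \<alpha>_def \<beta>_def by (simp add: diff_divide_distrib)
  have "\<alpha> \<le> \<beta>" unfolding \<alpha>_def \<beta>_def using assms by (intro divide_right_mono) auto
  then have "\<lfloor>\<beta>\<rfloor> - \<lceil>\<alpha>\<rceil> + 1 \<ge> 0" by linarith
  then have "real (card {n \<in> {u..v}. [n = a] (mod int q)}) = real_of_int (\<lfloor>\<beta>\<rfloor> - \<lceil>\<alpha>\<rceil> + 1)" using card by simp
  then show ?thesis unfolding diff[symmetric] by (simp add: abs_le_iff) linarith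
qed

text \<open>B will be the set of primes up to w, and b a residue class modulo their product in which
  no n + h i is divisible by any of them.\<close>

locale tuple_sieve = sieve_weights k w P R Y y
  for k w :: nat and P :: "nat set" and R Y :: real and y :: "(nat \<Rightarrow> nat) \<Rightarrow> real" +
  fixes h :: "nat \<Rightarrow> int" and B :: "nat set" and b :: int
  assumes shift_distinct: "\<And>p i j. p \<in> P \<Longrightarrow> i < k \<Longrightarrow> j < k \<Longrightarrow> i \<noteq> j \<Longrightarrow> \<not> [h i = h j] (mod int p)"
    and finite_B: "finite B" and prime_B: "\<And>p. p \<in> B \<Longrightarrow> prime p" and B_disjoint: "B \<inter> P = {}"
begin

definition W :: nat where "W = \<Prod>B"

definition meets :: "int \<Rightarrow> (nat \<Rightarrow> nat) \<Rightarrow> bool" where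
  "meets n d \<longleftrightarrow> (\<forall>p\<in>P. d p < k \<longrightarrow> int p dvd n + h (d p))"

definition compatible :: "(nat \<Rightarrow> nat) \<Rightarrow> (nat \<Rightarrow> nat) \<Rightarrow> bool" where
  "compatible d e \<longleftrightarrow> (\<forall>p\<in>P. d p < k \<longrightarrow> e p < k \<longrightarrow> d p = e p)"

text \<open>The primes dividing the least common multiple of the two moduli.\<close>

definition supp :: "(nat \<Rightarrow> nat) \<Rightarrow> (nat \<Rightarrow> nat) \<Rightarrow> nat set" where
  "supp d e = {p \<in> P. d p < k \<or> e p < k}"

definition nu :: "int \<Rightarrow> real" where
  "nu n = (\<Sum>d\<in>{d \<in> colourings P k. meets n d}. lam d)\<^sup>2"

lemma W_pos: "W > 0" unfolding W_def by (rule prod_pos_primes) (rule prime_B)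

lemma supp_sub: "supp d e \<subseteq> P" unfolding supp_def by auto

lemma finite_supp: "finite (supp d e)" using supp_sub finite_P finite_subset by blast

lemma prod_supp_pos: "A \<subseteq> P \<Longrightarrow> \<Prod>A > 0"
  by (rule prod_pos_primes) (use prime_P in auto)

lemma W_supp: "A \<subseteq> P \<Longrightarrow> W * \<Prod>A = \<Prod>(B \<union> A)"
  unfolding W_def using B_disjoint finite_B finite_P finite_subset[of A P]
  by (subst prod.union_disjoint) auto

lemma nu_nonneg: "0 \<le> nu n" unfolding nu_def by simp

lemma square_sum_meets:
  assumes "C \<subseteq> colourings P k"
  shows "(\<Sum>d\<in>{d \<in> C. meets n d}. lam d)\<^sup>2 = (\<Sum>d\<in>C. \<Sum>e\<in>C. lam d * lam e * of_bool (meets n d \<and> meets n e))"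
proof -
  have fin: "finite C" using assms finite_colourings[OF finite_P] finite_subset by blast
  have "(\<Sum>d\<in>{d \<in> C. meets n d}. lam d) = (\<Sum>d\<in>C. lam d * of_bool (meets n d))"
    by (subst sum.inter_filter[OF fin]) (auto intro!: sum.cong)
  then show ?thesis unfolding power2_eq_square by (simp only: sum_product of_bool_conj mult_ac)
qed

lemma meets_pair_iff:
  assumes d: "d \<in> colourings P k" and e: "e \<in> colourings P k" and comp: "compatible d e"
  shows "meets n d \<and> meets n e \<longleftrightarrow> (\<forall>p\<in>supp d e. [n = - h (if d p < k then d p else e p)] (mod int p))"
proof -
  have dvd: "int p dvd n + h i \<longleftrightarrow> [n = - h i] (mod int p)" for p i
    by (simp add: cong_iff_dvd_diff)
  show ?thesis unfolding meets_def supp_def dvd using comp unfolding compatible_def by (auto; metis)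
qed

lemma meets_incompatible:
  assumes "\<not> compatible d e" "meets n d" "meets n e"
  shows False
proof -
  obtain p where p: "p \<in> P" "d p < k" "e p < k" "d p \<noteq> e p" using assms(1) unfolding compatible_def by auto
  then have "int p dvd n + h (d p)" "int p dvd n + h (e p)" using assms unfolding meets_def by auto
  then have "int p dvd (n + h (d p)) - (n + h (e p))" by (rule dvd_diff)
  then have "[h (d p) = h (e p)] (mod int p)" by (simp add: cong_iff_dvd_diff)
  then show False using shift_distinct p by blast
qed

lemma residue_class_exists:
  assumes d: "d \<in> colourings P k" and e: "e \<in> colourings P k" and comp: "compatible d e"
  shows "\<exists>a. \<forall>n. ([n = b] (mod int W) \<and> meets n d \<and> meets n e) \<longleftrightarrow> [n = a] (mod int (W * \<Prod>(supp d e)))"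
proof -
  obtain c where c: "\<And>n. (\<forall>p\<in>supp d e. [n = - h (if d p < k then d p else e p)] (mod int p)) \<longleftrightarrow> [n = c] (mod int (\<Prod>(supp d e)))"
    using chinese_remainder_primes[of "supp d e" "\<lambda>p. - h (if d p < k then d p else e p)"] finite_supp supp_sub prime_P by blast
  have "coprime W (\<Prod>(supp d e))"
    unfolding W_def
  proof (intro prod_coprime_left prod_coprime_right)
    fix p q assume "p \<in> B" "q \<in> supp d e"
    then show "coprime p q" using prime_B prime_P supp_sub B_disjoint by (metis disjoint_iff primes_coprime subsetD)
  qed
  then have cop: "coprime (int W) (int (\<Prod>(supp d e)))" by (simp only: coprime_int_iff)
  obtain a where a: "[a = b] (mod int W)" "[a = c] (mod int (\<Prod>(supp d e)))"
    using binary_chinese_remainder_int[OF cop] by blast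
  have "([n = b] (mod int W) \<and> meets n d \<and> meets n e) \<longleftrightarrow> [n = a] (mod int (W * \<Prod>(supp d e)))" for n
  proof -
    have "([n = b] (mod int W) \<and> meets n d \<and> meets n e) \<longleftrightarrow> [n = b] (mod int W) \<and> [n = c] (mod int (\<Prod>(supp d e)))"
      using c meets_pair_iff[OF d e comp, of n] by simp
    also have "\<dots> \<longleftrightarrow> [n = a] (mod int W) \<and> [n = a] (mod int (\<Prod>(supp d e)))"
      using a by (meson cong_sym cong_trans)
    also have "\<dots> \<longleftrightarrow> [n = a] (mod int W * int (\<Prod>(supp d e)))"
      using cop by (meson coprime_cong_mult cong_dvd_modulus dvd_triv_left dvd_triv_right)
    finally show ?thesis by simp
  qed
  then show ?thesis by blast
qed

text \<open>This ties the tensor form to the sieve sum: n meets both d and e with density one over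
  their least common multiple, and never if some p would have to divide two different
  shifts.\<close>

lemma prod_density_matrix:
  assumes d: "d \<in> colourings P k" and e: "e \<in> colourings P k"
  shows "(\<Prod>p\<in>P. density_matrix k (real p) (d p) (e p)) = (if compatible d e then 1 / real (\<Prod>(supp d e)) else 0)"
proof (cases "compatible d e")
  case True
  have "(\<Prod>p\<in>P. density_matrix k (real p) (d p) (e p)) = (\<Prod>p\<in>P. if d p < k \<or> e p < k then 1 / real p else 1)"
  proof (intro prod.cong refl)
    fix p assume p: "p \<in> P"
    have "d p \<le> k" "e p \<le> k" using d e p by auto
    moreover have "d p < k \<Longrightarrow> e p < k \<Longrightarrow> d p = e p" using True p unfolding compatible_def by auto
    ultimately show "density_matrix k (real p) (d p) (e p) = (if d p < k \<or> e p < k then 1 / real p else 1)"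
      by (auto simp: density_matrix_def)
  qed
  also have "\<dots> = (\<Prod>p\<in>supp d e. 1 / real p)" unfolding supp_def by (rule prod.inter_filter[OF finite_P, symmetric])
  finally show ?thesis using True by (simp add: prod_dividef)
next
  case False
  then obtain p where p: "p \<in> P" "d p < k" "e p < k" "d p \<noteq> e p" unfolding compatible_def by auto
  then have "density_matrix k (real p) (d p) (e p) = 0" by (simp add: density_matrix_def)
  then show ?thesis using False p finite_P by (auto intro!: prod_zero)
qed

text \<open>Opening the square leaves, for each compatible pair, the count of one residue class in
  an interval, with error at most 1; incompatible pairs contribute nothing.\<close>

lemma sum_nu_approx:
  assumes uv: "u \<le> v"
  shows "\<bar>(\<Sum>n\<in>{n \<in> {u..v}. [n = b] (mod int W)}. nu n)
     - real_of_int (v - u) / real W * (\<Sum>d\<in>colourings P k. \<Sum>e\<in>colourings P k. lam d * lam e * (\<Prod>p\<in>P. density_matrix k (real p) (d p) (e p)))\<bar>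
    \<le> (\<Sum>d\<in>colourings P k. \<bar>lam d\<bar>)\<^sup>2"
proof -
  define C where "C = colourings P k"
  define cnt where "cnt d e = real (card {n \<in> {u..v}. [n = b] (mod int W) \<and> meets n d \<and> meets n e})" for d e
  define M where "M d e = (\<Prod>p\<in>P. density_matrix k (real p) (d p) (e p))" for d e
  have "(\<Sum>n\<in>{n \<in> {u..v}. [n = b] (mod int W)}. nu n)
    = (\<Sum>n\<in>{n \<in> {u..v}. [n = b] (mod int W)}. \<Sum>d\<in>C. \<Sum>e\<in>C. lam d * lam e * of_bool (meets n d \<and> meets n e))"
    unfolding nu_def C_def by (intro sum.cong refl square_sum_meets) auto
  also have "\<dots> = (\<Sum>d\<in>C. \<Sum>n\<in>{n \<in> {u..v}. [n = b] (mod int W)}. \<Sum>e\<in>C. lam d * lam e * of_bool (meets n d \<and> meets n e))"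
    by (rule sum.swap)
  also have "\<dots> = (\<Sum>d\<in>C. \<Sum>e\<in>C. \<Sum>n\<in>{n \<in> {u..v}. [n = b] (mod int W)}. lam d * lam e * of_bool (meets n d \<and> meets n e))"
    by (rule sum.cong[OF refl], rule sum.swap)
  also have "\<dots> = (\<Sum>d\<in>C. \<Sum>e\<in>C. lam d * lam e * cnt d e)"
  proof (intro sum.cong refl)
    fix d e
    have "(\<Sum>n\<in>{n \<in> {u..v}. [n = b] (mod int W)}. of_bool (meets n d \<and> meets n e) :: real)
      = real (card ({n \<in> {u..v}. [n = b] (mod int W)} \<inter> {n. meets n d \<and> meets n e}))"
      by (subst sum_of_bool_eq) (auto intro: finite_subset[of _ "{u..v}"])
    also have "{n \<in> {u..v}. [n = b] (mod int W)} \<inter> {n. meets n d \<and> meets n e} = {n \<in> {u..v}. [n = b] (mod int W) \<and> meets n d \<and> meets n e}" by auto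
    finally show "(\<Sum>n\<in>{n \<in> {u..v}. [n = b] (mod int W)}. lam d * lam e * of_bool (meets n d \<and> meets n e)) = lam d * lam e * cnt d e"
      unfolding sum_distrib_left[symmetric] cnt_def by simp
  qed
  finally have nu_eq: "(\<Sum>n\<in>{n \<in> {u..v}. [n = b] (mod int W)}. nu n) = (\<Sum>d\<in>C. \<Sum>e\<in>C. lam d * lam e * cnt d e)" .
  have linear: "(\<Sum>d\<in>C. \<Sum>e\<in>C. lam d * lam e * cnt d e) - r * (\<Sum>d\<in>C. \<Sum>e\<in>C. lam d * lam e * M d e)
     = (\<Sum>d\<in>C. \<Sum>e\<in>C. lam d * lam e * (cnt d e - r * M d e))" for r
    by (simp only: sum_distrib_left sum_subtractf right_diff_distrib mult_ac)
  have eq: "(\<Sum>n\<in>{n \<in> {u..v}. [n = b] (mod int W)}. nu n) - real_of_int (v - u) / real W * (\<Sum>d\<in>C. \<Sum>e\<in>C. lam d * lam e * M d e)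
     = (\<Sum>d\<in>C. \<Sum>e\<in>C. lam d * lam e * (cnt d e - real_of_int (v - u) / real W * M d e))"
    unfolding nu_eq by (rule linear)
  have cnt: "\<bar>cnt d e - real_of_int (v - u) / real W * M d e\<bar> \<le> 1" if de: "d \<in> C" "e \<in> C" for d e
  proof (cases "compatible d e")
    case True
    obtain a where a: "\<And>n. ([n = b] (mod int W) \<and> meets n d \<and> meets n e) \<longleftrightarrow> [n = a] (mod int (W * \<Prod>(supp d e)))"
      using residue_class_exists[OF de[unfolded C_def] True] by blast
    have "M d e = 1 / real (\<Prod>(supp d e))" using prod_density_matrix de True unfolding M_def C_def by simp
    then have "real_of_int (v - u) / real W * M d e = real_of_int (v - u) / real (W * \<Prod>(supp d e))" by simp
    then show ?thesis unfolding cnt_def a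
      using card_cong_approx[OF _ uv, of "W * \<Prod>(supp d e)" a] W_pos prod_supp_pos[OF supp_sub] by simp
  next
    case False
    then have e: "{n \<in> {u..v}. [n = b] (mod int W) \<and> meets n d \<and> meets n e} = {}" using meets_incompatible by blast
    have M0: "M d e = 0" using prod_density_matrix de False unfolding M_def C_def by simp
    show ?thesis unfolding cnt_def e M0 by simp
  qed
  have "\<bar>\<Sum>d\<in>C. \<Sum>e\<in>C. lam d * lam e * (cnt d e - real_of_int (v - u) / real W * M d e)\<bar>
     \<le> (\<Sum>d\<in>C. \<Sum>e\<in>C. \<bar>lam d * lam e * (cnt d e - real_of_int (v - u) / real W * M d e)\<bar>)"
    by (rule order_trans[OF sum_abs], rule sum_mono, rule sum_abs)
  also have "\<dots> \<le> (\<Sum>d\<in>C. \<Sum>e\<in>C. \<bar>lam d\<bar> * \<bar>lam e\<bar>)"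
  proof (intro sum_mono)
    fix d e assume de: "d \<in> C" "e \<in> C"
    show "\<bar>lam d * lam e * (cnt d e - real_of_int (v - u) / real W * M d e)\<bar> \<le> \<bar>lam d\<bar> * \<bar>lam e\<bar>"
      unfolding abs_mult using cnt[OF de] by (intro mult_left_le) auto
  qed
  also have "\<dots> = (\<Sum>d\<in>C. \<bar>lam d\<bar>)\<^sup>2" unfolding power2_eq_square sum_product ..
  finally show ?thesis using eq unfolding C_def M_def by simp
qed

end

subsection \<open>Primes in the sieve\<close>

definition dyadic :: "real \<Rightarrow> nat set" where "dyadic x = {t. x \<le> real t \<and> real t \<le> 2 * x}"

definition dyadic_mangoldt :: "real \<Rightarrow> real" where "dyadic_mangoldt x = (\<Sum>t\<in>dyadic x. mangoldt t)"

definition dyadic_prime_powers :: "real \<Rightarrow> real" where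
  "dyadic_prime_powers x = (\<Sum>t\<in>{t \<in> dyadic x. \<not> prime t}. mangoldt t)"

lemma finite_dyadic: "finite (dyadic x)"
  unfolding dyadic_def by (rule finite_subset[of _ "{..nat \<lceil>2 * x\<rceil>}"]) (auto, linarith)

lemma mangoldt_le_dyadic: "t \<in> dyadic x \<Longrightarrow> x \<ge> 1 \<Longrightarrow> mangoldt t \<le> ln (2 * x)"
proof -
  assume t: "t \<in> dyadic x" "x \<ge> 1"
  then have "real t \<ge> 1" "real t \<le> 2 * x" unfolding dyadic_def by auto
  then have "ln (real t) \<le> ln (2 * x)" by (subst ln_le_cancel_iff) auto
  then show ?thesis using mangoldt_le[of t] \<open>real t \<ge> 1\<close> by force
qed

text \<open>A prime power p^a \<le> 2x with a \<ge> 2 has p \<le> sqrt (2x) and a \<le> log 2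
  (2x).\<close>

lemma dyadic_prime_powers_le:
  assumes x: "x \<ge> 1"
  shows "dyadic_prime_powers x \<le> ln (2 * x) * (sqrt (2 * x) * (log 2 (2 * x) + 1))"
proof -
  define L where "L = nat \<lfloor>log 2 (2 * x)\<rfloor>"
  define s where "s = nat \<lfloor>sqrt (2 * x)\<rfloor>"
  have "{t \<in> {t \<in> dyadic x. \<not> prime t}. mangoldt t \<noteq> (0::real)} \<subseteq> (\<lambda>(p,a). p ^ a) ` ({1..s} \<times> {..L})"
  proof
    fix t assume "t \<in> {t \<in> {t \<in> dyadic x. \<not> prime t}. mangoldt t \<noteq> (0::real)}"
    then have t: "t \<in> dyadic x" "\<not> prime t" "primepow t" by (auto simp: mangoldt_def split: if_splits)
    then obtain p a where p: "prime p" "a > 0" "t = p ^ a" by (auto simp: primepow_def)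
    then have "a \<noteq> 1" using t(2) by auto
    then have a: "a \<ge> 2" using p by simp
    have p2: "p \<ge> 2" using prime_ge_2_nat p by auto
    have tx: "real p ^ a \<le> 2 * x" using t(1) p unfolding dyadic_def by simp
    have "real p ^ 2 \<le> real p ^ a" using a p2 by (intro power_increasing) auto
    then have "real p ^ 2 \<le> 2 * x" using tx by linarith
    then have "real p \<le> sqrt (2 * x)" by (rule real_le_rsqrt)
    then have ps: "p \<le> s" unfolding s_def by linarith
    have "(2::real) ^ a \<le> real p ^ a" using p2 by (intro power_mono) auto
    then have "2 powr real a \<le> 2 * x" using tx by (simp add: powr_realpow)
    then have "real a \<le> log 2 (2 * x)" using x by (subst le_log_iff) auto
    then have "a \<le> L" unfolding L_def by linarith
    then show "t \<in> (\<lambda>(p,a). p ^ a) ` ({1..s} \<times> {..L})" using ps p2 p(3) by force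
  qed
  then have "card {t \<in> {t \<in> dyadic x. \<not> prime t}. mangoldt t \<noteq> (0::real)} \<le> card ((\<lambda>(p,a). p ^ a) ` ({1..s} \<times> {..L}))"
    by (intro card_mono) auto
  also have "\<dots> \<le> card ({1..s} \<times> {..L})" by (rule card_image_le) auto
  also have "\<dots> = s * (L + 1)" by (simp add: card_cartesian_product)
  finally have card: "card {t \<in> {t \<in> dyadic x. \<not> prime t}. mangoldt t \<noteq> (0::real)} \<le> s * (L + 1)" .
  have "dyadic_prime_powers x = (\<Sum>t\<in>{t \<in> {t \<in> dyadic x. \<not> prime t}. mangoldt t \<noteq> (0::real)}. mangoldt t)"
    unfolding dyadic_prime_powers_def using finite_dyadic by (intro sum.mono_neutral_right) auto
  also have "\<dots> \<le> real (card {t \<in> {t \<in> dyadic x. \<not> prime t}. mangoldt t \<noteq> (0::real)}) * ln (2 * x)"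
    by (rule sum_bounded_above) (use mangoldt_le_dyadic x in auto)
  also have "\<dots> \<le> real (s * (L + 1)) * ln (2 * x)"
    using card x by (intro mult_right_mono) (auto simp only: of_nat_le_iff ln_ge_zero_iff)
  also have "real (s * (L + 1)) \<le> sqrt (2 * x) * (log 2 (2 * x) + 1)"
  proof -
    have "real s \<le> sqrt (2 * x)" unfolding s_def using x by simp
    moreover have "log 2 (2 * x) \<ge> 0" using x by simp
    then have "real L \<le> log 2 (2 * x)" unfolding L_def by simp
    ultimately show ?thesis unfolding of_nat_mult using x by (intro mult_mono) auto
  qed
  finally show ?thesis using x by (simp add: mult.commute mult_right_mono)
qed

lemma totient_prod_primes:
  fixes A :: "nat set"
  assumes "finite A" "\<And>p. p \<in> A \<Longrightarrow> prime p"
  shows "totient (\<Prod>A) = (\<Prod>p\<in>A. p - 1)"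
proof -
  have "totient (\<Prod>A) = (\<Prod>p\<in>A. totient p)"
    using assms by (intro totient_prod_coprime) (auto simp: pairwise_def intro: primes_coprime)
  then show ?thesis using assms by (simp add: totient_prime)
qed

context tuple_sieve
begin

lemma coprime_W_prod: "A \<subseteq> P \<Longrightarrow> coprime W (\<Prod>A)"
  unfolding W_def
proof (intro prod_coprime_left prod_coprime_right)
  fix p q assume "A \<subseteq> P" "p \<in> B" "q \<in> A"
  then show "coprime p q" using prime_B prime_P B_disjoint by (metis disjoint_iff primes_coprime subsetD)
qed

lemma totient_W_prod: "A \<subseteq> P \<Longrightarrow> real (totient (W * \<Prod>A)) = real (totient W) * (\<Prod>p\<in>A. real p - 1)"
proof -
  assume A: "A \<subseteq> P"
  then have "totient (\<Prod>A) = (\<Prod>p\<in>A. p - 1)"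
    using finite_P prime_P finite_subset by (intro totient_prod_primes) auto
  moreover have "real (\<Prod>p\<in>A. p - 1) = (\<Prod>p\<in>A. real p - 1)"
    unfolding of_nat_prod
  proof (rule prod.cong[OF refl])
    fix p assume "p \<in> A"
    then have "1 \<le> p" using A P_ge3[of p] by auto
    then show "real (p - 1) = real p - 1" by (simp add: of_nat_diff)
  qed
  ultimately show ?thesis using coprime_W_prod[OF A] by (simp add: totient_mult_coprime)
qed

text \<open>If n + h m is a prime exceeding all of P, no p in P divides it, so only these moduli
  contribute to the sum over primes.\<close>

definition avoiding :: "nat \<Rightarrow> (nat \<Rightarrow> nat) set" where
  "avoiding m = {d \<in> colourings P k. \<forall>p\<in>P. d p \<noteq> m}"

definition class_sum :: "real \<Rightarrow> nat \<Rightarrow> (nat \<Rightarrow> nat) \<Rightarrow> (nat \<Rightarrow> nat) \<Rightarrow> real" where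
  "class_sum x m d e = (\<Sum>t\<in>{t \<in> dyadic x. [int t = b + h m] (mod int W) \<and> meets (int t - h m) d \<and> meets (int t - h m) e}. mangoldt t)"

lemma prod_prime_density_matrix:
  assumes d: "d \<in> colourings P k" and e: "e \<in> colourings P k"
  shows "(\<Prod>p\<in>P. prime_density_matrix k m (real p) (d p) (e p))
    = (if compatible d e \<and> d \<in> avoiding m \<and> e \<in> avoiding m then real (totient W) / real (totient (W * \<Prod>(supp d e))) else 0)"
proof (cases "compatible d e \<and> d \<in> avoiding m \<and> e \<in> avoiding m")
  case True
  have "(\<Prod>p\<in>P. prime_density_matrix k m (real p) (d p) (e p)) = (\<Prod>p\<in>P. if d p < k \<or> e p < k then 1 / (real p - 1) else 1)"
  proof (intro prod.cong refl)
    fix p assume p: "p \<in> P"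
    have "d p \<le> k" "e p \<le> k" using d e p by auto
    moreover have "d p < k \<Longrightarrow> e p < k \<Longrightarrow> d p = e p" using True p unfolding compatible_def by auto
    moreover have "d p \<noteq> m" "e p \<noteq> m" using True p unfolding avoiding_def by auto
    ultimately show "prime_density_matrix k m (real p) (d p) (e p) = (if d p < k \<or> e p < k then 1 / (real p - 1) else 1)"
      by (auto simp: prime_density_matrix_def density_matrix_def)
  qed
  also have "\<dots> = (\<Prod>p\<in>supp d e. 1 / (real p - 1))" unfolding supp_def by (rule prod.inter_filter[OF finite_P, symmetric])
  also have "\<dots> = 1 / (\<Prod>p\<in>supp d e. real p - 1)" by (simp add: prod_dividef)
  also have "\<dots> = real (totient W) / real (totient (W * \<Prod>(supp d e)))"
    unfolding totient_W_prod[OF supp_sub] using W_pos by simp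
  finally show ?thesis using True by simp
next
  case False
  have "\<exists>p\<in>P. prime_density_matrix k m (real p) (d p) (e p) = 0"
  proof (cases "compatible d e")
    case True
    then obtain p where "p \<in> P" "d p = m \<or> e p = m" using False d e unfolding avoiding_def by auto
    then show ?thesis by (intro bexI[of _ p]) (auto simp: prime_density_matrix_def)
  next
    case False
    then obtain p where p: "p \<in> P" "d p < k" "e p < k" "d p \<noteq> e p" unfolding compatible_def by auto
    then show ?thesis by (intro bexI[of _ p]) (auto simp: prime_density_matrix_def density_matrix_def)
  qed
  then have "(\<Prod>p\<in>P. prime_density_matrix k m (real p) (d p) (e p)) = 0" using finite_P by (intro prod_zero) auto
  then show ?thesis using False by (simp only: if_False)
qed

lemma class_sum_incompatible: "\<not> compatible d e \<Longrightarrow> class_sum x m d e = 0"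
proof -
  assume "\<not> compatible d e"
  then have e: "{t \<in> dyadic x. [int t = b + h m] (mod int W) \<and> meets (int t - h m) d \<and> meets (int t - h m) e} = {}"
    using meets_incompatible by blast
  show ?thesis unfolding class_sum_def e by (rule sum.empty)
qed

definition class_error :: "real \<Rightarrow> nat \<Rightarrow> (nat \<Rightarrow> nat) \<Rightarrow> (nat \<Rightarrow> nat) \<Rightarrow> real" where
  "class_error x m d e = \<bar>class_sum x m d e - dyadic_mangoldt x / real (totient (W * \<Prod>(supp d e)))\<bar>"

definition total_error :: "real \<Rightarrow> nat \<Rightarrow> real" where
  "total_error x m = (\<Sum>x'\<in>{x' \<in> avoiding m \<times> avoiding m. compatible (fst x') (snd x')}.
     \<bar>lam (fst x')\<bar> * \<bar>lam (snd x')\<bar> * class_error x m (fst x') (snd x'))"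

lemma finite_avoiding: "finite (avoiding m)"
  unfolding avoiding_def using finite_colourings[OF finite_P] by auto

lemma sum_class_sum_approx:
  "(\<Sum>d\<in>avoiding m. \<Sum>e\<in>avoiding m. lam d * lam e * class_sum x m d e)
   \<ge> dyadic_mangoldt x / real (totient W) * (\<Sum>d\<in>colourings P k. \<Sum>e\<in>colourings P k. lam d * lam e * (\<Prod>p\<in>P. prime_density_matrix k m (real p) (d p) (e p)))
     - total_error x m"
proof -
  define C where "C = colourings P k"
  define S where "S = {x' \<in> avoiding m \<times> avoiding m. compatible (fst x') (snd x')}"
  define l where "l x' = lam (fst x') * lam (snd x')" for x'
  define \<Psi> where "\<Psi> = dyadic_mangoldt x"
  have S: "finite S" "S \<subseteq> C \<times> C" unfolding S_def C_def using finite_avoiding by (auto simp: avoiding_def)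
  have finC: "finite C" unfolding C_def using finite_colourings[OF finite_P] .
  have 1: "(\<Sum>d\<in>avoiding m. \<Sum>e\<in>avoiding m. lam d * lam e * class_sum x m d e) = (\<Sum>x'\<in>S. l x' * class_sum x m (fst x') (snd x'))"
  proof -
    have "(\<Sum>d\<in>avoiding m. \<Sum>e\<in>avoiding m. lam d * lam e * class_sum x m d e) = (\<Sum>x'\<in>avoiding m \<times> avoiding m. l x' * class_sum x m (fst x') (snd x'))"
      unfolding sum.cartesian_product l_def by (simp add: split_def)
    also have "\<dots> = (\<Sum>x'\<in>S. l x' * class_sum x m (fst x') (snd x'))"
      unfolding S_def using finite_avoiding class_sum_incompatible by (intro sum.mono_neutral_right) auto
    finally show ?thesis .
  qed
  have 2: "\<Psi> / real (totient W) * (\<Sum>d\<in>C. \<Sum>e\<in>C. lam d * lam e * (\<Prod>p\<in>P. prime_density_matrix k m (real p) (d p) (e p)))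
     = (\<Sum>x'\<in>S. l x' * (\<Psi> / real (totient (W * \<Prod>(supp (fst x') (snd x'))))))"
  proof -
    define M where "M x' = (\<Prod>p\<in>P. prime_density_matrix k m (real p) (fst x' p) (snd x' p))" for x'
    have M: "M x' = (if x' \<in> S then real (totient W) / real (totient (W * \<Prod>(supp (fst x') (snd x')))) else 0)" if "x' \<in> C \<times> C" for x'
      using that prod_prime_density_matrix[of "fst x'" "snd x'" m] unfolding C_def M_def S_def by (auto simp: mem_Times_iff)
    have "(\<Sum>d\<in>C. \<Sum>e\<in>C. lam d * lam e * (\<Prod>p\<in>P. prime_density_matrix k m (real p) (d p) (e p))) = (\<Sum>x'\<in>C \<times> C. l x' * M x')"
      unfolding sum.cartesian_product l_def M_def by (simp add: split_def)
    also have "\<dots> = (\<Sum>x'\<in>S. l x' * M x')"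
      using finC S M by (intro sum.mono_neutral_right) auto
    also have "\<dots> = (\<Sum>x'\<in>S. l x' * (real (totient W) / real (totient (W * \<Prod>(supp (fst x') (snd x'))))))"
      using M S(2) by (intro sum.cong refl) auto
    finally show ?thesis using W_pos by (simp add: sum_distrib_left field_simps)
  qed
  have "(\<Sum>x'\<in>S. l x' * (\<Psi> / real (totient (W * \<Prod>(supp (fst x') (snd x')))))) - (\<Sum>x'\<in>S. l x' * class_sum x m (fst x') (snd x'))
     \<le> total_error x m"
    unfolding total_error_def S_def[symmetric] sum_subtractf[symmetric]
  proof (rule sum_mono)
    fix x'
    have "l x' * (\<Psi> / real (totient (W * \<Prod>(supp (fst x') (snd x'))))) - l x' * class_sum x m (fst x') (snd x')
       = l x' * (\<Psi> / real (totient (W * \<Prod>(supp (fst x') (snd x')))) - class_sum x m (fst x') (snd x'))"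
      by (simp only: right_diff_distrib)
    also have "\<dots> \<le> \<bar>l x' * (\<Psi> / real (totient (W * \<Prod>(supp (fst x') (snd x')))) - class_sum x m (fst x') (snd x'))\<bar>" by (rule abs_ge_self)
    also have "\<dots> = \<bar>lam (fst x')\<bar> * \<bar>lam (snd x')\<bar> * class_error x m (fst x') (snd x')"
      unfolding abs_mult l_def class_error_def \<Psi>_def by (simp add: abs_minus_commute)
    finally show "l x' * (\<Psi> / real (totient (W * \<Prod>(supp (fst x') (snd x'))))) - l x' * class_sum x m (fst x') (snd x')
       \<le> \<bar>lam (fst x')\<bar> * \<bar>lam (snd x')\<bar> * class_error x m (fst x') (snd x')" .
  qed
  then show ?thesis unfolding 1 C_def[symmetric] \<Psi>_def[symmetric] 2 by linarith
qed

text \<open>The sum over primes is compared with the sum of \<open>mangoldt t\<close> over all t = n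
  + h m in the class, with the square restricted to \<open>avoiding m\<close>. At primes this square
  equals \<open>nu\<close>; at the remaining t it is bounded by V, and \<open>mangoldt\<close>
  leaves only proper prime powers there.\<close>

lemma sum_nu_prime_ge:
  fixes x V :: real and u v :: int
  assumes m: "m < k" and P_less: "\<And>p. p \<in> P \<Longrightarrow> real p < x"
    and u: "real_of_int u \<le> x - h m" and v: "2 * x - h m \<le> real_of_int v"
    and V: "\<And>t C. t \<in> dyadic x \<Longrightarrow> C \<subseteq> colourings P k \<Longrightarrow> (\<Sum>d\<in>{d \<in> C. meets (int t - h m) d}. lam d)\<^sup>2 \<le> V"
  shows "(\<Sum>n\<in>{n \<in> {u..v}. [n = b] (mod int W)}. nu n * (if prime (n + h m) \<and> nat (n + h m) \<in> dyadic x then ln (n + h m) else 0))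
     \<ge> dyadic_mangoldt x / real (totient W) * (\<Sum>d\<in>colourings P k. \<Sum>e\<in>colourings P k. lam d * lam e * (\<Prod>p\<in>P. prime_density_matrix k m (real p) (d p) (e p)))
     - total_error x m - V * dyadic_prime_powers x"
proof -
  define X where "X = {t \<in> dyadic x. [int t = b + h m] (mod int W)}"
  define num where "num t = (\<Sum>d\<in>{d \<in> avoiding m. meets (int t - h m) d}. lam d)\<^sup>2" for t :: nat
  have finX: "finite X" unfolding X_def using finite_dyadic by auto
  have "(\<Sum>t\<in>{t \<in> X. prime t}. num t * mangoldt t) = (\<Sum>t\<in>{t \<in> X. prime t}. nu (int t - h m) * ln (real t))"
  proof (rule sum.cong[OF refl])
    fix t assume t: "t \<in> {t \<in> X. prime t}"
    have "{d \<in> avoiding m. meets (int t - h m) d} = {d \<in> colourings P k. meets (int t - h m) d}"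
    proof (intro equalityI subsetI)
      fix d assume d: "d \<in> {d \<in> colourings P k. meets (int t - h m) d}"
      have "d p \<noteq> m" if p: "p \<in> P" for p
      proof
        assume "d p = m"
        then have "int p dvd (int t - h m) + h m" using d p m unfolding meets_def by auto
        then have "p dvd t" by simp
        then have "p = t" using t p prime_P by (auto dest: primes_dvd_imp_eq)
        then show False using P_less[OF p] t unfolding X_def dyadic_def by simp
      qed
      then show "d \<in> {d \<in> avoiding m. meets (int t - h m) d}" using d unfolding avoiding_def by auto
    qed (auto simp: avoiding_def)
    then show "num t * mangoldt t = nu (int t - h m) * ln (real t)"
      using t unfolding num_def nu_def by simp
  qed
  also have "\<dots> = (\<Sum>n\<in>(\<lambda>t. int t - h m) ` {t \<in> X. prime t}. nu n * (if prime (n + h m) \<and> nat (n + h m) \<in> dyadic x then ln (n + h m) else 0))"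
    by (subst sum.reindex) (auto simp: inj_on_def X_def intro!: sum.cong)
  also have "\<dots> \<le> (\<Sum>n\<in>{n \<in> {u..v}. [n = b] (mod int W)}. nu n * (if prime (n + h m) \<and> nat (n + h m) \<in> dyadic x then ln (n + h m) else 0))"
  proof (rule sum_mono2)
    show "finite {n \<in> {u..v}. [n = b] (mod int W)}" by (rule finite_subset[of _ "{u..v}"]) auto
    show "(\<lambda>t. int t - h m) ` {t \<in> X. prime t} \<subseteq> {n \<in> {u..v}. [n = b] (mod int W)}"
    proof
      fix n assume "n \<in> (\<lambda>t. int t - h m) ` {t \<in> X. prime t}"
      then obtain t where t: "n = int t - h m" "t \<in> X" by auto
      have "real_of_int u \<le> real_of_int n" "real_of_int n \<le> real_of_int v"
        using t u v unfolding X_def dyadic_def by auto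
      moreover have "[int t - h m = b + h m - h m] (mod int W)" using t unfolding X_def by (intro cong_diff) auto
      ultimately show "n \<in> {n \<in> {u..v}. [n = b] (mod int W)}" using t(1) by (simp only: of_int_le_iff) simp
    qed
    fix n
    show "0 \<le> nu n * (if prime (n + h m) \<and> nat (n + h m) \<in> dyadic x then ln (n + h m) else 0)"
    proof (cases "prime (n + h m)")
      case True
      then have "1 \<le> real_of_int (n + h m)" using prime_ge_1_int[of "n + h m"] by linarith
      then have "0 \<le> ln (real_of_int (n + h m))" by (rule ln_ge_zero)
      then show ?thesis using nu_nonneg[of n] by simp
    qed (simp add: nu_nonneg)
  qed
  finally have A: "(\<Sum>t\<in>{t \<in> X. prime t}. num t * mangoldt t) \<le> (\<Sum>n\<in>{n \<in> {u..v}. [n = b] (mod int W)}. nu n * (if prime (n + h m) \<and> nat (n + h m) \<in> dyadic x then ln (n + h m) else 0))" .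
  have split: "(\<Sum>t\<in>X. num t * mangoldt t) = (\<Sum>t\<in>{t \<in> X. prime t}. num t * mangoldt t) + (\<Sum>t\<in>{t \<in> X. \<not> prime t}. num t * mangoldt t)"
    by (subst sum.union_disjoint[symmetric]) (use finX in \<open>auto intro!: sum.cong\<close>)
  have "(\<Sum>t\<in>{t \<in> X. \<not> prime t}. num t * mangoldt t) \<le> (\<Sum>t\<in>{t \<in> X. \<not> prime t}. V * mangoldt t)"
    unfolding num_def by (intro sum_mono mult_right_mono V mangoldt_nonneg) (auto simp: X_def avoiding_def)
  also have "\<dots> \<le> (\<Sum>t\<in>{t \<in> dyadic x. \<not> prime t}. V * mangoldt t)"
  proof (cases "dyadic x = {}")
    case False
    then obtain t where "t \<in> dyadic x" by auto
    from V[OF this, of "{}"] have "V \<ge> 0" by simp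
    then show ?thesis using finite_dyadic by (intro sum_mono2) (auto simp: X_def mangoldt_nonneg)
  qed (auto simp: X_def)
  also have "\<dots> = V * dyadic_prime_powers x" unfolding dyadic_prime_powers_def by (rule sum_distrib_left[symmetric])
  finally have B: "(\<Sum>t\<in>{t \<in> X. \<not> prime t}. num t * mangoldt t) \<le> V * dyadic_prime_powers x" .
  have "(\<Sum>t\<in>X. num t * mangoldt t) = (\<Sum>d\<in>avoiding m. \<Sum>e\<in>avoiding m. lam d * lam e * class_sum x m d e)"
  proof -
    have "(\<Sum>t\<in>X. num t * mangoldt t) = (\<Sum>t\<in>X. \<Sum>d\<in>avoiding m. \<Sum>e\<in>avoiding m. lam d * lam e * of_bool (meets (int t - h m) d \<and> meets (int t - h m) e) * mangoldt t)"
    proof (rule sum.cong[OF refl])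
      fix t
      have "num t = (\<Sum>d\<in>avoiding m. \<Sum>e\<in>avoiding m. lam d * lam e * of_bool (meets (int t - h m) d \<and> meets (int t - h m) e))"
        unfolding num_def by (rule square_sum_meets) (auto simp: avoiding_def)
      then show "num t * mangoldt t = (\<Sum>d\<in>avoiding m. \<Sum>e\<in>avoiding m. lam d * lam e * of_bool (meets (int t - h m) d \<and> meets (int t - h m) e) * mangoldt t)"
        by (simp only: sum_distrib_right)
    qed
    also have "\<dots> = (\<Sum>d\<in>avoiding m. \<Sum>t\<in>X. \<Sum>e\<in>avoiding m. lam d * lam e * of_bool (meets (int t - h m) d \<and> meets (int t - h m) e) * mangoldt t)"
      by (rule sum.swap)
    also have "\<dots> = (\<Sum>d\<in>avoiding m. \<Sum>e\<in>avoiding m. \<Sum>t\<in>X. lam d * lam e * of_bool (meets (int t - h m) d \<and> meets (int t - h m) e) * mangoldt t)"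
      by (rule sum.cong[OF refl], rule sum.swap)
    also have "\<dots> = (\<Sum>d\<in>avoiding m. \<Sum>e\<in>avoiding m. lam d * lam e * class_sum x m d e)"
    proof (intro sum.cong refl)
      fix d e
      have "(\<Sum>t\<in>X. of_bool (meets (int t - h m) d \<and> meets (int t - h m) e) * mangoldt t) = class_sum x m d e"
      proof -
        have "{t \<in> dyadic x. [int t = b + h m] (mod int W) \<and> meets (int t - h m) d \<and> meets (int t - h m) e} = {t \<in> X. meets (int t - h m) d \<and> meets (int t - h m) e}"
          unfolding X_def by auto
        then show ?thesis unfolding class_sum_def by (simp only: sum.inter_filter[OF finX]) (intro sum.cong refl, simp)
      qed
      then show "(\<Sum>t\<in>X. lam d * lam e * of_bool (meets (int t - h m) d \<and> meets (int t - h m) e) * mangoldt t) = lam d * lam e * class_sum x m d e"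
        by (simp only: mult.assoc sum_distrib_left[symmetric])
    qed
    finally show ?thesis .
  qed
  then show ?thesis using A B split sum_class_sum_approx[where m = m and x = x] by linarith
qed

lemma prod_primes_dvd:
  assumes "finite A" "\<And>p. p \<in> A \<Longrightarrow> prime (p::nat)" "\<And>p. p \<in> A \<Longrightarrow> p dvd n"
  shows "\<Prod>A dvd n"
  using assms
proof (induction A rule: finite_induct)
  case (insert q A)
  have "coprime q (\<Prod>A)"
    using insert by (intro prod_coprime_right) (metis insertCI primes_coprime)
  then show ?case using insert by (simp add: divides_mult)
qed simp

text \<open>All primes in P exceed w, so w to the number of those dividing n is at most n.\<close>

lemma card_prime_divisors_le:
  fixes M :: real
  assumes "0 < n" "real_of_int n \<le> M" "M \<ge> 1"
  shows "real (card {p \<in> P. int p dvd n}) * ln w \<le> ln M"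
proof -
  define A where "A = {p \<in> P. int p dvd n}"
  have A: "finite A" "\<And>p. p \<in> A \<Longrightarrow> prime p" unfolding A_def using finite_P prime_P by auto
  have "p dvd nat n" if "p \<in> A" for p
  proof -
    have "int p dvd int (nat n)" using that assms(1) unfolding A_def by simp
    then show ?thesis by (simp only: int_dvd_int_iff)
  qed
  then have "\<Prod>A dvd nat n" using A by (intro prod_primes_dvd)
  then have "\<Prod>A \<le> nat n" using assms by (intro dvd_imp_le) auto
  moreover have "w ^ card A \<le> \<Prod>A"
    using P_gt by (subst prod_constant[symmetric]) (intro prod_mono, auto simp: A_def less_imp_le)
  ultimately have "w ^ card A \<le> nat n" by linarith
  then have "real (w ^ card A) \<le> real (nat n)" by (simp only: of_nat_le_iff)
  then have "real w ^ card A \<le> M" using assms by simp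
  then have "ln (real w ^ card A) \<le> ln M" using w_ge assms by (subst ln_le_cancel_iff) auto
  then show ?thesis using w_ge unfolding A_def by (simp add: ln_realpow)
qed

text \<open>Only colourings whose primes divide the corresponding n + h i count, so the sum factors
  over p, and a prime contributes a factor of at most 3 = 1 + 2 for each n + h i it divides. Each n
  + h i has at most ln M / ln w such primes, and 3 to this power is M powr (ln 3 / ln w), a small
  power of M once w is large.\<close>

lemma square_sum_le:
  fixes M :: real
  assumes n: "\<And>i. i < k \<Longrightarrow> 0 < n + h i \<and> real_of_int (n + h i) \<le> M" and M: "M \<ge> 1"
    and C: "C \<subseteq> colourings P k"
  shows "(\<Sum>d\<in>{d \<in> C. meets n d}. lam d)\<^sup>2 \<le> (exp 1 * Y * \<Omega> ^ (2 * k))\<^sup>2 * M powr (2 * k * ln 3 / ln w)"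
proof -
  define c where "c i = card {p \<in> P. int p dvd n + h i}" for i
  have "\<bar>\<Sum>d\<in>{d \<in> C. meets n d}. lam d\<bar> \<le> (\<Sum>d\<in>{d \<in> C. meets n d}. \<bar>lam d\<bar>)" by (rule sum_abs)
  also have "\<dots> \<le> (\<Sum>d\<in>{d \<in> colourings P k. meets n d}. \<bar>lam d\<bar>)"
    using C finite_colourings[OF finite_P] by (intro sum_mono2) auto
  also have "\<dots> \<le> (\<Sum>d\<in>{d \<in> colourings P k. meets n d}. exp 1 * Y * \<Omega> ^ (2 * k) * 2 ^ card {p \<in> P. d p < k})"
    by (intro sum_mono abs_lam_le) auto
  also have "\<dots> = exp 1 * Y * \<Omega> ^ (2 * k) * (\<Sum>d\<in>{d \<in> colourings P k. meets n d}. 2 ^ card {p \<in> P. d p < k})"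
    by (rule sum_distrib_left[symmetric])
  also have "(\<Sum>d\<in>{d \<in> colourings P k. meets n d}. 2 ^ card {p \<in> P. d p < k} :: real)
     = (\<Sum>d\<in>colourings P k. \<Prod>p\<in>P. if d p < k then (if int p dvd n + h (d p) then 2 else 0) else 1)"
  proof -
    have "(\<Prod>p\<in>P. if d p < k then (if int p dvd n + h (d p) then 2 else 0) else 1) = (if meets n d then 2 ^ card {p \<in> P. d p < k} else 0 :: real)" for d
    proof (cases "meets n d")
      case True
      then have "(\<Prod>p\<in>P. if d p < k then (if int p dvd n + h (d p) then 2 else 0) else 1 :: real) = (\<Prod>p\<in>P. if d p < k then 2 else 1)"
        by (intro prod.cong refl) (auto simp: meets_def)
      then show ?thesis using True by (simp add: prod.inter_filter[OF finite_P, symmetric])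
    next
      case False
      then obtain p where "p \<in> P" "d p < k" "\<not> int p dvd n + h (d p)" unfolding meets_def by auto
      then have "(\<Prod>p\<in>P. if d p < k then (if int p dvd n + h (d p) then 2 else 0) else 1 :: real) = 0"
        using finite_P by (intro prod_zero bexI[of _ p]) auto
      then show ?thesis using False by simp
    qed
    then show ?thesis using finite_colourings[OF finite_P] by (simp add: sum.inter_filter)
  qed
  also have "\<dots> = (\<Prod>p\<in>P. \<Sum>a\<le>k. if a < k then (if int p dvd n + h a then 2 else 0) else 1)"
    by (rule prod_sum_PiE[symmetric]) (auto simp: finite_P)
  also have "\<dots> \<le> (\<Prod>p\<in>P. \<Prod>i<k. if int p dvd n + h i then 3 else 1)"
  proof (intro prod_mono conjI sum_nonneg)
    fix p assume p: "p \<in> P"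
    have "(\<Sum>a\<le>k. if a < k then (if int p dvd n + h a then 2 else 0) else 1 :: real) = (\<Sum>a<k. if int p dvd n + h a then 2 else 0) + 1"
      by (simp add: lessThan_Suc_atMost[symmetric])
    also have "\<dots> \<le> (\<Prod>i<k. if int p dvd n + h i then 3 else 1)"
    proof (induction k)
      case (Suc k)
      have "0 \<le> (\<Sum>a<k. if int p dvd n + h a then 2 else 0 :: real)" by (intro sum_nonneg) auto
      then show ?case using Suc by (auto simp: algebra_simps)
    qed simp
    finally show "(\<Sum>a\<le>k. if a < k then (if int p dvd n + h a then 2 else 0) else 1) \<le> (\<Prod>i<k. if int p dvd n + h i then 3 else 1 :: real)" .
  qed auto
  also have "\<dots> = (\<Prod>i<k. \<Prod>p\<in>P. if int p dvd n + h i then 3 else 1)" by (rule prod.swap)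
  also have "\<dots> = (\<Prod>i<k. 3 ^ c i)"
    unfolding c_def by (intro prod.cong refl) (simp add: prod.inter_filter[OF finite_P, symmetric])
  also have "\<dots> \<le> (\<Prod>i<k. M powr (ln 3 / ln w))"
  proof (intro prod_mono conjI)
    fix i assume i: "i \<in> {..<k}"
    have lnw: "ln (real w) > 0" using w_ge by simp
    have "real (c i) * ln w \<le> ln M" unfolding c_def using n i M by (intro card_prime_divisors_le) auto
    then have "real (c i) \<le> ln M / ln w" using lnw by (simp add: field_simps)
    then have "(3::real) powr real (c i) \<le> 3 powr (ln M / ln w)" by (intro powr_mono) auto
    also have "\<dots> = M powr (ln 3 / ln w)" using M by (simp add: powr_def mult.commute)
    finally show "(3::real) ^ c i \<le> M powr (ln 3 / ln w)" by (simp add: powr_realpow)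
  qed auto
  also have "\<dots> = M powr (k * ln 3 / ln w)" using M by (simp add: powr_power)
  finally have le: "\<bar>\<Sum>d\<in>{d \<in> C. meets n d}. lam d\<bar> \<le> exp 1 * Y * \<Omega> ^ (2 * k) * M powr (k * ln 3 / ln w)"
    using Y_nonneg \<Omega>_ge1 by (simp add: mult_left_mono)
  have "(\<Sum>d\<in>{d \<in> C. meets n d}. lam d)\<^sup>2 = \<bar>\<Sum>d\<in>{d \<in> C. meets n d}. lam d\<bar>\<^sup>2" by simp
  also have "\<dots> \<le> (exp 1 * Y * \<Omega> ^ (2 * k) * M powr (k * ln 3 / ln w))\<^sup>2" by (rule power_mono[OF le]) simp
  also have "\<dots> = (exp 1 * Y * \<Omega> ^ (2 * k))\<^sup>2 * M powr (2 * k * ln 3 / ln w)"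
    using M by (simp add: power_mult_distrib powr_power mult.assoc)
  finally show ?thesis .
qed

end

lemma cong_prod_primes_iff:
  fixes A :: "nat set"
  assumes "finite A" "\<And>p. p \<in> A \<Longrightarrow> prime p"
  shows "[n = a] (mod int (\<Prod>A)) \<longleftrightarrow> (\<forall>p\<in>A. [n = a] (mod int p))"
proof -
  obtain c where c: "\<And>n. (\<forall>p\<in>A. [n = a] (mod int p)) \<longleftrightarrow> [n = c] (mod int (\<Prod>A))"
    using chinese_remainder_primes[of A "\<lambda>_. a"] assms by blast
  have "[a = c] (mod int (\<Prod>A))" using c[of a] by simp
  then show ?thesis using c[of n] by (meson cong_sym cong_trans)
qed

lemma infsum_finite_support:
  fixes f :: "nat \<Rightarrow> real"
  assumes "finite F" "\<And>n. n \<in> S \<Longrightarrow> n \<notin> F \<Longrightarrow> f n = 0"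
  shows "(\<Sum>\<^sub>\<infinity>n\<in>S. f n) = (\<Sum>n\<in>{n \<in> F. n \<in> S}. f n)"
proof -
  have "(\<Sum>\<^sub>\<infinity>n\<in>S. f n) = (\<Sum>\<^sub>\<infinity>n\<in>{n \<in> F. n \<in> S}. f n)"
    using assms(2) by (intro infsum_cong_neutral) auto
  then show ?thesis using assms(1) by simp
qed

lemma discrepancy_dyadic:
  "discrepancy (\<lambda>n. mangoldt n * indicator {x..2 * x} (real n)) a q
    = (\<Sum>t\<in>{t \<in> dyadic x. [int t = a] (mod int q)}. mangoldt t)
      - 1 / real (totient q) * (\<Sum>t\<in>{t \<in> dyadic x. coprime t q}. mangoldt t)"
proof -
  have zero: "mangoldt n * indicator {x..2 * x} (real n) = (0::real)" if "n \<notin> dyadic x" for n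
    using that by (auto simp: dyadic_def)
  have one: "mangoldt n * indicator {x..2 * x} (real n) = (mangoldt n :: real)" if "n \<in> dyadic x" for n
    using that by (auto simp: dyadic_def)
  show ?thesis unfolding discrepancy_def
    using infsum_finite_support[OF finite_dyadic[of x], of "{n. [int n = a] (mod int q)}" "\<lambda>n. mangoldt n * indicator {x..2 * x} (real n)"]
      infsum_finite_support[OF finite_dyadic[of x], of "{n. coprime n q}" "\<lambda>n. mangoldt n * indicator {x..2 * x} (real n)"]
    by (simp add: zero one)
qed

section \<open>Reduction of the error terms to one residue class\<close>

context tuple_sieve
begin

definition follows :: "(nat \<Rightarrow> nat) \<Rightarrow> (nat \<Rightarrow> nat) \<Rightarrow> (nat \<Rightarrow> nat) \<Rightarrow> bool" where
  "follows X d e \<longleftrightarrow> (\<forall>p\<in>P. d p \<in> {k, X p} \<and> e p \<in> {k, X p})"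

text \<open>The residue class of \<open>n + h m\<close> modulo the primes dividing the moduli depends on the colours of
  these primes. A colouring \<open>X\<close> of all primes chosen at random agrees with a given pair of moduli
  with probability \<open>(k - 1)\<close> to the minus number of primes involved, so some \<open>X\<close> captures at least
  its fair share; this leaves a single residue class for all moduli.\<close>
lemma exists_dominating_colouring:
  fixes g :: "(nat \<Rightarrow> nat) \<times> (nat \<Rightarrow> nat) \<Rightarrow> real"
  assumes m: "m < k" and k: "k \<ge> 2"
  defines "S \<equiv> {x \<in> avoiding m \<times> avoiding m. compatible (fst x) (snd x)}"
  shows "\<exists>X\<in>PiE P (\<lambda>_. {..<k} - {m}).
    (\<Sum>x\<in>S. g x) \<le> (\<Sum>x\<in>{x \<in> S. follows X (fst x) (snd x)}. real (k - 1) ^ card (supp (fst x) (snd x)) * g x)"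
proof (rule ccontr)
  define T where "T = PiE P (\<lambda>_. {..<k} - {m})"
  define wt where "wt x = real (k - 1) ^ card (supp (fst x) (snd x))" for x
  assume "\<not> ?thesis"
  then have less: "(\<Sum>x\<in>{x \<in> S. follows X (fst x) (snd x)}. wt x * g x) < (\<Sum>x\<in>S. g x)" if "X \<in> T" for X
    using that unfolding T_def wt_def by fastforce
  have finT: "finite T" unfolding T_def using finite_P by (intro finite_PiE) auto
  have finS: "finite S" unfolding S_def using finite_avoiding by auto
  have cardc: "card ({..<k} - {m}) = k - 1" using m by simp
  have cardT: "card T = (k - 1) ^ card P" unfolding T_def using finite_P cardc by (simp add: card_PiE)
  \<comment> \<open>The primes of \<open>supp\<close> are forced to their colour, and each of the
    others has k - 1 choices.\<close>
  have count: "real (card {X \<in> T. follows X (fst x) (snd x)}) * wt x = real (card T)" if x: "x \<in> S" for x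
  proof -
    define d e where "d = fst x" and "e = snd x"
    have de: "d \<in> avoiding m" "e \<in> avoiding m" "compatible d e" using x unfolding S_def d_def e_def by auto
    define col where "col p = (if d p < k then d p else e p)" for p
    have dk: "d p \<le> k" "e p \<le> k" "d p \<noteq> m" "e p \<noteq> m" if "p \<in> P" for p
      using de that unfolding avoiding_def by auto
    have "{X \<in> T. follows X d e} = PiE P (\<lambda>p. if p \<in> supp d e then {col p} else {..<k} - {m})"
    proof (rule Set.set_eqI)
      fix X
      have "(X p \<in> {..<k} - {m} \<and> d p \<in> {k, X p} \<and> e p \<in> {k, X p}) \<longleftrightarrow> X p \<in> (if p \<in> supp d e then {col p} else {..<k} - {m})"
        if p: "p \<in> P" for p
      proof (cases "p \<in> supp d e")
        case True
        then have "d p < k \<or> e p < k" unfolding supp_def by auto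
        moreover have "d p < k \<Longrightarrow> e p < k \<Longrightarrow> d p = e p" using de(3) p unfolding compatible_def by auto
        ultimately show ?thesis using dk[OF p] True unfolding col_def by (cases "d p = k"; cases "e p = k") auto
      next
        case False
        then have "d p = k" "e p = k" using dk[OF p] p unfolding supp_def by auto
        then show ?thesis using False by simp
      qed
      note E = this
      have "X \<in> {X \<in> T. follows X d e} \<longleftrightarrow> X \<in> extensional P \<and> (\<forall>p\<in>P. X p \<in> {..<k} - {m} \<and> d p \<in> {k, X p} \<and> e p \<in> {k, X p})"
        unfolding T_def follows_def by (simp only: PiE_iff mem_Collect_eq) blast
      also have "\<dots> \<longleftrightarrow> X \<in> extensional P \<and> (\<forall>p\<in>P. X p \<in> (if p \<in> supp d e then {col p} else {..<k} - {m}))"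
        by (rule arg_cong[where f = "\<lambda>b. X \<in> extensional P \<and> b"], rule ball_cong[OF refl E])
      finally show "X \<in> {X \<in> T. follows X d e} \<longleftrightarrow> X \<in> PiE P (\<lambda>p. if p \<in> supp d e then {col p} else {..<k} - {m})"
        by (simp only: PiE_iff) blast
    qed
    then have "card {X \<in> T. follows X d e} = (\<Prod>p\<in>P. card (if p \<in> supp d e then {col p} else {..<k} - {m}))"
      using finite_P by (simp add: card_PiE)
    also have "\<dots> = (\<Prod>p\<in>P. if p \<in> P - supp d e then k - 1 else 1)"
      using cardc by (intro prod.cong refl) auto
    also have "\<dots> = (k - 1) ^ card {p \<in> P. p \<in> P - supp d e}"
      by (subst prod.inter_filter[OF finite_P, symmetric]) simp
    also have "{p \<in> P. p \<in> P - supp d e} = P - supp d e" by auto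
    also have "card (P - supp d e) = card P - card (supp d e)" using supp_sub finite_supp by (simp add: card_Diff_subset)
    finally have "card {X \<in> T. follows X d e} * (k - 1) ^ card (supp d e) = (k - 1) ^ card P"
      using card_mono[OF finite_P supp_sub[of d e]] by (simp add: power_add[symmetric])
    then have "real (card {X \<in> T. follows X d e} * (k - 1) ^ card (supp d e)) = real (card T)" using cardT by simp
    then show ?thesis unfolding wt_def d_def e_def by simp
  qed
  have "T \<noteq> {}"
  proof -
    have "card T > 0" using cardT k by simp
    then show ?thesis by auto
  qed
  \<comment> \<open>Summed over all X, every pair is counted with exactly its fair share, so a
    strict deficit for each X is impossible.\<close>
  have "(\<Sum>X\<in>T. \<Sum>x\<in>{x \<in> S. follows X (fst x) (snd x)}. wt x * g x) < (\<Sum>X\<in>T. \<Sum>x\<in>S. g x)"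
    using finT \<open>T \<noteq> {}\<close> less by (intro sum_strict_mono) auto
  moreover have "(\<Sum>X\<in>T. \<Sum>x\<in>{x \<in> S. follows X (fst x) (snd x)}. wt x * g x) = (\<Sum>x\<in>S. \<Sum>X\<in>{X \<in> T. follows X (fst x) (snd x)}. wt x * g x)"
    by (rule sum.swap_restrict[OF finT finS])
  moreover have "\<dots> = (\<Sum>x\<in>S. real (card T) * g x)"
  proof (rule sum.cong[OF refl])
    fix x assume "x \<in> S"
    from count[OF this] show "(\<Sum>X\<in>{X \<in> T. follows X (fst x) (snd x)}. wt x * g x) = real (card T) * g x"
      by (simp add: mult.assoc[symmetric])
  qed
  ultimately show False by (simp add: sum_distrib_left)
qed

text \<open>Here n stands for the shifted variable; at p in P the class is given by p dividing n - h
  m + h (X p). It is invertible because X p \<noteq> m and the shifts are distinct mod p; at p in B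
  it is invertible by the choice of b. So a is a primitive class, as \<open>MPZ\<close>
  requires.\<close>

lemma common_residue:
  assumes m: "m < k" and X: "X \<in> PiE P (\<lambda>_. {..<k} - {m})" and b: "\<And>p. p \<in> B \<Longrightarrow> \<not> int p dvd b + h m"
  shows "\<exists>a. (\<forall>p\<in>B \<union> P. \<not> int p dvd a) \<and>
    (\<forall>d e. d \<in> colourings P k \<longrightarrow> e \<in> colourings P k \<longrightarrow> follows X d e \<longrightarrow>
      (\<forall>n. ([n = b + h m] (mod int W) \<and> meets (n - h m) d \<and> meets (n - h m) e) \<longleftrightarrow> [n = a] (mod int (W * \<Prod>(supp d e)))))"
proof -
  define f where "f p = (if p \<in> P then h m - h (X p) else b + h m)" for p
  have fin: "finite (B \<union> P)" and pr: "\<And>p. p \<in> B \<union> P \<Longrightarrow> prime p" using finite_B finite_P prime_B prime_P by auto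
  obtain a where a: "\<And>n. (\<forall>p\<in>B \<union> P. [n = f p] (mod int p)) \<longleftrightarrow> [n = a] (mod int (\<Prod>(B \<union> P)))"
    using chinese_remainder_primes[OF fin pr, of f] by blast
  have af: "[a = f p] (mod int p)" if "p \<in> B \<union> P" for p using a[of a] that by simp
  have "\<not> int p dvd a" if p: "p \<in> B \<union> P" for p
  proof -
    have "\<not> int p dvd f p"
    proof (cases "p \<in> P")
      case True
      then have "X p < k" "X p \<noteq> m" using X by auto
      then have "\<not> [h m = h (X p)] (mod int p)" using shift_distinct[OF True m] by auto
      then show ?thesis using True by (simp add: f_def cong_iff_dvd_diff)
    next
      case False
      then show ?thesis using b p by (simp add: f_def)
    qed
    then show ?thesis using cong_dvd_iff[OF af[OF p]] by blast
  qed
  moreover have "([n = b + h m] (mod int W) \<and> meets (n - h m) d \<and> meets (n - h m) e) \<longleftrightarrow> [n = a] (mod int (W * \<Prod>(supp d e)))"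
    if d: "d \<in> colourings P k" and e: "e \<in> colourings P k" and fl: "follows X d e" for d e n
  proof -
    have comp: "compatible d e" using fl unfolding follows_def compatible_def by auto
    have "meets (n - h m) d \<and> meets (n - h m) e \<longleftrightarrow> (\<forall>p\<in>supp d e. [n - h m = - h (if d p < k then d p else e p)] (mod int p))"
      by (rule meets_pair_iff[OF d e comp])
    also have "\<dots> \<longleftrightarrow> (\<forall>p\<in>supp d e. [n = f p] (mod int p))"
    proof (rule ball_cong[OF refl])
      fix p assume p: "p \<in> supp d e"
      then have pP: "p \<in> P" and "d p < k \<or> e p < k" unfolding supp_def by auto
      then have "(if d p < k then d p else e p) = X p" using fl unfolding follows_def by force
      then show "[n - h m = - h (if d p < k then d p else e p)] (mod int p) \<longleftrightarrow> [n = f p] (mod int p)"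
        using pP by (simp add: f_def cong_iff_dvd_diff algebra_simps)
    qed
    also have "\<dots> \<longleftrightarrow> (\<forall>p\<in>supp d e. [n = a] (mod int p))"
      using af supp_sub by (meson UnCI cong_sym cong_trans subsetD)
    finally have 1: "meets (n - h m) d \<and> meets (n - h m) e \<longleftrightarrow> (\<forall>p\<in>supp d e. [n = a] (mod int p))" .
    have "[n = b + h m] (mod int W) \<longleftrightarrow> (\<forall>p\<in>B. [n = b + h m] (mod int p))"
      unfolding W_def by (rule cong_prod_primes_iff[OF finite_B prime_B])
    also have "\<dots> \<longleftrightarrow> (\<forall>p\<in>B. [n = f p] (mod int p))"
      using B_disjoint by (intro ball_cong refl) (auto simp: f_def)
    also have "\<dots> \<longleftrightarrow> (\<forall>p\<in>B. [n = a] (mod int p))"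
      using af by (meson UnCI cong_sym cong_trans)
    finally have "([n = b + h m] (mod int W) \<and> meets (n - h m) d \<and> meets (n - h m) e) \<longleftrightarrow> (\<forall>p\<in>B \<union> supp d e. [n = a] (mod int p))"
      using 1 by blast
    also have "\<dots> \<longleftrightarrow> [n = a] (mod int (W * \<Prod>(supp d e)))"
      unfolding W_supp[OF supp_sub]
    proof (rule cong_prod_primes_iff[symmetric])
      show "prime p" if "p \<in> B \<union> supp d e" for p using that prime_B prime_P supp_sub by blast
    qed (use finite_B finite_supp in auto)
    finally show ?thesis .
  qed
  ultimately show ?thesis by blast
qed

text \<open>\<open>discrepancy\<close> compares with the t coprime to the modulus, while
  \<open>dyadic_mangoldt\<close> counts all t. The difference is carried by proper prime powers,
  since the primes of the moduli lie below x; it is bounded by the second summand.\<close>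

definition modulus_error :: "real \<Rightarrow> int \<Rightarrow> nat set \<Rightarrow> real" where
  "modulus_error x a A = \<bar>discrepancy (\<lambda>n. mangoldt n * indicator {x..2 * x} (real n)) a (W * \<Prod>A)\<bar>
     + dyadic_prime_powers x / real (totient (W * \<Prod>A))"

lemma dyadic_prime_powers_nonneg: "0 \<le> dyadic_prime_powers x"
  unfolding dyadic_prime_powers_def by (intro sum_nonneg mangoldt_nonneg)

lemma modulus_error_nonneg: "0 \<le> modulus_error x a A"
  unfolding modulus_error_def using dyadic_prime_powers_nonneg by auto

lemma class_error_le:
  assumes less: "\<And>p. p \<in> B \<union> P \<Longrightarrow> real p < x"
    and a: "\<And>n. ([n = b + h m] (mod int W) \<and> meets (n - h m) d \<and> meets (n - h m) e) \<longleftrightarrow> [n = a] (mod int (W * \<Prod>(supp d e)))"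
  shows "class_error x m d e \<le> modulus_error x a (supp d e)"
proof -
  define q where "q = W * \<Prod>(supp d e)"
  define \<Psi>q where "\<Psi>q = (\<Sum>t\<in>{t \<in> dyadic x. coprime t q}. mangoldt t :: real)"
  have cls: "class_sum x m d e = (\<Sum>t\<in>{t \<in> dyadic x. [int t = a] (mod int q)}. mangoldt t)"
    unfolding class_sum_def a q_def ..
  have split: "dyadic_mangoldt x = \<Psi>q + (\<Sum>t\<in>{t \<in> dyadic x. \<not> coprime t q}. mangoldt t)"
    unfolding dyadic_mangoldt_def \<Psi>q_def
    by (subst sum.union_disjoint[symmetric]) (use finite_dyadic in \<open>auto intro!: sum.cong\<close>)
  have "(\<Sum>t\<in>{t \<in> dyadic x. \<not> coprime t q}. mangoldt t) \<le> dyadic_prime_powers x"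
    unfolding dyadic_prime_powers_def
  proof (rule sum_mono2)
    show "{t \<in> dyadic x. \<not> coprime t q} \<subseteq> {t \<in> dyadic x. \<not> prime t}"
    proof
      fix t assume t: "t \<in> {t \<in> dyadic x. \<not> coprime t q}"
      have "\<not> prime t"
      proof
        assume pt: "prime t"
        then have "t dvd q" using t prime_imp_coprime by blast
        then have "t dvd \<Prod>(B \<union> supp d e)" unfolding q_def W_supp[OF supp_sub] .
        then have "t \<in> B \<union> supp d e"
          using prime_dvd_prod_primes_iff[of "B \<union> supp d e" t] finite_B finite_supp prime_B prime_P supp_sub pt by blast
        then have "real t < x" using less supp_sub by blast
        then show False using t unfolding dyadic_def by simp
      qed
      then show "t \<in> {t \<in> dyadic x. \<not> prime t}" using t by simp
    qed
  qed (use finite_dyadic mangoldt_nonneg in auto)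
  then have d: "0 \<le> dyadic_mangoldt x - \<Psi>q" "dyadic_mangoldt x - \<Psi>q \<le> dyadic_prime_powers x"
    using split by (auto simp: sum_nonneg mangoldt_nonneg)
  have "class_sum x m d e - dyadic_mangoldt x / real (totient q)
     = discrepancy (\<lambda>n. mangoldt n * indicator {x..2 * x} (real n)) a q - (dyadic_mangoldt x - \<Psi>q) / real (totient q)"
    unfolding discrepancy_dyadic cls \<Psi>q_def by (simp add: diff_divide_distrib)
  also have "\<bar>\<dots>\<bar> \<le> \<bar>discrepancy (\<lambda>n. mangoldt n * indicator {x..2 * x} (real n)) a q\<bar> + \<bar>(dyadic_mangoldt x - \<Psi>q) / real (totient q)\<bar>"
    by (rule abs_triangle_ineq4)
  also have "\<bar>(dyadic_mangoldt x - \<Psi>q) / real (totient q)\<bar> \<le> dyadic_prime_powers x / real (totient q)"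
    using d by (simp add: divide_right_mono)
  finally show ?thesis unfolding class_error_def modulus_error_def q_def by simp
qed

lemma prod_supp_le: "real (\<Prod>(supp d e)) \<le> modulus d * modulus e"
proof -
  define U V where "U = {p \<in> P. d p < k}" and "V = {p \<in> P. e p < k}"
  have fin: "finite U" "finite V" unfolding U_def V_def using finite_P by auto
  have eq: "supp d e = U \<union> (V - U)" unfolding supp_def U_def V_def by auto
  have "real (\<Prod>(supp d e)) = (\<Prod>p\<in>U. real p) * (\<Prod>p\<in>V - U. real p)"
    unfolding eq of_nat_prod using fin by (subst prod.union_disjoint) auto
  also have "\<dots> \<le> (\<Prod>p\<in>U. real p) * (\<Prod>p\<in>V. real p)"
  proof (intro mult_left_mono prod_mono2 prod_nonneg)
    show "1 \<le> real p" if "p \<in> V - (V - U)" for p using that P_ge3[of p] unfolding V_def by auto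
  qed (use fin in auto)
  finally show ?thesis unfolding U_def V_def modulus_def .
qed

lemma card_supp_pair: 
  "card {p \<in> P. d p < k} + card {p \<in> P. e p < k} \<le> 2 * card (supp d e)"
proof -
  have "card {p \<in> P. d p < k} \<le> card (supp d e)" "card {p \<in> P. e p < k} \<le> card (supp d e)"
    using finite_supp by (intro card_mono; auto simp: supp_def)+
  then show ?thesis by simp
qed

text \<open>The factor 16 * (k - 1) per prime is composed of k - 1 from the random colouring, 4 from
  the powers of 2 bounding the two values of \<open>lam\<close>, and 4 for the pairs (d, e) that
  follow X and have support A: at each p in A both d and e are either blank or X p.\<close>

lemma total_error_le:
  assumes m: "m < k" and k: "k \<ge> 2" and less: "\<And>p. p \<in> B \<union> P \<Longrightarrow> real p < x"
    and b: "\<And>p. p \<in> B \<Longrightarrow> \<not> int p dvd b + h m"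
  shows "\<exists>a. (\<forall>p\<in>B \<union> P. \<not> int p dvd a) \<and>
    total_error x m \<le> (exp 1 * Y * \<Omega> ^ (2 * k))\<^sup>2 *
      (\<Sum>A\<in>{A \<in> Pow P. real (\<Prod>A) \<le> R\<^sup>2}. real (16 * (k - 1)) ^ card A * modulus_error x a A)"
proof -
  define S where "S = {x \<in> avoiding m \<times> avoiding m. compatible (fst x) (snd x)}"
  define sp where "sp x = supp (fst x) (snd x)" for x
  define g where "g x' = \<bar>lam (fst x')\<bar> * \<bar>lam (snd x')\<bar> * class_error x m (fst x') (snd x')" for x'
  define K1 where "K1 = (exp 1 * Y * \<Omega> ^ (2 * k))\<^sup>2"
  obtain X where X: "X \<in> PiE P (\<lambda>_. {..<k} - {m})"
    and dom: "(\<Sum>x\<in>S. g x) \<le> (\<Sum>x\<in>{x \<in> S. follows X (fst x) (snd x)}. real (k - 1) ^ card (supp (fst x) (snd x)) * g x)"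
    using exists_dominating_colouring[OF m k, of g] unfolding S_def by blast
  obtain a where A: "(\<forall>p\<in>B \<union> P. \<not> int p dvd a) \<and>
    (\<forall>d e. d \<in> colourings P k \<longrightarrow> e \<in> colourings P k \<longrightarrow> follows X d e \<longrightarrow>
      (\<forall>n. ([n = b + h m] (mod int W) \<and> meets (n - h m) d \<and> meets (n - h m) e) \<longleftrightarrow> [n = a] (mod int (W * \<Prod>(supp d e)))))"
    using common_residue[OF m X b] by (rule exE)
  note a1 = conjunct1[OF A] and a2 = conjunct2[OF A, rule_format]
  define F where "F = {x \<in> S. follows X (fst x) (snd x)}"
  define F' where "F' = {x \<in> F. real (\<Prod>(sp x)) \<le> R\<^sup>2}"
  define AA where "AA = {A \<in> Pow P. real (\<Prod>A) \<le> R\<^sup>2}"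
  have finF: "finite F" unfolding F_def S_def using finite_avoiding by auto
  have finAA: "finite AA" unfolding AA_def using finite_P by auto
  have Sc: "fst x \<in> colourings P k" "snd x \<in> colourings P k" if "x \<in> S" for x
    using that unfolding S_def avoiding_def by auto
  have R1: "R \<ge> 0" using R_gt by simp
  \<comment> \<open>Both moduli are at most R where \<open>lam\<close> is nonzero, which bounds
    their least common multiple by R^2.\<close>
  have zero: "g x = 0" if "x \<in> F - F'" for x
  proof (rule ccontr)
    assume "g x \<noteq> 0"
    then have "lam (fst x) \<noteq> 0" "lam (snd x) \<noteq> 0" unfolding g_def by auto
    moreover have "x \<in> S" using that unfolding F_def by auto
    ultimately have "modulus (fst x) \<le> R" "modulus (snd x) \<le> R" using lam_support Sc by auto
    then have "modulus (fst x) * modulus (snd x) \<le> R * R" using modulus_pos R1 by (intro mult_mono) (auto intro: less_imp_le)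
    then have "real (\<Prod>(sp x)) \<le> R\<^sup>2" unfolding sp_def power2_eq_square using prod_supp_le order_trans by blast
    then show False using that unfolding F'_def by auto
  qed
  have gle: "g x' \<le> K1 * (4 ^ card (sp x') * modulus_error x a (sp x'))" if x': "x' \<in> F" for x'
  proof -
    define d e where "d = fst x'" and "e = snd x'"
    have de: "d \<in> colourings P k" "e \<in> colourings P k" "follows X d e" using x' Sc unfolding F_def d_def e_def by auto
    have ce: "class_error x m d e \<le> modulus_error x a (supp d e)"
      by (rule class_error_le[OF less a2[OF de]])
    have "\<bar>lam d\<bar> * \<bar>lam e\<bar> \<le> (exp 1 * Y * \<Omega> ^ (2 * k) * 2 ^ card {p \<in> P. d p < k}) * (exp 1 * Y * \<Omega> ^ (2 * k) * 2 ^ card {p \<in> P. e p < k})"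
      using abs_lam_le[OF de(1)] abs_lam_le[OF de(2)] by (intro mult_mono) (auto intro: order_trans[OF abs_ge_zero])
    also have "\<dots> = K1 * 2 ^ (card {p \<in> P. d p < k} + card {p \<in> P. e p < k})"
      unfolding K1_def by (simp add: power2_eq_square power_add mult_ac)
    also have "\<dots> \<le> K1 * 2 ^ (2 * card (supp d e))"
      using card_supp_pair unfolding K1_def by (intro mult_left_mono power_increasing) auto
    also have "\<dots> = K1 * 4 ^ card (supp d e)" by (simp add: power_mult)
    finally have l: "\<bar>lam d\<bar> * \<bar>lam e\<bar> \<le> K1 * 4 ^ card (supp d e)" .
    have "g x' \<le> (K1 * 4 ^ card (supp d e)) * modulus_error x a (supp d e)"
      unfolding g_def d_def[symmetric] e_def[symmetric]
      by (rule mult_mono[OF l ce]) (auto simp: class_error_def K1_def)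
    then show ?thesis unfolding sp_def d_def e_def by (simp add: mult.assoc)
  qed
  have "total_error x m = (\<Sum>x\<in>S. g x)" unfolding total_error_def S_def g_def ..
  also have "\<dots> \<le> (\<Sum>x\<in>F. real (k - 1) ^ card (sp x) * g x)" using dom unfolding F_def sp_def .
  also have "\<dots> = (\<Sum>x\<in>F'. real (k - 1) ^ card (sp x) * g x)"
    using finF zero by (intro sum.mono_neutral_right) (auto simp: F'_def)
  also have "\<dots> \<le> (\<Sum>x'\<in>F'. K1 * (real (4 * (k - 1)) ^ card (sp x') * modulus_error x a (sp x')))"
  proof (rule sum_mono)
    fix x' assume "x' \<in> F'"
    then have "g x' \<le> K1 * (4 ^ card (sp x') * modulus_error x a (sp x'))" using gle unfolding F'_def by auto
    then have "real (k - 1) ^ card (sp x') * g x' \<le> real (k - 1) ^ card (sp x') * (K1 * (4 ^ card (sp x') * modulus_error x a (sp x')))"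
      by (intro mult_left_mono) auto
    also have "\<dots> = K1 * (real (4 * (k - 1)) ^ card (sp x') * modulus_error x a (sp x'))"
      by (simp add: power_mult_distrib)
    finally show "real (k - 1) ^ card (sp x') * g x' \<le> K1 * (real (4 * (k - 1)) ^ card (sp x') * modulus_error x a (sp x'))" .
  qed
  also have "\<dots> = K1 * (\<Sum>x'\<in>F'. real (4 * (k - 1)) ^ card (sp x') * modulus_error x a (sp x'))" by (rule sum_distrib_left[symmetric])
  also have "(\<Sum>x'\<in>F'. real (4 * (k - 1)) ^ card (sp x') * modulus_error x a (sp x'))
     = (\<Sum>A\<in>AA. \<Sum>x'\<in>{x' \<in> F'. sp x' = A}. real (4 * (k - 1)) ^ card (sp x') * modulus_error x a (sp x'))"
  proof (rule sum.group[symmetric])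
    show "finite F'" unfolding F'_def using finF by auto
    show "sp ` F' \<subseteq> AA" unfolding F'_def AA_def sp_def using supp_sub by auto
  qed (rule finAA)
  also have "\<dots> \<le> (\<Sum>A\<in>AA. real (16 * (k - 1)) ^ card A * modulus_error x a A)"
  proof (rule sum_mono)
    fix A assume A: "A \<in> AA"
    define E where "E = PiE P (\<lambda>p. if p \<in> A then {k, X p} else {k})"
    have AP: "A \<subseteq> P" using A unfolding AA_def by auto
    have finE: "finite E" unfolding E_def using finite_P by (intro finite_PiE) auto
    have cardE: "card E \<le> 2 ^ card A"
    proof -
      have "card E = (\<Prod>p\<in>P. card (if p \<in> A then {k, X p} else {k}))" unfolding E_def using finite_P by (simp add: card_PiE)
      also have "\<dots> \<le> (\<Prod>p\<in>P. if p \<in> A then 2 else 1)"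
        by (intro prod_mono conjI) (auto simp: card_insert_if)
      also have "\<dots> = 2 ^ card A"
        using AP by (subst prod.inter_filter[OF finite_P, symmetric]) (simp add: Int_absorb1 Collect_conj_eq Int_def[symmetric] inf.absorb2)
      finally show ?thesis .
    qed
    have sub: "{x' \<in> F'. sp x' = A} \<subseteq> E \<times> E"
    proof
      fix x' assume x': "x' \<in> {x' \<in> F'. sp x' = A}"
      then have xS: "x' \<in> S" and fl: "follows X (fst x') (snd x')" and s: "supp (fst x') (snd x') = A" unfolding F'_def F_def sp_def by auto
      have mem: "v \<in> E" if v: "v \<in> colourings P k" "\<And>p. p \<in> P \<Longrightarrow> v p \<in> {k, X p}" "\<And>p. p \<in> P \<Longrightarrow> v p < k \<Longrightarrow> p \<in> A" for v
        unfolding E_def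
      proof (rule PiE_I)
        fix p assume p: "p \<in> P"
        have "v p \<le> k" using v(1) p by auto
        then show "v p \<in> (if p \<in> A then {k, X p} else {k})" using v(2,3)[OF p] by (cases "v p = k") auto
      qed (use v(1) in auto)
      have "fst x' \<in> E" by (rule mem[OF Sc(1)[OF xS]]) (use fl s in \<open>auto simp: follows_def supp_def\<close>)
      moreover have "snd x' \<in> E" by (rule mem[OF Sc(2)[OF xS]]) (use fl s in \<open>auto simp: follows_def supp_def\<close>)
      ultimately show "x' \<in> E \<times> E" by (simp add: mem_Times_iff)
    qed
    have "card {x' \<in> F'. sp x' = A} \<le> card (E \<times> E)" using sub finE by (intro card_mono) auto
    also have "\<dots> \<le> 2 ^ card A * 2 ^ card A" unfolding card_cartesian_product using cardE by (intro mult_mono) auto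
    also have "\<dots> = 4 ^ card A" by (simp add: power_mult_distrib[symmetric])
    finally have "card {x' \<in> F'. sp x' = A} \<le> 4 ^ card A" .
    then have "real (card {x' \<in> F'. sp x' = A}) \<le> real (4 ^ card A)" by (simp only: of_nat_le_iff)
    then have c4: "real (card {x' \<in> F'. sp x' = A}) \<le> 4 ^ card A" by simp
    have "(\<Sum>x'\<in>{x' \<in> F'. sp x' = A}. real (4 * (k - 1)) ^ card (sp x') * modulus_error x a (sp x'))
       = real (card {x' \<in> F'. sp x' = A}) * (real (4 * (k - 1)) ^ card A * modulus_error x a A)" by simp
    also have "\<dots> \<le> 4 ^ card A * (real (4 * (k - 1)) ^ card A * modulus_error x a A)"
      using c4 modulus_error_nonneg by (intro mult_right_mono mult_nonneg_nonneg) auto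
    also have "\<dots> = real (16 * (k - 1)) ^ card A * modulus_error x a A"
    proof -
      have "4 ^ card A * real (4 * (k - 1)) ^ card A = (4 * real (4 * (k - 1))) ^ card A"
        by (rule power_mult_distrib[symmetric])
      also have "4 * real (4 * (k - 1)) = real (16 * (k - 1))" by (simp only: of_nat_mult)
      finally show ?thesis by (simp only: mult.assoc[symmetric])
    qed
    finally show "(\<Sum>x'\<in>{x' \<in> F'. sp x' = A}. real (4 * (k - 1)) ^ card (sp x') * modulus_error x a (sp x'))
       \<le> real (16 * (k - 1)) ^ card A * modulus_error x a A" .
  qed
  finally have "total_error x m \<le> K1 * (\<Sum>A\<in>AA. real (16 * (k - 1)) ^ card A * modulus_error x a A)"
    unfolding K1_def by (simp add: mult_left_mono)
  then show ?thesis using a1 unfolding K1_def AA_def by blast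
qed

end

lemma card_dyadic_class_le:
  assumes x: "x \<ge> 1" and q: "q > 0"
  shows "real (card {t \<in> dyadic x. [int t = a] (mod int q)}) \<le> x / q + 1"
proof -
  define u v where "u = \<lceil>x\<rceil>" and "v = \<lfloor>2 * x\<rfloor>"
  have uv: "u \<le> v" unfolding u_def v_def using x by linarith
  have "int ` {t \<in> dyadic x. [int t = a] (mod int q)} \<subseteq> {n \<in> {u..v}. [n = a] (mod int q)}"
    unfolding dyadic_def u_def v_def by (auto simp: ceiling_le_iff le_floor_iff)
  moreover have "finite {n \<in> {u..v}. [n = a] (mod int q)}" by (rule finite_subset[of _ "{u..v}"]) auto
  ultimately have "card (int ` {t \<in> dyadic x. [int t = a] (mod int q)}) \<le> card {n \<in> {u..v}. [n = a] (mod int q)}"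
    by (intro card_mono)
  moreover have "card (int ` {t \<in> dyadic x. [int t = a] (mod int q)}) = card {t \<in> dyadic x. [int t = a] (mod int q)}"
    by (rule card_image) (auto simp: inj_on_def)
  ultimately have "real (card {t \<in> dyadic x. [int t = a] (mod int q)}) \<le> real (card {n \<in> {u..v}. [n = a] (mod int q)})"
    by simp
  also have "\<dots> \<le> real_of_int (v - u) / q + 1" using card_cong_approx[OF q uv, of a] by linarith
  also have "real_of_int (v - u) / q \<le> x / q"
    unfolding u_def v_def by (intro divide_right_mono) (auto, linarith)
  finally show ?thesis by simp
qed

text \<open>The condition q \<le> x turns the count x / q + 1 into 2x / q, so that both parts of the
  discrepancy are bounded by a multiple of x * ln (2x) / totient q.\<close>

lemma discrepancy_trivial:
  assumes x: "x \<ge> 1" and q: "q > 0" "real q \<le> x"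
  shows "\<bar>discrepancy (\<lambda>n. mangoldt n * indicator {x..2 * x} (real n)) a q\<bar> \<le> 4 * x * ln (2 * x) / real (totient q)"
proof -
  have ln0: "0 \<le> ln (2 * x)" using x by simp
  have tq: "0 < totient q" "real (totient q) \<le> real q" using q totient_le[of q] by auto
  have s: "(\<Sum>t\<in>U. mangoldt t) \<le> real (card U) * ln (2 * x)" if "U \<subseteq> dyadic x" for U
    by (rule sum_bounded_above) (use mangoldt_le_dyadic[OF _ x] that in auto)
  have "(\<Sum>t\<in>{t \<in> dyadic x. [int t = a] (mod int q)}. mangoldt t) \<le> real (card {t \<in> dyadic x. [int t = a] (mod int q)}) * ln (2 * x)"
    by (rule s) auto
  also have "\<dots> \<le> (x / q + 1) * ln (2 * x)" using card_dyadic_class_le[OF x q(1), of a] ln0 by (rule mult_right_mono)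
  also have "\<dots> \<le> (2 * x / q) * ln (2 * x)"
    using q x ln0 by (intro mult_right_mono) (auto simp: field_simps)
  also have "\<dots> \<le> (2 * x / real (totient q)) * ln (2 * x)"
    using tq x ln0 q by (intro mult_right_mono divide_left_mono) auto
  finally have 1: "(\<Sum>t\<in>{t \<in> dyadic x. [int t = a] (mod int q)}. mangoldt t) \<le> 2 * x * ln (2 * x) / real (totient q)" by simp
  have "(\<Sum>t\<in>{t \<in> dyadic x. coprime t q}. mangoldt t) \<le> real (card {t \<in> dyadic x. coprime t q}) * ln (2 * x)"
    by (rule s) auto
  also have "\<dots> \<le> (2 * x) * ln (2 * x)"
  proof (rule mult_right_mono[OF _ ln0])
    have "card {t \<in> dyadic x. coprime t q} \<le> card {t \<in> dyadic x. [int t = 0] (mod int 1)}"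
      using finite_dyadic by (intro card_mono) auto
    then have "real (card {t \<in> dyadic x. coprime t q}) \<le> real (card {t \<in> dyadic x. [int t = 0] (mod int 1)})" by simp
    also have "\<dots> \<le> x / real 1 + 1" by (rule card_dyadic_class_le[OF x]) simp
    finally show "real (card {t \<in> dyadic x. coprime t q}) \<le> 2 * x" using x by simp
  qed
  finally have 2: "1 / real (totient q) * (\<Sum>t\<in>{t \<in> dyadic x. coprime t q}. mangoldt t) \<le> 2 * x * ln (2 * x) / real (totient q)"
    using tq by (simp add: divide_right_mono)
  have 3: "0 \<le> (\<Sum>t\<in>{t \<in> dyadic x. [int t = a] (mod int q)}. mangoldt t :: real)"
    "0 \<le> 1 / real (totient q) * (\<Sum>t\<in>{t \<in> dyadic x. coprime t q}. mangoldt t :: real)"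
    by (auto intro!: sum_nonneg mult_nonneg_nonneg divide_nonneg_nonneg mangoldt_nonneg)
  have "2 * x * ln (2 * x) / real (totient q) \<le> 4 * x * ln (2 * x) / real (totient q)"
    using x ln0 by (intro divide_right_mono mult_right_mono) auto
  then show ?thesis unfolding discrepancy_dyadic abs_le_iff using 1 2 3 by linarith
qed

context tuple_sieve
begin

text \<open>Rankin's trick for moduli up to R^2, where the truncation costs (R^2) powr \<sigma> =
  e^2; the bound 1 / (p - 1) \<le> 2 / p doubles the constant C.\<close>

lemma sum_inverse_totient_le:
  "(\<Sum>A\<in>{A \<in> Pow P. real (\<Prod>A) \<le> R\<^sup>2}. real C ^ card A / real (totient (W * \<Prod>A))) \<le> exp 2 * \<Omega> ^ (2 * C)"
proof -
  have "(\<Sum>A\<in>{A \<in> Pow P. real (\<Prod>A) \<le> R\<^sup>2}. real C ^ card A / real (totient (W * \<Prod>A)))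
    \<le> (\<Sum>A\<in>{A \<in> Pow P. real (\<Prod>A) \<le> R\<^sup>2}. exp 2 * (\<Prod>p\<in>A. real (2 * C) * real p powr (-(1 + \<sigma>))))"
  proof (rule sum_mono)
    fix A assume "A \<in> {A \<in> Pow P. real (\<Prod>A) \<le> R\<^sup>2}"
    then have A: "A \<subseteq> P" "real (\<Prod>A) \<le> R\<^sup>2" by auto
    have finA: "finite A" using A finite_P finite_subset by blast
    have pos: "real (\<Prod>A) > 0" using prod_supp_pos[OF A(1)] by (simp only: of_nat_0_less_iff)
    have "real (\<Prod>A) powr \<sigma> \<le> (R\<^sup>2) powr \<sigma>" using A pos \<sigma>_pos by (intro powr_mono2) auto
    also have "\<dots> = (R powr \<sigma>)\<^sup>2" using R_gt by (simp add: power2_eq_square powr_mult)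
    also have "\<dots> = exp 2" unfolding R_powr by (simp add: power2_eq_square exp_add[symmetric])
    finally have "1 \<le> exp 2 * real (\<Prod>A) powr (-\<sigma>)" using pos by (simp add: powr_minus field_simps)
    also have "real (\<Prod>A) powr (-\<sigma>) = (\<Prod>p\<in>A. real p powr (-\<sigma>))" by (simp add: prod_powr_distrib)
    finally have rank: "1 \<le> exp 2 * (\<Prod>p\<in>A. real p powr (-\<sigma>))" .
    have "real C ^ card A / real (totient (W * \<Prod>A)) \<le> real C ^ card A / (\<Prod>p\<in>A. real p - 1)"
    proof (rule divide_left_mono)
      have "0 < (\<Prod>p\<in>A. real p - 1)"
      proof (rule prod_pos)
        fix p assume "p \<in> A"
        then have "3 \<le> p" using A P_ge3 by blast
        then show "0 < real p - 1" by simp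
      qed
      moreover have "1 \<le> real (totient W)" using W_pos by (simp add: Suc_le_eq)
      ultimately show "(\<Prod>p\<in>A. real p - 1) \<le> real (totient (W * \<Prod>A))" "0 < real (totient (W * \<Prod>A)) * (\<Prod>p\<in>A. real p - 1)"
        unfolding totient_W_prod[OF A(1)] using W_pos by (auto intro!: mult_pos_pos)
    qed auto
    also have "\<dots> = (\<Prod>p\<in>A. real C / (real p - 1))" by (simp add: prod_dividef)
    also have "\<dots> \<le> (\<Prod>p\<in>A. real C * (2 / p))"
    proof (intro prod_mono conjI)
      fix p assume "p \<in> A"
      then have p: "3 \<le> real p" using A P_ge3[of p] by auto
      have "1 / (real p - 1) \<le> 2 / p" using p by (simp add: divide_simps)
      then have "real C * (1 / (real p - 1)) \<le> real C * (2 / p)" by (rule mult_left_mono) simp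
      then show "real C / (real p - 1) \<le> real C * (2 / p)" by simp
      show "0 \<le> real C / (real p - 1)" using p by simp
    qed
    also have "\<dots> * 1 \<le> (\<Prod>p\<in>A. real C * (2 / p)) * (exp 2 * (\<Prod>p\<in>A. real p powr (-\<sigma>)))"
      using rank by (intro mult_left_mono prod_nonneg) auto
    also have "\<dots> = exp 2 * (\<Prod>p\<in>A. real C * (2 / p) * real p powr (-\<sigma>))" by (simp only: prod.distrib mult_ac)
    also have "(\<Prod>p\<in>A. real C * (2 / p) * real p powr (-\<sigma>)) = (\<Prod>p\<in>A. real (2 * C) * real p powr (-(1 + \<sigma>)))"
      using A p_powr_split by (intro prod.cong refl) auto
    finally show "real C ^ card A / real (totient (W * \<Prod>A)) \<le> exp 2 * (\<Prod>p\<in>A. real (2 * C) * real p powr (-(1 + \<sigma>)))"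
      by simp
  qed
  also have "\<dots> \<le> (\<Sum>A\<in>Pow P. exp 2 * (\<Prod>p\<in>A. real (2 * C) * real p powr (-(1 + \<sigma>))))"
    using finite_P by (intro sum_mono2 mult_nonneg_nonneg prod_nonneg) auto
  also have "\<dots> = exp 2 * (\<Prod>p\<in>P. real (2 * C) * real p powr (-(1 + \<sigma>)) + 1)"
    unfolding sum_distrib_left[symmetric] by (subst prod_add[OF finite_P]) simp
  also have "\<dots> \<le> exp 2 * \<Omega> ^ (2 * C)"
    by (intro mult_left_mono prod_le_\<Omega>_power) auto
  finally show ?thesis .
qed

text \<open>By unique factorisation the moduli W * \<Prod>A are distinct, so their discrepancies
  form part of a sum of the kind bounded by \<open>MPZ\<close>.\<close>

lemma sum_modulus_le:
  assumes sub: "\<And>p. p \<in> B \<union> P \<Longrightarrow> real p \<in> I" and Q: "real W * R\<^sup>2 \<le> Q"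
  shows "(\<Sum>A\<in>{A \<in> Pow P. real (\<Prod>A) \<le> R\<^sup>2}. \<bar>discrepancy f a (W * \<Prod>A)\<bar>)
    \<le> (\<Sum>q | real q \<le> Q \<and> q \<in> squarefree_with_factors_in I. \<bar>discrepancy f a q\<bar>)"
proof -
  define AA where "AA = {A \<in> Pow P. real (\<Prod>A) \<le> R\<^sup>2}"
  have inj: "inj_on (\<lambda>A. W * \<Prod>A) AA"
  proof (rule inj_onI)
    fix A A' assume A: "A \<in> AA" "A' \<in> AA" "W * \<Prod>A = W * \<Prod>A'"
    then have "\<Prod>A = \<Prod>A'" using W_pos by simp
    then show "A = A'" using inj_on_prod_primes[OF finite_P prime_P] A unfolding AA_def inj_on_def by blast
  qed
  have "(\<Sum>A\<in>AA. \<bar>discrepancy f a (W * \<Prod>A)\<bar>) = (\<Sum>q\<in>(\<lambda>A. W * \<Prod>A) ` AA. \<bar>discrepancy f a q\<bar>)"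
    by (subst sum.reindex[OF inj]) simp
  also have "\<dots> \<le> (\<Sum>q | real q \<le> Q \<and> q \<in> squarefree_with_factors_in I. \<bar>discrepancy f a q\<bar>)"
  proof (rule sum_mono2)
    show "finite {q. real q \<le> Q \<and> q \<in> squarefree_with_factors_in I}"
      by (rule finite_subset[of _ "{..nat \<lceil>Q\<rceil>}"]) (auto, linarith)
    show "(\<lambda>A. W * \<Prod>A) ` AA \<subseteq> {q. real q \<le> Q \<and> q \<in> squarefree_with_factors_in I}"
    proof
      fix q assume "q \<in> (\<lambda>A. W * \<Prod>A) ` AA"
      then obtain A where A: "q = W * \<Prod>A" "A \<subseteq> P" "real (\<Prod>A) \<le> R\<^sup>2" unfolding AA_def by auto
      have q: "q = \<Prod>(B \<union> A)" unfolding A(1) W_supp[OF A(2)] ..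
      have fin: "finite (B \<union> A)" and pr: "\<And>p. p \<in> B \<union> A \<Longrightarrow> prime p"
        using finite_B A(2) finite_P finite_subset prime_B prime_P by blast+
      have "squarefree q" unfolding q
        by (rule squarefree_prod_coprime) (use pr in \<open>auto intro: primes_coprime squarefree_prime simp: squarefree_prime\<close>)
      moreover have "real p \<in> I" if "prime p" "p dvd q" for p
        using prime_dvd_prod_primes_iff[OF fin pr that(1)] that(2) sub A(2) unfolding q by blast
      moreover have "real q \<le> Q"
      proof -
        have "real q \<le> real W * R\<^sup>2" unfolding A(1) of_nat_mult using A(3) by (intro mult_left_mono) auto
        then show ?thesis using Q by linarith
      qed
      ultimately show "q \<in> {q. real q \<le> Q \<and> q \<in> squarefree_with_factors_in I}"
        unfolding squarefree_with_factors_in_def by auto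
    qed
  qed auto
  finally show ?thesis unfolding AA_def .
qed

text \<open>The weights \<open>c ^ card A\<close> are removed by \<open>c \<le> (c\<^sup>2 / L + L) / 2\<close>, the first term being bounded
  trivially.\<close>
lemma total_error_bound:
  assumes m: "m < k" and k: "k \<ge> 2" and less: "\<And>p. p \<in> B \<union> P \<Longrightarrow> real p < x"
    and b: "\<And>p. p \<in> B \<Longrightarrow> \<not> int p dvd b + h m"
    and x: "x \<ge> 1" "real W * R\<^sup>2 \<le> x" and L: "L > 0"
    and E: "\<And>a. (\<forall>p\<in>B \<union> P. \<not> int p dvd a) \<Longrightarrow>
      (\<Sum>A\<in>{A \<in> Pow P. real (\<Prod>A) \<le> R\<^sup>2}. \<bar>discrepancy (\<lambda>n. mangoldt n * indicator {x..2 * x} (real n)) a (W * \<Prod>A)\<bar>) \<le> E"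
  shows "total_error x m \<le> (exp 1 * Y * \<Omega> ^ (2 * k))\<^sup>2 *
    ((2 * x * ln (2 * x) / L + dyadic_prime_powers x) * (exp 2 * \<Omega> ^ (2 * (16 * (k - 1))\<^sup>2)) + L / 2 * E)"
proof -
  define c where "c = 16 * (k - 1)"
  define AA where "AA = {A \<in> Pow P. real (\<Prod>A) \<le> R\<^sup>2}"
  define PP where "PP = dyadic_prime_powers x"
  have c: "real c \<ge> 1" unfolding c_def using k by simp
  have PP0: "0 \<le> PP" unfolding PP_def by (rule dyadic_prime_powers_nonneg)
  obtain a where a: "\<forall>p\<in>B \<union> P. \<not> int p dvd a" and
    T: "total_error x m \<le> (exp 1 * Y * \<Omega> ^ (2 * k))\<^sup>2 * (\<Sum>A\<in>AA. real c ^ card A * modulus_error x a A)"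
    using total_error_le[OF m k less b] unfolding AA_def c_def by auto
  define dc where "dc A = \<bar>discrepancy (\<lambda>n. mangoldt n * indicator {x..2 * x} (real n)) a (W * \<Prod>A)\<bar>" for A
  define ph where "ph A = real (totient (W * \<Prod>A))" for A
  have "real c ^ card A * modulus_error x a A \<le> (2 * x * ln (2 * x) / L + PP) * (real (c\<^sup>2) ^ card A / ph A) + L / 2 * dc A"
    if A: "A \<in> AA" for A
  proof -
    have AP: "A \<subseteq> P" "real (\<Prod>A) \<le> R\<^sup>2" using A unfolding AA_def by auto
    have q: "0 < W * \<Prod>A" using W_pos prod_supp_pos[OF AP(1)] by simp
    have qx: "real (W * \<Prod>A) \<le> x"
    proof -
      have "real (W * \<Prod>A) \<le> real W * R\<^sup>2" unfolding of_nat_mult using AP(2) by (intro mult_left_mono) auto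
      then show ?thesis using x(2) by linarith
    qed
    define cc where "cc = real c ^ card A"
    have cc1: "cc \<ge> 1" unfolding cc_def using c by (rule one_le_power)
    have cc2: "cc\<^sup>2 = real (c\<^sup>2) ^ card A" unfolding cc_def by (simp add: power_mult[symmetric] mult.commute)
    have dc: "0 \<le> dc A" "dc A \<le> 4 * x * ln (2 * x) / ph A"
      unfolding dc_def ph_def using discrepancy_trivial[OF x(1) q qx] by auto
    \<comment> \<open>L will be a power of ln x: large enough to make the trivially bounded part
      negligible, and small compared with the saving that \<open>MPZ\<close> supplies.\<close>
    have "2 * cc * L \<le> cc\<^sup>2 + L\<^sup>2" using sum_squares_bound[of cc L] by simp
    then have "cc \<le> cc\<^sup>2 / (2 * L) + L / 2" using L by (simp add: field_simps power2_eq_square)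
    then have "cc * dc A \<le> (cc\<^sup>2 / (2 * L) + L / 2) * dc A" using dc(1) by (rule mult_right_mono)
    also have "\<dots> = cc\<^sup>2 / (2 * L) * dc A + L / 2 * dc A" by (rule distrib_right)
    also have "\<dots> \<le> cc\<^sup>2 / (2 * L) * (4 * x * ln (2 * x) / ph A) + L / 2 * dc A"
      using dc(2) L by (intro add_right_mono mult_left_mono) auto
    also have "cc\<^sup>2 / (2 * L) * (4 * x * ln (2 * x) / ph A) = 2 * x * ln (2 * x) / L * (cc\<^sup>2 / ph A)" by simp
    finally have 1: "cc * dc A \<le> 2 * x * ln (2 * x) / L * (cc\<^sup>2 / ph A) + L / 2 * dc A" .
    have "cc \<le> cc\<^sup>2" using cc1 by (simp add: power2_eq_square)
    then have "cc * (PP / ph A) \<le> cc\<^sup>2 * (PP / ph A)" using PP0 unfolding ph_def by (intro mult_right_mono) auto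
    then have 2: "cc * (PP / ph A) \<le> PP * (cc\<^sup>2 / ph A)" by (simp add: mult.commute)
    have "cc * modulus_error x a A = cc * dc A + cc * (PP / ph A)"
      unfolding modulus_error_def dc_def ph_def PP_def by (rule distrib_left)
    also have "\<dots> \<le> (2 * x * ln (2 * x) / L * (cc\<^sup>2 / ph A) + L / 2 * dc A) + PP * (cc\<^sup>2 / ph A)"
      using 1 2 by (rule add_mono)
    also have "\<dots> = (2 * x * ln (2 * x) / L + PP) * (cc\<^sup>2 / ph A) + L / 2 * dc A"
      by (simp only: distrib_right add_ac)
    finally show ?thesis unfolding cc2 unfolding cc_def .
  qed
  then have "(\<Sum>A\<in>AA. real c ^ card A * modulus_error x a A)
    \<le> (\<Sum>A\<in>AA. (2 * x * ln (2 * x) / L + PP) * (real (c\<^sup>2) ^ card A / ph A) + L / 2 * dc A)"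
    by (rule sum_mono)
  also have "\<dots> = (2 * x * ln (2 * x) / L + PP) * (\<Sum>A\<in>AA. real (c\<^sup>2) ^ card A / ph A) + L / 2 * (\<Sum>A\<in>AA. dc A)"
    by (simp only: sum.distrib sum_distrib_left)
  also have "\<dots> \<le> (2 * x * ln (2 * x) / L + PP) * (exp 2 * \<Omega> ^ (2 * c\<^sup>2)) + L / 2 * E"
  proof (intro add_mono mult_left_mono)
    show "(\<Sum>A\<in>AA. real (c\<^sup>2) ^ card A / ph A) \<le> exp 2 * \<Omega> ^ (2 * c\<^sup>2)"
      unfolding AA_def ph_def by (rule sum_inverse_totient_le)
    show "(\<Sum>A\<in>AA. dc A) \<le> E" unfolding AA_def dc_def by (rule E[OF a])
    show "0 \<le> 2 * x * ln (2 * x) / L + PP" using x(1) L PP0 by simp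
  qed (use L in auto)
  finally have "(exp 1 * Y * \<Omega> ^ (2 * k))\<^sup>2 * (\<Sum>A\<in>AA. real c ^ card A * modulus_error x a A)
    \<le> (exp 1 * Y * \<Omega> ^ (2 * k))\<^sup>2 * ((2 * x * ln (2 * x) / L + PP) * (exp 2 * \<Omega> ^ (2 * c\<^sup>2)) + L / 2 * E)"
    by (rule mult_left_mono) simp
  then show ?thesis using T unfolding c_def PP_def by linarith
qed

end

subsection \<open>Approximation by functions on a grid\<close>

interpretation product_sigma_finite "\<lambda>_::nat. lborel :: real measure" ..

text \<open>Written as a sum of products of one-dimensional indicators, so that integrals factor;
  inside the unit cube it is just the value of \<phi> at the cell of t.\<close>

definition grid_function :: "nat \<Rightarrow> nat \<Rightarrow> ((nat \<Rightarrow> nat) \<Rightarrow> real) \<Rightarrow> (nat \<Rightarrow> real) \<Rightarrow> real" where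
  "grid_function k N \<phi> t = (\<Sum>j\<in>PiE {..<k} (\<lambda>_. {..<N}). \<phi> j * (\<Prod>i<k. indicator {real (j i) / N..<real (Suc (j i)) / N} (t i)))"

definition grid_cell :: "nat \<Rightarrow> nat \<Rightarrow> (nat \<Rightarrow> real) \<Rightarrow> nat \<Rightarrow> nat" where
  "grid_cell k N t = (\<lambda>i\<in>{..<k}. nat \<lfloor>N * t i\<rfloor>)"

definition unit_cube :: "nat \<Rightarrow> (nat \<Rightarrow> real) set" where
  "unit_cube k = PiE {..<k} (\<lambda>_. {0..<1})"

lemma unit_cubeD:
  assumes "t \<in> unit_cube k"
  shows "i < k \<Longrightarrow> 0 \<le> t i" "i < k \<Longrightarrow> t i < 1" "t \<in> extensional {..<k}"
  using assms PiE_mem[of t "{..<k}" "\<lambda>_. {0..<1}" i] unfolding unit_cube_def by (simp_all add: PiE_iff)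

lemma mem_grid_interval_iff:
  fixes N a :: nat and s :: real
  assumes "N \<ge> 1"
  shows "s \<in> {real a / N..<real (Suc a) / N} \<longleftrightarrow> 0 \<le> s \<and> nat \<lfloor>N * s\<rfloor> = a"
proof -
  have N: "real N > 0" using assms by simp
  have "s \<in> {real a / N..<real (Suc a) / N} \<longleftrightarrow> real a \<le> N * s \<and> N * s < real a + 1"
    using N by (auto simp: field_simps)
  also have "\<dots> \<longleftrightarrow> \<lfloor>N * s\<rfloor> = int a" by (subst floor_eq_iff) auto
  also have "\<dots> \<longleftrightarrow> 0 \<le> s \<and> nat \<lfloor>N * s\<rfloor> = a"
  proof -
    have "0 \<le> s" if "\<lfloor>N * s\<rfloor> = int a"
    proof -
      have "0 \<le> N * s" using that by linarith
      then show ?thesis using N by (simp add: zero_le_mult_iff)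
    qed
    moreover have "0 \<le> \<lfloor>N * s\<rfloor>" if "0 \<le> s" using that by simp
    ultimately show ?thesis by (auto simp: eq_nat_nat_iff)
  qed
  finally show ?thesis .
qed

lemma grid_cell_mem:
  assumes "N \<ge> 1" "t \<in> unit_cube k"
  shows "grid_cell k N t \<in> PiE {..<k} (\<lambda>_. {..<N})"
proof -
  have "nat \<lfloor>N * t i\<rfloor> < N" if "i < k" for i
  proof -
    have "0 \<le> t i" "t i < 1" using unit_cubeD[OF assms(2)] that by simp_all
    then have "N * t i < N" using assms(1) by simp
    then have "\<lfloor>N * t i\<rfloor> < int N" by linarith
    then show ?thesis using assms(1) by linarith
  qed
  then show ?thesis unfolding grid_cell_def by auto
qed

lemma grid_function_eq:
  assumes N: "N \<ge> 1" and t: "t \<in> unit_cube k"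
  shows "grid_function k N \<phi> t = \<phi> (grid_cell k N t)"
proof -
  have "grid_function k N \<phi> t = (\<Sum>j\<in>PiE {..<k} (\<lambda>_. {..<N}). if j = grid_cell k N t then \<phi> j else 0)"
    unfolding grid_function_def
  proof (rule sum.cong[OF refl])
    fix j assume j: "j \<in> PiE {..<k} (\<lambda>_. {..<N})"
    have ind: "indicator {real (j i) / N..<real (Suc (j i)) / N} (t i) = (of_bool (grid_cell k N t i = j i) :: real)" if "i < k" for i
      unfolding indicator_def mem_grid_interval_iff[OF N] grid_cell_def using unit_cubeD(1)[OF t that] that by simp
    show "\<phi> j * (\<Prod>i<k. indicator {real (j i) / N..<real (Suc (j i)) / N} (t i)) = (if j = grid_cell k N t then \<phi> j else 0)"
    proof (cases "j = grid_cell k N t")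
      case True then show ?thesis using ind by simp
    next
      case False
      then obtain i where "i < k" "grid_cell k N t i \<noteq> j i"
        using PiE_ext[OF grid_cell_mem[OF N t] j] by fastforce
      then have "(\<Prod>i<k. indicator {real (j i) / N..<real (Suc (j i)) / N} (t i) :: real) = 0"
        using ind by (intro prod_zero) auto
      then show ?thesis using False by simp
    qed
  qed
  also have "\<dots> = \<phi> (grid_cell k N t)"
    using grid_cell_mem[OF N t] by (simp add: finite_PiE)
  finally show ?thesis .
qed

lemma grid_function_outside:
  assumes N: "N \<ge> 1" and t: "t \<in> extensional {..<k}" "t \<notin> unit_cube k"
  shows "grid_function k N \<phi> t = 0"
  unfolding grid_function_def
proof (rule sum.neutral, rule ballI)
  fix j assume j: "j \<in> PiE {..<k} (\<lambda>_. {..<N})"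
  obtain i where i: "i < k" "t i \<notin> {0..<1}" using t unfolding unit_cube_def PiE_iff by blast
  have "t i \<notin> {real (j i) / N..<real (Suc (j i)) / N}"
  proof
    assume m: "t i \<in> {real (j i) / N..<real (Suc (j i)) / N}"
    have "Suc (j i) \<le> N" using j i(1) by (auto simp: PiE_iff Suc_le_eq)
    then have "real (Suc (j i)) \<le> real N" by (simp only: of_nat_le_iff)
    then have "real (Suc (j i)) / N \<le> 1" using N by (simp add: divide_le_eq_1)
    then have "t i < 1" using m by (meson atLeastLessThan_iff less_le_trans)
    moreover have "0 \<le> t i" using m by (meson atLeastLessThan_iff divide_nonneg_nonneg of_nat_0_le_iff order_trans)
    ultimately show False using i(2) by simp
  qed
  then have "(\<Prod>i<k. indicator {real (j i) / N..<real (Suc (j i)) / N} (t i) :: real) = 0"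
    using i(1) by (intro prod_zero bexI[of _ i]) auto
  then show "\<phi> j * (\<Prod>i<k. indicator {real (j i) / N..<real (Suc (j i)) / N} (t i)) = 0" by simp
qed

lemma grid_function_measurable [measurable]:
  "grid_function k N \<phi> \<in> borel_measurable (lebesgue_prod {..<k})"
  unfolding grid_function_def by measurable

lemma grid_function_linear:
  "grid_function k N \<phi> t + grid_function k N \<psi> t = grid_function k N (\<lambda>j. \<phi> j + \<psi> j) t"
  unfolding grid_function_def by (simp add: sum.distrib distrib_right)

lemma grid_function_scale:
  "c * grid_function k N \<phi> t = grid_function k N (\<lambda>j. c * \<phi> j) t"
  unfolding grid_function_def by (simp add: sum_distrib_left mult.assoc)

lemma unit_cube_sets [measurable]: "unit_cube k \<in> sets (lebesgue_prod {..<k})"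
  unfolding unit_cube_def by (intro sets_PiM_I_finite) auto

text \<open>A finite measure, so that constants are integrable and serve as dominating functions.
  The simplex lies in the half-open cube up to a null set.\<close>

definition cube_measure :: "nat \<Rightarrow> (nat \<Rightarrow> real) measure" where
  "cube_measure k = density (lebesgue_prod {..<k}) (indicator (unit_cube k))"

lemma sets_cube_measure [measurable_cong]: "sets (cube_measure k) = sets (lebesgue_prod {..<k})"
  unfolding cube_measure_def by simp

lemma nn_integral_cube:
  assumes "f \<in> borel_measurable (lebesgue_prod {..<k})"
  shows "(\<integral>\<^sup>+ t. f t \<partial>cube_measure k) = (\<integral>\<^sup>+ t. f t * indicator (unit_cube k) t \<partial>lebesgue_prod {..<k})"
  unfolding cube_measure_def using assms by (subst nn_integral_density) (auto simp: mult.commute)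

lemma AE_cube: "(\<And>t. t \<in> unit_cube k \<Longrightarrow> Q t) \<Longrightarrow> AE t in cube_measure k. Q t"
  unfolding cube_measure_def by (subst AE_density) (auto simp: indicator_def)

lemma emeasure_cube: "emeasure (cube_measure k) (space (cube_measure k)) \<le> 1"
proof -
  have "emeasure (cube_measure k) (space (cube_measure k)) = (\<integral>\<^sup>+ t. 1 \<partial>cube_measure k)" by simp
  also have "\<dots> = emeasure (lebesgue_prod {..<k}) (unit_cube k)"
    by (subst nn_integral_cube) auto
  also have "\<dots> = 1" unfolding unit_cube_def by (subst emeasure_PiM) auto
  finally show ?thesis by simp
qed

lemma finite_measure_cube: "finite_measure (cube_measure k)"
proof
  show "emeasure (cube_measure k) (space (cube_measure k)) \<noteq> \<infinity>"
    using emeasure_cube[of k] by (metis ennreal_one_less_top infinity_ennreal_def leD)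
qed

text \<open>Approximation is demanded for all large N, not only for some N: two functions can then
  be approximated on the same grid, which gives closure under sums.\<close>

definition grid_approximable :: "nat \<Rightarrow> ((nat \<Rightarrow> real) \<Rightarrow> real) \<Rightarrow> bool" where
  "grid_approximable k f \<longleftrightarrow> (\<forall>e>0. \<forall>\<^sub>F N in sequentially.
     \<exists>\<phi>. (\<integral>\<^sup>+ t. ennreal \<bar>f t - grid_function k N \<phi> t\<bar> \<partial>cube_measure k) \<le> ennreal e)"

lemma L1_triangle:
  fixes f g h :: "_ \<Rightarrow> real"
  assumes [measurable]: "f \<in> borel_measurable M" "g \<in> borel_measurable M" "h \<in> borel_measurable M"
    and "(\<integral>\<^sup>+ t. ennreal \<bar>f t - g t\<bar> \<partial>M) \<le> ennreal a" "(\<integral>\<^sup>+ t. ennreal \<bar>g t - h t\<bar> \<partial>M) \<le> ennreal b" "0 \<le> a" "0 \<le> b"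
  shows "(\<integral>\<^sup>+ t. ennreal \<bar>f t - h t\<bar> \<partial>M) \<le> ennreal (a + b)"
proof -
  have "(\<integral>\<^sup>+ t. ennreal \<bar>f t - h t\<bar> \<partial>M) \<le> (\<integral>\<^sup>+ t. ennreal \<bar>f t - g t\<bar> + ennreal \<bar>g t - h t\<bar> \<partial>M)"
    by (intro nn_integral_mono) (simp add: ennreal_plus[symmetric] del: ennreal_plus)
  also have "\<dots> = (\<integral>\<^sup>+ t. ennreal \<bar>f t - g t\<bar> \<partial>M) + (\<integral>\<^sup>+ t. ennreal \<bar>g t - h t\<bar> \<partial>M)"
    by (rule nn_integral_add) auto
  also have "\<dots> \<le> ennreal a + ennreal b" by (intro add_mono assms)
  finally show ?thesis using assms by simp
qed

lemma grid_approximable_add: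
  assumes [measurable]: "f \<in> borel_measurable (lebesgue_prod {..<k})" "g \<in> borel_measurable (lebesgue_prod {..<k})"
    and f: "grid_approximable k f" and g: "grid_approximable k g"
  shows "grid_approximable k (\<lambda>t. f t + g t)"
  unfolding grid_approximable_def
proof (intro allI impI)
  fix e :: real assume "e > 0"
  then have "e / 2 > 0" by simp
  then have "\<forall>\<^sub>F N in sequentially. (\<exists>\<phi>. (\<integral>\<^sup>+ t. ennreal \<bar>f t - grid_function k N \<phi> t\<bar> \<partial>cube_measure k) \<le> ennreal (e / 2))
     \<and> (\<exists>\<phi>. (\<integral>\<^sup>+ t. ennreal \<bar>g t - grid_function k N \<phi> t\<bar> \<partial>cube_measure k) \<le> ennreal (e / 2))"
    using f g unfolding grid_approximable_def by (intro eventually_conj) auto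
  then show "\<forall>\<^sub>F N in sequentially. \<exists>\<phi>. (\<integral>\<^sup>+ t. ennreal \<bar>f t + g t - grid_function k N \<phi> t\<bar> \<partial>cube_measure k) \<le> ennreal e"
  proof (rule eventually_mono)
    fix N
    assume "(\<exists>\<phi>. (\<integral>\<^sup>+ t. ennreal \<bar>f t - grid_function k N \<phi> t\<bar> \<partial>cube_measure k) \<le> ennreal (e / 2))
     \<and> (\<exists>\<phi>. (\<integral>\<^sup>+ t. ennreal \<bar>g t - grid_function k N \<phi> t\<bar> \<partial>cube_measure k) \<le> ennreal (e / 2))"
    then obtain \<phi> \<psi> where p: "(\<integral>\<^sup>+ t. ennreal \<bar>f t - grid_function k N \<phi> t\<bar> \<partial>cube_measure k) \<le> ennreal (e / 2)"
      "(\<integral>\<^sup>+ t. ennreal \<bar>g t - grid_function k N \<psi> t\<bar> \<partial>cube_measure k) \<le> ennreal (e / 2)" by auto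
    have "(\<integral>\<^sup>+ t. ennreal \<bar>(f t + g t) - (grid_function k N \<phi> t + grid_function k N \<psi> t)\<bar> \<partial>cube_measure k) \<le> ennreal (e / 2 + e / 2)"
      by (rule L1_triangle[where g = "\<lambda>t. grid_function k N \<phi> t + g t"]) (use p \<open>e > 0\<close> in \<open>auto simp: add.commute\<close>)
    then show "\<exists>\<phi>. (\<integral>\<^sup>+ t. ennreal \<bar>f t + g t - grid_function k N \<phi> t\<bar> \<partial>cube_measure k) \<le> ennreal e"
      unfolding grid_function_linear by auto
  qed
qed

lemma grid_approximable_limit:
  assumes [measurable]: "f \<in> borel_measurable (lebesgue_prod {..<k})" "\<And>n. s n \<in> borel_measurable (lebesgue_prod {..<k})"
    and s: "\<And>n::nat. grid_approximable k (s n)"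
    and lim: "(\<lambda>n. \<integral>\<^sup>+ t. ennreal \<bar>f t - s n t\<bar> \<partial>cube_measure k) \<longlonglongrightarrow> 0"
  shows "grid_approximable k f"
  unfolding grid_approximable_def
proof (intro allI impI)
  fix e :: real assume e: "e > 0"
  then have "\<forall>\<^sub>F n in sequentially. (\<integral>\<^sup>+ t. ennreal \<bar>f t - s n t\<bar> \<partial>cube_measure k) < ennreal (e / 2)"
    using lim by (intro order_tendstoD) auto
  then obtain n where n: "(\<integral>\<^sup>+ t. ennreal \<bar>f t - s n t\<bar> \<partial>cube_measure k) \<le> ennreal (e / 2)"
    using eventually_sequentially by (meson less_imp_le order_refl)
  have "\<forall>\<^sub>F N in sequentially. \<exists>\<phi>. (\<integral>\<^sup>+ t. ennreal \<bar>s n t - grid_function k N \<phi> t\<bar> \<partial>cube_measure k) \<le> ennreal (e / 2)"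
    using s[of n] e unfolding grid_approximable_def by auto
  then show "\<forall>\<^sub>F N in sequentially. \<exists>\<phi>. (\<integral>\<^sup>+ t. ennreal \<bar>f t - grid_function k N \<phi> t\<bar> \<partial>cube_measure k) \<le> ennreal e"
  proof (rule eventually_mono)
    fix N assume "\<exists>\<phi>. (\<integral>\<^sup>+ t. ennreal \<bar>s n t - grid_function k N \<phi> t\<bar> \<partial>cube_measure k) \<le> ennreal (e / 2)"
    then obtain \<phi> where p: "(\<integral>\<^sup>+ t. ennreal \<bar>s n t - grid_function k N \<phi> t\<bar> \<partial>cube_measure k) \<le> ennreal (e / 2)" by auto
    have "(\<integral>\<^sup>+ t. ennreal \<bar>f t - grid_function k N \<phi> t\<bar> \<partial>cube_measure k) \<le> ennreal (e / 2 + e / 2)"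
      by (rule L1_triangle[OF _ _ _ n p]) (use e in auto)
    then show "\<exists>\<phi>. (\<integral>\<^sup>+ t. ennreal \<bar>f t - grid_function k N \<phi> t\<bar> \<partial>cube_measure k) \<le> ennreal e" by auto
  qed
qed

lemma dominated_L1_convergence:
  fixes f :: "(nat \<Rightarrow> real) \<Rightarrow> real" and s :: "nat \<Rightarrow> (nat \<Rightarrow> real) \<Rightarrow> real"
  assumes [measurable]: "f \<in> borel_measurable (lebesgue_prod {..<k})" "\<And>n. s n \<in> borel_measurable (lebesgue_prod {..<k})"
    and bound: "\<And>n t. t \<in> unit_cube k \<Longrightarrow> \<bar>s n t\<bar> \<le> C"
    and conv: "AE t in cube_measure k. (\<lambda>n. s n t) \<longlonglongrightarrow> f t"
  shows "(\<lambda>n. \<integral>\<^sup>+ t. ennreal \<bar>f t - s n t\<bar> \<partial>cube_measure k) \<longlonglongrightarrow> 0"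
proof -
  have "(\<lambda>n. \<integral>\<^sup>+ t. ennreal (norm (f t - s n t)) \<partial>cube_measure k) \<longlonglongrightarrow> 0"
  proof (rule nn_integral_dominated_convergence_norm[where w = "\<lambda>_. C"])
    show "AE t in cube_measure k. norm (s n t) \<le> C" for n by (rule AE_cube) (use bound in auto)
    show "(\<integral>\<^sup>+ t. ennreal C \<partial>cube_measure k) < \<infinity>"
      using finite_measure.emeasure_finite[OF finite_measure_cube] by (simp add: ennreal_mult_less_top less_top)
  qed (use conv in auto)
  then show ?thesis by simp
qed

lemma eventually_grid_below:
  fixes a s :: real
  assumes "s < a"
  shows "\<forall>\<^sub>F N in sequentially. real (Suc (nat \<lfloor>N * s\<rfloor>)) \<le> a * N \<or> s < 0"
proof -
  obtain M :: nat where M: "1 / (a - s) < M" using reals_Archimedean2 by blast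
  show ?thesis
  proof (rule eventually_mono[OF eventually_ge_at_top[of M]])
    fix N assume N: "N \<ge> M"
    show "real (Suc (nat \<lfloor>N * s\<rfloor>)) \<le> a * N \<or> s < 0"
    proof (cases "s < 0")
      case False
      have "1 / (a - s) < N" using M N by linarith
      then have "1 \<le> (a - s) * N" using assms by (simp add: field_simps)
      moreover have "real (nat \<lfloor>N * s\<rfloor>) \<le> N * s" using False by simp
      moreover have "(a - s) * N = a * N - N * s" by (simp add: algebra_simps)
      ultimately have "real (Suc (nat \<lfloor>N * s\<rfloor>)) \<le> a * N" unfolding of_nat_Suc by linarith
      then show ?thesis ..
    qed simp
  qed
qed

lemma grid_above:
  fixes a s :: real
  assumes "a \<le> s" "0 \<le> s"
  shows "\<not> real (Suc (nat \<lfloor>real N * s\<rfloor>)) \<le> a * N"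
proof -
  have "a * N \<le> s * N" using assms by (intro mult_right_mono) auto
  moreover have "N * s < real (Suc (nat \<lfloor>real N * s\<rfloor>))" using assms by (simp add: floor_less_iff) linarith
  ultimately show ?thesis by (simp add: mult.commute)
qed

text \<open>Take the indicator of the cells lying wholly below the upper bounds of the box. Since
  the box is open there, this converges at every point of the cube: the cell of a point in the box
  eventually qualifies, and that of a point outside never does.\<close>

lemma grid_approximable_box:
  "grid_approximable k (indicator (PiE {..<k} (\<lambda>i. {..<a i})))"
proof -
  define B where "B = PiE {..<k} (\<lambda>i. {..<a i})"
  define \<phi> where "\<phi> N j = (of_bool (\<forall>i<k. real (Suc (j i)) \<le> a i * real N) :: real)" for N :: nat and j :: "nat \<Rightarrow> nat"
  have [measurable]: "B \<in> sets (lebesgue_prod {..<k})" unfolding B_def by (intro sets_PiM_I_finite) auto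
  \<comment> \<open>The index is shifted because the grid with N = 0 is degenerate.\<close>
  have lim: "(\<lambda>N. \<integral>\<^sup>+ t. ennreal \<bar>indicator B t - grid_function k (Suc N) (\<phi> (Suc N)) t\<bar> \<partial>cube_measure k) \<longlonglongrightarrow> 0"
  proof (rule dominated_L1_convergence[where C = 1])
    show "\<bar>grid_function k (Suc N) (\<phi> (Suc N)) t\<bar> \<le> 1" if "t \<in> unit_cube k" for N t
      using that by (subst grid_function_eq) (auto simp: \<phi>_def)
    show "AE t in cube_measure k. (\<lambda>N. grid_function k (Suc N) (\<phi> (Suc N)) t) \<longlonglongrightarrow> indicator B t"
    proof (rule AE_cube)
      fix t assume t: "t \<in> unit_cube k"
      then have t0: "\<And>i. i < k \<Longrightarrow> 0 \<le> t i" and ext: "t \<in> extensional {..<k}" using unit_cubeD by blast+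
      have eq: "grid_function k (Suc N) (\<phi> (Suc N)) t = \<phi> (Suc N) (grid_cell k (Suc N) t)" for N
        using t by (intro grid_function_eq) auto
      have "\<forall>\<^sub>F N in sequentially. \<phi> N (grid_cell k N t) = indicator B t"
      proof (cases "t \<in> B")
        case True
        have "\<forall>\<^sub>F N in sequentially. \<forall>i\<in>{..<k}. real (Suc (nat \<lfloor>real N * t i\<rfloor>)) \<le> a i * real N \<or> t i < 0"
          using True unfolding B_def by (intro eventually_ball_finite ballI eventually_grid_below) (auto simp: PiE_iff)
        then show ?thesis
          by (rule eventually_mono) (use True t0 in \<open>force simp: \<phi>_def grid_cell_def\<close>)
      next
        case False
        then obtain i where i: "i < k" "a i \<le> t i" using ext unfolding B_def by (force simp: PiE_iff)
        have "\<phi> N (grid_cell k N t) = 0" for N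
          using grid_above[OF i(2) t0[OF i(1)], of N] i(1) unfolding \<phi>_def grid_cell_def by auto
        then show ?thesis using False by simp
      qed
      then have "(\<lambda>N. \<phi> N (grid_cell k N t)) \<longlonglongrightarrow> indicator B t" by (rule tendsto_eventually)
      then show "(\<lambda>N. grid_function k (Suc N) (\<phi> (Suc N)) t) \<longlonglongrightarrow> indicator B t"
        unfolding eq by (rule LIMSEQ_Suc)
    qed
  qed auto
  show ?thesis unfolding grid_approximable_def B_def[symmetric]
  proof (intro allI impI)
    fix e :: real assume "e > 0"
    have "(\<lambda>N. \<integral>\<^sup>+ t. ennreal \<bar>indicator B t - grid_function k N (\<phi> N) t\<bar> \<partial>cube_measure k) \<longlonglongrightarrow> 0"
      using lim by (rule LIMSEQ_imp_Suc)
    then have "\<forall>\<^sub>F N in sequentially. (\<integral>\<^sup>+ t. ennreal \<bar>indicator B t - grid_function k N (\<phi> N) t\<bar> \<partial>cube_measure k) < ennreal e"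
      using \<open>e > 0\<close> by (intro order_tendstoD) auto
    then show "\<forall>\<^sub>F N in sequentially. \<exists>\<phi>. (\<integral>\<^sup>+ t. ennreal \<bar>indicator B t - grid_function k N \<phi> t\<bar> \<partial>cube_measure k) \<le> ennreal e"
      by (rule eventually_mono) (auto intro: less_imp_le)
  qed
qed

lemma sets_lebesgue_prod_boxes:
  "sets (lebesgue_prod {..<k}) = sigma_sets (extensional {..<k}) {PiE {..<k} F | F. \<forall>i\<in>{..<k}. F i \<in> range (\<lambda>a. {..<a::real})}"
proof -
  define E where "E = range (\<lambda>a. {..<a::real})"
  define G where "G = {PiE {..<k} F | F. \<forall>i\<in>{..<k}. F i \<in> E}"
  have sub: "G \<subseteq> Pow (extensional {..<k})" unfolding G_def by (auto simp: PiE_iff)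
  have ext: "PiE {..<k} (\<lambda>_. UNIV) = extensional {..<k}" by (simp add: PiE_def)
  have "sets (lebesgue_prod {..<k}) = sets (PiM {..<k} (\<lambda>_. sigma UNIV E))"
    by (rule sets_PiM_cong) (simp_all add: E_def borel_Iio[where 'a = real])
  also have "\<dots> = sets (sigma (PiE {..<k} (\<lambda>_. UNIV)) {{f\<in>(PiE {..<k} (\<lambda>_. UNIV)). \<forall>i\<in>j. f i \<in> A i} | A j. j \<in> {{..<k}} \<and> A \<in> Pi j (\<lambda>_. E)})"
  proof (rule sets_PiM_sigma)
    fix i assume "i \<in> {..<k}"
    have "UNIV = \<Union>(range (\<lambda>n. {..<real n}))" by (auto intro: reals_Archimedean2)
    moreover have "range (\<lambda>n. {..<real n}) \<subseteq> E" unfolding E_def by auto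
    moreover have "countable (range (\<lambda>n. {..<real n}))" by simp
    ultimately show "\<exists>S\<subseteq>E. countable S \<and> UNIV = \<Union>S" by blast
  qed auto
  also have "{{f\<in>(PiE {..<k} (\<lambda>_. UNIV)). \<forall>i\<in>j. f i \<in> A i} | A j. j \<in> {{..<k}} \<and> A \<in> Pi j (\<lambda>_. E)} = G"
  proof -
    have "{f\<in>(PiE {..<k} (\<lambda>_. UNIV)). \<forall>i\<in>{..<k}. f i \<in> A i} = PiE {..<k} A" for A :: "nat \<Rightarrow> real set"
      by (rule Set.set_eqI) (simp add: PiE_iff, blast)
    then show ?thesis unfolding G_def by (auto simp: Pi_iff)
  qed
  also have "sets (sigma (PiE {..<k} (\<lambda>_. UNIV)) G) = sigma_sets (extensional {..<k}) G"
    unfolding ext using sub by (rule sets_measure_of)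
  finally show ?thesis unfolding G_def E_def .
qed

text \<open>Dynkin's \<pi>-\<lambda> theorem, started from the boxes: complements replace \<phi> by
  1 - \<phi>, and disjoint unions follow from finite sums by dominated convergence.\<close>

lemma grid_approximable_indicator:
  assumes "A \<in> sets (lebesgue_prod {..<k})"
  shows "grid_approximable k (indicator A)"
proof -
  define G where "G = {PiE {..<k} F | F. \<forall>i\<in>{..<k}. F i \<in> range (\<lambda>a. {..<a::real})}"
  have sets: "sets (lebesgue_prod {..<k}) = sigma_sets (extensional {..<k}) G"
    unfolding G_def by (rule sets_lebesgue_prod_boxes)
  have box: "\<exists>a. F = PiE {..<k} (\<lambda>i. {..<a i::real})" if FG: "F \<in> G" for F
  proof -
    from FG have "\<exists>F'. F = PiE {..<k} F' \<and> (\<forall>i\<in>{..<k}. F' i \<in> range (\<lambda>a. {..<a::real}))"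
      unfolding G_def by (rule CollectD)
    then obtain F' where F': "F = PiE {..<k} F'" "\<forall>i\<in>{..<k}. F' i \<in> range (\<lambda>a. {..<a::real})"
      by (elim exE conjE)
    have "\<forall>i\<in>{..<k}. \<exists>a. F' i = {..<a}"
    proof
      fix i assume "i \<in> {..<k}"
      with F'(2) have "F' i \<in> range (\<lambda>a. {..<a::real})" ..
      then show "\<exists>a. F' i = {..<a}" by (rule rangeE) (rule exI)
    qed
    from bchoice[OF this] obtain a where a: "\<forall>i\<in>{..<k}. F' i = {..<a i}" by (rule exE)
    have "F = PiE {..<k} (\<lambda>i. {..<a i})" unfolding F'(1) by (rule PiE_cong) (use a in simp)
    then show ?thesis by (rule exI[of _ a])
  qed
  have A: "A \<in> sigma_sets (extensional {..<k}) G" using assms sets by simp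
  have stable: "Int_stable G"
  proof (rule Int_stableI)
    fix E F assume "E \<in> G" "F \<in> G"
    then obtain a b where "E = PiE {..<k} (\<lambda>i. {..<a i::real})" "F = PiE {..<k} (\<lambda>i. {..<b i::real})" using box by metis
    then have "E \<inter> F = PiE {..<k} (\<lambda>i. {..<min (a i) (b i)})"
      by (intro Set.set_eqI) (simp add: PiE_iff, blast)
    then show "E \<inter> F \<in> G" unfolding G_def by auto
  qed
  have sub: "G \<subseteq> Pow (extensional {..<k})" unfolding G_def by (auto simp: PiE_iff)
  from stable sub A show ?thesis
  proof (induction rule: sigma_sets_induct_disjoint)
    case (basic F)
    then show ?case using box grid_approximable_box by metis
  next
    case empty
    have "grid_function k N (\<lambda>_. 0) t = 0" for N t unfolding grid_function_def by simp
    then show ?case unfolding grid_approximable_def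
      by (auto intro!: always_eventually exI[of _ "\<lambda>_. 0"])
  next
    case (compl F)
    show ?case unfolding grid_approximable_def
    proof (intro allI impI)
      fix e :: real assume "e > 0"
      then have "\<forall>\<^sub>F N in sequentially. N \<ge> 1 \<and> (\<exists>\<phi>. (\<integral>\<^sup>+ t. ennreal \<bar>indicator F t - grid_function k N \<phi> t\<bar> \<partial>cube_measure k) \<le> ennreal e)"
        using compl(2) unfolding grid_approximable_def by (intro eventually_conj eventually_ge_at_top) auto
      then show "\<forall>\<^sub>F N in sequentially. \<exists>\<phi>. (\<integral>\<^sup>+ t. ennreal \<bar>indicator (extensional {..<k} - F) t - grid_function k N \<phi> t\<bar> \<partial>cube_measure k) \<le> ennreal e"
      proof (rule eventually_mono)
        fix N assume "N \<ge> 1 \<and> (\<exists>\<phi>. (\<integral>\<^sup>+ t. ennreal \<bar>indicator F t - grid_function k N \<phi> t\<bar> \<partial>cube_measure k) \<le> ennreal e)"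
        then obtain \<phi> where N: "N \<ge> 1" and p: "(\<integral>\<^sup>+ t. ennreal \<bar>indicator F t - grid_function k N \<phi> t\<bar> \<partial>cube_measure k) \<le> ennreal e" by auto
        have "(\<integral>\<^sup>+ t. ennreal \<bar>indicator (extensional {..<k} - F) t - grid_function k N (\<lambda>j. 1 - \<phi> j) t\<bar> \<partial>cube_measure k)
           = (\<integral>\<^sup>+ t. ennreal \<bar>indicator F t - grid_function k N \<phi> t\<bar> \<partial>cube_measure k)"
        proof (rule nn_integral_cong_AE, rule AE_cube)
          fix t assume t: "t \<in> unit_cube k"
          then have "t \<in> extensional {..<k}" by (rule unit_cubeD(3))
          then show "ennreal \<bar>indicator (extensional {..<k} - F) t - grid_function k N (\<lambda>j. 1 - \<phi> j) t\<bar> = ennreal \<bar>indicator F t - grid_function k N \<phi> t\<bar>"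
            unfolding grid_function_eq[OF N t] by (auto simp: indicator_def abs_minus_commute)
        qed
        then show "\<exists>\<phi>. (\<integral>\<^sup>+ t. ennreal \<bar>indicator (extensional {..<k} - F) t - grid_function k N \<phi> t\<bar> \<partial>cube_measure k) \<le> ennreal e"
          using p by metis
      qed
    qed
  next
    case (union F)
    have [measurable]: "F i \<in> sets (lebesgue_prod {..<k})" for i using union(2) sets by auto
    define s where "s n t = (\<Sum>i<n. indicator (F i) t :: real)" for n and t :: "nat \<Rightarrow> real"
    have s_eq: "s n t = indicator (\<Union>i<n. F i) t" for n t
      unfolding s_def using union(1) by (subst indicator_UN_disjoint) (auto simp: disjoint_family_on_def)
    have [measurable]: "s n \<in> borel_measurable (lebesgue_prod {..<k})" for n unfolding s_def by measurable
    have appr: "grid_approximable k (s n)" for n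
    proof (induction n)
      case 0
      have "grid_function k N (\<lambda>_. 0) t = 0" for N t unfolding grid_function_def by simp
      then show ?case unfolding grid_approximable_def s_def
        by (auto intro!: always_eventually exI[of _ "\<lambda>_. 0"])
    next
      case (Suc n)
      have "grid_approximable k (\<lambda>t. s n t + indicator (F n) t)"
        by (rule grid_approximable_add) (use Suc union(3) in auto)
      then show ?case unfolding s_def by simp
    qed
    show ?case
    proof (rule grid_approximable_limit[OF _ _ appr])
      show "(\<lambda>n. \<integral>\<^sup>+ t. ennreal \<bar>indicator (\<Union>i. F i) t - s n t\<bar> \<partial>cube_measure k) \<longlonglongrightarrow> 0"
      proof (rule dominated_L1_convergence[where C = 1])
        show "AE t in cube_measure k. (\<lambda>n. s n t) \<longlonglongrightarrow> indicator (\<Union>i. F i) t"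
          unfolding s_eq by (intro AE_I2 LIMSEQ_indicator_UN)
      qed (auto simp: s_eq indicator_def)
    qed auto
  qed
qed

lemma grid_approximable_integrable:
  assumes "integrable (cube_measure k) f"
  shows "grid_approximable k f"
  using assms
proof (induction rule: integrable_induct)
  case (base A c)
  have A: "grid_approximable k (indicator A)" using base by (intro grid_approximable_indicator) (simp add: sets_cube_measure)
  show ?case unfolding grid_approximable_def
  proof (intro allI impI)
    fix e :: real assume e: "e > 0"
    have "\<forall>\<^sub>F N in sequentially. \<exists>\<phi>. (\<integral>\<^sup>+ t. ennreal \<bar>indicator A t - grid_function k N \<phi> t\<bar> \<partial>cube_measure k) \<le> ennreal (e / (\<bar>c\<bar> + 1))"
      using A e unfolding grid_approximable_def by auto
    then show "\<forall>\<^sub>F N in sequentially. \<exists>\<phi>. (\<integral>\<^sup>+ t. ennreal \<bar>indicator A t *\<^sub>R c - grid_function k N \<phi> t\<bar> \<partial>cube_measure k) \<le> ennreal e"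
    proof (rule eventually_mono)
      fix N assume "\<exists>\<phi>. (\<integral>\<^sup>+ t. ennreal \<bar>indicator A t - grid_function k N \<phi> t\<bar> \<partial>cube_measure k) \<le> ennreal (e / (\<bar>c\<bar> + 1))"
      then obtain \<phi> where p: "(\<integral>\<^sup>+ t. ennreal \<bar>indicator A t - grid_function k N \<phi> t\<bar> \<partial>cube_measure k) \<le> ennreal (e / (\<bar>c\<bar> + 1))" by auto
      have [measurable]: "A \<in> sets (lebesgue_prod {..<k})" using base by (simp add: sets_cube_measure)
      have "(\<integral>\<^sup>+ t. ennreal \<bar>indicator A t *\<^sub>R c - grid_function k N (\<lambda>j. c * \<phi> j) t\<bar> \<partial>cube_measure k)
         = (\<integral>\<^sup>+ t. ennreal \<bar>c\<bar> * ennreal \<bar>indicator A t - grid_function k N \<phi> t\<bar> \<partial>cube_measure k)"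
        unfolding grid_function_scale[symmetric]
        by (intro nn_integral_cong) (simp add: ennreal_mult[symmetric] abs_mult[symmetric] right_diff_distrib mult.commute)
      also have "\<dots> = ennreal \<bar>c\<bar> * (\<integral>\<^sup>+ t. ennreal \<bar>indicator A t - grid_function k N \<phi> t\<bar> \<partial>cube_measure k)"
        by (rule nn_integral_cmult) measurable
      also have "\<dots> \<le> ennreal \<bar>c\<bar> * ennreal (e / (\<bar>c\<bar> + 1))" by (intro mult_left_mono p) auto
      also have "\<dots> = ennreal (\<bar>c\<bar> * (e / (\<bar>c\<bar> + 1)))" using e by (subst ennreal_mult) auto
      also have "\<dots> \<le> ennreal e" using e by (intro ennreal_leI) (simp add: field_simps)
      finally show "\<exists>\<phi>. (\<integral>\<^sup>+ t. ennreal \<bar>indicator A t *\<^sub>R c - grid_function k N \<phi> t\<bar> \<partial>cube_measure k) \<le> ennreal e" by blast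
    qed
  qed
next
  case (add f g)
  then show ?case by (intro grid_approximable_add) (auto dest!: borel_measurable_integrable simp: measurable_cong_sets[OF sets_cube_measure])
next
  case (lim f s)
  have meas: "f \<in> borel_measurable (lebesgue_prod {..<k})" "\<And>n. s n \<in> borel_measurable (lebesgue_prod {..<k})"
    using lim by (auto dest!: borel_measurable_integrable simp: measurable_cong_sets[OF sets_cube_measure])
  show ?case
  proof (rule grid_approximable_limit[OF meas lim.IH])
    have "(\<lambda>n. \<integral>\<^sup>+ t. ennreal (norm (f t - s n t)) \<partial>cube_measure k) \<longlonglongrightarrow> 0"
    proof (rule nn_integral_dominated_convergence_norm[where w = "\<lambda>t. 2 * norm (f t)"])
      show "(\<integral>\<^sup>+ t. ennreal (2 * norm (f t)) \<partial>cube_measure k) < \<infinity>"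
      proof -
        have "integrable (cube_measure k) f" using lim by blast
        then have "integrable (cube_measure k) (\<lambda>t. 2 * f t)" by (rule integrable_mult_right)
        then have "(\<integral>\<^sup>+ t. ennreal (norm (2 * f t)) \<partial>cube_measure k) < \<infinity>"
          unfolding integrable_iff_bounded by (rule conjunct2)
        then show ?thesis by (simp only: real_norm_def abs_mult abs_numeral)
      qed
    qed (use lim borel_measurable_integrable in auto)
    then show "(\<lambda>n. \<integral>\<^sup>+ t. ennreal \<bar>f t - s n t\<bar> \<partial>cube_measure k) \<longlonglongrightarrow> 0" by simp
  qed
qed

section \<open>Stability of the functionals in L^1 and their values on step functions\<close>

text \<open>The functional J_i of a nonnegative function, valued in \<open>ennreal\<close> so that
  it may be infinite and monotone limits can be taken.\<close>

definition inner_square :: "nat \<Rightarrow> nat \<Rightarrow> ((nat \<Rightarrow> real) \<Rightarrow> real) \<Rightarrow> ennreal" where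
  "inner_square k i g = (\<integral>\<^sup>+ t. (\<integral>\<^sup>+ s. ennreal (g (t(i := s))) \<partial>lborel)\<^sup>2 \<partial>lebesgue_prod ({..<k} - {i}))"

lemma insert_Diff_index: "i < k \<Longrightarrow> insert i ({..<k} - {i}) = {..<k}" for i k :: nat by auto

lemma measurable_section [measurable (raw)]:
  assumes g: "g \<in> borel_measurable (lebesgue_prod {..<k})" and i: "i < k"
  shows "(\<lambda>t. \<integral>\<^sup>+ s. ennreal (g (t(i := s))) \<partial>lborel) \<in> borel_measurable (lebesgue_prod ({..<k} - {i}))"
proof -
  have "(\<lambda>(t, s). t(i := s)) \<in> measurable (lebesgue_prod ({..<k} - {i}) \<Otimes>\<^sub>M lborel) (lebesgue_prod {..<k})"
    using measurable_add_dim[of i "{..<k} - {i}" "\<lambda>_. lborel"] unfolding insert_Diff_index[OF i] .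
  from measurable_compose[OF this g]
  have [measurable]: "(\<lambda>x. g ((fst x)(i := snd x))) \<in> borel_measurable (lebesgue_prod ({..<k} - {i}) \<Otimes>\<^sub>M lborel)"
    by (simp add: split_def)
  show ?thesis
    by (rule lborel.borel_measurable_nn_integral) (simp add: split_def)
qed

text \<open>Sections are taken at every t: either the line is that of a point of the product space,
  or the function vanishes along all of it.\<close>

lemma measurable_line:
  assumes g: "g \<in> borel_measurable (lebesgue_prod {..<k})" and i: "i < k" and out: "\<And>t. t \<notin> extensional {..<k} \<Longrightarrow> g t = 0"
  shows "(\<lambda>s. g (t(i := s))) \<in> borel_measurable (lborel :: real measure)"
proof (cases "t \<in> extensional ({..<k} - {i}) \<or> t(i := undefined) \<in> extensional ({..<k} - {i})")
  case True
  then have e: "t(i := undefined) \<in> space (lebesgue_prod ({..<k} - {i}))"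
    by (auto simp: space_PiM PiE_def extensional_def)
  have "(\<lambda>s. (t(i := undefined))(i := s)) \<in> measurable lborel (lebesgue_prod (insert i ({..<k} - {i})))"
    by (rule measurable_component_update[OF e]) simp
  then have "(\<lambda>s. t(i := s)) \<in> measurable lborel (lebesgue_prod {..<k})"
    unfolding insert_Diff_index[OF i] by simp
  then show ?thesis using g by (rule measurable_compose)
next
  case False
  have "t(i := s) \<notin> extensional {..<k}" for s
  proof
    assume "t(i := s) \<in> extensional {..<k}"
    then have "t(i := undefined) \<in> extensional ({..<k} - {i})"
      by (auto simp: extensional_def)
    then show False using False by simp
  qed
  then show ?thesis using out by simp
qed

lemma nn_integral_section:
  assumes "h \<in> borel_measurable (lebesgue_prod {..<k})" "i < k"
  shows "(\<integral>\<^sup>+ t. h t \<partial>lebesgue_prod {..<k}) = (\<integral>\<^sup>+ t. (\<integral>\<^sup>+ s. h (t(i := s)) \<partial>lborel) \<partial>lebesgue_prod ({..<k} - {i}))"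
  using product_nn_integral_insert[of "{..<k} - {i}" i h] assms unfolding insert_Diff_index[OF assms(2)] by simp

text \<open>Fubini's theorem in direction i; it serves for the hyperplanes bounding the truncated
  simplex.\<close>

lemma null_of_finite_sections:
  assumes S: "S \<in> sets (lebesgue_prod {..<k})" and i: "i < k" and fin: "\<And>t. finite {s. t(i := s) \<in> S}"
  shows "S \<in> null_sets (lebesgue_prod {..<k})"
proof -
  have "emeasure (lebesgue_prod {..<k}) S = (\<integral>\<^sup>+ t. indicator S t \<partial>lebesgue_prod {..<k})" using S by simp
  also have "\<dots> = (\<integral>\<^sup>+ t. (\<integral>\<^sup>+ s. indicator S (t(i := s)) \<partial>lborel) \<partial>lebesgue_prod ({..<k} - {i}))"
    by (rule nn_integral_section) (use S i in auto)
  also have "\<dots> = (\<integral>\<^sup>+ t. 0 \<partial>lebesgue_prod ({..<k} - {i}))"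
  proof (rule nn_integral_cong)
    fix t
    have "(\<integral>\<^sup>+ s. indicator S (t(i := s)) \<partial>lborel) = (\<integral>\<^sup>+ s. indicator {s. t(i := s) \<in> S} s \<partial>lborel)"
      by (intro nn_integral_cong) (simp add: indicator_def)
    also have "\<dots> = emeasure lborel {s. t(i := s) \<in> S}"
      using fin[of t] by (subst nn_integral_indicator) (auto intro: borel_closed finite_imp_closed)
    also have "\<dots> = 0" using fin[of t] by (simp add: emeasure_lborel_countable countable_finite)
    finally show "(\<integral>\<^sup>+ s. indicator S (t(i := s)) \<partial>lborel) = 0" .
  qed
  finally show ?thesis using S by auto
qed

text \<open>The inner integrals a of f and b of g are at most B, because both functions are bounded
  by B and live on [0, 1] in direction i; and a \<le> b + d for the inner L^1 distance d. Hence a^2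
  \<le> b^2 + 2 * B * d. So L^1 approximation controls J_i for bounded functions, which is why F
  gets truncated.\<close>

lemma inner_square_le:
  assumes [measurable]: "f \<in> borel_measurable (lebesgue_prod {..<k})" "g \<in> borel_measurable (lebesgue_prod {..<k})"
    and i: "i < k" and B: "0 \<le> B"
    and f: "\<And>t. 0 \<le> f t" "\<And>t. f t \<le> B" "\<And>t j. j < k \<Longrightarrow> f t \<noteq> 0 \<Longrightarrow> t j \<in> {0..1}" "\<And>t. t \<notin> extensional {..<k} \<Longrightarrow> f t = 0"
    and g: "\<And>t. 0 \<le> g t" "\<And>t. g t \<le> B" "\<And>t j. j < k \<Longrightarrow> g t \<noteq> 0 \<Longrightarrow> t j \<in> {0..1}" "\<And>t. t \<notin> extensional {..<k} \<Longrightarrow> g t = 0"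
  shows "inner_square k i f \<le> inner_square k i g + ennreal (2 * B) * (\<integral>\<^sup>+ t. ennreal \<bar>f t - g t\<bar> \<partial>lebesgue_prod {..<k})"
proof -
  define a where "a t = (\<integral>\<^sup>+ s. ennreal (f (t(i := s))) \<partial>lborel)" for t
  define b where "b t = (\<integral>\<^sup>+ s. ennreal (g (t(i := s))) \<partial>lborel)" for t
  define d where "d t = (\<integral>\<^sup>+ s. ennreal \<bar>f (t(i := s)) - g (t(i := s))\<bar> \<partial>lborel)" for t
  have bound: "(\<integral>\<^sup>+ s. ennreal (h (t(i := s))) \<partial>lborel) \<le> ennreal B"
    if h: "\<And>t. 0 \<le> h t" "\<And>t. h t \<le> B" "\<And>t j. j < k \<Longrightarrow> h t \<noteq> 0 \<Longrightarrow> t j \<in> {0..1}" for h :: "(nat \<Rightarrow> real) \<Rightarrow> real" and t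
  proof -
    have "(\<integral>\<^sup>+ s. ennreal (h (t(i := s))) \<partial>lborel) \<le> (\<integral>\<^sup>+ s. ennreal B * indicator {0..1::real} s \<partial>lborel)"
    proof (rule nn_integral_mono)
      fix s :: real
      show "ennreal (h (t(i := s))) \<le> ennreal B * indicator {0..1} s"
        using h(1)[of "t(i := s)"] h(2)[of "t(i := s)"] h(3)[of i "t(i := s)"] i
        by (cases "h (t(i := s)) = 0") (auto intro: ennreal_leI)
    qed
    also have "\<dots> = ennreal B" by (subst nn_integral_cmult) auto
    finally show ?thesis .
  qed
  have aB: "a t \<le> ennreal B" and bB: "b t \<le> ennreal B" for t
    unfolding a_def b_def by (rule bound; use f g in blast)+
  have abd: "a t \<le> b t + d t" for t
  proof -
    have ml[measurable]: "(\<lambda>s. f (t(i := s))) \<in> borel_measurable lborel" "(\<lambda>s. g (t(i := s))) \<in> borel_measurable lborel"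
      by (rule measurable_line[OF _ i]; use f g in auto)+
    have "a t \<le> (\<integral>\<^sup>+ s. ennreal (g (t(i := s))) + ennreal \<bar>f (t(i := s)) - g (t(i := s))\<bar> \<partial>lborel)"
      unfolding a_def by (intro nn_integral_mono) (simp add: ennreal_plus[symmetric] g ennreal_leI del: ennreal_plus)
    also have "\<dots> = b t + d t" unfolding b_def d_def by (rule nn_integral_add) measurable
    finally show ?thesis .
  qed
  have key: "(a t)\<^sup>2 \<le> (b t)\<^sup>2 + ennreal (2 * B) * d t" for t
  proof -
    have "(a t)\<^sup>2 = a t * a t" by (simp add: power2_eq_square)
    also have "\<dots> \<le> a t * (b t + d t)" by (intro mult_left_mono abd) simp
    also have "\<dots> = a t * b t + a t * d t" by (simp add: distrib_left)
    also have "\<dots> \<le> (b t + d t) * b t + ennreal B * d t" by (intro add_mono mult_right_mono abd aB) auto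
    also have "\<dots> = (b t)\<^sup>2 + b t * d t + ennreal B * d t" by (simp add: distrib_left distrib_right power2_eq_square mult.commute)
    also have "\<dots> \<le> (b t)\<^sup>2 + ennreal B * d t + ennreal B * d t" by (intro add_mono mult_right_mono bB) auto
    also have "\<dots> = (b t)\<^sup>2 + ennreal (2 * B) * d t"
    proof -
      have "ennreal (2 * B) = ennreal B + ennreal B" using B by (simp add: ennreal_plus[symmetric] del: ennreal_plus)
      then show ?thesis by (simp only: distrib_right add.assoc)
    qed
    finally show ?thesis .
  qed
  have [measurable]: "b \<in> borel_measurable (lebesgue_prod ({..<k} - {i}))"
    unfolding b_def by (rule measurable_section) (use i in auto)
  have [measurable]: "d \<in> borel_measurable (lebesgue_prod ({..<k} - {i}))"
    unfolding d_def by (rule measurable_section[of "\<lambda>t. \<bar>f t - g t\<bar>"]) (use i in auto)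
  have "inner_square k i f \<le> (\<integral>\<^sup>+ t. (b t)\<^sup>2 + ennreal (2 * B) * d t \<partial>lebesgue_prod ({..<k} - {i}))"
    unfolding inner_square_def a_def[symmetric] by (intro nn_integral_mono key)
  also have "\<dots> = inner_square k i g + ennreal (2 * B) * (\<integral>\<^sup>+ t. d t \<partial>lebesgue_prod ({..<k} - {i}))"
    unfolding inner_square_def b_def[symmetric] by (subst nn_integral_add) (auto simp: nn_integral_cmult)
  also have "(\<integral>\<^sup>+ t. d t \<partial>lebesgue_prod ({..<k} - {i})) = (\<integral>\<^sup>+ t. ennreal \<bar>f t - g t\<bar> \<partial>lebesgue_prod {..<k})"
    unfolding d_def by (rule nn_integral_section[symmetric]) (use i in auto)
  finally show ?thesis .
qed

lemma square_integral_le: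
  assumes [measurable]: "f \<in> borel_measurable M" "g \<in> borel_measurable M" and B: "0 \<le> B"
    and f: "\<And>t. 0 \<le> f t" "\<And>t. f t \<le> B" and g: "\<And>t. 0 \<le> g t" "\<And>t. g t \<le> (B::real)"
  shows "(\<integral>\<^sup>+ t. ennreal ((g t)\<^sup>2) \<partial>M) \<le> (\<integral>\<^sup>+ t. ennreal ((f t)\<^sup>2) \<partial>M) + ennreal (2 * B) * (\<integral>\<^sup>+ t. ennreal \<bar>f t - g t\<bar> \<partial>M)"
proof -
  have "(\<integral>\<^sup>+ t. ennreal ((g t)\<^sup>2) \<partial>M) \<le> (\<integral>\<^sup>+ t. ennreal ((f t)\<^sup>2) + ennreal (2 * B) * ennreal \<bar>f t - g t\<bar> \<partial>M)"
  proof (rule nn_integral_mono)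
    fix t
    have "(g t)\<^sup>2 - (f t)\<^sup>2 = (g t + f t) * (g t - f t)" by (simp add: power2_eq_square algebra_simps)
    also have "\<dots> \<le> (g t + f t) * \<bar>f t - g t\<bar>" using f[of t] g[of t] by (intro mult_left_mono) auto
    also have "\<dots> \<le> (2 * B) * \<bar>f t - g t\<bar>" using f[of t] g[of t] by (intro mult_right_mono) auto
    finally have "(g t)\<^sup>2 \<le> (f t)\<^sup>2 + (2 * B) * \<bar>f t - g t\<bar>" by linarith
    then have "ennreal ((g t)\<^sup>2) \<le> ennreal ((f t)\<^sup>2 + (2 * B) * \<bar>f t - g t\<bar>)" by (rule ennreal_leI)
    also have "\<dots> = ennreal ((f t)\<^sup>2) + ennreal (2 * B) * ennreal \<bar>f t - g t\<bar>"
      using B by (simp add: ennreal_plus ennreal_mult)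
    finally show "ennreal ((g t)\<^sup>2) \<le> ennreal ((f t)\<^sup>2) + ennreal (2 * B) * ennreal \<bar>f t - g t\<bar>" .
  qed
  also have "\<dots> = (\<integral>\<^sup>+ t. ennreal ((f t)\<^sup>2) \<partial>M) + ennreal (2 * B) * (\<integral>\<^sup>+ t. ennreal \<bar>f t - g t\<bar> \<partial>M)"
    by (subst nn_integral_add) (auto simp: nn_integral_cmult)
  finally show ?thesis .
qed

lemma emeasure_grid_interval: "(N::nat) \<ge> 1 \<Longrightarrow> emeasure lborel {real a / real N..<real (Suc a) / real N} = ennreal (1 / real N)"
proof -
  assume N: "N \<ge> 1"
  then have "real a / real N \<le> real (Suc a) / real N" by (intro divide_right_mono) auto
  then have "emeasure lborel {real a / real N..<real (Suc a) / real N} = ennreal (real (Suc a) / real N - real a / real N)" by simp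
  also have "real (Suc a) / real N - real a / real N = 1 / real N" by (simp add: diff_divide_distrib[symmetric])
  finally show ?thesis .
qed

lemma nn_integral_grid_indicators:
  fixes N :: nat
  assumes "finite I" "N \<ge> 1"
  shows "(\<integral>\<^sup>+ t. ennreal (\<Prod>i\<in>I. indicator {real (j i) / N..<real (Suc (j i)) / N} (t i)) \<partial>lebesgue_prod I) = ennreal (1 / N ^ card I)"
proof -
  have "(\<integral>\<^sup>+ t. ennreal (\<Prod>i\<in>I. indicator {real (j i) / N..<real (Suc (j i)) / N} (t i)) \<partial>lebesgue_prod I)
     = (\<integral>\<^sup>+ t. (\<Prod>i\<in>I. indicator {real (j i) / N..<real (Suc (j i)) / N} (t i)) \<partial>lebesgue_prod I)"
    by (intro nn_integral_cong) (simp add: prod_ennreal[symmetric] ennreal_indicator)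
  also have "\<dots> = (\<Prod>i\<in>I. \<integral>\<^sup>+ s. indicator {real (j i) / N..<real (Suc (j i)) / N} s \<partial>lborel)"
    by (rule product_nn_integral_prod) (use assms in auto)
  also have "\<dots> = (\<Prod>i\<in>I. ennreal (1 / N))"
    using emeasure_grid_interval[OF assms(2)] by simp
  also have "\<dots> = ennreal (1 / N ^ card I)" by (simp add: ennreal_power power_divide)
  finally show ?thesis .
qed

lemma nn_integral_sum_grid:
  fixes N :: nat
  assumes "finite I" "N \<ge> 1" "finite J" and c: "\<And>j. j \<in> J \<Longrightarrow> 0 \<le> c j"
  shows "(\<integral>\<^sup>+ t. ennreal (\<Sum>j\<in>J. c j * (\<Prod>i\<in>I. indicator {real (q j i) / N..<real (Suc (q j i)) / N} (t i))) \<partial>lebesgue_prod I)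
    = ennreal ((\<Sum>j\<in>J. c j) / N ^ card I)"
proof -
  have "(\<integral>\<^sup>+ t. ennreal (\<Sum>j\<in>J. c j * (\<Prod>i\<in>I. indicator {real (q j i) / N..<real (Suc (q j i)) / N} (t i))) \<partial>lebesgue_prod I)
    = (\<integral>\<^sup>+ t. (\<Sum>j\<in>J. ennreal (c j) * ennreal (\<Prod>i\<in>I. indicator {real (q j i) / N..<real (Suc (q j i)) / N} (t i))) \<partial>lebesgue_prod I)"
    using c by (intro nn_integral_cong) (simp add: sum_ennreal[symmetric] ennreal_mult prod_nonneg)
  also have "\<dots> = (\<Sum>j\<in>J. ennreal (c j) * (\<integral>\<^sup>+ t. ennreal (\<Prod>i\<in>I. indicator {real (q j i) / N..<real (Suc (q j i)) / N} (t i)) \<partial>lebesgue_prod I))"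
    by (subst nn_integral_sum) (auto simp: nn_integral_cmult)
  also have "\<dots> = (\<Sum>j\<in>J. ennreal (c j * (1 / N ^ card I)))"
  proof (rule sum.cong[OF refl])
    fix j assume "j \<in> J"
    show "ennreal (c j) * (\<integral>\<^sup>+ t. ennreal (\<Prod>i\<in>I. indicator {real (q j i) / N..<real (Suc (q j i)) / N} (t i)) \<partial>lebesgue_prod I) = ennreal (c j * (1 / N ^ card I))"
      unfolding nn_integral_grid_indicators[OF assms(1,2)] by (rule ennreal_mult[symmetric]) (use c[OF \<open>j \<in> J\<close>] in auto)
  qed
  also have "\<dots> = ennreal (\<Sum>j\<in>J. c j * (1 / N ^ card I))" using c by (intro sum_ennreal) auto
  finally show ?thesis by (simp add: sum_divide_distrib)
qed

lemma grid_function_square: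
  assumes "N \<ge> 1" "t \<in> extensional {..<k}"
  shows "(grid_function k N \<phi> t)\<^sup>2 = grid_function k N (\<lambda>j. (\<phi> j)\<^sup>2) t"
  using assms grid_function_eq grid_function_outside by (cases "t \<in> unit_cube k") auto

lemma square_integral_grid:
  assumes N: "N \<ge> 1"
  shows "(\<integral>\<^sup>+ t. ennreal ((grid_function k N \<phi> t)\<^sup>2) \<partial>lebesgue_prod {..<k}) = ennreal ((\<Sum>j\<in>PiE {..<k} (\<lambda>_. {..<N}). (\<phi> j)\<^sup>2) / N ^ k)"
proof -
  have "(\<integral>\<^sup>+ t. ennreal ((grid_function k N \<phi> t)\<^sup>2) \<partial>lebesgue_prod {..<k}) = (\<integral>\<^sup>+ t. ennreal (grid_function k N (\<lambda>j. (\<phi> j)\<^sup>2) t) \<partial>lebesgue_prod {..<k})"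
    by (intro nn_integral_cong) (simp add: grid_function_square[OF N] space_PiM PiE_def)
  also have "\<dots> = ennreal ((\<Sum>j\<in>PiE {..<k} (\<lambda>_. {..<N}). (\<phi> j)\<^sup>2) / N ^ card {..<k})"
    unfolding grid_function_def by (rule nn_integral_sum_grid) (use N in \<open>auto intro: finite_PiE\<close>)
  finally show ?thesis by simp
qed

text \<open>In the square of the inner integral two cells interact only if they agree outside
  coordinate i, which gives the pairs j and j(i := v). The power N ^ (k + 1) consists of N ^ 2 from
  the two inner integrals and N ^ (k - 1) from the outer one.\<close>

lemma inner_square_grid:
  assumes N: "N \<ge> 1" and i: "i < k" and \<phi>: "\<And>j. 0 \<le> \<phi> j"
  shows "inner_square k i (grid_function k N \<phi>) = ennreal ((\<Sum>j\<in>PiE {..<k} (\<lambda>_. {..<N}). \<Sum>v<N. \<phi> j * \<phi> (j(i := v))) / N ^ Suc k)"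
proof -
  define S where "S = PiE {..<k} (\<lambda>_. {..<N})"
  define I where "I = {..<k} - {i}"
  define ind where "ind a s = (indicator {real a / N..<real (Suc a) / N} s :: real)" for a :: nat and s :: real
  define w where "w j t = (\<Prod>l\<in>I. ind (j l) (t l))" for j :: "nat \<Rightarrow> nat" and t :: "nat \<Rightarrow> real"
  have finS: "finite S" unfolding S_def by (intro finite_PiE) auto
  have finI: "finite I" unfolding I_def by simp
  have cardI: "card I = k - 1" unfolding I_def using i by simp
  have w0: "0 \<le> w j t" for j t unfolding w_def ind_def by (intro prod_nonneg) auto
  have line: "(\<integral>\<^sup>+ s. ennreal (grid_function k N \<phi> (t(i := s))) \<partial>lborel) = ennreal ((\<Sum>j\<in>S. \<phi> j * w j t) / N)" for t
  proof -
    have g: "grid_function k N \<phi> (t(i := s)) = (\<Sum>j\<in>S. \<phi> j * w j t * ind (j i) s)" for s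
    proof -
      have "(\<Prod>l<k. ind (j l) ((t(i := s)) l)) = ind (j i) s * w j t" for j
      proof -
        have "(\<Prod>l<k. ind (j l) ((t(i := s)) l)) = ind (j i) ((t(i := s)) i) * (\<Prod>l\<in>{..<k} - {i}. ind (j l) ((t(i := s)) l))"
          by (rule prod.remove) (use i in auto)
        also have "(\<Prod>l\<in>{..<k} - {i}. ind (j l) ((t(i := s)) l)) = w j t" unfolding w_def I_def by (intro prod.cong) auto
        finally show ?thesis by simp
      qed
      then show ?thesis unfolding grid_function_def S_def[symmetric] ind_def[symmetric] by (simp add: mult_ac)
    qed
    have "(\<integral>\<^sup>+ s. ennreal (grid_function k N \<phi> (t(i := s))) \<partial>lborel) = (\<integral>\<^sup>+ s. (\<Sum>j\<in>S. ennreal (\<phi> j * w j t) * ennreal (ind (j i) s)) \<partial>lborel)"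
      unfolding g using \<phi> w0 by (intro nn_integral_cong) (simp add: sum_ennreal[symmetric] ennreal_mult ind_def)
    also have "\<dots> = (\<Sum>j\<in>S. ennreal (\<phi> j * w j t) * (\<integral>\<^sup>+ s. ennreal (ind (j i) s) \<partial>lborel))"
      unfolding ind_def by (subst nn_integral_sum) (auto simp: nn_integral_cmult)
    also have "\<dots> = (\<Sum>j\<in>S. ennreal (\<phi> j * w j t * (1 / N)))"
    proof (rule sum.cong[OF refl])
      fix j
      have "(\<integral>\<^sup>+ s. ennreal (ind (j i) s) \<partial>lborel) = ennreal (1 / N)"
        unfolding ind_def ennreal_indicator using emeasure_grid_interval[OF N, of "j i"] by simp
      then show "ennreal (\<phi> j * w j t) * (\<integral>\<^sup>+ s. ennreal (ind (j i) s) \<partial>lborel) = ennreal (\<phi> j * w j t * (1 / N))"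
        using \<phi>[of j] w0[of j t] by (simp only: ennreal_mult mult_nonneg_nonneg divide_nonneg_nonneg of_nat_0_le_iff zero_le_one)
    qed
    also have "\<dots> = ennreal (\<Sum>j\<in>S. \<phi> j * w j t * (1 / N))" using \<phi> w0 by (intro sum_ennreal) auto
    finally show ?thesis by (simp add: sum_divide_distrib)
  qed
  have ww: "w j t * w j' t = (if \<forall>l\<in>I. j l = j' l then w j t else 0)" for j j' t
  proof (cases "\<forall>l\<in>I. j l = j' l")
    case True
    then have "w j' t = w j t" unfolding w_def by (intro prod.cong) auto
    moreover have "w j t * w j t = w j t" unfolding w_def prod.distrib[symmetric] ind_def by (intro prod.cong) (auto simp: indicator_def)
    ultimately show ?thesis using True by simp
  next
    case False
    then obtain l where l: "l \<in> I" "j l \<noteq> j' l" by auto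
    have "ind (j l) (t l) * ind (j' l) (t l) = 0"
      using l(2) mem_grid_interval_iff[OF N, of "t l" "j l"] mem_grid_interval_iff[OF N, of "t l" "j' l"]
      unfolding ind_def by (auto simp: indicator_def simp del: atLeastLessThan_iff)
    then have "w j t * w j' t = 0" unfolding w_def prod.distrib[symmetric] using finI l(1) by (intro prod_zero) auto
    then show ?thesis using False by (simp only: if_False)
  qed
  have sq: "(\<integral>\<^sup>+ s. ennreal (grid_function k N \<phi> (t(i := s))) \<partial>lborel)\<^sup>2
     = ennreal (\<Sum>x\<in>S \<times> S. (if \<forall>l\<in>I. fst x l = snd x l then \<phi> (fst x) * \<phi> (snd x) / N ^ 2 else 0) * w (fst x) t)" for t
  proof -
    have "(\<integral>\<^sup>+ s. ennreal (grid_function k N \<phi> (t(i := s))) \<partial>lborel)\<^sup>2 = ennreal (((\<Sum>j\<in>S. \<phi> j * w j t) / N)\<^sup>2)"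
      unfolding line using \<phi> w0 by (intro ennreal_power) (auto intro!: sum_nonneg divide_nonneg_nonneg)
    also have "((\<Sum>j\<in>S. \<phi> j * w j t) / N)\<^sup>2 = (\<Sum>x\<in>S \<times> S. \<phi> (fst x) * w (fst x) t * (\<phi> (snd x) * w (snd x) t)) / N ^ 2"
      by (simp add: power_divide power2_eq_square sum_product sum.cartesian_product split_def)
    also have "\<dots> = (\<Sum>x\<in>S \<times> S. (if \<forall>l\<in>I. fst x l = snd x l then \<phi> (fst x) * \<phi> (snd x) / N ^ 2 else 0) * w (fst x) t)"
      unfolding sum_divide_distrib
    proof (rule sum.cong[OF refl])
      fix x
      have "\<phi> (fst x) * w (fst x) t * (\<phi> (snd x) * w (snd x) t) = \<phi> (fst x) * \<phi> (snd x) * (w (fst x) t * w (snd x) t)" by simp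
      then show "\<phi> (fst x) * w (fst x) t * (\<phi> (snd x) * w (snd x) t) / N ^ 2
         = (if \<forall>l\<in>I. fst x l = snd x l then \<phi> (fst x) * \<phi> (snd x) / N ^ 2 else 0) * w (fst x) t"
        using ww[of "fst x" t "snd x"]
        by (auto simp only: if_P if_not_P mult_zero_left mult_zero_right div_0 times_divide_eq_left split: if_split)
    qed
    finally show ?thesis .
  qed
  have "inner_square k i (grid_function k N \<phi>)
    = ennreal ((\<Sum>x\<in>S \<times> S. if \<forall>l\<in>I. fst x l = snd x l then \<phi> (fst x) * \<phi> (snd x) / N ^ 2 else 0) / N ^ card I)"
    unfolding inner_square_def sq w_def ind_def I_def[symmetric]
    by (rule nn_integral_sum_grid) (use finI finS N \<phi> in auto)
  also have "(\<Sum>x\<in>S \<times> S. if \<forall>l\<in>I. fst x l = snd x l then \<phi> (fst x) * \<phi> (snd x) / N ^ 2 else 0)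
     = (\<Sum>j\<in>S. \<Sum>v<N. \<phi> j * \<phi> (j(i := v))) / N ^ 2"
  proof -
    have "(\<Sum>j'\<in>S. if \<forall>l\<in>I. j l = j' l then \<phi> j * \<phi> j' / N ^ 2 else 0) = (\<Sum>v<N. \<phi> j * \<phi> (j(i := v))) / N ^ 2" if j: "j \<in> S" for j
    proof -
      have img: "{j' \<in> S. \<forall>l\<in>I. j l = j' l} = (\<lambda>v. j(i := v)) ` {..<N}"
      proof (intro equalityI subsetI)
        fix j' assume j': "j' \<in> {j' \<in> S. \<forall>l\<in>I. j l = j' l}"
        have "j' x = (j(i := j' i)) x" for x
          using j j' unfolding S_def I_def by (cases "x = i"; cases "x < k") (simp_all add: PiE_iff extensional_def)
        then have "j' = j(i := j' i)" by (rule ext)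
        moreover have "j' i \<in> {..<N}" using j' i unfolding S_def by (simp add: PiE_iff)
        ultimately show "j' \<in> (\<lambda>v. j(i := v)) ` {..<N}" by (rule image_eqI)
      next
        fix j' assume "j' \<in> (\<lambda>v. j(i := v)) ` {..<N}"
        then obtain v where v: "v < N" "j' = j(i := v)" by auto
        have "j' l = j l" if "l \<in> I" for l using that unfolding v(2) I_def by simp
        moreover have "j' \<in> S" using j i v(1) unfolding S_def v(2) by (simp add: PiE_iff extensional_def)
        ultimately show "j' \<in> {j' \<in> S. \<forall>l\<in>I. j l = j' l}" by simp
      qed
      have "(\<Sum>j'\<in>S. if \<forall>l\<in>I. j l = j' l then \<phi> j * \<phi> j' / N ^ 2 else 0) = (\<Sum>j'\<in>{j' \<in> S. \<forall>l\<in>I. j l = j' l}. \<phi> j * \<phi> j' / N ^ 2)"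
        by (rule sum.inter_filter[OF finS, symmetric])
      also have "\<dots> = (\<Sum>v<N. \<phi> j * \<phi> (j(i := v)) / N ^ 2)"
        unfolding img by (subst sum.reindex) (auto simp: inj_on_def dest: fun_cong[where x = i])
      finally show ?thesis by (simp add: sum_divide_distrib)
    qed
    then show ?thesis unfolding sum_divide_distrib sum.cartesian_product' fst_conv snd_conv by (rule sum.cong[OF refl])
  qed
  also have "(\<Sum>j\<in>S. \<Sum>v<N. \<phi> j * \<phi> (j(i := v))) / N ^ 2 / N ^ card I = (\<Sum>j\<in>S. \<Sum>v<N. \<phi> j * \<phi> (j(i := v))) / N ^ Suc k"
  proof -
    have "Suc k = 2 + card I" using cardI i by simp
    then show ?thesis by (simp only: divide_divide_eq_left power_add of_nat_mult)
  qed
  finally show ?thesis unfolding S_def .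
qed

text \<open>Passing to a majorant of the absolute value can only increase J_i. A Bochner integral
  that does not exist has the value 0, which is harmless for an upper bound.\<close>

lemma ennreal_J_functional_le:
  assumes f: "\<And>t. ennreal \<bar>F t\<bar> \<le> ennreal (f t) \<or> t \<notin> extensional {..<k}" and i: "i < k"
  shows "ennreal (J_functional k i F) \<le> inner_square k i f"
proof -
  define h where "h t = indicator (orthant ({..<k} - {i})) t *\<^sub>R (LINT s:{0..}|lborel. F (t(i := s)))\<^sup>2" for t
  have J: "J_functional k i F = integral\<^sup>L (lebesgue_prod ({..<k} - {i})) h"
    unfolding J_functional_def set_lebesgue_integral_def h_def ..
  have h0: "0 \<le> h t" for t unfolding h_def by simp
  have hle: "ennreal (h t) \<le> (\<integral>\<^sup>+ s. ennreal (f (t(i := s))) \<partial>lborel)\<^sup>2" if t: "t \<in> space (lebesgue_prod ({..<k} - {i}))" for t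
  proof -
    define c where "c = (LINT s:{0..}|lborel. F (t(i := s)))"
    have ext: "t(i := s) \<in> extensional {..<k}" for s using t i by (auto simp: space_PiM PiE_def extensional_def)
    have "ennreal \<bar>c\<bar> \<le> (\<integral>\<^sup>+ s. ennreal (f (t(i := s))) \<partial>lborel)"
    proof (cases "integrable lborel (\<lambda>s. indicator {0..} s *\<^sub>R F (t(i := s)))")
      case True
      have "ennreal \<bar>c\<bar> \<le> (\<integral>\<^sup>+ s. ennreal (norm (indicator {0..} s *\<^sub>R F (t(i := s)))) \<partial>lborel)"
        unfolding c_def set_lebesgue_integral_def using integral_norm_bound_ennreal[OF True] by simp
      also have "\<dots> \<le> (\<integral>\<^sup>+ s. ennreal (f (t(i := s))) \<partial>lborel)"
      proof (rule nn_integral_mono)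
        fix s :: real
        show "ennreal (norm (indicator {0..} s *\<^sub>R F (t(i := s)))) \<le> ennreal (f (t(i := s)))"
          using f[of "t(i := s)"] ext[of s] by (cases "s \<in> {0..}") auto
      qed
      finally show ?thesis .
    next
      case False
      then have "c = 0" unfolding c_def set_lebesgue_integral_def by (rule not_integrable_integral_eq)
      then show ?thesis by simp
    qed
    then have "(ennreal \<bar>c\<bar>)\<^sup>2 \<le> (\<integral>\<^sup>+ s. ennreal (f (t(i := s))) \<partial>lborel)\<^sup>2" by (intro power_mono) auto
    moreover have "ennreal (h t) \<le> (ennreal \<bar>c\<bar>)\<^sup>2"
      unfolding h_def c_def[symmetric] by (simp add: ennreal_power indicator_def)
    ultimately show ?thesis by (rule order_trans[rotated])
  qed
  have "ennreal (J_functional k i F) \<le> (\<integral>\<^sup>+ t. ennreal (h t) \<partial>lebesgue_prod ({..<k} - {i}))"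
  proof (cases "integrable (lebesgue_prod ({..<k} - {i})) h")
    case True
    then show ?thesis unfolding J using nn_integral_eq_integral[OF True] h0 by simp
  next
    case False
    then show ?thesis unfolding J by (simp add: not_integrable_integral_eq)
  qed
  also have "\<dots> \<le> inner_square k i f" unfolding inner_square_def by (rule nn_integral_mono) (rule hle)
  finally show ?thesis .
qed

text \<open>Monotone convergence, for the inner and then for the outer integral.\<close>

lemma inner_square_truncate:
  assumes f [measurable]: "f \<in> borel_measurable (lebesgue_prod {..<k})" and i: "i < k"
    and f0: "\<And>t. 0 \<le> f t" and out: "\<And>t. t \<notin> extensional {..<k} \<Longrightarrow> f t = 0"
  shows "(\<lambda>B. inner_square k i (\<lambda>t. min (f t) (real B))) \<longlonglongrightarrow> inner_square k i f"
proof -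
  define g where "g B t = min (f t) (real B)" for B t
  have gm [measurable]: "g B \<in> borel_measurable (lebesgue_prod {..<k})" for B unfolding g_def by measurable
  have inc: "g A t \<le> g B t" if "A \<le> B" for A B t using that unfolding g_def by (auto simp: min_def)
  have lim: "(\<lambda>B. ennreal (g B t)) \<longlonglongrightarrow> ennreal (f t)" for t
  proof (rule tendsto_eventually)
    obtain n where n: "f t \<le> real n" using real_arch_simple by blast
    show "\<forall>\<^sub>F B in sequentially. ennreal (g B t) = ennreal (f t)"
      using eventually_ge_at_top[of n]
    proof (rule eventually_mono)
      fix B assume "n \<le> B"
      then have "f t \<le> real B" using n by (meson of_nat_le_iff order_trans)
      then show "ennreal (g B t) = ennreal (f t)" unfolding g_def by simp
    qed
  qed
  define a where "a B t = (\<integral>\<^sup>+ s. ennreal (g B (t(i := s))) \<partial>lborel)" for B t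
  have am: "a B \<in> borel_measurable (lebesgue_prod ({..<k} - {i}))" for B
    unfolding a_def by (rule measurable_section[OF gm i])
  have ainc: "a A t \<le> a B t" if "A \<le> B" for A B t
    unfolding a_def using inc[OF that] by (intro nn_integral_mono ennreal_leI) auto
  have alim: "(\<lambda>B. a B t) \<longlonglongrightarrow> (\<integral>\<^sup>+ s. ennreal (f (t(i := s))) \<partial>lborel)" for t
    unfolding a_def
  proof (rule nn_integral_LIMSEQ)
    show "incseq (\<lambda>B s. ennreal (g B (t(i := s))))"
      unfolding incseq_def le_fun_def using inc by (auto intro: ennreal_leI)
    show "(\<lambda>s. ennreal (g B (t(i := s)))) \<in> borel_measurable lborel" for B
    proof -
      have "(\<lambda>s. g B (t(i := s))) \<in> borel_measurable lborel"
        by (rule measurable_line[OF gm i]) (use out in \<open>auto simp: g_def\<close>)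
      then show ?thesis by measurable
    qed
    show "(\<lambda>B. ennreal (g B (t(i := s)))) \<longlonglongrightarrow> ennreal (f (t(i := s)))" for s by (rule lim)
  qed
  show ?thesis unfolding inner_square_def g_def[symmetric] a_def[symmetric]
  proof (rule nn_integral_LIMSEQ)
    show "incseq (\<lambda>B t. (a B t)\<^sup>2)"
      unfolding incseq_def le_fun_def using ainc by (auto intro: power_mono)
    show "(\<lambda>t. (a B t)\<^sup>2) \<in> borel_measurable (lebesgue_prod ({..<k} - {i}))" for B using am[of B] by measurable
    show "(\<lambda>B. (a B t)\<^sup>2) \<longlonglongrightarrow> (\<integral>\<^sup>+ s. ennreal (f (t(i := s))) \<partial>lborel)\<^sup>2" for t
      unfolding power2_eq_square by (rule tendsto_mult_ennreal[OF alim alim]) auto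
  qed
qed

text \<open>The upper corner of the cell satisfies the inequalities of the truncated simplex, just
  as the sieve demands of the support of \<Phi>.\<close>

definition inside_cell :: "nat \<Rightarrow> real \<Rightarrow> nat \<Rightarrow> (nat \<Rightarrow> nat) \<Rightarrow> bool" where
  "inside_cell k \<alpha> N j \<longleftrightarrow> (\<Sum>i<k. Suc (j i)) \<le> N \<and> (\<forall>i<k. real (Suc (j i)) \<le> \<alpha> * N)"

lemma eventually_inside:
  assumes t: "t \<in> unit_cube k" and s: "(\<Sum>i<k. t i) < 1" and a: "\<And>i. i < k \<Longrightarrow> t i < \<alpha>"
  shows "\<forall>\<^sub>F N in sequentially. inside_cell k \<alpha> N (grid_cell k N t)"
proof -
  have t0: "\<And>i. i < k \<Longrightarrow> 0 \<le> t i" using unit_cubeD(1)[OF t] by blast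
  have 1: "\<forall>\<^sub>F N in sequentially. \<forall>i\<in>{..<k}. real (Suc (nat \<lfloor>real N * t i\<rfloor>)) \<le> \<alpha> * real N \<or> t i < 0"
    using a by (intro eventually_ball_finite ballI eventually_grid_below) auto
  define S where "S = (\<Sum>i<k. t i)"
  obtain M :: nat where M: "real k / (1 - S) < M" using reals_Archimedean2 by blast
  have 2: "\<forall>\<^sub>F N in sequentially. (\<Sum>i<k. Suc (nat \<lfloor>real N * t i\<rfloor>)) \<le> N"
    using eventually_ge_at_top[of M]
  proof (rule eventually_mono)
    fix N assume N: "M \<le> N"
    have "real k / (1 - S) < N" using M N by linarith
    then have kS: "real k < N * (1 - S)" using s unfolding S_def by (simp add: field_simps)
    have "real (\<Sum>i<k. Suc (nat \<lfloor>real N * t i\<rfloor>)) = (\<Sum>i<k. 1 + real (nat \<lfloor>real N * t i\<rfloor>))" by simp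
    also have "\<dots> \<le> (\<Sum>i<k. 1 + real N * t i)"
      using t0 by (intro sum_mono add_left_mono) (auto simp: zero_le_mult_iff)
    also have "\<dots> = real k + N * S" unfolding S_def by (simp add: sum.distrib sum_distrib_left)
    also have "\<dots> \<le> N" using kS by (simp add: algebra_simps)
    finally show "(\<Sum>i<k. Suc (nat \<lfloor>real N * t i\<rfloor>)) \<le> N" by (simp only: of_nat_le_iff)
  qed
  show ?thesis using eventually_conj[OF 1 2]
  proof (rule eventually_mono)
    fix N assume "(\<forall>i\<in>{..<k}. real (Suc (nat \<lfloor>real N * t i\<rfloor>)) \<le> \<alpha> * real N \<or> t i < 0) \<and> (\<Sum>i<k. Suc (nat \<lfloor>real N * t i\<rfloor>)) \<le> N"
    then show "inside_cell k \<alpha> N (grid_cell k N t)"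
      unfolding inside_cell_def grid_cell_def using t0 by (simp add: not_less[symmetric])
  qed
qed

text \<open>The cell of a point in the interior of the truncated simplex is eventually inside, which
  may fail for points with sum 1 or with a coordinate \<alpha>. These form finitely many
  hyperplanes, each met at most once by every line in a suitable coordinate direction.\<close>

lemma null_boundary:
  assumes "k \<ge> 1"
  shows "AE t in lebesgue_prod {..<k}. (\<Sum>i<k. t i) \<noteq> 1 \<and> (\<forall>i<k. t i \<noteq> \<alpha>)"
proof -
  define U where "U = {t \<in> space (lebesgue_prod {..<k}). (\<Sum>i<k. t i) = 1}"
  define V where "V i = {t \<in> space (lebesgue_prod {..<k}). t i = \<alpha>}" for i
  have U: "U \<in> null_sets (lebesgue_prod {..<k})"
  proof (rule null_of_finite_sections[of _ _ 0])
    show "U \<in> sets (lebesgue_prod {..<k})" unfolding U_def by measurable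
    show "finite {s. t(0 := s) \<in> U}" for t
    proof (rule finite_subset)
      have "(\<Sum>i<k. (t(0 := s)) i) = s + (\<Sum>i\<in>{..<k} - {0}. t i)" for s
        using assms by (subst sum.remove[of _ 0]) (auto intro!: sum.cong)
      then show "{s. t(0 := s) \<in> U} \<subseteq> {1 - (\<Sum>i\<in>{..<k} - {0}. t i)}" unfolding U_def by auto
    qed simp
  qed (use assms in auto)
  have V: "V i \<in> null_sets (lebesgue_prod {..<k})" if "i < k" for i
  proof (rule null_of_finite_sections[OF _ that])
    have [measurable]: "(\<lambda>t. t i) \<in> borel_measurable (lebesgue_prod {..<k})"
      using measurable_component_singleton[of i "{..<k}" "\<lambda>_. lborel :: real measure"] that by simp
    show "V i \<in> sets (lebesgue_prod {..<k})" unfolding V_def by measurable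
    show "finite {s. t(i := s) \<in> V i}" for t
      by (rule finite_subset[of _ "{\<alpha>}"]) (auto simp: V_def)
  qed
  have "AE t in lebesgue_prod {..<k}. t \<notin> U" using U by (rule AE_not_in)
  moreover have "AE t in lebesgue_prod {..<k}. \<forall>i\<in>{..<k}. t \<notin> V i"
    using V by (subst AE_ball_countable) (auto intro: AE_not_in)
  ultimately show ?thesis
  proof (rule AE_mp[OF AE_conjI], intro AE_I2 impI)
    fix t assume "t \<in> space (lebesgue_prod {..<k})" "t \<notin> U \<and> (\<forall>i\<in>{..<k}. t \<notin> V i)"
    then show "(\<Sum>i<k. t i) \<noteq> 1 \<and> (\<forall>i<k. t i \<noteq> \<alpha>)" unfolding U_def V_def by auto
  qed
qed

lemma AE_cube_of_AE: "AE t in lebesgue_prod {..<k}. Q t \<Longrightarrow> AE t in cube_measure k. t \<in> unit_cube k \<and> Q t"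
  unfolding cube_measure_def by (subst AE_density) (auto simp: indicator_def elim!: AE_mp)

text \<open>A grid function close to f in L^1 is clipped to [0, B] and set to 0 on the cells that
  are not inside. Clipping only improves the approximation, and the discarded cells cost the
  integral of f over them, which tends to 0.\<close>

lemma grid_L1_approx:
  fixes f :: "(nat \<Rightarrow> real) \<Rightarrow> real" and \<alpha> B e :: real
  assumes k: "k \<ge> 1" and f [measurable]: "f \<in> borel_measurable (lebesgue_prod {..<k})"
    and B: "0 < B" and f0: "\<And>t. 0 \<le> f t" and fB: "\<And>t. f t \<le> B" and supp: "\<And>t. f t \<noteq> 0 \<Longrightarrow> t \<in> truncated_simplex k \<alpha>"
    and e: "e > 0"
  shows "\<exists>(N::nat) (\<phi>::(nat \<Rightarrow> nat) \<Rightarrow> real). N \<ge> 1 \<and> (\<forall>j. 0 \<le> \<phi> j \<and> \<phi> j \<le> B) \<and> (\<forall>j. \<phi> j \<noteq> 0 \<longrightarrow> j \<in> PiE {..<k} (\<lambda>_. {..<N}) \<and> inside_cell k \<alpha> N j) \<and>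
    (\<integral>\<^sup>+ t. ennreal \<bar>f t - grid_function k N \<phi> t\<bar> \<partial>lebesgue_prod {..<k}) \<le> ennreal e"
proof -
  define ins where "ins N j = (of_bool (inside_cell k \<alpha> N j) :: real)" for N j
  have fmc: "f \<in> borel_measurable (cube_measure k)" using f by (simp add: measurable_cong_sets[OF sets_cube_measure])
  have "integrable (cube_measure k) f"
  proof (rule finite_measure.integrable_const_bound[OF finite_measure_cube _ fmc])
    show "AE t in cube_measure k. norm (f t) \<le> B" by (rule AE_I2) (simp add: f0 fB)
  qed
  then have "grid_approximable k f" by (rule grid_approximable_integrable)
  then have ev1: "\<forall>\<^sub>F N in sequentially. \<exists>\<phi>. (\<integral>\<^sup>+ t. ennreal \<bar>f t - grid_function k N \<phi> t\<bar> \<partial>cube_measure k) \<le> ennreal (e / 2)"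
    using e unfolding grid_approximable_def by auto
  have suppD: "t \<in> extensional {..<k}" "(\<Sum>i<k. t i) \<le> 1" "\<And>i. i < k \<Longrightarrow> 0 \<le> t i \<and> t i \<le> \<alpha>" if "f t \<noteq> 0" for t
    using supp[OF that] unfolding truncated_simplex_def by (auto simp: PiE_iff)
  have ae: "AE t in lebesgue_prod {..<k}. f t \<noteq> 0 \<longrightarrow> (\<Sum>i<k. t i) < 1 \<and> (\<forall>i<k. t i < \<alpha>)"
    using null_boundary[OF k, of \<alpha>]
  proof (rule AE_mp, intro AE_I2 impI)
    fix t assume "(\<Sum>i<k. t i) \<noteq> 1 \<and> (\<forall>i<k. t i \<noteq> \<alpha>)" "f t \<noteq> 0"
    then show "(\<Sum>i<k. t i) < 1 \<and> (\<forall>i<k. t i < \<alpha>)" using suppD(2,3) by (metis less_le)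
  qed
  have "(\<lambda>N. \<integral>\<^sup>+ t. ennreal \<bar>f t - f t * grid_function k (Suc N) (ins (Suc N)) t\<bar> \<partial>cube_measure k) \<longlonglongrightarrow> 0"
  proof (rule dominated_L1_convergence[where C = B])
    show "\<bar>f t * grid_function k (Suc N) (ins (Suc N)) t\<bar> \<le> B" if "t \<in> unit_cube k" for N t
      using f0[of t] fB[of t] by (subst grid_function_eq[OF _ that]) (auto simp: ins_def)
    show "AE t in cube_measure k. (\<lambda>N. f t * grid_function k (Suc N) (ins (Suc N)) t) \<longlonglongrightarrow> f t"
      using AE_cube_of_AE[OF ae]
    proof (rule AE_mp, intro AE_I2 impI)
      fix t assume t: "t \<in> unit_cube k \<and> (f t \<noteq> 0 \<longrightarrow> (\<Sum>i<k. t i) < 1 \<and> (\<forall>i<k. t i < \<alpha>))"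
      show "(\<lambda>N. f t * grid_function k (Suc N) (ins (Suc N)) t) \<longlonglongrightarrow> f t"
      proof (cases "f t = 0")
        case False
        then have "\<forall>\<^sub>F N in sequentially. inside_cell k \<alpha> N (grid_cell k N t)" using t by (intro eventually_inside) auto
        then have "\<forall>\<^sub>F N in sequentially. inside_cell k \<alpha> (Suc N) (grid_cell k (Suc N) t)"
          by (rule eventually_sequentially_Suc[THEN iffD2])
        then have "\<forall>\<^sub>F N in sequentially. f t * grid_function k (Suc N) (ins (Suc N)) t = f t"
          by (rule eventually_mono) (use t in \<open>auto simp: grid_function_eq ins_def\<close>)
        then show ?thesis by (rule tendsto_eventually)
      qed simp
    qed
  qed auto
  then have "(\<lambda>N. \<integral>\<^sup>+ t. ennreal \<bar>f t - f t * grid_function k N (ins N) t\<bar> \<partial>cube_measure k) \<longlonglongrightarrow> 0"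
    by (rule LIMSEQ_imp_Suc)
  then have ev2: "\<forall>\<^sub>F N in sequentially. (\<integral>\<^sup>+ t. ennreal \<bar>f t - f t * grid_function k N (ins N) t\<bar> \<partial>cube_measure k) < ennreal (e / 2)"
    using e by (intro order_tendstoD) auto
  have "\<forall>\<^sub>F N in sequentially. (\<exists>\<phi>. (\<integral>\<^sup>+ t. ennreal \<bar>f t - grid_function k N \<phi> t\<bar> \<partial>cube_measure k) \<le> ennreal (e / 2))
     \<and> (\<integral>\<^sup>+ t. ennreal \<bar>f t - f t * grid_function k N (ins N) t\<bar> \<partial>cube_measure k) < ennreal (e / 2) \<and> N \<ge> 1"
    using ev1 ev2 by (intro eventually_conj eventually_ge_at_top)
  then obtain N where "(\<exists>\<phi>. (\<integral>\<^sup>+ t. ennreal \<bar>f t - grid_function k N \<phi> t\<bar> \<partial>cube_measure k) \<le> ennreal (e / 2))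
     \<and> (\<integral>\<^sup>+ t. ennreal \<bar>f t - f t * grid_function k N (ins N) t\<bar> \<partial>cube_measure k) < ennreal (e / 2) \<and> N \<ge> 1"
    unfolding eventually_sequentially by blast
  then obtain \<phi> where N: "N \<ge> 1" and p: "(\<integral>\<^sup>+ t. ennreal \<bar>f t - grid_function k N \<phi> t\<bar> \<partial>cube_measure k) \<le> ennreal (e / 2)"
    and q: "(\<integral>\<^sup>+ t. ennreal \<bar>f t - f t * grid_function k N (ins N) t\<bar> \<partial>cube_measure k) \<le> ennreal (e / 2)" by auto
  define \<psi> where "\<psi> j = (if j \<in> PiE {..<k} (\<lambda>_. {..<N}) \<and> inside_cell k \<alpha> N j then max 0 (min B (\<phi> j)) else 0)" for j
  have "(\<integral>\<^sup>+ t. ennreal \<bar>f t - grid_function k N \<psi> t\<bar> \<partial>cube_measure k)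
    \<le> (\<integral>\<^sup>+ t. ennreal \<bar>f t - grid_function k N \<phi> t\<bar> + ennreal \<bar>f t - f t * grid_function k N (ins N) t\<bar> \<partial>cube_measure k)"
  proof (rule nn_integral_mono_AE, rule AE_cube)
    fix t assume t: "t \<in> unit_cube k"
    define j where "j = grid_cell k N t"
    have j: "j \<in> PiE {..<k} (\<lambda>_. {..<N})" unfolding j_def by (rule grid_cell_mem[OF N t])
    \<comment> \<open>On a kept cell the first summand suffices; on a discarded one the second
      equals f t.\<close>
    have "\<bar>f t - \<psi> j\<bar> \<le> \<bar>f t - \<phi> j\<bar> + \<bar>f t - f t * ins N j\<bar>"
      using j f0[of t] fB[of t] B unfolding \<psi>_def ins_def by (auto simp: max_def min_def)
    then show "ennreal \<bar>f t - grid_function k N \<psi> t\<bar> \<le> ennreal \<bar>f t - grid_function k N \<phi> t\<bar> + ennreal \<bar>f t - f t * grid_function k N (ins N) t\<bar>"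
      unfolding grid_function_eq[OF N t] j_def[symmetric] by (simp add: ennreal_plus[symmetric] ennreal_leI del: ennreal_plus)
  qed
  also have "\<dots> = (\<integral>\<^sup>+ t. ennreal \<bar>f t - grid_function k N \<phi> t\<bar> \<partial>cube_measure k) + (\<integral>\<^sup>+ t. ennreal \<bar>f t - f t * grid_function k N (ins N) t\<bar> \<partial>cube_measure k)"
    by (rule nn_integral_add) auto
  also have "\<dots> \<le> ennreal (e / 2) + ennreal (e / 2)" by (rule add_mono[OF p q])
  also have "\<dots> = ennreal e" using e by (simp add: ennreal_plus[symmetric] del: ennreal_plus)
  finally have "(\<integral>\<^sup>+ t. ennreal \<bar>f t - grid_function k N \<psi> t\<bar> \<partial>cube_measure k) \<le> ennreal e" .
  moreover have "(\<integral>\<^sup>+ t. ennreal \<bar>f t - grid_function k N \<psi> t\<bar> \<partial>lebesgue_prod {..<k}) = (\<integral>\<^sup>+ t. ennreal \<bar>f t - grid_function k N \<psi> t\<bar> \<partial>cube_measure k)"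
  proof -
    have "(\<integral>\<^sup>+ t. ennreal \<bar>f t - grid_function k N \<psi> t\<bar> \<partial>lebesgue_prod {..<k})
      = (\<integral>\<^sup>+ t. ennreal \<bar>f t - grid_function k N \<psi> t\<bar> * indicator (unit_cube k) t \<partial>lebesgue_prod {..<k})"
    proof (rule nn_integral_cong_AE, rule AE_mp[OF ae], intro AE_I2 impI)
      fix t assume sp: "t \<in> space (lebesgue_prod {..<k})" and t: "f t \<noteq> 0 \<longrightarrow> (\<Sum>i<k. t i) < 1 \<and> (\<forall>i<k. t i < \<alpha>)"
      show "ennreal \<bar>f t - grid_function k N \<psi> t\<bar> = ennreal \<bar>f t - grid_function k N \<psi> t\<bar> * indicator (unit_cube k) t"
      proof (cases "t \<in> unit_cube k")
        case False
        have ext: "t \<in> extensional {..<k}" using sp by (simp add: space_PiM PiE_def)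
        have "f t = 0"
        proof (rule ccontr)
          assume nz: "f t \<noteq> 0"
          have "t i \<in> {0..<1}" if "i < k" for i
          proof -
            have "t i \<le> (\<Sum>i<k. t i)" using suppD(3)[OF nz] that by (intro member_le_sum) auto
            then show ?thesis using t nz suppD(3)[OF nz that] by auto
          qed
          then have "t \<in> unit_cube k" using ext unfolding unit_cube_def by (simp add: PiE_iff)
          then show False using False by simp
        qed
        then show ?thesis using grid_function_outside[OF N ext False] False by simp
      qed simp
    qed
    also have "\<dots> = (\<integral>\<^sup>+ t. ennreal \<bar>f t - grid_function k N \<psi> t\<bar> \<partial>cube_measure k)" by (rule nn_integral_cube[symmetric]) measurable
    finally show ?thesis .
  qed
  ultimately have "(\<integral>\<^sup>+ t. ennreal \<bar>f t - grid_function k N \<psi> t\<bar> \<partial>lebesgue_prod {..<k}) \<le> ennreal e" by simp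
  moreover have "\<forall>j. 0 \<le> \<psi> j \<and> \<psi> j \<le> B" using B unfolding \<psi>_def by auto
  moreover have "\<forall>j. \<psi> j \<noteq> 0 \<longrightarrow> j \<in> PiE {..<k} (\<lambda>_. {..<N}) \<and> inside_cell k \<alpha> N j" unfolding \<psi>_def by auto
  ultimately show ?thesis using N by blast
qed

text \<open>F is replaced by its absolute value, which keeps I and lowers no J_i, and then truncated
  at a height B, which does not raise I and, for large B, keeps the sum of the J_i above c * I. For
  the bounded function L^1 approximation changes each functional unfavourably by at most 2 * B times
  the distance.\<close>

lemma grid_function_exists:
  assumes k: "k \<ge> 1" and F: "F \<in> truncated_functions k \<alpha>" and c: "c \<ge> 0"
    and gt: "c * I_functional k F < (\<Sum>i<k. J_functional k i F)"
  shows "\<exists>(N::nat) (\<phi>::(nat \<Rightarrow> nat) \<Rightarrow> real) (B::real). N \<ge> 1 \<and> (\<forall>j. 0 \<le> \<phi> j \<and> \<phi> j \<le> B) \<and> (\<forall>j. \<phi> j \<noteq> 0 \<longrightarrow> j \<in> PiE {..<k} (\<lambda>_. {..<N}) \<and> inside_cell k \<alpha> N j) \<and>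
    c * ((\<Sum>j\<in>PiE {..<k} (\<lambda>_. {..<N}). (\<phi> j)\<^sup>2) / N ^ k)
      < (\<Sum>i<k. (\<Sum>j\<in>PiE {..<k} (\<lambda>_. {..<N}). \<Sum>v<N. \<phi> j * \<phi> (j(i := v))) / N ^ Suc k)"
proof -
  define \<mu> where "\<mu> = lebesgue_prod {..<k}"
  have Fm [measurable]: "F \<in> borel_measurable (lebesgue_prod {..<k})" and Fi: "set_integrable (lebesgue_prod {..<k}) (orthant {..<k}) (\<lambda>t. (F t)\<^sup>2)"
    and Fs: "\<And>t. t \<in> space (lebesgue_prod {..<k}) \<Longrightarrow> t \<notin> truncated_simplex k \<alpha> \<Longrightarrow> F t = 0"
    using F unfolding truncated_functions_def square_integrable_def by auto
  define f where "f t = \<bar>F t\<bar> * indicator (space (lebesgue_prod {..<k})) t" for t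
  have sp: "space (lebesgue_prod {..<k}) = extensional {..<k}" by (simp add: space_PiM PiE_def)
  have fm [measurable]: "f \<in> borel_measurable (lebesgue_prod {..<k})" unfolding f_def by measurable
  have f0: "0 \<le> f t" for t unfolding f_def by simp
  have fs: "f t \<noteq> 0 \<Longrightarrow> t \<in> truncated_simplex k \<alpha>" for t using Fs unfolding f_def by (auto simp: indicator_def split: if_splits)
  have fout: "t \<notin> extensional {..<k} \<Longrightarrow> f t = 0" for t unfolding f_def sp by simp
  have I: "ennreal (I_functional k F) = (\<integral>\<^sup>+ t. ennreal ((f t)\<^sup>2) \<partial>lebesgue_prod {..<k})"
  proof -
    have "ennreal (I_functional k F) = (\<integral>\<^sup>+ t. ennreal (indicator (orthant {..<k}) t *\<^sub>R (F t)\<^sup>2) \<partial>lebesgue_prod {..<k})"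
      unfolding I_functional_def set_lebesgue_integral_def
      using Fi unfolding set_integrable_def by (intro nn_integral_eq_integral[symmetric]) auto
    also have "\<dots> = (\<integral>\<^sup>+ t. ennreal ((f t)\<^sup>2) \<partial>lebesgue_prod {..<k})"
    proof (rule nn_integral_cong)
      fix t assume t: "t \<in> space (lebesgue_prod {..<k})"
      show "ennreal (indicator (orthant {..<k}) t *\<^sub>R (F t)\<^sup>2) = ennreal ((f t)\<^sup>2)"
      proof (cases "t \<in> truncated_simplex k \<alpha>")
        case True
        then have "t \<in> orthant {..<k}" unfolding truncated_simplex_def orthant_def by (auto simp: PiE_iff)
        then show ?thesis using t unfolding f_def by simp
      next
        case False
        then show ?thesis using Fs[OF t] unfolding f_def by simp
      qed
    qed
    finally show ?thesis .
  qed
  have I0: "0 \<le> I_functional k F" unfolding I_functional_def set_lebesgue_integral_def by (rule Bochner_Integration.integral_nonneg) auto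
  have J: "ennreal (J_functional k i F) \<le> inner_square k i f" if "i < k" for i
    by (rule ennreal_J_functional_le[OF _ that]) (auto simp: f_def sp)
  have J0: "0 \<le> J_functional k i F" for i unfolding J_functional_def set_lebesgue_integral_def by (rule Bochner_Integration.integral_nonneg) auto
  have "ennreal (c * I_functional k F) < ennreal (\<Sum>i<k. J_functional k i F)"
    using gt c I0 by (intro ennreal_lessI) (auto intro: le_less_trans[rotated])
  also have "\<dots> = (\<Sum>i<k. ennreal (J_functional k i F))" using J0 by (intro sum_ennreal[symmetric]) auto
  also have "\<dots> \<le> (\<Sum>i<k. inner_square k i f)" by (intro sum_mono J) auto
  finally have "ennreal (c * I_functional k F) < (\<Sum>i<k. inner_square k i f)" .
  moreover have "(\<lambda>B. \<Sum>i<k. inner_square k i (\<lambda>t. min (f t) (real B))) \<longlonglongrightarrow> (\<Sum>i<k. inner_square k i f)"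
    by (intro tendsto_sum inner_square_truncate) (use f0 fout in auto)
  ultimately have "\<forall>\<^sub>F B in sequentially. ennreal (c * I_functional k F) < (\<Sum>i<k. inner_square k i (\<lambda>t. min (f t) (real B)))"
    by (rule order_tendstoD(1)[rotated])
  then have "\<forall>\<^sub>F B in sequentially. B \<ge> 1 \<and> ennreal (c * I_functional k F) < (\<Sum>i<k. inner_square k i (\<lambda>t. min (f t) (real B)))"
    by (intro eventually_conj eventually_ge_at_top)
  then obtain n where n: "n \<ge> 1" "ennreal (c * I_functional k F) < (\<Sum>i<k. inner_square k i (\<lambda>t. min (f t) (real n)))"
    unfolding eventually_sequentially by blast
  define B where "B = real n"
  define g where "g t = min (f t) B" for t
  have B: "B > 0" using n unfolding B_def by simp
  have gm [measurable]: "g \<in> borel_measurable (lebesgue_prod {..<k})" unfolding g_def by measurable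
  have g0: "0 \<le> g t" and gB: "g t \<le> B" for t unfolding g_def using f0[of t] B by auto
  have gs: "g t \<noteq> 0 \<Longrightarrow> t \<in> truncated_simplex k \<alpha>" for t using fs[of t] B unfolding g_def by (auto simp: min_def split: if_splits)
  have gout: "t \<notin> extensional {..<k} \<Longrightarrow> g t = 0" for t using fout[of t] B unfolding g_def by simp
  have Ig: "(\<integral>\<^sup>+ t. ennreal ((g t)\<^sup>2) \<partial>lebesgue_prod {..<k}) \<le> ennreal (I_functional k F)"
    unfolding I using f0 g0 by (intro nn_integral_mono ennreal_leI power_mono) (auto simp: g_def)
  \<comment> \<open>A real number is put in between, as the right-hand side is an
    \<open>ennreal\<close> whose finiteness has not been established.\<close>
  obtain r where r: "c * I_functional k F < r" "ennreal r \<le> (\<Sum>i<k. inner_square k i g)"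
  proof -
    obtain z where z: "ennreal (c * I_functional k F) < z" "z < (\<Sum>i<k. inner_square k i g)"
      using dense[OF n(2)] unfolding g_def B_def by blast
    then obtain r where "z = ennreal r" "0 \<le> r" by (cases z) auto
    then show ?thesis using z that[of r] c I0 by (auto simp: ennreal_less_iff intro: less_imp_le)
  qed
  define \<eta> where "\<eta> = r - c * I_functional k F"
  have \<eta>: "\<eta> > 0" using r unfolding \<eta>_def by simp
  \<comment> \<open>The total loss is (k + c) * 2 * B * e: one unit for each J_i and c for I. This
    choice makes it less than \<eta>.\<close>
  define e where "e = \<eta> / (4 * B * (real k + c + 1))"
  have e: "e > 0" unfolding e_def using \<eta> B c by (intro divide_pos_pos mult_pos_pos) auto
  obtain N \<phi> where N: "N \<ge> 1" and \<phi>B: "\<forall>j. 0 \<le> \<phi> j \<and> \<phi> j \<le> B"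
    and \<phi>s: "\<forall>j. \<phi> j \<noteq> 0 \<longrightarrow> j \<in> PiE {..<k} (\<lambda>_. {..<N}) \<and> inside_cell k \<alpha> N j"
    and \<phi>e: "(\<integral>\<^sup>+ t. ennreal \<bar>g t - grid_function k N \<phi> t\<bar> \<partial>lebesgue_prod {..<k}) \<le> ennreal e"
    using grid_L1_approx[OF k gm B g0 gB gs e] by blast
  define q where "q t = grid_function k N \<phi> t * indicator (extensional {..<k}) t" for t
  have qg: "t \<in> extensional {..<k} \<Longrightarrow> q t = grid_function k N \<phi> t" for t unfolding q_def by simp
  have qm [measurable]: "q \<in> borel_measurable (lebesgue_prod {..<k})"
    by (subst measurable_cong[of _ _ "grid_function k N \<phi>"]) (auto simp: sp qg)
  have q0: "0 \<le> q t" and qB: "q t \<le> B" for t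
    unfolding q_def using \<phi>B B grid_function_eq[OF N, of t k \<phi>] grid_function_outside[OF N, of t k \<phi>]
    by (cases "t \<in> unit_cube k"; cases "t \<in> extensional {..<k}"; simp)+
  have qout: "t \<notin> extensional {..<k} \<Longrightarrow> q t = 0" for t unfolding q_def by simp
  have qs: "t j \<in> {0..1}" if "j < k" "q t \<noteq> 0" for t j
  proof -
    have "t \<in> extensional {..<k}" "grid_function k N \<phi> t \<noteq> 0" using that(2) unfolding q_def by (auto simp: indicator_def split: if_splits)
    then have "t \<in> unit_cube k" using grid_function_outside[OF N] by blast
    then show ?thesis using unit_cubeD(1,2)[of t k j] that(1) by auto
  qed
  have gs1: "t j \<in> {0..1}" if "j < k" "g t \<noteq> 0" for t j
  proof -
    have T: "\<And>i. i < k \<Longrightarrow> 0 \<le> t i" "(\<Sum>i<k. t i) \<le> 1" using gs[OF that(2)] unfolding truncated_simplex_def by (auto simp: PiE_iff)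
    have "t j \<le> (\<Sum>i<k. t i)" using T(1) that by (intro member_le_sum) auto
    then show ?thesis using T that by auto
  qed
  have qe: "(\<integral>\<^sup>+ t. ennreal \<bar>g t - q t\<bar> \<partial>lebesgue_prod {..<k}) \<le> ennreal e"
  proof -
    have "(\<integral>\<^sup>+ t. ennreal \<bar>g t - q t\<bar> \<partial>lebesgue_prod {..<k}) = (\<integral>\<^sup>+ t. ennreal \<bar>g t - grid_function k N \<phi> t\<bar> \<partial>lebesgue_prod {..<k})"
      by (intro nn_integral_cong) (simp add: sp qg)
    then show ?thesis using \<phi>e by simp
  qed
  define IS where "IS = (\<Sum>j\<in>PiE {..<k} (\<lambda>_. {..<N}). (\<phi> j)\<^sup>2) / N ^ k"
  define JS where "JS i = (\<Sum>j\<in>PiE {..<k} (\<lambda>_. {..<N}). \<Sum>v<N. \<phi> j * \<phi> (j(i := v))) / N ^ Suc k" for i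
  have JS0: "0 \<le> JS i" for i unfolding JS_def using \<phi>B by (intro divide_nonneg_nonneg sum_nonneg mult_nonneg_nonneg) auto
  have IS0: "0 \<le> IS" unfolding IS_def by (intro divide_nonneg_nonneg sum_nonneg) auto
  have be: "ennreal (2 * B) * ennreal e = ennreal (2 * B * e)" using B e by (intro ennreal_mult[symmetric]) auto
  have "ennreal IS = (\<integral>\<^sup>+ t. ennreal ((q t)\<^sup>2) \<partial>lebesgue_prod {..<k})"
    unfolding IS_def square_integral_grid[OF N, symmetric] by (intro nn_integral_cong) (simp add: sp qg)
  also have "\<dots> \<le> (\<integral>\<^sup>+ t. ennreal ((g t)\<^sup>2) \<partial>lebesgue_prod {..<k}) + ennreal (2 * B) * (\<integral>\<^sup>+ t. ennreal \<bar>g t - q t\<bar> \<partial>lebesgue_prod {..<k})"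
    by (rule square_integral_le) (use B g0 gB q0 qB in auto)
  also have "\<dots> \<le> ennreal (I_functional k F) + ennreal (2 * B) * ennreal e"
    by (intro add_mono Ig mult_left_mono qe) auto
  also have "\<dots> = ennreal (I_functional k F + 2 * B * e)" unfolding be using I0 B e by (intro ennreal_plus[symmetric]) auto
  finally have ISle: "IS \<le> I_functional k F + 2 * B * e" using I0 B e by (subst (asm) ennreal_le_iff) auto
  have JSle: "inner_square k i g \<le> ennreal (JS i + 2 * B * e)" if i: "i < k" for i
  proof -
    have "inner_square k i g \<le> inner_square k i q + ennreal (2 * B) * (\<integral>\<^sup>+ t. ennreal \<bar>g t - q t\<bar> \<partial>lebesgue_prod {..<k})"
      by (rule inner_square_le) (use i B g0 gB gs1 gout q0 qB qs qout in auto)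
    also have "inner_square k i q = inner_square k i (grid_function k N \<phi>)"
      unfolding inner_square_def
    proof (rule nn_integral_cong)
      fix t assume "t \<in> space (lebesgue_prod ({..<k} - {i}))"
      then have "t(i := s) \<in> extensional {..<k}" for s using i by (auto simp: space_PiM PiE_def extensional_def)
      then show "(\<integral>\<^sup>+ s. ennreal (q (t(i := s))) \<partial>lborel)\<^sup>2 = (\<integral>\<^sup>+ s. ennreal (grid_function k N \<phi> (t(i := s))) \<partial>lborel)\<^sup>2"
        by (simp add: qg)
    qed
    also have "\<dots> = ennreal (JS i)" unfolding JS_def using inner_square_grid[OF N i, of \<phi>] \<phi>B by simp
    also have "ennreal (JS i) + ennreal (2 * B) * (\<integral>\<^sup>+ t. ennreal \<bar>g t - q t\<bar> \<partial>lebesgue_prod {..<k}) \<le> ennreal (JS i) + ennreal (2 * B) * ennreal e"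
      by (intro add_mono mult_left_mono qe) auto
    also have "\<dots> = ennreal (JS i + 2 * B * e)" unfolding be using JS0 B e by (intro ennreal_plus[symmetric]) auto
    finally show ?thesis .
  qed
  have "ennreal r \<le> (\<Sum>i<k. ennreal (JS i + 2 * B * e))"
    using r(2) JSle by (intro order_trans[OF r(2)] sum_mono) auto
  also have "\<dots> = ennreal (\<Sum>i<k. JS i + 2 * B * e)" using JS0 B e by (intro sum_ennreal) (auto intro: add_nonneg_nonneg)
  finally have "ennreal r \<le> ennreal (\<Sum>i<k. JS i + 2 * B * e)" .
  then have "r \<le> (\<Sum>i<k. JS i + 2 * B * e)"
    by (subst (asm) ennreal_le_iff) (use JS0 B e in \<open>auto intro!: sum_nonneg add_nonneg_nonneg\<close>)
  then have rle: "r \<le> (\<Sum>i<k. JS i) + real k * (2 * B * e)" by (simp add: sum.distrib)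
  have small: "(real k + c) * (2 * B * e) < \<eta>"
  proof -
    have "D * (4 * B * (\<eta> / (4 * B * D))) = \<eta>" if "D > 0" for D using B that by simp
    from this[of "real k + c + 1"] have "(real k + c + 1) * (4 * B * e) = \<eta>" unfolding e_def using c by simp
    moreover have "(real k + c) * (2 * B * e) \<le> (real k + c + 1) * (2 * B * e)" using B e by (intro mult_right_mono) auto
    moreover have "0 < (real k + c + 1) * (2 * B * e)" using B e c by (intro mult_pos_pos) auto
    ultimately show ?thesis by (simp add: algebra_simps)
  qed
  have "c * IS \<le> c * (I_functional k F + 2 * B * e)" using ISle c by (rule mult_left_mono)
  also have "\<dots> = r - \<eta> + c * (2 * B * e)" unfolding \<eta>_def by (simp add: algebra_simps)
  also have "\<dots> < (\<Sum>i<k. JS i)" using rle small by (simp add: algebra_simps)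
  finally show ?thesis using N \<phi>B \<phi>s unfolding IS_def JS_def by blast
qed

subsection \<open>Uniform equidistribution and the sieve inequalities\<close>

text \<open>The residue class in \<open>MPZ\<close> may depend on \<open>x\<close>, so choosing a bad class for every \<open>x\<close> that admits
  one turns the bound for a single family into a bound uniform over all classes.\<close>

lemma MPZ_uniform:
  assumes mpz: "MPZ varpi \<delta>" and A: "A \<ge> 1" and Q: "lessapprox Q (\<lambda>x. x powr (1/2 + 2 * varpi))"
  shows "\<exists>C>0. \<forall>\<^sub>F x in at_top. \<forall>a. (\<forall>p. prime p \<longrightarrow> real p \<le> x powr \<delta> \<longrightarrow> \<not> int p dvd a) \<longrightarrow>
     (\<Sum>q | real q \<le> Q x \<and> q \<in> squarefree_with_factors_in {1..x powr \<delta>}.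
        \<bar>discrepancy (\<lambda>n. mangoldt n * indicator {x..2 * x} (real n)) a q\<bar>) \<le> C * (x * ln x powr (- A))"
proof -
  obtain C where C: "C > 0" and bound: "\<And>(I :: real \<Rightarrow> real set) (Q :: real \<Rightarrow> real) (a :: real \<Rightarrow> int).
        (\<forall>\<^sub>F x in at_top. I x \<subseteq> {1..x powr \<delta>}) \<Longrightarrow> lessapprox Q (\<lambda>x. x powr (1/2 + 2 * varpi)) \<Longrightarrow>
        (\<forall>\<^sub>F x in at_top. coprime (a x) (int (prime_product (I x)))) \<Longrightarrow>
        (\<forall>\<^sub>F x in at_top. (\<Sum>q | real q \<le> Q x \<and> q \<in> squarefree_with_factors_in (I x).
              \<bar>discrepancy (\<lambda>n. mangoldt n * indicator {x..2 * x} (real n)) (a x) q\<bar>) \<le> C * (x * ln x powr (- A)))"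
    using mpz A unfolding MPZ_def by blast
  define good where "good x a \<longleftrightarrow> (\<forall>p. prime p \<longrightarrow> real p \<le> x powr \<delta> \<longrightarrow> \<not> int p dvd a)" for x :: real and a :: int
  define S where "S x a = (\<Sum>q | real q \<le> Q x \<and> q \<in> squarefree_with_factors_in {1..x powr \<delta>}.
        \<bar>discrepancy (\<lambda>n. mangoldt n * indicator {x..2 * x} (real n)) a q\<bar>)" for x :: real and a :: int
  define bad where "bad x a \<longleftrightarrow> good x a \<and> \<not> S x a \<le> C * (x * ln x powr (- A))" for x a
  \<comment> \<open>The default 1 is divisible by no prime, so the family is primitive for every
    x.\<close>
  define a where "a x = (if \<exists>a. bad x a then SOME a. bad x a else 1)" for x
  have a_bad: "bad x (a x)" if "bad x a'" for x a'
    using that someI[of "bad x" a'] unfolding a_def by auto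
  have good_a: "good x (a x)" for x
  proof (cases "\<exists>a'. bad x a'")
    case True
    then show ?thesis using a_bad unfolding bad_def by blast
  next
    case False
    then have "a x = 1" unfolding a_def by (simp only: if_False)
    then show ?thesis unfolding good_def by (auto dest: prime_gt_1_nat)
  qed
  have cop: "coprime (a x) (int (prime_product {1..x powr \<delta>}))" for x
  proof -
    have "coprime (int p) (a x)" if "p \<in> {p. prime p \<and> real p \<in> {1..x powr \<delta>}}" for p
      using that good_a[of x] unfolding good_def by (intro prime_imp_coprime) auto
    then have "coprime (a x) (\<Prod>p\<in>{p. prime p \<and> real p \<in> {1..x powr \<delta>}}. int p)"
      by (intro prod_coprime_right) (simp only: coprime_commute)
    then show ?thesis unfolding prime_product_def by (simp only: of_nat_prod)
  qed
  have "\<forall>\<^sub>F x in at_top. S x (a x) \<le> C * (x * ln x powr (- A))"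
    unfolding S_def by (rule bound[where I = "\<lambda>x. {1..x powr \<delta>}" and Q = Q and a = a]) (use Q cop in simp_all)
  then have "\<forall>\<^sub>F x in at_top. \<forall>a'. good x a' \<longrightarrow> S x a' \<le> C * (x * ln x powr (- A))"
    by (rule eventually_mono) (use a_bad in \<open>unfold bad_def, blast\<close>)
  then show ?thesis using C unfolding good_def S_def by blast
qed

definition harm_cell :: "nat \<Rightarrow> nat \<Rightarrow> real \<Rightarrow> nat \<Rightarrow> real" where
  "harm_cell W N R j = coprime_harm W (R powr (Suc j / N)) - coprime_harm W (R powr (j / N))"

definition prime_power_bound :: "real \<Rightarrow> real" where
  "prime_power_bound x = ln (2 * x) * (sqrt (2 * x) * (log 2 (2 * x) + 1))"

text \<open>The sieve at a single x with all errors explicit: one weight \<nu>, an upper bound for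
  its sum and a lower bound for each sum over primes. E stands for the bound from
  \<open>MPZ\<close>, and \<open>O1\<close> replaces the Euler product \<Omega>, so that only
  asymptotics in x remain.\<close>

lemma sieve_inequalities:
  fixes k w N :: nat and h :: "nat \<Rightarrow> int" and b u v :: int and \<Phi> :: "(nat \<Rightarrow> nat) \<Rightarrow> real" and Y R z x E L :: real
  defines "W \<equiv> primorial w"
  defines "O1 \<equiv> totient W / W * (1 + ln R) + W"
  assumes k: "k \<ge> 2" and grid: "grid_sieve k w N z R Y \<Phi>" and wz: "real w \<le> z"
    and distinct: "\<And>p i j. prime p \<Longrightarrow> w < p \<Longrightarrow> i < k \<Longrightarrow> j < k \<Longrightarrow> i \<noteq> j \<Longrightarrow> \<not> [h i = h j] (mod int p)"
    and b: "\<And>p i. prime p \<Longrightarrow> p \<le> w \<Longrightarrow> i < k \<Longrightarrow> \<not> int p dvd b + h i"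
    and x: "x \<ge> 1" "z < x" "real W * R\<^sup>2 \<le> x" and L: "L > 0" and uv: "u \<le> v"
    and shift: "\<And>i. i < k \<Longrightarrow> real_of_int u \<le> x - h i \<and> 2 * x - h i \<le> real_of_int v"
    and pos: "\<And>i j. i < k \<Longrightarrow> j < k \<Longrightarrow> 0 < x - h i + h j \<and> 2 * x - h i + h j \<le> 3 * x"
    and E: "\<And>a. (\<And>p. prime p \<Longrightarrow> real p \<le> z \<Longrightarrow> \<not> int p dvd a) \<Longrightarrow>
      (\<Sum>q | real q \<le> W * R\<^sup>2 \<and> q \<in> squarefree_with_factors_in {1..z}.
         \<bar>discrepancy (\<lambda>n. mangoldt n * indicator {x..2 * x} (real n)) a q\<bar>) \<le> E"
  shows "\<exists>\<nu>. (\<forall>n. 0 \<le> \<nu> n) \<and>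
    (\<Sum>n\<in>{n \<in> {u..v}. [n = b] (mod int W)}. \<nu> n)
      \<le> real_of_int (v - u) / W * ((\<Sum>j\<in>PiE {..<k} (\<lambda>_. {..<N}). (\<Phi> j)\<^sup>2 * (\<Prod>i<k. harm_cell W N R (j i)))
            + (exp 1 * Y)\<^sup>2 * (O1 ^ k * (exp (6 * (k + 1)\<^sup>2 / w) - 1)))
        + (exp 2 * Y * R * O1 ^ (4 * k))\<^sup>2 \<and>
    (\<forall>m<k. (\<Sum>n\<in>{n \<in> {u..v}. [n = b] (mod int W)}. \<nu> n * (if prime (n + h m) \<and> nat (n + h m) \<in> dyadic x then ln (n + h m) else 0))
      \<ge> dyadic_mangoldt x / totient W *
          ((\<Sum>j\<in>PiE {..<Suc k} (\<lambda>_. {..<N}). \<Phi> (restrict j {..<k}) * \<Phi> (restrict (j(m := j k)) {..<k}) * (\<Prod>i<Suc k. harm_cell W N R (j i)))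
            - Y\<^sup>2 * (real (Suc k) ^ 2 / w * coprime_harm W R ^ Suc k)
            - (exp 1 * Y)\<^sup>2 * (O1 ^ (k + 1) * (exp (6 * (k + 1)\<^sup>2 / w) - 1)))
        - (exp 1 * Y * O1 ^ (2 * k))\<^sup>2 *
          ((2 * x * ln (2 * x) / L + prime_power_bound x) * (exp 2 * O1 ^ (2 * (16 * (k - 1))\<^sup>2)) + L / 2 * E)
        - (exp 1 * Y * O1 ^ (2 * k))\<^sup>2 * (3 * x) powr (2 * k * ln 3 / ln w) * prime_power_bound x)"
proof -
  interpret G: grid_sieve k w N z R Y \<Phi> by (rule grid)
  define B where "B = {p::nat. prime p \<and> p \<le> w}"
  interpret T: tuple_sieve k w G.P R Y G.y h B b
  proof
    show "\<not> [h i = h j] (mod int p)" if "p \<in> G.P" "i < k" "j < k" "i \<noteq> j" for p i j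
      using that distinct unfolding G.P_def by auto
    show "finite B" unfolding B_def by (rule finite_primes_le)
    show "prime p" if "p \<in> B" for p using that unfolding B_def by simp
    show "B \<inter> G.P = {}" unfolding B_def G.P_def by auto
  qed
  have TW: "T.W = W" unfolding T.W_def unfolding W_def B_def primorial_def ..
  have Wpos: "W > 0" using T.W_pos TW by simp
  have BP: "p \<in> B \<union> G.P \<longleftrightarrow> prime p \<and> real p \<le> z" for p
    unfolding B_def G.P_def using wz by auto
  \<comment> \<open>Here 1 + 1 / \<sigma> = 1 + ln R.\<close>
  have \<Omega>: "G.\<Omega> \<le> O1" "1 \<le> G.\<Omega>"
  proof -
    show "G.\<Omega> \<le> O1"
      using euler_prod_le[of G.P W G.\<sigma>] G.finite_P G.prime_P G.P_coprime Wpos G.\<sigma>_pos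
      unfolding O1_def G.\<Omega>_def W_def by (simp add: G.\<sigma>_def)
    show "1 \<le> G.\<Omega>" by (rule G.\<Omega>_ge1)
  qed
  have pw: "0 \<le> G.\<Omega> ^ n" "G.\<Omega> ^ n \<le> O1 ^ n" for n using \<Omega> by (auto intro!: power_mono)
  have K0: "0 \<le> exp (6 * (k + 1)\<^sup>2 / real w) - 1" by simp
  have H: "G.H (j i) = harm_cell W N R (j i)" if "j \<in> PiE {..<K} (\<lambda>_. {..<N})" "i < K" for j i K
    using that PiE_mem[of j "{..<K}" "\<lambda>_. {..<N}" i] G.H_eq[of "j i"] unfolding harm_cell_def W_def by simp
  have HP: "(\<Prod>i<K. G.H (j i)) = (\<Prod>i<K. harm_cell W N R (j i))" if "j \<in> PiE {..<K} (\<lambda>_. {..<N})" for j K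
    by (intro prod.cong refl H[OF that]) simp
  define ppb where "ppb = prime_power_bound x"
  have ppb: "dyadic_prime_powers x \<le> ppb" unfolding ppb_def prime_power_bound_def by (rule dyadic_prime_powers_le) (rule x)
  have pp0: "0 \<le> dyadic_prime_powers x" by (rule T.dyadic_prime_powers_nonneg)
  have S1: "(\<Sum>n\<in>{n \<in> {u..v}. [n = b] (mod int W)}. T.nu n)
      \<le> real_of_int (v - u) / W * ((\<Sum>j\<in>PiE {..<k} (\<lambda>_. {..<N}). (\<Phi> j)\<^sup>2 * (\<Prod>i<k. harm_cell W N R (j i)))
            + (exp 1 * Y)\<^sup>2 * (O1 ^ k * (exp (6 * (k + 1)\<^sup>2 / w) - 1)))
        + (exp 2 * Y * R * O1 ^ (4 * k))\<^sup>2"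
  proof -
    define F where "F = (\<Sum>d\<in>colourings G.P k. \<Sum>e\<in>colourings G.P k. G.lam d * G.lam e * (\<Prod>p\<in>G.P. density_matrix k (real p) (d p) (e p)))"
    have "F \<le> (\<Sum>j\<in>PiE {..<k} (\<lambda>_. {..<N}). (\<Phi> j)\<^sup>2 * (\<Prod>i<k. G.H (j i)))
       + (exp 1 * Y)\<^sup>2 * (G.\<Omega> ^ k * (exp (6 * (k + 1)\<^sup>2 / w) - 1))"
      using G.density_form_approx G.main_form_le unfolding F_def by linarith
    also have "(\<Sum>j\<in>PiE {..<k} (\<lambda>_. {..<N}). (\<Phi> j)\<^sup>2 * (\<Prod>i<k. G.H (j i))) = (\<Sum>j\<in>PiE {..<k} (\<lambda>_. {..<N}). (\<Phi> j)\<^sup>2 * (\<Prod>i<k. harm_cell W N R (j i)))"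
      by (intro sum.cong refl) (simp only: HP)
    also have "(exp 1 * Y)\<^sup>2 * (G.\<Omega> ^ k * (exp (6 * (k + 1)\<^sup>2 / w) - 1)) \<le> (exp 1 * Y)\<^sup>2 * (O1 ^ k * (exp (6 * (k + 1)\<^sup>2 / w) - 1))"
      by (intro mult_left_mono mult_right_mono pw K0 zero_le_power2)
    finally have F: "F \<le> (\<Sum>j\<in>PiE {..<k} (\<lambda>_. {..<N}). (\<Phi> j)\<^sup>2 * (\<Prod>i<k. harm_cell W N R (j i)))
       + (exp 1 * Y)\<^sup>2 * (O1 ^ k * (exp (6 * (k + 1)\<^sup>2 / w) - 1))" by simp
    have "(\<Sum>d\<in>colourings G.P k. \<bar>G.lam d\<bar>) \<le> exp 2 * Y * R * O1 ^ (4 * k)"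
      using G.sum_abs_lam_le by (rule order_trans) (use pw G.Y_nonneg G.R_gt1 in \<open>intro mult_left_mono, auto\<close>)
    then have sq: "(\<Sum>d\<in>colourings G.P k. \<bar>G.lam d\<bar>)\<^sup>2 \<le> (exp 2 * Y * R * O1 ^ (4 * k))\<^sup>2"
      by (intro power_mono sum_nonneg) auto
    have "real_of_int (v - u) / W * F \<le> real_of_int (v - u) / W * ((\<Sum>j\<in>PiE {..<k} (\<lambda>_. {..<N}). (\<Phi> j)\<^sup>2 * (\<Prod>i<k. harm_cell W N R (j i)))
       + (exp 1 * Y)\<^sup>2 * (O1 ^ k * (exp (6 * (k + 1)\<^sup>2 / w) - 1)))"
      using F uv by (intro mult_left_mono) auto
    then show ?thesis using T.sum_nu_approx[OF uv] sq unfolding TW F_def by linarith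
  qed
  have S2: "(\<Sum>n\<in>{n \<in> {u..v}. [n = b] (mod int W)}. T.nu n * (if prime (n + h m) \<and> nat (n + h m) \<in> dyadic x then ln (n + h m) else 0))
      \<ge> dyadic_mangoldt x / totient W *
          ((\<Sum>j\<in>PiE {..<Suc k} (\<lambda>_. {..<N}). \<Phi> (restrict j {..<k}) * \<Phi> (restrict (j(m := j k)) {..<k}) * (\<Prod>i<Suc k. harm_cell W N R (j i)))
            - Y\<^sup>2 * (real (Suc k) ^ 2 / w * coprime_harm W R ^ Suc k)
            - (exp 1 * Y)\<^sup>2 * (O1 ^ (k + 1) * (exp (6 * (k + 1)\<^sup>2 / w) - 1)))
        - (exp 1 * Y * O1 ^ (2 * k))\<^sup>2 *
          ((2 * x * ln (2 * x) / L + ppb) * (exp 2 * O1 ^ (2 * (16 * (k - 1))\<^sup>2)) + L / 2 * E)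
        - (exp 1 * Y * O1 ^ (2 * k))\<^sup>2 * (3 * x) powr (2 * k * ln 3 / ln w) * ppb" if m: "m < k" for m
  proof -
    define F where "F = (\<Sum>d\<in>colourings G.P k. \<Sum>e\<in>colourings G.P k. G.lam d * G.lam e * (\<Prod>p\<in>G.P. prime_density_matrix k m (real p) (d p) (e p)))"
    define M where "M = (\<Sum>j\<in>PiE {..<Suc k} (\<lambda>_. {..<N}). \<Phi> (restrict j {..<k}) * \<Phi> (restrict (j(m := j k)) {..<k}) * (\<Prod>i<Suc k. harm_cell W N R (j i)))
            - Y\<^sup>2 * (real (Suc k) ^ 2 / w * coprime_harm W R ^ Suc k)
            - (exp 1 * Y)\<^sup>2 * (O1 ^ (k + 1) * (exp (6 * (k + 1)\<^sup>2 / w) - 1))"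
    have Hs: "(\<Sum>j\<in>PiE {..<Suc k} (\<lambda>_. {..<N}). \<Phi> (restrict j {..<k}) * \<Phi> (restrict (j(m := j k)) {..<k}) * (\<Prod>i<Suc k. G.H (j i)))
      = (\<Sum>j\<in>PiE {..<Suc k} (\<lambda>_. {..<N}). \<Phi> (restrict j {..<k}) * \<Phi> (restrict (j(m := j k)) {..<k}) * (\<Prod>i<Suc k. harm_cell W N R (j i)))"
      by (intro sum.cong refl) (simp only: HP)
    have Os: "(exp 1 * Y)\<^sup>2 * (G.\<Omega> ^ (k + 1) * (exp (6 * (k + 1)\<^sup>2 / w) - 1)) \<le> (exp 1 * Y)\<^sup>2 * (O1 ^ (k + 1) * (exp (6 * (k + 1)\<^sup>2 / w) - 1))"
      by (intro mult_left_mono mult_right_mono pw K0 zero_le_power2)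
    have "M \<le> F"
      using G.prime_density_form_approx[OF m] G.prime_main_form_ge[OF m] Os
      unfolding F_def M_def Hs G.sum_D_eq W_def[symmetric] by linarith
    then have FM: "dyadic_mangoldt x / totient W * M \<le> dyadic_mangoldt x / totient W * F"
      unfolding dyadic_mangoldt_def by (intro mult_left_mono) (auto intro!: divide_nonneg_nonneg sum_nonneg mangoldt_nonneg)
    define K where "K = (exp 1 * Y * O1 ^ (2 * k))\<^sup>2"
    have K: "(exp 1 * Y * G.\<Omega> ^ (2 * k))\<^sup>2 \<le> K"
      unfolding K_def by (intro power_mono[OF mult_left_mono[OF pw(2)]] mult_nonneg_nonneg pw(1) G.Y_nonneg exp_ge_zero)
    define V where "V = (exp 1 * Y * G.\<Omega> ^ (2 * k))\<^sup>2 * (3 * x) powr (2 * k * ln 3 / ln w)"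
    have V: "(\<Sum>d\<in>{d \<in> C. T.meets (int t - h m) d}. G.lam d)\<^sup>2 \<le> V" if t: "t \<in> dyadic x" and C: "C \<subseteq> colourings G.P k" for t C
      unfolding V_def
    proof (rule T.square_sum_le[OF _ _ C])
      fix i assume i: "i < k"
      have "0 < x - h m + h i \<and> 2 * x - h m + h i \<le> 3 * x" by (rule pos[OF m i])
      then have "0 < real_of_int (int t - h m + h i) \<and> real_of_int (int t - h m + h i) \<le> 3 * x"
        using t unfolding dyadic_def by auto
      then show "0 < int t - h m + h i \<and> real_of_int (int t - h m + h i) \<le> 3 * x" by (simp only: of_int_0_less_iff)
    qed (use x in simp)
    have "T.total_error x m \<le> (exp 1 * Y * G.\<Omega> ^ (2 * k))\<^sup>2 *
       ((2 * x * ln (2 * x) / L + dyadic_prime_powers x) * (exp 2 * G.\<Omega> ^ (2 * (16 * (k - 1))\<^sup>2)) + L / 2 * E)"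
    proof (rule T.total_error_bound[OF m k _ _ x(1) _ L])
      show "real p < x" if "p \<in> B \<union> G.P" for p using that BP[of p] x(2) by auto
      show "\<not> int p dvd b + h m" if "p \<in> B" for p using that b m unfolding B_def by auto
      show "real T.W * R\<^sup>2 \<le> x" unfolding TW by (rule x(3))
      fix a assume a: "\<forall>p\<in>B \<union> G.P. \<not> int p dvd a"
      have "(\<Sum>A\<in>{A \<in> Pow G.P. real (\<Prod>A) \<le> R\<^sup>2}. \<bar>discrepancy (\<lambda>n. mangoldt n * indicator {x..2 * x} (real n)) a (T.W * \<Prod>A)\<bar>)
        \<le> (\<Sum>q | real q \<le> W * R\<^sup>2 \<and> q \<in> squarefree_with_factors_in {1..z}.
         \<bar>discrepancy (\<lambda>n. mangoldt n * indicator {x..2 * x} (real n)) a q\<bar>)"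
        by (rule T.sum_modulus_le) (use BP prime_ge_1_nat in \<open>auto simp: TW Suc_le_eq prime_gt_0_nat\<close>)
      also have "\<dots> \<le> E" by (rule E) (use a BP in auto)
      finally show "(\<Sum>A\<in>{A \<in> Pow G.P. real (\<Prod>A) \<le> R\<^sup>2}. \<bar>discrepancy (\<lambda>n. mangoldt n * indicator {x..2 * x} (real n)) a (T.W * \<Prod>A)\<bar>) \<le> E" .
    qed
    also have "\<dots> \<le> K * ((2 * x * ln (2 * x) / L + ppb) * (exp 2 * O1 ^ (2 * (16 * (k - 1))\<^sup>2)) + L / 2 * E)"
    proof (rule mult_mono[OF K])
      \<comment> \<open>The class a = 1 is always primitive, so E bounds at least one sum of
        absolute values.\<close>
      have E0: "0 \<le> E" by (rule order_trans[OF _ E[of 1]]) (auto intro: sum_nonneg dest: prime_gt_1_nat)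
      have l0: "0 \<le> 2 * x * ln (2 * x) / L" using x(1) L by auto
      show "(2 * x * ln (2 * x) / L + dyadic_prime_powers x) * (exp 2 * G.\<Omega> ^ (2 * (16 * (k - 1))\<^sup>2)) + L / 2 * E
        \<le> (2 * x * ln (2 * x) / L + ppb) * (exp 2 * O1 ^ (2 * (16 * (k - 1))\<^sup>2)) + L / 2 * E"
        by (intro add_right_mono mult_mono add_left_mono ppb pw order_refl mult_nonneg_nonneg add_nonneg_nonneg l0
            order_trans[OF pp0 ppb] exp_ge_zero)
      show "0 \<le> (2 * x * ln (2 * x) / L + dyadic_prime_powers x) * (exp 2 * G.\<Omega> ^ (2 * (16 * (k - 1))\<^sup>2)) + L / 2 * E"
        using L by (intro add_nonneg_nonneg mult_nonneg_nonneg l0 pp0 pw E0 exp_ge_zero) simp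
    qed (simp add: K_def)
    finally have TE: "T.total_error x m \<le> K * ((2 * x * ln (2 * x) / L + ppb) * (exp 2 * O1 ^ (2 * (16 * (k - 1))\<^sup>2)) + L / 2 * E)" .
    have Vp: "V * dyadic_prime_powers x \<le> K * (3 * x) powr (2 * k * ln 3 / ln w) * ppb"
      unfolding V_def using K ppb pp0 by (intro mult_mono mult_right_mono) (auto simp: K_def)
    have "dyadic_mangoldt x / real (totient W) * F - T.total_error x m - V * dyadic_prime_powers x
      \<le> (\<Sum>n\<in>{n \<in> {u..v}. [n = b] (mod int W)}. T.nu n * (if prime (n + h m) \<and> nat (n + h m) \<in> dyadic x then ln (n + h m) else 0))"
      unfolding F_def TW[symmetric]
    proof (rule T.sum_nu_prime_ge[OF m])
      show "real p < x" if "p \<in> G.P" for p using that BP[of p] x(2) by auto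
    qed (use shift[OF m] V in blast)+
    then show ?thesis using FM TE Vp unfolding M_def K_def by linarith
  qed
  show ?thesis
    using S1 S2 T.nu_nonneg unfolding ppb_def by (intro exI[of _ T.nu]) blast
qed

subsection \<open>Asymptotics\<close>

lemma sum_PiE_Suc:
  fixes g :: "(nat \<Rightarrow> nat) \<Rightarrow> real"
  shows "(\<Sum>j\<in>PiE {..<Suc k} (\<lambda>_. {..<N}). g j) = (\<Sum>j\<in>PiE {..<k} (\<lambda>_. {..<N}). \<Sum>v<N. g (j(k := v)))"
proof -
  have eq: "PiE {..<Suc k} (\<lambda>_. {..<N}) = (\<lambda>(v, j). j(k := v)) ` ({..<N} \<times> PiE {..<k} (\<lambda>_. {..<N}))"
    unfolding lessThan_Suc by (rule PiE_insert_eq)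
  have inj: "inj_on (\<lambda>(v, j). j(k := v)) ({..<N} \<times> PiE {..<k} (\<lambda>_. {..<N}))"
    by (rule inj_combinator) simp
  have "(\<Sum>j\<in>PiE {..<Suc k} (\<lambda>_. {..<N}). g j) = (\<Sum>(v, j)\<in>{..<N} \<times> PiE {..<k} (\<lambda>_. {..<N}). g (j(k := v)))"
    unfolding eq sum.reindex[OF inj] by (intro sum.cong) auto
  also have "\<dots> = (\<Sum>v<N. \<Sum>j\<in>PiE {..<k} (\<lambda>_. {..<N}). g (j(k := v)))"
    by (rule sum.cartesian_product[symmetric])
  finally show ?thesis by (subst sum.swap)
qed

text \<open>The extra coordinate k of j becomes the replacement value v in coordinate m, as in the
  step function form of J_m.\<close>

lemma sum_switched_pairs:
  fixes \<Phi> :: "(nat \<Rightarrow> nat) \<Rightarrow> real"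
  assumes m: "m < k"
  shows "(\<Sum>j\<in>PiE {..<Suc k} (\<lambda>_. {..<N}). \<Phi> (restrict j {..<k}) * \<Phi> (restrict (j(m := j k)) {..<k}))
    = (\<Sum>j\<in>PiE {..<k} (\<lambda>_. {..<N}). \<Sum>v<N. \<Phi> j * \<Phi> (j(m := v)))"
  unfolding sum_PiE_Suc
proof (intro sum.cong refl)
  fix j v assume j: "j \<in> PiE {..<k} (\<lambda>_. {..<N})"
  have "restrict (j(k := v)) {..<k} = j"
    using PiE_arb[OF j] by (intro ext) (simp add: restrict_def)
  moreover have "restrict ((j(k := v))(m := (j(k := v)) k)) {..<k} = j(m := v)"
    using PiE_arb[OF j] m by (intro ext) (simp add: restrict_def)
  ultimately show "\<Phi> (restrict (j(k := v)) {..<k}) * \<Phi> (restrict ((j(k := v))(m := (j(k := v)) k)) {..<k}) = \<Phi> j * \<Phi> (j(m := v))"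
    by (simp only:)
qed

lemma powr_ln_power_smallo:
  fixes a :: real
  assumes "a < 1" "f \<in> O(\<lambda>x. x powr a * ln x ^ n)"
  shows "f \<in> o(\<lambda>x. x)"
proof (rule landau_o.big_small_trans[OF assms(2)])
  show "(\<lambda>x. x powr a * ln x ^ n) \<in> o(\<lambda>x. x)" using assms(1) by real_asymp
qed

locale sieve_asymptotics =
  fixes k w N :: nat and Y \<theta> :: real and \<Phi> :: "(nat \<Rightarrow> nat) \<Rightarrow> real"
  assumes N: "N \<ge> 1" and \<theta>: "0 < \<theta>" "\<theta> < 1/2"
begin

definition W :: nat where "W = primorial w"

definition \<tau> :: real where "\<tau> = totient W / W"

text \<open>This is totient W / W * ln R, the asymptotic size of the sum of 1 / n over n < R coprime
  to W: the unit in which the main terms are measured.\<close>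

definition \<beta> :: "real \<Rightarrow> real" where "\<beta> x = \<tau> * \<theta> * ln x"

definition \<omega> :: "real \<Rightarrow> real" where "\<omega> x = totient W / W * (1 + ln (x powr \<theta>)) + W"

definition upper :: "real \<Rightarrow> real" where
  "upper x = (\<Sum>j\<in>PiE {..<k} (\<lambda>_. {..<N}). (\<Phi> j)\<^sup>2 * (\<Prod>i<k. harm_cell W N (x powr \<theta>) (j i)))
            + (exp 1 * Y)\<^sup>2 * (\<omega> x ^ k * (exp (6 * (k + 1)\<^sup>2 / w) - 1))"

definition upper_error :: "real \<Rightarrow> real" where
  "upper_error x = (exp 2 * Y * x powr \<theta> * \<omega> x ^ (4 * k))\<^sup>2"

definition lower :: "nat \<Rightarrow> real \<Rightarrow> real" where
  "lower m x = (\<Sum>j\<in>PiE {..<Suc k} (\<lambda>_. {..<N}). \<Phi> (restrict j {..<k}) * \<Phi> (restrict (j(m := j k)) {..<k}) * (\<Prod>i<Suc k. harm_cell W N (x powr \<theta>) (j i)))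
            - Y\<^sup>2 * (real (Suc k) ^ 2 / w * coprime_harm W (x powr \<theta>) ^ Suc k)
            - (exp 1 * Y)\<^sup>2 * (\<omega> x ^ (k + 1) * (exp (6 * (k + 1)\<^sup>2 / w) - 1))"

text \<open>The power of \<omega> in the trivially bounded part of the class errors: the square of
  the weight 16 * (k - 1) per prime, doubled by the passage from p - 1 to p.\<close>

definition q :: nat where "q = 2 * (16 * (k - 1))\<^sup>2"

definition lower_error :: "real \<Rightarrow> real \<Rightarrow> real \<Rightarrow> real" where
  "lower_error L E x = (exp 1 * Y * \<omega> x ^ (2 * k))\<^sup>2 *
          ((2 * x * ln (2 * x) / L + prime_power_bound x) * (exp 2 * \<omega> x ^ (2 * (16 * (k - 1))\<^sup>2)) + L / 2 * E)
        + (exp 1 * Y * \<omega> x ^ (2 * k))\<^sup>2 * (3 * x) powr (2 * k * ln 3 / ln w) * prime_power_bound x"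

lemma W_pos: "W > 0" unfolding W_def by (rule primorial_pos)

lemma \<tau>_pos: "\<tau> > 0" unfolding \<tau>_def using W_pos by simp

lemma coprime_harm_limit:
  assumes s: "s \<ge> 0"
  shows "((\<lambda>x. coprime_harm W ((x powr \<theta>) powr s) / \<beta> x) \<longlongrightarrow> s) at_top"
proof -
  have "((\<lambda>x. coprime_harm W ((x powr \<theta>) powr s) / \<beta> x - s) \<longlongrightarrow> 0) at_top"
  proof (rule Lim_null_comparison)
    show "\<forall>\<^sub>F x in at_top. norm (coprime_harm W ((x powr \<theta>) powr s) / \<beta> x - s) \<le> (W + 1) / \<beta> x"
      using eventually_gt_at_top[of 1]
    proof (rule eventually_mono)
      fix x :: real assume x: "x > 1"
      have \<beta>: "\<beta> x > 0" unfolding \<beta>_def using \<tau>_pos \<theta> x by simp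
      have "ln ((x powr \<theta>) powr s) = s * \<theta> * ln x" using x by (simp add: ln_powr)
      moreover have "(x powr \<theta>) powr s \<ge> 1" using x \<theta> s by (intro ge_one_powr_ge_zero) auto
      ultimately have "\<bar>coprime_harm W ((x powr \<theta>) powr s) - \<beta> x * s\<bar> \<le> W + 1"
        using coprime_harm_approx[OF W_pos, of "(x powr \<theta>) powr s"] unfolding \<beta>_def \<tau>_def by (simp add: mult_ac)
      moreover have "coprime_harm W ((x powr \<theta>) powr s) / \<beta> x - s = (coprime_harm W ((x powr \<theta>) powr s) - \<beta> x * s) / \<beta> x"
        using \<beta> by (simp add: field_simps)
      ultimately show "norm (coprime_harm W ((x powr \<theta>) powr s) / \<beta> x - s) \<le> (W + 1) / \<beta> x"
        using \<beta> by (simp add: abs_divide divide_right_mono)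
    qed
    have "filterlim \<beta> at_top at_top" unfolding \<beta>_def using \<tau>_pos \<theta>
      by (intro filterlim_tendsto_pos_mult_at_top[OF tendsto_const _ ln_at_top]) simp
    then show "((\<lambda>x. (W + 1) / \<beta> x) \<longlongrightarrow> 0) at_top"
      by (intro tendsto_divide_0[OF tendsto_const] filterlim_at_top_imp_at_infinity)
  qed
  then show ?thesis by (simp add: LIM_zero_iff)
qed

text \<open>All cells have the same logarithmic length, hence asymptotically the same mass \<beta> /
  N; this makes the main terms integrals of the step function.\<close>

lemma harm_cell_limit: "((\<lambda>x. harm_cell W N (x powr \<theta>) j / \<beta> x) \<longlongrightarrow> 1 / N) at_top"
proof -
  have "((\<lambda>x. coprime_harm W ((x powr \<theta>) powr (Suc j / N)) / \<beta> x - coprime_harm W ((x powr \<theta>) powr (j / N)) / \<beta> x)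
    \<longlongrightarrow> real (Suc j) / N - real j / N) at_top"
    by (intro tendsto_diff coprime_harm_limit) auto
  moreover have "real (Suc j) / N - real j / N = 1 / N" by (simp add: diff_divide_distrib[symmetric])
  ultimately show ?thesis unfolding harm_cell_def diff_divide_distrib by (simp only:)
qed

lemma coprime_harm_limit_1: "((\<lambda>x. coprime_harm W (x powr \<theta>) / \<beta> x) \<longlongrightarrow> 1) at_top"
  using coprime_harm_limit[of 1] by simp

lemma \<beta>_at_top: "filterlim \<beta> at_top at_top"
  unfolding \<beta>_def using \<tau>_pos \<theta> by (intro filterlim_tendsto_pos_mult_at_top[OF tendsto_const _ ln_at_top]) simp

lemma \<omega>_eq: "x > 1 \<Longrightarrow> \<omega> x = \<beta> x + (\<tau> + W)"
  unfolding \<omega>_def \<beta>_def \<tau>_def by (simp add: ln_powr algebra_simps add_divide_distrib)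

lemma \<omega>_limit: "((\<lambda>x. \<omega> x / \<beta> x) \<longlongrightarrow> 1) at_top"
proof -
  have "((\<lambda>x. 1 + (\<tau> + W) / \<beta> x) \<longlongrightarrow> 1 + 0) at_top"
    by (intro tendsto_add tendsto_const tendsto_divide_0[OF tendsto_const] filterlim_at_top_imp_at_infinity \<beta>_at_top)
  moreover have "\<forall>\<^sub>F x in at_top. 1 + (\<tau> + W) / \<beta> x = \<omega> x / \<beta> x"
    using eventually_gt_at_top[of 1] filterlim_at_top_dense[THEN iffD1, OF \<beta>_at_top, rule_format, of 0]
    by eventually_elim (simp add: \<omega>_eq field_simps)
  ultimately show ?thesis by (simp add: tendsto_cong)
qed

lemma weighted_sum_limit:
  assumes "finite S"
  shows "((\<lambda>x. (\<Sum>j\<in>S. g j * (\<Prod>i<n. harm_cell W N (x powr \<theta>) (j i))) / \<beta> x ^ n) \<longlongrightarrow> (\<Sum>j\<in>S. g j) / N ^ n) at_top"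
proof -
  have "((\<lambda>x. \<Sum>j\<in>S. g j * (\<Prod>i<n. harm_cell W N (x powr \<theta>) (j i) / \<beta> x)) \<longlongrightarrow> (\<Sum>j\<in>S. g j * (\<Prod>i<n. 1 / N))) at_top"
    by (intro tendsto_sum tendsto_mult tendsto_const tendsto_prod harm_cell_limit)
  moreover have "(\<Sum>j\<in>S. g j * (\<Prod>i<n. harm_cell W N (x powr \<theta>) (j i) / \<beta> x)) = (\<Sum>j\<in>S. g j * (\<Prod>i<n. harm_cell W N (x powr \<theta>) (j i))) / \<beta> x ^ n" for x
    by (simp add: prod_dividef sum_divide_distrib)
  moreover have "(\<Sum>j\<in>S. g j * (\<Prod>i<n. 1 / real N)) = (\<Sum>j\<in>S. g j) / N ^ n"
    by (simp add: power_divide sum_divide_distrib)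
  ultimately show ?thesis by simp
qed

lemma upper_limit:
  "((\<lambda>x. upper x / \<beta> x ^ k) \<longlongrightarrow> (\<Sum>j\<in>PiE {..<k} (\<lambda>_. {..<N}). (\<Phi> j)\<^sup>2) / N ^ k
     + (exp 1 * Y)\<^sup>2 * (exp (6 * (k + 1)\<^sup>2 / w) - 1)) at_top"
proof -
  have "((\<lambda>x. (\<Sum>j\<in>PiE {..<k} (\<lambda>_. {..<N}). (\<Phi> j)\<^sup>2 * (\<Prod>i<k. harm_cell W N (x powr \<theta>) (j i))) / \<beta> x ^ k
     + (exp 1 * Y)\<^sup>2 * ((\<omega> x / \<beta> x) ^ k * (exp (6 * (k + 1)\<^sup>2 / w) - 1)))
    \<longlongrightarrow> (\<Sum>j\<in>PiE {..<k} (\<lambda>_. {..<N}). (\<Phi> j)\<^sup>2) / N ^ k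
     + (exp 1 * Y)\<^sup>2 * (1 ^ k * (exp (6 * (k + 1)\<^sup>2 / w) - 1))) at_top"
    by (intro tendsto_add weighted_sum_limit finite_PiE tendsto_mult tendsto_const tendsto_power \<omega>_limit) auto
  then show ?thesis unfolding upper_def by (simp add: add_divide_distrib power_divide)
qed

lemma lower_limit:
  assumes m: "m < k"
  shows "((\<lambda>x. lower m x / \<beta> x ^ Suc k) \<longlongrightarrow> (\<Sum>j\<in>PiE {..<k} (\<lambda>_. {..<N}). \<Sum>v<N. \<Phi> j * \<Phi> (j(m := v))) / N ^ Suc k
     - Y\<^sup>2 * (real (Suc k) ^ 2 / w) - (exp 1 * Y)\<^sup>2 * (exp (6 * (k + 1)\<^sup>2 / w) - 1)) at_top"
proof -
  have "((\<lambda>x. (\<Sum>j\<in>PiE {..<Suc k} (\<lambda>_. {..<N}). \<Phi> (restrict j {..<k}) * \<Phi> (restrict (j(m := j k)) {..<k}) * (\<Prod>i<Suc k. harm_cell W N (x powr \<theta>) (j i))) / \<beta> x ^ Suc k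
     - Y\<^sup>2 * (real (Suc k) ^ 2 / w * (coprime_harm W (x powr \<theta>) / \<beta> x) ^ Suc k)
     - (exp 1 * Y)\<^sup>2 * ((\<omega> x / \<beta> x) ^ Suc k * (exp (6 * (k + 1)\<^sup>2 / w) - 1)))
    \<longlongrightarrow> (\<Sum>j\<in>PiE {..<Suc k} (\<lambda>_. {..<N}). \<Phi> (restrict j {..<k}) * \<Phi> (restrict (j(m := j k)) {..<k})) / N ^ Suc k
     - Y\<^sup>2 * (real (Suc k) ^ 2 / w * 1 ^ Suc k)
     - (exp 1 * Y)\<^sup>2 * (1 ^ Suc k * (exp (6 * (k + 1)\<^sup>2 / w) - 1))) at_top"
    by (intro tendsto_diff weighted_sum_limit finite_PiE tendsto_mult tendsto_const tendsto_power \<omega>_limit coprime_harm_limit_1) auto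
  moreover have "(\<Sum>j\<in>PiE {..<Suc k} (\<lambda>_. {..<N}). \<Phi> (restrict j {..<k}) * \<Phi> (restrict (j(m := j k)) {..<k}) * (\<Prod>i<Suc k. harm_cell W N (x powr \<theta>) (j i))) / \<beta> x ^ Suc k
     - Y\<^sup>2 * (real (Suc k) ^ 2 / w * (coprime_harm W (x powr \<theta>) / \<beta> x) ^ Suc k)
     - (exp 1 * Y)\<^sup>2 * ((\<omega> x / \<beta> x) ^ Suc k * (exp (6 * (k + 1)\<^sup>2 / w) - 1)) = lower m x / \<beta> x ^ Suc k" for x
    unfolding lower_def power_divide Suc_eq_plus1 by (simp only: diff_divide_distrib times_divide_eq_right times_divide_eq_left)
  ultimately show ?thesis unfolding sum_switched_pairs[OF m] power_one mult_1_left mult_1_right by (simp only:)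
qed

lemma \<omega>_power_bigo: "(\<lambda>x. \<omega> x ^ n) \<in> O(\<lambda>x. ln x ^ n)"
proof (rule landau_o.big_power)
  have "\<omega> \<in> O(\<beta>)" using \<omega>_limit by (intro bigoI_tendsto[of _ _ 1]) (auto intro!: eventually_mono[OF filterlim_at_top_dense[THEN iffD1, OF \<beta>_at_top, rule_format, of 0]])
  also have "\<beta> \<in> O(ln)" unfolding \<beta>_def by (intro bigoI[of _ "\<bar>\<tau> * \<theta>\<bar>"]) (simp add: abs_mult)
  finally show "\<omega> \<in> O(ln)" .
qed

lemma prime_power_bound_bigo: "prime_power_bound \<in> O(\<lambda>x. x powr (1/2) * ln x ^ 2)"
  unfolding prime_power_bound_def log_def by real_asymp

lemma upper_error_smallo: "(\<lambda>x. ln (2 * x) * upper_error x) \<in> o(\<lambda>x. x)"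
proof (rule powr_ln_power_smallo)
  show "2 * \<theta> < 1" using \<theta> by simp
  have eq: "upper_error x = (exp 2 * Y)\<^sup>2 * (x powr (2 * \<theta>) * \<omega> x ^ (8 * k))" for x
  proof -
    have "(x powr \<theta>)\<^sup>2 = x powr (2 * \<theta>)" by (simp add: power2_eq_square powr_add[symmetric])
    moreover have "(\<omega> x ^ (4 * k))\<^sup>2 = \<omega> x ^ (8 * k)" unfolding power_mult[symmetric] by (simp add: mult.commute)
    ultimately show ?thesis unfolding upper_error_def by (simp only: power_mult_distrib mult.assoc)
  qed
  have "(\<lambda>x::real. ln (2 * x)) \<in> O(\<lambda>x. ln x)" by real_asymp
  then have "(\<lambda>x. ln (2 * x) * ((exp 2 * Y)\<^sup>2 * (x powr (2 * \<theta>) * \<omega> x ^ (8 * k)))) \<in> O(\<lambda>x. ln x * (1 * (x powr (2 * \<theta>) * ln x ^ (8 * k))))"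
    by (intro landau_o.big_mult \<omega>_power_bigo) auto
  then show "(\<lambda>x. ln (2 * x) * upper_error x) \<in> O(\<lambda>x. x powr (2 * \<theta>) * ln x ^ Suc (8 * k))"
    unfolding eq by (simp add: mult_ac)
qed

lemma weight_bigo: "(\<lambda>x. (exp 1 * Y * \<omega> x ^ (2 * k))\<^sup>2) \<in> O(\<lambda>x. ln x ^ (4 * k))"
proof -
  have "(exp 1 * Y * \<omega> x ^ (2 * k))\<^sup>2 = (exp 1 * Y)\<^sup>2 * \<omega> x ^ (4 * k)" for x
  proof -
    have "(\<omega> x ^ (2 * k))\<^sup>2 = \<omega> x ^ (4 * k)" unfolding power_mult[symmetric] by (simp add: mult.commute)
    then show ?thesis by (simp only: power_mult_distrib)
  qed
  moreover have "(\<lambda>x. (exp 1 * Y)\<^sup>2 * \<omega> x ^ (4 * k)) \<in> O(\<lambda>x. 1 * ln x ^ (4 * k))"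
    by (intro landau_o.big_mult \<omega>_power_bigo) auto
  ultimately show ?thesis by simp
qed

text \<open>With M = 4 * k + q + 2 the trivially bounded part is of order x * ln x ^ (4 * k + 1 + q)
  / ln x ^ M = x / ln x, and the part from \<open>MPZ\<close> is of order x * ln x ^ (4 * k + M) /
  ln x ^ (8 * k + q + 3) = x / ln x. The prime powers contribute x powr (1/2) or, together with the
  pointwise bound for the weight, at most x powr (3/4), up to logarithms.\<close>

lemma lower_error_smallo:
  assumes w: "2 * k * ln 3 / ln w \<le> 1/4"
  shows "(\<lambda>x. lower_error (ln x ^ (4 * k + q + 2)) (C * (x * ln x powr (- real (8 * k + q + 3)))) x) \<in> o(\<lambda>x. x)"
proof -
  define M where "M = 4 * k + q + 2"
  define K where "K x = (exp 1 * Y * \<omega> x ^ (2 * k))\<^sup>2" for x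
  have K: "K \<in> O(\<lambda>x. ln x ^ (4 * k))" unfolding K_def by (rule weight_bigo)
  have inv: "(\<lambda>x::real. x / ln x) \<in> o(\<lambda>x. x)" by real_asymp
  have lnpos: "\<forall>\<^sub>F x::real in at_top. ln x > 0" by real_asymp
  have "(\<lambda>x. K x * (2 * x * ln (2 * x) / ln x ^ M * (exp 2 * \<omega> x ^ q))) \<in> o(\<lambda>x. x)"
  proof (rule landau_o.big_small_trans[OF _ inv])
    have "(\<lambda>x::real. 2 * x * ln (2 * x)) \<in> O(\<lambda>x. x * ln x)" by real_asymp
    then have "(\<lambda>x::real. 2 * x * ln (2 * x) * inverse (ln x ^ M)) \<in> O(\<lambda>x. x * ln x * inverse (ln x ^ M))"
      by (rule landau_o.big_mult) (rule landau_o.big_refl)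
    then have "(\<lambda>x::real. 2 * x * ln (2 * x) / ln x ^ M) \<in> O(\<lambda>x. x * ln x / ln x ^ M)"
      unfolding divide_inverse .
    moreover have "(\<lambda>x. exp 2 * \<omega> x ^ q) \<in> O(\<lambda>x. 1 * ln x ^ q)"
      by (rule landau_o.big_mult[OF _ \<omega>_power_bigo]) simp
    ultimately have "(\<lambda>x. K x * (2 * x * ln (2 * x) / ln x ^ M * (exp 2 * \<omega> x ^ q))) \<in> O(\<lambda>x. ln x ^ (4 * k) * (x * ln x / ln x ^ M * (1 * ln x ^ q)))"
      by (rule landau_o.big_mult[OF K landau_o.big_mult])
    also have "(\<lambda>x::real. ln x ^ (4 * k) * (x * ln x / ln x ^ M * (1 * ln x ^ q))) \<in> \<Theta>(\<lambda>x. x / ln x)"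
      by (rule bigthetaI_cong, rule eventually_mono[OF lnpos]) (simp add: M_def power_add field_simps power2_eq_square)
    finally show "(\<lambda>x. K x * (2 * x * ln (2 * x) / ln x ^ M * (exp 2 * \<omega> x ^ q))) \<in> O(\<lambda>x. x / ln x)" .
  qed
  moreover have "(\<lambda>x. K x * (prime_power_bound x * (exp 2 * \<omega> x ^ q))) \<in> o(\<lambda>x. x)"
  proof (rule powr_ln_power_smallo)
    have "(\<lambda>x. K x * (prime_power_bound x * (exp 2 * \<omega> x ^ q))) \<in> O(\<lambda>x. ln x ^ (4 * k) * (x powr (1/2) * ln x ^ 2 * (1 * ln x ^ q)))"
      by (intro landau_o.big_mult \<omega>_power_bigo K prime_power_bound_bigo) auto
    then show "(\<lambda>x. K x * (prime_power_bound x * (exp 2 * \<omega> x ^ q))) \<in> O(\<lambda>x. x powr (1/2) * ln x ^ (4 * k + 2 + q))"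
      by (simp only: power_add mult_1_left mult_ac)
  qed simp
  moreover have "(\<lambda>x. K x * (ln x ^ M / 2 * (C * (x * ln x powr (- real (8 * k + q + 3)))))) \<in> o(\<lambda>x. x)"
  proof (rule landau_o.big_small_trans[OF _ inv])
    have "(\<lambda>x. K x * (ln x ^ M / 2 * (C * (x * ln x powr (- real (8 * k + q + 3))))))
       \<in> O(\<lambda>x. ln x ^ (4 * k) * (ln x ^ M * (1 * (x * ln x powr (- real (8 * k + q + 3))))))"
      by (intro landau_o.big_mult K) auto
    also have "(\<lambda>x::real. ln x ^ (4 * k) * (ln x ^ M * (1 * (x * ln x powr (- real (8 * k + q + 3)))))) \<in> \<Theta>(\<lambda>x. x / ln x)"
    proof (rule bigthetaI_cong, rule eventually_mono[OF lnpos])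
      fix x :: real assume x: "ln x > 0"
      have "ln x powr (- real (8 * k + q + 3)) = 1 / ln x ^ (8 * k + q + 3)"
        using x by (simp only: powr_minus powr_realpow inverse_eq_divide)
      moreover have "ln x ^ (8 * k + q + 3) = ln x ^ (4 * k) * ln x ^ M * ln x"
      proof -
        have "8 * k + q + 3 = 4 * k + M + 1" unfolding M_def by simp
        then show ?thesis by (simp only: power_add power_one_right)
      qed
      ultimately show "ln x ^ (4 * k) * (ln x ^ M * (1 * (x * ln x powr (- real (8 * k + q + 3))))) = x / ln x"
        using x by simp
    qed
    finally show "(\<lambda>x. K x * (ln x ^ M / 2 * (C * (x * ln x powr (- real (8 * k + q + 3)))))) \<in> O(\<lambda>x. x / ln x)" .
  qed
  moreover have "(\<lambda>x. K x * (3 * x) powr (2 * k * ln 3 / ln w) * prime_power_bound x) \<in> o(\<lambda>x. x)"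
  proof (rule powr_ln_power_smallo)
    have "(\<lambda>x. (3 * x) powr (2 * k * ln 3 / ln w)) \<in> O(\<lambda>x. x powr (1/4))"
    proof -
      have "(\<lambda>x. (3 * x) powr (2 * k * ln 3 / ln w)) \<in> O(\<lambda>x::real. (3 * x) powr (1/4))"
        by (rule landau_o.big_mono, rule eventually_mono[OF eventually_ge_at_top[of 1]]) (use w in \<open>simp add: powr_mono\<close>)
      also have "(\<lambda>x::real. (3 * x) powr (1/4)) \<in> O(\<lambda>x. x powr (1/4))" by real_asymp
      finally show ?thesis .
    qed
    then have "(\<lambda>x. K x * (3 * x) powr (2 * k * ln 3 / ln w) * prime_power_bound x) \<in> O(\<lambda>x. ln x ^ (4 * k) * x powr (1/4) * (x powr (1/2) * ln x ^ 2))"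
      by (intro landau_o.big_mult K prime_power_bound_bigo)
    also have "(\<lambda>x. ln x ^ (4 * k) * x powr (1/4) * (x powr (1/2) * ln x ^ 2)) = (\<lambda>x::real. x powr (3/4) * ln x ^ (4 * k + 2))"
    proof
      fix x :: real
      have "x powr (1/4) * x powr (1/2) = x powr (3/4)" by (simp add: powr_add[symmetric])
      moreover have "ln x ^ (4 * k) * x powr (1/4) * (x powr (1/2) * ln x ^ 2) = (x powr (1/4) * x powr (1/2)) * (ln x ^ (4 * k) * ln x ^ 2)"
        by (simp only: mult_ac)
      ultimately show "ln x ^ (4 * k) * x powr (1/4) * (x powr (1/2) * ln x ^ 2) = x powr (3/4) * ln x ^ (4 * k + 2)"
        by (simp only: power_add)
    qed
    finally show "(\<lambda>x. K x * (3 * x) powr (2 * k * ln 3 / ln w) * prime_power_bound x) \<in> O(\<lambda>x. x powr (3/4) * ln x ^ (4 * k + 2))" .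
  qed simp
  ultimately have "(\<lambda>x. K x * (2 * x * ln (2 * x) / ln x ^ M * (exp 2 * \<omega> x ^ q)) + K x * (prime_power_bound x * (exp 2 * \<omega> x ^ q))
      + K x * (ln x ^ M / 2 * (C * (x * ln x powr (- real (8 * k + q + 3)))))
      + K x * (3 * x) powr (2 * k * ln 3 / ln w) * prime_power_bound x) \<in> o(\<lambda>x. x)"
    by (intro sum_in_smallo)
  also have "(\<lambda>x. K x * (2 * x * ln (2 * x) / ln x ^ M * (exp 2 * \<omega> x ^ q)) + K x * (prime_power_bound x * (exp 2 * \<omega> x ^ q))
      + K x * (ln x ^ M / 2 * (C * (x * ln x powr (- real (8 * k + q + 3)))))
      + K x * (3 * x) powr (2 * k * ln 3 / ln w) * prime_power_bound x)
     = (\<lambda>x. lower_error (ln x ^ (4 * k + q + 2)) (C * (x * ln x powr (- real (8 * k + q + 3)))) x)"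
    unfolding lower_error_def K_def[symmetric] M_def[symmetric] q_def[symmetric]
    by (simp only: distrib_left distrib_right add.assoc)
  finally show ?thesis .
qed

end

context sieve_asymptotics
begin

definition upper_main :: real where
  "upper_main = (\<Sum>j\<in>PiE {..<k} (\<lambda>_. {..<N}). (\<Phi> j)\<^sup>2) / N ^ k + (exp 1 * Y)\<^sup>2 * (exp (6 * (k + 1)\<^sup>2 / w) - 1)"

definition lower_main :: "nat \<Rightarrow> real" where
  "lower_main m = (\<Sum>j\<in>PiE {..<k} (\<lambda>_. {..<N}). \<Sum>v<N. \<Phi> j * \<Phi> (j(m := v))) / N ^ Suc k
     - Y\<^sup>2 * (real (Suc k) ^ 2 / w) - (exp 1 * Y)\<^sup>2 * (exp (6 * (k + 1)\<^sup>2 / w) - 1)"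

lemma smallo_scaled_limit:
  assumes "e \<in> o(\<lambda>x. x)"
  shows "((\<lambda>x. e x * (totient W / (x * \<beta> x ^ Suc k))) \<longlongrightarrow> 0) at_top"
proof -
  have "((\<lambda>x. e x / x) \<longlongrightarrow> 0) at_top" by (rule smalloD_tendsto[OF assms])
  moreover have "((\<lambda>x. totient W * (1 / \<beta> x) ^ Suc k) \<longlongrightarrow> real (totient W) * 0 ^ Suc k) at_top"
    by (intro tendsto_mult tendsto_const tendsto_power tendsto_divide_0[OF tendsto_const] filterlim_at_top_imp_at_infinity \<beta>_at_top)
  ultimately have "((\<lambda>x. e x / x * (totient W * (1 / \<beta> x) ^ Suc k)) \<longlongrightarrow> 0 * (real (totient W) * 0 ^ Suc k)) at_top"
    by (rule tendsto_mult)
  moreover have "e x / x * (totient W * (1 / \<beta> x) ^ Suc k) = e x * (totient W / (x * \<beta> x ^ Suc k))" for x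
    unfolding power_divide by simp
  ultimately show ?thesis by simp
qed

text \<open>Both sides are multiplied by totient W / (x * \<beta> x ^ Suc k) and compared in the
  limit. The class mod W has density 1 / W among integers and 1 / totient W among primes, which
  leaves the factor \<tau> / \<beta> x = 1 / (\<theta> * ln x); together with ln (2x) it tends to 1
  / \<theta>. The claim is uniform in \<Psi> because the mass of primes is known to be large only
  for certain x.\<close>

lemma eventually_lower_exceeds_upper:
  fixes H \<epsilon> :: real and m :: nat
  assumes e: "e \<in> o(\<lambda>x. x)" and pos: "0 < (\<Sum>i<k. lower_main i)"
    and gap: "m / \<theta> * upper_main < (1 - \<epsilon>) * (\<Sum>i<k. lower_main i)"
  shows "\<forall>\<^sub>F x in at_top. \<forall>\<Psi>. (1 - \<epsilon>) * x \<le> \<Psi> \<longrightarrow>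
    m * ln (2 * x) * ((x + 2 * H) / W * upper x + upper_error x) < (\<Sum>i<k. \<Psi> / totient W * lower i x - e x)"
proof -
  define T where "T x = totient W / (x * \<beta> x ^ Suc k)" for x
  define S where "S x = (\<Sum>i<k. lower i x / \<beta> x ^ Suc k)" for x
  define G where "G x = (1 - \<epsilon>) * S x - k * (e x * T x)
     - m * (ln (2 * x) / ln x * (1 / \<theta>) * ((x + 2 * H) / x) * (upper x / \<beta> x ^ k) + ln (2 * x) * upper_error x * T x)" for x
  have S: "(S \<longlongrightarrow> (\<Sum>i<k. lower_main i)) at_top"
    unfolding S_def lower_main_def by (intro tendsto_sum lower_limit) auto
  have U: "((\<lambda>x. upper x / \<beta> x ^ k) \<longlongrightarrow> upper_main) at_top"
    unfolding upper_main_def by (rule upper_limit)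
  have l: "((\<lambda>x::real. ln (2 * x) / ln x) \<longlongrightarrow> 1) at_top" "((\<lambda>x::real. (x + 2 * H) / x) \<longlongrightarrow> 1) at_top" by real_asymp+
  have "(G \<longlongrightarrow> (1 - \<epsilon>) * (\<Sum>i<k. lower_main i) - real k * 0 - real m * (1 * (1 / \<theta>) * 1 * upper_main + 0)) at_top"
    unfolding G_def T_def
    by (intro tendsto_diff tendsto_mult tendsto_add tendsto_const S U l smallo_scaled_limit e upper_error_smallo)
  then have "\<forall>\<^sub>F x in at_top. 0 < G x" by (rule order_tendstoD) (use gap in simp)
  moreover have "\<forall>\<^sub>F x in at_top. 0 < S x" by (rule order_tendstoD(1)[OF S pos])
  ultimately show ?thesis using eventually_gt_at_top[of 1]
  proof eventually_elim
    case (elim x)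
    have \<beta>: "\<beta> x > 0" unfolding \<beta>_def using \<tau>_pos \<theta> elim by simp
    have tot: "real (totient W) > 0" using W_pos by simp
    have T: "T x > 0" unfolding T_def using \<beta> tot elim by simp
    show ?case
    proof (intro allI impI)
      fix \<Psi> assume \<Psi>: "(1 - \<epsilon>) * x \<le> \<Psi>"
      have "1 - \<epsilon> \<le> \<Psi> / x" using \<Psi> elim by (simp add: field_simps)
      \<comment> \<open>Positivity of the lower main term ensures that a larger \<Psi> can only
        help.\<close>
      then have "(1 - \<epsilon>) * S x \<le> \<Psi> / x * S x" using elim by (intro mult_right_mono) auto
      also have "\<dots> = (\<Sum>i<k. \<Psi> / totient W * lower i x) * T x"
        unfolding S_def T_def sum_distrib_left sum_distrib_right using tot by (intro sum.cong refl) simp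
      finally have A: "(1 - \<epsilon>) * S x - k * (e x * T x) \<le> (\<Sum>i<k. \<Psi> / totient W * lower i x - e x) * T x"
        by (simp add: sum_subtractf left_diff_distrib)
      have "ln (2 * x) * ((x + 2 * H) / W * upper x) * T x = ln (2 * x) / ln x * (1 / \<theta>) * ((x + 2 * H) / x) * (upper x / \<beta> x ^ k)"
      proof -
        have "ln (2 * x) * ((x + 2 * H) / W * upper x) * T x = ln (2 * x) * (\<tau> / \<beta> x) * ((x + 2 * H) / x) * (upper x / \<beta> x ^ k)"
          unfolding T_def \<tau>_def power_Suc
          by (simp only: times_divide_times_eq times_divide_eq_right times_divide_eq_left divide_divide_eq_left mult_ac)
        moreover have "\<tau> / \<beta> x = 1 / ln x * (1 / \<theta>)" unfolding \<beta>_def using \<tau>_pos by simp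
        ultimately show ?thesis by simp
      qed
      then have "m * ln (2 * x) * ((x + 2 * H) / W * upper x + upper_error x) * T x
        = m * (ln (2 * x) / ln x * (1 / \<theta>) * ((x + 2 * H) / x) * (upper x / \<beta> x ^ k) + ln (2 * x) * upper_error x * T x)"
        by (simp only: distrib_left distrib_right mult.assoc)
      then have "m * ln (2 * x) * ((x + 2 * H) / W * upper x + upper_error x) * T x < (\<Sum>i<k. \<Psi> / totient W * lower i x - e x) * T x"
        using A elim(1) unfolding G_def by linarith
      then show "m * ln (2 * x) * ((x + 2 * H) / W * upper x + upper_error x) < (\<Sum>i<k. \<Psi> / totient W * lower i x - e x)"
        using T by (simp only: mult_less_cancel_right_pos)
    qed
  qed
qed

end

section \<open>Choice of the parameters and conclusion\<close>

lemma eventually_gap_with_errors: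
  fixes Y c IS JS :: real and k :: nat
  assumes "c * IS < JS"
  shows "\<forall>\<^sub>F w::nat in sequentially. c * (IS + (exp 1 * Y)\<^sup>2 * (exp (6 * (k + 1)\<^sup>2 / w) - 1))
     < JS - k * (Y\<^sup>2 * (real (Suc k) ^ 2 / w) + (exp 1 * Y)\<^sup>2 * (exp (6 * (k + 1)\<^sup>2 / w) - 1))"
proof -
  have 1: "((\<lambda>w::nat. a / real w) \<longlongrightarrow> 0) sequentially" for a :: real by real_asymp
  have 2: "((\<lambda>w::nat. exp (a / real w) - 1) \<longlongrightarrow> exp 0 - 1) sequentially" for a :: real
    by (intro tendsto_diff tendsto_exp 1 tendsto_const)
  have "((\<lambda>w::nat. JS - k * (Y\<^sup>2 * (real (Suc k) ^ 2 / w) + (exp 1 * Y)\<^sup>2 * (exp (6 * (k + 1)\<^sup>2 / w) - 1))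
      - c * (IS + (exp 1 * Y)\<^sup>2 * (exp (6 * (k + 1)\<^sup>2 / w) - 1))) \<longlongrightarrow>
      JS - k * (Y\<^sup>2 * 0 + (exp 1 * Y)\<^sup>2 * (exp 0 - 1)) - c * (IS + (exp 1 * Y)\<^sup>2 * (exp 0 - 1))) sequentially"
    by (intro tendsto_diff tendsto_mult tendsto_add tendsto_const 1 2)
  then have "\<forall>\<^sub>F w::nat in sequentially. 0 < JS - k * (Y\<^sup>2 * (real (Suc k) ^ 2 / w) + (exp 1 * Y)\<^sup>2 * (exp (6 * (k + 1)\<^sup>2 / w) - 1))
      - c * (IS + (exp 1 * Y)\<^sup>2 * (exp (6 * (k + 1)\<^sup>2 / w) - 1))"
    by (rule order_tendstoD(1)) (use assms in simp)
  then show ?thesis by (rule eventually_mono) linarith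
qed

text \<open>If the shifts avoid the class a p mod p, then b = - a p mod p makes every b + h i
  nonzero mod p; the Chinese remainder theorem combines the primes up to w.\<close>

lemma admissible_residue_exists:
  assumes "admissible_tuple k h"
  shows "\<exists>b. \<forall>p i. prime p \<longrightarrow> p \<le> w \<longrightarrow> i < k \<longrightarrow> \<not> int p dvd b + h i"
proof -
  have "\<forall>p. \<exists>a. prime p \<longrightarrow> (\<forall>i<k. \<not> [h i = a] (mod int p))"
    using assms unfolding admissible_tuple_def by blast
  then obtain a where a: "\<And>p i. prime p \<Longrightarrow> i < k \<Longrightarrow> \<not> [h i = a p] (mod int p)" by metis
  obtain b where b: "\<And>n. (\<forall>p\<in>{p. prime p \<and> p \<le> w}. [n = - a p] (mod int p)) \<longleftrightarrow> [n = b] (mod int (\<Prod>{p. prime p \<and> p \<le> w}))"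
    using chinese_remainder_primes[OF finite_primes_le, of w "\<lambda>p. - a p"] by auto
  have "\<not> int p dvd b + h i" if p: "prime p" "p \<le> w" "i < k" for p i
  proof
    assume "int p dvd b + h i"
    moreover have "[b = - a p] (mod int p)" using b[of b] p by auto
    then have "int p dvd b + a p" by (simp add: cong_iff_dvd_diff)
    ultimately have "int p dvd (b + h i) - (b + a p)" by (rule dvd_diff)
    then have "[h i = a p] (mod int p)" by (simp add: cong_iff_dvd_diff)
    then show False using a p by blast
  qed
  then show ?thesis by blast
qed

lemma sum_prime_logs_le:
  fixes x :: real and n :: int and h :: "nat \<Rightarrow> int"
  assumes x: "x \<ge> 1" and card: "card {i. i < k \<and> prime (n + h i)} \<le> m"
  shows "(\<Sum>i<k. if prime (n + h i) \<and> nat (n + h i) \<in> dyadic x then ln (n + h i) else 0) \<le> m * ln (2 * x)"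
proof -
  have ln0: "0 \<le> ln (2 * x)" using x by simp
  have "(\<Sum>i<k. if prime (n + h i) \<and> nat (n + h i) \<in> dyadic x then ln (n + h i) else 0) \<le> (\<Sum>i<k. if prime (n + h i) then ln (2 * x) else 0)"
  proof (rule sum_mono)
    fix i
    have "ln (real_of_int (n + h i)) \<le> ln (2 * x)" if "prime (n + h i)" "nat (n + h i) \<in> dyadic x"
    proof -
      have "n + h i > 0" using that(1) by (simp add: prime_gt_0_int)
      moreover have "real (nat (n + h i)) \<le> 2 * x" using that(2) unfolding dyadic_def by simp
      ultimately show ?thesis by simp
    qed
    then show "(if prime (n + h i) \<and> nat (n + h i) \<in> dyadic x then ln (n + h i) else 0) \<le> (if prime (n + h i) then ln (2 * x) else 0)"
      using ln0 by auto
  qed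
  also have "\<dots> = (\<Sum>i\<in>{i \<in> {..<k}. prime (n + h i)}. ln (2 * x))" by (rule sum.inter_filter[OF finite_lessThan, symmetric])
  also have "\<dots> = card {i. i < k \<and> prime (n + h i)} * ln (2 * x)" by simp
  also have "\<dots> \<le> m * ln (2 * x)" using card ln0 by (intro mult_right_mono) auto
  finally show ?thesis .
qed

text \<open>The constant is written as x powr (ln c / ln x); this lets the factor W into the range
  of moduli.\<close>

lemma lessapprox_const_powr:
  fixes c a :: real
  assumes "c > 0"
  shows "lessapprox (\<lambda>x. c * x powr a) (\<lambda>x. x powr a)"
  unfolding lessapprox_def
proof (intro exI[of _ "\<lambda>x. ln c / ln x"] conjI)
  show "((\<lambda>x. ln c / ln x) \<longlongrightarrow> 0) at_top"
    by (intro tendsto_divide_0[OF tendsto_const] filterlim_at_top_imp_at_infinity ln_at_top)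
  show "\<forall>\<^sub>F x in at_top. \<bar>c * x powr a\<bar> \<le> x powr (ln c / ln x) * x powr a"
    using eventually_gt_at_top[of 1]
  proof (rule eventually_mono)
    fix x :: real assume "x > 1"
    then have "x powr (ln c / ln x) = c" using assms by (simp add: powr_def)
    then show "\<bar>c * x powr a\<bar> \<le> x powr (ln c / ln x) * x powr a" using assms by (simp add: abs_mult)
  qed
qed

text \<open>The truncation at \<delta> / \<theta> becomes the bound x powr \<delta>, since (x powr
  \<theta>) powr (\<delta> / \<theta>) = x powr \<delta>.\<close>

lemma grid_sieve_powr:
  fixes x \<theta> \<delta> Y :: real
  assumes "w \<ge> 2" "N \<ge> 1" "x > 1" and \<theta>: "\<theta> > 0"
    and \<Phi>: "\<And>j. 0 \<le> \<Phi> j \<and> \<Phi> j \<le> Y"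
    and supp: "\<And>j. \<Phi> j \<noteq> 0 \<Longrightarrow> j \<in> PiE {..<k} (\<lambda>_. {..<N}) \<and> inside_cell k (\<delta> / \<theta>) N j"
  shows "grid_sieve k w N (x powr \<delta>) (x powr \<theta>) Y \<Phi>"
proof
  show "x powr \<theta> > 1" using assms by (intro gr_one_powr)
  fix j assume j: "\<Phi> j \<noteq> 0"
  show "j \<in> PiE {..<k} (\<lambda>_. {..<N})" "(\<Sum>i<k. Suc (j i)) \<le> N"
    using supp[OF j] unfolding inside_cell_def by auto
  fix i assume i: "i < k"
  have "real (Suc (j i)) \<le> \<delta> / \<theta> * N" using supp[OF j] i unfolding inside_cell_def by blast
  then have "\<theta> * (Suc (j i) / N) \<le> \<delta>" using \<theta> \<open>N \<ge> 1\<close> by (simp add: field_simps)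
  then show "(x powr \<theta>) powr (Suc (j i) / N) \<le> x powr \<delta>"
    unfolding powr_powr using \<open>x > 1\<close> by (intro powr_mono) auto
qed (use assms in auto)

text \<open>Order of choice: w depends on \<Phi>, N, Y and the shifts, \<epsilon> also on w, and x
  is then taken beyond all thresholds among the dyadic intervals rich in primes. If every large n
  had at most m primes among the n + h i, the sum of their logarithms would be at most m * ln (2x)
  for each n, contrary to the comparison of the weighted sums.\<close>

lemma primes_in_tuple_beyond:
  fixes k m N n0 :: nat and varpi \<delta> Y :: real and \<Phi> :: "(nat \<Rightarrow> nat) \<Rightarrow> real" and h :: "nat \<Rightarrow> int"
  defines "\<theta> \<equiv> 1/4 + varpi"
  assumes k: "k \<ge> 2" and varpi: "0 < varpi" "varpi < 1/4" and \<delta>: "0 < \<delta>" "\<delta> < 1/2"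
    and mpz: "MPZ varpi \<delta>" and adm: "admissible_tuple k h"
    and N: "N \<ge> 1" and \<Phi>: "\<And>j. 0 \<le> \<Phi> j \<and> \<Phi> j \<le> Y"
    and supp: "\<And>j. \<Phi> j \<noteq> 0 \<Longrightarrow> j \<in> PiE {..<k} (\<lambda>_. {..<N}) \<and> inside_cell k (\<delta> / \<theta>) N j"
    and gap: "m / \<theta> * ((\<Sum>j\<in>PiE {..<k} (\<lambda>_. {..<N}). (\<Phi> j)\<^sup>2) / N ^ k)
      < (\<Sum>i<k. (\<Sum>j\<in>PiE {..<k} (\<lambda>_. {..<N}). \<Sum>v<N. \<Phi> j * \<Phi> (j(i := v))) / N ^ Suc k)"
  shows "\<exists>n\<ge>n0. card {i. i < k \<and> prime (int n + h i)} \<ge> m + 1"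
proof (rule ccontr)
  assume none: "\<not> ?thesis"
  have \<theta>: "0 < \<theta>" "\<theta> < 1/2" unfolding \<theta>_def using varpi by auto
  define Hm :: nat where "Hm = (\<Sum>i<k. nat \<bar>h i\<bar>)"
  have h_le: "\<bar>h i\<bar> \<le> int Hm" if "i < k" for i
  proof -
    have "nat \<bar>h i\<bar> \<le> Hm" unfolding Hm_def using that by (intro member_le_sum) auto
    then show ?thesis by simp
  qed
  have "\<forall>\<^sub>F w::nat in sequentially. 2 * k * ln 3 / ln w \<le> 1/4"
  proof -
    have "((\<lambda>w::nat. 2 * k * ln 3 / ln w) \<longlongrightarrow> 0) sequentially" by real_asymp
    then have "\<forall>\<^sub>F w::nat in sequentially. 2 * k * ln 3 / ln w < 1/4" by (rule order_tendstoD(2)) simp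
    then show ?thesis by (rule eventually_mono) simp
  qed
  then have "\<forall>\<^sub>F w::nat in sequentially. 2 * k * ln 3 / ln w \<le> 1/4 \<and> max 2 (2 * Hm + 1) \<le> w \<and>
     m / \<theta> * ((\<Sum>j\<in>PiE {..<k} (\<lambda>_. {..<N}). (\<Phi> j)\<^sup>2) / N ^ k + (exp 1 * Y)\<^sup>2 * (exp (6 * (k + 1)\<^sup>2 / w) - 1))
     < (\<Sum>i<k. (\<Sum>j\<in>PiE {..<k} (\<lambda>_. {..<N}). \<Sum>v<N. \<Phi> j * \<Phi> (j(i := v))) / N ^ Suc k)
       - k * (Y\<^sup>2 * (real (Suc k) ^ 2 / w) + (exp 1 * Y)\<^sup>2 * (exp (6 * (k + 1)\<^sup>2 / w) - 1))"
    by (intro eventually_conj eventually_ge_at_top eventually_gap_with_errors gap)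
  \<comment> \<open>The bound 1/4 keeps the pointwise weight times the prime powers at x powr (3/4)
    up to logarithms; w \<ge> 2 * Hm + 1 ensures that no prime above w divides a difference of two
    shifts.\<close>
  then obtain w where w1: "2 * k * ln 3 / ln (real w) \<le> 1/4" and w2: "max 2 (2 * Hm + 1) \<le> w"
    and w3: "m / \<theta> * ((\<Sum>j\<in>PiE {..<k} (\<lambda>_. {..<N}). (\<Phi> j)\<^sup>2) / N ^ k + (exp 1 * Y)\<^sup>2 * (exp (6 * (k + 1)\<^sup>2 / w) - 1))
     < (\<Sum>i<k. (\<Sum>j\<in>PiE {..<k} (\<lambda>_. {..<N}). \<Sum>v<N. \<Phi> j * \<Phi> (j(i := v))) / N ^ Suc k)
       - k * (Y\<^sup>2 * (real (Suc k) ^ 2 / w) + (exp 1 * Y)\<^sup>2 * (exp (6 * (k + 1)\<^sup>2 / w) - 1))"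
    unfolding eventually_sequentially by blast
  interpret A: sieve_asymptotics k w N Y \<theta> \<Phi> by standard (use N \<theta> in auto)
  obtain b where b: "\<And>p i. prime p \<Longrightarrow> p \<le> w \<Longrightarrow> i < k \<Longrightarrow> \<not> int p dvd b + h i"
    using admissible_residue_exists[OF adm, of w] by blast
  have distinct: "\<not> [h i = h j] (mod int p)" if "prime p" "w < p" "i < k" "j < k" "i \<noteq> j" for p i j
  proof
    assume "[h i = h j] (mod int p)"
    then have "int p dvd h i - h j" by (simp add: cong_iff_dvd_diff)
    moreover have "h i \<noteq> h j"
      using adm that(3-5) unfolding admissible_tuple_def by (metis lessThan_iff linorder_neq_iff strict_mono_onD)
    ultimately have "int p \<le> \<bar>h i - h j\<bar>" using dvd_imp_le_int[of "h i - h j" "int p"] by simp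
    then show False using h_le[OF that(3)] h_le[OF that(4)] that(2) w2 by linarith
  qed
  define um lm where "um = A.upper_main" and "lm = (\<Sum>i<k. A.lower_main i)"
  have lt: "m / \<theta> * um < lm"
    using w3 unfolding um_def lm_def A.upper_main_def A.lower_main_def
    by (simp only: sum_subtractf sum_constant card_lessThan distrib_left diff_diff_eq)
  have "0 \<le> um" unfolding um_def A.upper_main_def
    by (intro add_nonneg_nonneg divide_nonneg_nonneg sum_nonneg mult_nonneg_nonneg) auto
  then have mu0: "0 \<le> m / \<theta> * um" using \<theta> by simp
  then have lm0: "0 < lm" using lt by linarith
  \<comment> \<open>Half of the relative gap, so that (1 - \<epsilon>) * lm is the midpoint between
    m / \<theta> * um and lm.\<close>
  define \<epsilon> where "\<epsilon> = (lm - m / \<theta> * um) / (2 * lm)"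
  have \<epsilon>: "\<epsilon> > 0" unfolding \<epsilon>_def using lt lm0 by simp
  have gap': "m / \<theta> * um < (1 - \<epsilon>) * lm"
  proof -
    define c e where "c = m / \<theta> * um" and "e = \<epsilon> * lm"
    have "2 * (a / (2 * lm) * lm) = a" for a using lm0 by simp
    then have "2 * e = lm - c" unfolding \<epsilon>_def c_def e_def .
    moreover have "c < lm" unfolding c_def by (rule lt)
    ultimately have "c < lm - e" by linarith
    then show ?thesis unfolding c_def e_def by (simp only: left_diff_distrib mult_1_left)
  qed
  have Q: "lessapprox (\<lambda>x. real A.W * (x powr \<theta>)\<^sup>2) (\<lambda>x. x powr (1/2 + 2 * varpi))"
  proof -
    have "(x powr \<theta>)\<^sup>2 = x powr (1/2 + 2 * varpi)" for x :: real
      unfolding power2_eq_square \<theta>_def by (simp add: powr_add[symmetric])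
    then show ?thesis using lessapprox_const_powr[of "real A.W"] A.W_pos by simp
  qed
  obtain C where C: "C > 0" and E: "\<forall>\<^sub>F x in at_top. \<forall>a. (\<forall>p. prime p \<longrightarrow> real p \<le> x powr \<delta> \<longrightarrow> \<not> int p dvd a) \<longrightarrow>
     (\<Sum>q | real q \<le> real A.W * (x powr \<theta>)\<^sup>2 \<and> q \<in> squarefree_with_factors_in {1..x powr \<delta>}.
        \<bar>discrepancy (\<lambda>n. mangoldt n * indicator {x..2 * x} (real n)) a q\<bar>) \<le> C * (x * ln x powr (- real (8 * k + A.q + 3)))"
    using MPZ_uniform[OF mpz _ Q, of "real (8 * k + A.q + 3)"] by auto
  define err where "err x = A.lower_error (ln x ^ (4 * k + A.q + 2)) (C * (x * ln x powr (- real (8 * k + A.q + 3)))) x" for x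
  have err: "err \<in> o(\<lambda>x. x)" unfolding err_def by (rule A.lower_error_smallo[OF w1])
  have big: "\<forall>\<^sub>F x in at_top. \<forall>\<Psi>. (1 - \<epsilon>) * x \<le> \<Psi> \<longrightarrow>
    m * ln (2 * x) * ((x + 2 * real Hm) / A.W * A.upper x + A.upper_error x) < (\<Sum>i<k. \<Psi> / totient A.W * A.lower i x - err x)"
    by (rule A.eventually_lower_exceeds_upper[OF err]) (use gap' lm0 in \<open>unfold um_def lm_def\<close>)
  have "\<forall>\<^sub>F x in at_top. real w \<le> x powr \<delta>" using \<delta> by real_asymp
  moreover have "\<forall>\<^sub>F x in at_top. x powr \<delta> < x" using \<delta> by real_asymp
  moreover have "\<forall>\<^sub>F x in at_top. real A.W * (x powr \<theta>)\<^sup>2 \<le> x"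
  proof -
    have "(\<lambda>x. real A.W * (x powr \<theta>)\<^sup>2) \<in> o(\<lambda>x. x)"
    proof (rule powr_ln_power_smallo[where a = "2 * \<theta>" and n = 0])
      have "(\<lambda>x. real A.W * (x powr \<theta>)\<^sup>2) = (\<lambda>x. real A.W * x powr (2 * \<theta>))"
        by (simp add: power2_eq_square powr_add[symmetric])
      then show "(\<lambda>x. real A.W * (x powr \<theta>)\<^sup>2) \<in> O(\<lambda>x. x powr (2 * \<theta>) * ln x ^ 0)" by simp
    qed (use \<theta> in simp)
    then have "\<forall>\<^sub>F x in at_top. norm (real A.W * (x powr \<theta>)\<^sup>2) \<le> 1 * norm x" by (rule landau_o.smallD) simp
    then show ?thesis using eventually_ge_at_top[of 0] by eventually_elim simp
  qed
  ultimately have "\<forall>\<^sub>F x in at_top. real w \<le> x powr \<delta> \<and> x powr \<delta> < x \<and> real A.W * (x powr \<theta>)\<^sup>2 \<le> x \<and> 2 \<le> x \<and> real (n0 + 2 * Hm + 1) \<le> x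
     \<and> (\<forall>a. (\<forall>p. prime p \<longrightarrow> real p \<le> x powr \<delta> \<longrightarrow> \<not> int p dvd a) \<longrightarrow>
       (\<Sum>q | real q \<le> real A.W * (x powr \<theta>)\<^sup>2 \<and> q \<in> squarefree_with_factors_in {1..x powr \<delta>}.
        \<bar>discrepancy (\<lambda>n. mangoldt n * indicator {x..2 * x} (real n)) a q\<bar>) \<le> C * (x * ln x powr (- real (8 * k + A.q + 3))))
     \<and> (\<forall>\<Psi>. (1 - \<epsilon>) * x \<le> \<Psi> \<longrightarrow>
       m * ln (2 * x) * ((x + 2 * real Hm) / A.W * A.upper x + A.upper_error x) < (\<Sum>i<k. \<Psi> / totient A.W * A.lower i x - err x))"
    using E big by (intro eventually_conj eventually_ge_at_top)
  then obtain x0 where x0: "\<And>x. x0 \<le> x \<Longrightarrow> real w \<le> x powr \<delta> \<and> x powr \<delta> < x \<and> real A.W * (x powr \<theta>)\<^sup>2 \<le> x \<and> 2 \<le> x \<and> real (n0 + 2 * Hm + 1) \<le> x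
     \<and> (\<forall>a. (\<forall>p. prime p \<longrightarrow> real p \<le> x powr \<delta> \<longrightarrow> \<not> int p dvd a) \<longrightarrow>
       (\<Sum>q | real q \<le> real A.W * (x powr \<theta>)\<^sup>2 \<and> q \<in> squarefree_with_factors_in {1..x powr \<delta>}.
        \<bar>discrepancy (\<lambda>n. mangoldt n * indicator {x..2 * x} (real n)) a q\<bar>) \<le> C * (x * ln x powr (- real (8 * k + A.q + 3))))
     \<and> (\<forall>\<Psi>. (1 - \<epsilon>) * x \<le> \<Psi> \<longrightarrow>
       m * ln (2 * x) * ((x + 2 * real Hm) / A.W * A.upper x + A.upper_error x) < (\<Sum>i<k. \<Psi> / totient A.W * A.lower i x - err x))"
    unfolding eventually_at_top_linorder by blast
  \<comment> \<open>The dyadic lower bound holds at integers, so x is taken to be an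
    integer.\<close>
  obtain X where X: "nat \<lceil>x0\<rceil> \<le> X" and psi: "(1 - \<epsilon>) * real X \<le> (\<Sum>n=X..2*X. mangoldt n)"
    using dyadic_mangoldt_ge[OF \<epsilon>] by blast
  define x where "x = real X"
  have x0x: "x0 \<le> x" using X unfolding x_def by linarith
  note props = x0[OF x0x]
  have p1: "real w \<le> x powr \<delta>" and p2: "x powr \<delta> < x" and p3: "real A.W * (x powr \<theta>)\<^sup>2 \<le> x" and p4: "2 \<le> x" and p5: "real (n0 + 2 * Hm + 1) \<le> x"
    and p6: "\<And>a. (\<And>p. prime p \<Longrightarrow> real p \<le> x powr \<delta> \<Longrightarrow> \<not> int p dvd a) \<Longrightarrow>
       (\<Sum>q | real q \<le> real A.W * (x powr \<theta>)\<^sup>2 \<and> q \<in> squarefree_with_factors_in {1..x powr \<delta>}.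
        \<bar>discrepancy (\<lambda>n. mangoldt n * indicator {x..2 * x} (real n)) a q\<bar>) \<le> C * (x * ln x powr (- real (8 * k + A.q + 3)))"
    and p7: "\<And>\<Psi>. (1 - \<epsilon>) * x \<le> \<Psi> \<Longrightarrow>
       m * ln (2 * x) * ((x + 2 * real Hm) / A.W * A.upper x + A.upper_error x) < (\<Sum>i<k. \<Psi> / totient A.W * A.lower i x - err x)"
    using props by blast+
  have pX: "n0 + 2 * Hm + 1 \<le> X" using p5 unfolding x_def by (simp only: of_nat_le_iff)
  have "dyadic x = {X..2*X}" unfolding dyadic_def x_def
    by (auto simp: of_nat_le_iff[symmetric, where 'a = real] simp del: of_nat_le_iff)
  then have psi': "(1 - \<epsilon>) * x \<le> dyadic_mangoldt x" using psi unfolding dyadic_mangoldt_def x_def by simp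
  \<comment> \<open>The range is widened by \<open>Hm\<close> on both sides, so that every shift n +
    h i covers the whole interval from x to 2x.\<close>
  define u v where "u = int X - int Hm" and "v = 2 * int X + int Hm"
  have hr: "\<bar>real_of_int (h i)\<bar> \<le> real Hm" if "i < k" for i
    using h_le[OF that] by linarith
  define S where "S = {n \<in> {u..v}. [n = b] (mod int A.W)}"
  define logp where "logp i n = (if prime (n + h i) \<and> nat (n + h i) \<in> dyadic x then ln (n + h i) else 0)" for i n
  have "\<exists>\<nu>. (\<forall>n. 0 \<le> \<nu> n) \<and>
     (\<Sum>n\<in>S. \<nu> n) \<le> real_of_int (v - u) / A.W * A.upper x + A.upper_error x \<and>
     (\<forall>i<k. (\<Sum>n\<in>S. \<nu> n * logp i n) \<ge> dyadic_mangoldt x / totient A.W * A.lower i x - err x)"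
    unfolding S_def logp_def A.upper_def A.upper_error_def A.lower_def err_def A.lower_error_def A.\<omega>_def diff_diff_eq[symmetric] A.W_def
  proof (rule sieve_inequalities[OF k, where z = "x powr \<delta>"])
    show "grid_sieve k w N (x powr \<delta>) (x powr \<theta>) Y \<Phi>"
      by (rule grid_sieve_powr[OF _ N _ \<theta>(1) \<Phi> supp]) (use w2 p4 in auto)
    show "real_of_int u \<le> x - h i \<and> 2 * x - h i \<le> real_of_int v" if "i < k" for i
      using hr[OF that] unfolding u_def v_def x_def by auto
    show "0 < x - h i + h j \<and> 2 * x - h i + h j \<le> 3 * x" if "i < k" "j < k" for i j
      using hr[OF that(1)] hr[OF that(2)] p5 by auto
    show "u \<le> v" unfolding u_def v_def by simp
    show "0 < ln x ^ (4 * k + A.q + 2)" using p4 by simp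
    show "real (primorial w) * (x powr \<theta>)\<^sup>2 \<le> x" using p3 unfolding A.W_def .
  qed (use p1 p2 p4 p6 b distinct in \<open>simp_all add: A.W_def[symmetric]\<close>)
  then obtain \<nu> where \<nu>0: "\<And>n. 0 \<le> \<nu> n" and S1: "(\<Sum>n\<in>S. \<nu> n) \<le> real_of_int (v - u) / A.W * A.upper x + A.upper_error x"
    and S2: "\<And>i. i < k \<Longrightarrow> dyadic_mangoldt x / totient A.W * A.lower i x - err x \<le> (\<Sum>n\<in>S. \<nu> n * logp i n)"
    by blast
  have vu: "real_of_int (v - u) = x + 2 * real Hm" unfolding u_def v_def x_def by simp
  have le: "(\<Sum>i<k. logp i n) \<le> m * ln (2 * x)" if "n \<in> S" for n
  proof -
    have n: "int n0 \<le> n" using that pX unfolding S_def u_def by auto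
    then have "n0 \<le> nat n" by simp
    then have "\<not> m + 1 \<le> card {i. i < k \<and> prime (int (nat n) + h i)}" using none by blast
    then have "card {i. i < k \<and> prime (n + h i)} \<le> m" using n by simp
    then show ?thesis unfolding logp_def by (rule sum_prime_logs_le[rotated]) (use p4 in simp)
  qed
  have "(\<Sum>i<k. dyadic_mangoldt x / totient A.W * A.lower i x - err x) \<le> (\<Sum>i<k. \<Sum>n\<in>S. \<nu> n * logp i n)"
    by (intro sum_mono S2) simp
  also have "\<dots> = (\<Sum>n\<in>S. \<nu> n * (\<Sum>i<k. logp i n))" unfolding sum_distrib_left by (rule sum.swap)
  also have "\<dots> \<le> (\<Sum>n\<in>S. \<nu> n * (m * ln (2 * x)))" by (intro sum_mono mult_left_mono le \<nu>0)
  also have "\<dots> = m * ln (2 * x) * (\<Sum>n\<in>S. \<nu> n)" unfolding sum_distrib_right[symmetric] by (rule mult.commute)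
  also have "\<dots> \<le> m * ln (2 * x) * ((x + 2 * real Hm) / A.W * A.upper x + A.upper_error x)"
    using S1 p4 unfolding vu by (intro mult_left_mono) auto
  also have "\<dots> < (\<Sum>i<k. dyadic_mangoldt x / totient A.W * A.lower i x - err x)" by (rule p7[OF psi'])
  finally show False by simp
qed

text \<open>Membership excludes functions that vanish almost everywhere; positivity allows
  multiplying out the quotient in \<open>M_truncated\<close>.\<close>

lemma I_functional_pos:
  assumes F: "F \<in> truncated_functions k \<alpha>"
  shows "I_functional k F > 0"
proof -
  define f where "f t = indicator (orthant {..<k}) t *\<^sub>R (F t)\<^sup>2" for t
  have int: "integrable (lebesgue_prod {..<k}) f"
    using F unfolding truncated_functions_def square_integrable_def set_integrable_def f_def by auto
  have I: "I_functional k F = integral\<^sup>L (lebesgue_prod {..<k}) f"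
    unfolding I_functional_def set_lebesgue_integral_def f_def ..
  have f0: "0 \<le> f t" for t unfolding f_def by simp
  have "I_functional k F \<noteq> 0"
  proof
    assume "I_functional k F = 0"
    then have "AE t in lebesgue_prod {..<k}. f t = 0"
      unfolding I using integral_nonneg_eq_0_iff_AE[OF int] f0 by simp
    then have "AE t in lebesgue_prod {..<k}. F t = 0"
    proof (rule AE_mp, intro AE_I2 impI)
      fix t assume t: "t \<in> space (lebesgue_prod {..<k})" "f t = 0"
      show "F t = 0"
      proof (cases "t \<in> truncated_simplex k \<alpha>")
        case True
        then have "t \<in> orthant {..<k}" unfolding truncated_simplex_def orthant_def by (auto simp: PiE_iff)
        then show ?thesis using t(2) unfolding f_def by simp
      next
        case False
        then show ?thesis using F t(1) unfolding truncated_functions_def by blast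
      qed
    qed
    then show False using F unfolding truncated_functions_def by blast
  qed
  moreover have "0 \<le> I_functional k F" unfolding I by (rule Bochner_Integration.integral_nonneg) (rule f0)
  ultimately show ?thesis by simp
qed

theorem theorem3p10:
  fixes k m :: nat and varpi \<delta> :: real
  assumes "k \<ge> 2" and "m \<ge> 1"
    and "0 < varpi" and "varpi < 1/4"
    and "0 < \<delta>" and "\<delta> < 1/2"
    and "MPZ varpi \<delta>"
    and "M_truncated k (\<delta> / (1/4 + varpi)) > ereal (real m / (1/4 + varpi))"
  shows "DHL k (m + 1)"
proof -
  define \<theta> where "\<theta> = 1/4 + varpi"
  have \<theta>: "\<theta> > 0" unfolding \<theta>_def using assms(3) by simp
  \<comment> \<open>A value below the supremum is exceeded by some F, also when the supremum is
    infinite.\<close>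
  obtain F where F: "F \<in> truncated_functions k (\<delta> / \<theta>)"
    and gt: "ereal (real m / \<theta>) < ereal ((\<Sum>i<k. J_functional k i F) / I_functional k F)"
    using assms(8) unfolding M_truncated_def less_SUP_iff \<theta>_def by blast
  have "real m / \<theta> * I_functional k F < (\<Sum>i<k. J_functional k i F)"
    using gt I_functional_pos[OF F] by (simp add: pos_less_divide_eq)
  then obtain N :: nat and \<Phi> Y where N: "N \<ge> 1" and \<Phi>: "\<And>j. 0 \<le> \<Phi> j \<and> \<Phi> j \<le> Y"
    and supp: "\<And>j. \<Phi> j \<noteq> 0 \<Longrightarrow> j \<in> PiE {..<k} (\<lambda>_. {..<N}) \<and> inside_cell k (\<delta> / \<theta>) N j"
    and gap: "m / \<theta> * ((\<Sum>j\<in>PiE {..<k} (\<lambda>_. {..<N}). (\<Phi> j)\<^sup>2) / N ^ k)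
      < (\<Sum>i<k. (\<Sum>j\<in>PiE {..<k} (\<lambda>_. {..<N}). \<Sum>v<N. \<Phi> j * \<Phi> (j(i := v))) / N ^ Suc k)"
    using grid_function_exists[OF _ F, of "real m / \<theta>"] assms(1) \<theta> by auto
  show ?thesis unfolding DHL_def infinite_nat_iff_unbounded_le
    using primes_in_tuple_beyond[OF assms(1,3-7) _ N \<Phi> supp[unfolded \<theta>_def] gap[unfolded \<theta>_def]] by blast
qed

end
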